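(* Let $\Delta$ be a constant and let $\Pi$ be an LCL problem. If $\Pi$ can be solved by a deterministic LOCAL algorithm in $o(n)$ rounds on trees of maximum degree at most $\Delta$ (where $n$ is the number of nodes), then $\Pi$ can be solved by a deterministic LOCAL algorithm in $O(\sqrt n)$ rounds on trees of maximum degree at most $\Delta$. In particular, on bounded-degree trees there is no LCL problem whose deterministic time complexity is both $\omega(\sqrt n)$ and $o(n)$.
   Context: Graphs. Here the input graphs are finite trees $T=(V,E)$ with $n=|V|$ nodes and maximum degree at most a known constant $\Delta=O(1)$ (independent of $n$). Let $\mathcal F$ be the family of such trees. LOCAL model. Each node runs the same deterministic algorithm. Nodes are labelled with unique $O(\log n)$-bit identifiers; initially each node knows its own identifier, its own degree, the number $n$, and its own input label (if any). Computation proceeds in synchronous rounds; in each round each node sends a message of unbounded size to each neighbour, receives the messages from its neighbours, and performs arbitrary local computation. Time is the number of rounds until all nodes have stopped and produced their local outputs. Equivalently, a $t$-round algorithm is a function from $t$-radius neighbourhoods (with degrees, identifiers, inputs, and the value $n$) to outputs, where the $t$-radius neighbourhood of $v$ is the subgraph containing all nodes at distance at most $t$ from $v$ and all edges incident to nodes at distance at most $t-1$ from $v$. LCL problem. An LCL (locally checkable labelling) is a tuple $\Pi=(\Sigma_{\mathrm{in}},\Sigma_{\mathrm{out}},C,r)$, where $\Sigma_{\mathrm{in}},\Sigma_{\mathrm{out}}$ are constant-size label sets, $r$ is a constant (checkability radius), and $C$ is a set of graphs $H$, each centred at some node $v$ from which all nodes of $H$ are at distance at most $r$, with each node $u$ of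 $H$ labelled by a pair $(i(u),o(u))\in\Sigma_{\mathrm{in}}\times\Sigma_{\mathrm{out}}$. Given $T\in\mathcal F$ and an input labelling $i\colon V\to\Sigma_{\mathrm{in}}$, an output labelling $o\colon V\to\Sigma_{\mathrm{out}}$ is valid if for every $v\in V$ the subgraph induced by the nodes at distance at most $r$ from $v$, centred at $v$ and augmented with the inputs and outputs, belongs to $C$. An algorithm solves $\Pi$ if on every $T\in\mathcal F$, every input labelling, and every identifier assignment, the outputs form a valid output labelling. Time complexity. The time complexity of $\Pi$ in $\mathcal F$ is the pointwise smallest $t\colon\mathbb N\to\mathbb N$ such that some deterministic LOCAL algorithm solves $\Pi$ in $t(n)$ rounds in every $T\in\mathcal F$ with $n$ nodes, for every $n$ and every input labelling. *)

theory Defs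
  imports
    "Graph_Theory.Digraph_Component"
    "HOL-Library.Extended_Nat"
    "HOL-Library.Landau_Symbols"
begin

section \<open>Trees of bounded degree\<close>

text \<open>
  A finite simple graph is a symmetric loop-free pair digraph (locale \<^locale>\<open>pair_graph\<close>): the edge
  \<open>{u, v}\<close> is represented by the two arcs \<open>(u, v)\<close> and \<open>(v, u)\<close>.  The library predicate
  \<^const>\<open>Digraph_Component.tree\<close> is not usable for this representation: it forbids all directed
  cycles, and \<open>(u, v), (v, u)\<close> is one.  An undirected cycle is a directed cycle of length at least 3.
\<close>

definition is_tree :: "'v pair_pre_digraph \<Rightarrow> bool" where
  "is_tree G \<longleftrightarrow> pair_graph G \<and> Digraph_Component.connected (with_proj G) \<and>
     \<not> (\<exists>p. pre_digraph.cycle (with_proj G) p \<and> 3 \<le> length p)"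

abbreviation degree :: "'v pair_pre_digraph \<Rightarrow> 'v \<Rightarrow> nat" where
  "degree G v \<equiv> out_degree (with_proj G) v"

text \<open>
  Every finite graph has a copy on natural numbers.  The node names carry no information; they are
  not the identifiers and are never revealed to an algorithm.
\<close>

definition trees :: "nat \<Rightarrow> nat pair_pre_digraph set" where
  "trees \<Delta> = {T. is_tree T \<and> (\<forall>v\<in>pverts T. degree T v \<le> \<Delta>)}"

definition gdist :: "'v pair_pre_digraph \<Rightarrow> 'v \<Rightarrow> 'v \<Rightarrow> enat" where
  "gdist G u v = (INF p\<in>{p. pre_digraph.awalk (with_proj G) u p v}. enat (length p))"

definition nodes_within :: "'v pair_pre_digraph \<Rightarrow> nat \<Rightarrow> 'v \<Rightarrow> 'v set" where
  "nodes_within G k v = {u \<in> pverts G. gdist G v u \<le> enat k}"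


section \<open>Locally checkable labellings\<close>

record ('v, 'i, 'o) centred_graph =
  cgraph :: "'v pair_pre_digraph"
  centre :: 'v
  labels :: "'v \<Rightarrow> 'i \<times> 'o"

definition centred_iso ::
    "('v, 'i, 'o) centred_graph \<Rightarrow> ('w, 'i, 'o) centred_graph \<Rightarrow> bool" where
  "centred_iso H K \<longleftrightarrow> (\<exists>f. bij_betw f (pverts (cgraph H)) (pverts (cgraph K)) \<and>
     (\<forall>u\<in>pverts (cgraph H). \<forall>v\<in>pverts (cgraph H).
        (u, v) \<in> parcs (cgraph H) \<longleftrightarrow> (f u, f v) \<in> parcs (cgraph K)) \<and>
     f (centre H) = centre K \<and>
     (\<forall>u\<in>pverts (cgraph H). labels H u = labels K (f u)))"

record ('i, 'o) lcl =
  in_labels :: "'i set"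
  out_labels :: "'o set"
  constraints :: "(nat, 'i, 'o) centred_graph set"
  radius :: nat

definition is_lcl :: "('i, 'o) lcl \<Rightarrow> bool" where
  "is_lcl P \<longleftrightarrow> finite (in_labels P) \<and> finite (out_labels P) \<and>
     (\<forall>H\<in>constraints P. pair_graph (cgraph H) \<and> centre H \<in> pverts (cgraph H) \<and>
        (\<forall>u\<in>pverts (cgraph H). gdist (cgraph H) (centre H) u \<le> enat (radius P) \<and>
           labels H u \<in> in_labels P \<times> out_labels P))"

definition labelled_ball ::
    "'v pair_pre_digraph \<Rightarrow> ('v \<Rightarrow> 'i) \<Rightarrow> ('v \<Rightarrow> 'o) \<Rightarrow> nat \<Rightarrow> 'v \<Rightarrow> ('v, 'i, 'o) centred_graph" where
  "labelled_ball T inp out r v =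
     \<lparr>cgraph = \<lparr>pverts = nodes_within T r v,
                parcs = parcs T \<inter> nodes_within T r v \<times> nodes_within T r v\<rparr>,
      centre = v,
      labels = (\<lambda>u. (inp u, out u))\<rparr>"

text \<open>Membership in the constraint set is understood up to isomorphism.\<close>

definition valid_labelling ::
    "('i, 'o) lcl \<Rightarrow> 'v pair_pre_digraph \<Rightarrow> ('v \<Rightarrow> 'i) \<Rightarrow> ('v \<Rightarrow> 'o) \<Rightarrow> bool" where
  "valid_labelling P T inp out \<longleftrightarrow>
     (\<forall>v\<in>pverts T. out v \<in> out_labels P \<and>
        (\<exists>H\<in>constraints P. centred_iso (labelled_ball T inp out (radius P) v) H))"


section \<open>Deterministic LOCAL algorithms\<close>

text \<open>
  What a node knows after \<open>t\<close> rounds.  Nodes occur only through their identifiers, and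
  \<open>view_info\<close> contains one triple (identifier, degree, input label) per node of the neighbourhood,
  so that nothing outside the neighbourhood is visible.
\<close>

record 'i view =
  view_size :: nat
  view_graph :: "nat pair_pre_digraph"
  view_centre :: nat
  view_info :: "(nat \<times> nat \<times> 'i) set"

definition view_of ::
    "'v pair_pre_digraph \<Rightarrow> ('v \<Rightarrow> nat) \<Rightarrow> ('v \<Rightarrow> 'i) \<Rightarrow> nat \<Rightarrow> 'v \<Rightarrow> 'i view" where
  "view_of T ident inp t v =
     \<lparr>view_size = card (pverts T),
      view_graph =
        \<lparr>pverts = ident ` nodes_within T t v,
         parcs = {(ident x, ident y) | x y. (x, y) \<in> parcs T \<and>
                    (gdist T v x < enat t \<or> gdist T v y < enat t)}\<rparr>,
      view_centre = ident v,
      view_info = (\<lambda>u. (ident u, degree T u, inp u)) ` nodes_within T t v\<rparr>"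

type_synonym ('i, 'o) local_algorithm = "'i view \<Rightarrow> 'o"

text \<open>
  Identifiers of \<open>O(log n)\<close> bits: distinct elements of \<open>{1..n ^ c}\<close>, for a constant \<open>c\<close>.
\<close>

definition identifiers :: "nat \<Rightarrow> 'v pair_pre_digraph \<Rightarrow> ('v \<Rightarrow> nat) \<Rightarrow> bool" where
  "identifiers c T ident \<longleftrightarrow>
     inj_on ident (pverts T) \<and> ident ` pverts T \<subseteq> {1..card (pverts T) ^ c}"

definition solves_in ::
    "nat \<Rightarrow> nat \<Rightarrow> ('i, 'o) lcl \<Rightarrow> ('i, 'o) local_algorithm \<Rightarrow> (nat \<Rightarrow> nat) \<Rightarrow> bool" where
  "solves_in c \<Delta> P A t \<longleftrightarrow>
     (\<forall>T\<in>trees \<Delta>. \<forall>inp ident.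
        inp ` pverts T \<subseteq> in_labels P \<longrightarrow> identifiers c T ident \<longrightarrow>
        valid_labelling P T inp (\<lambda>v. A (view_of T ident inp (t (card (pverts T))) v)))"

definition solvable_in :: "nat \<Rightarrow> nat \<Rightarrow> ('i, 'o) lcl \<Rightarrow> (nat \<Rightarrow> nat) \<Rightarrow> bool" where
  "solvable_in c \<Delta> P t \<longleftrightarrow> (\<exists>A. solves_in c \<Delta> P A t)"

text \<open>A problem that no algorithm solves has no time complexity.\<close>

definition is_time_complexity :: "nat \<Rightarrow> nat \<Rightarrow> ('i, 'o) lcl \<Rightarrow> (nat \<Rightarrow> nat) \<Rightarrow> bool" where
  "is_time_complexity c \<Delta> P t \<longleftrightarrow>
     solvable_in c \<Delta> P t \<and> (\<forall>t'. solvable_in c \<Delta> P t' \<longrightarrow> (\<forall>n. t n \<le> t' n))"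

end

theory Submission
  imports Defs
begin

text \<open>
  The problem is encoded by states of directed edges, namely truncated unfoldings of the labelled tree, so that
  validity becomes a condition at every node and each branch of a tree has one of finitely many types.
  Fix \<open>\<tau>\<close> of order \<open>sqrt n\<close> and call a branch heavy if it is deeper than \<open>\<tau>\<close>.
  On long paths whose inner nodes have exactly two heavy branches, segments of constant length are cut
  out, at places that are chosen greedily along a colouring of the nodes with polylogarithmically many colours.  Since every other node
  away from the leaves carries a third branch with more than \<open>\<tau>\<close> nodes, the remaining components have
  diameter \<open>O(n / \<tau> + \<tau>)\<close>.  A component is solved by brute force, each cut edge being treated as
  a branch whose type is prescribed by a function \<open>g\<close> of the word of letters on the segment.

  It remains to find a feasible \<open>g\<close>, that is, one for which all these local problems
  are solvable.  A sublinear algorithm provides it: pump every word to a long path with the same relation between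
  its end states.  In the middle of such a path the sublinear algorithm sees nothing but the path, so its output
  there depends only on the identifiers on the path; by the pigeonhole principle many disjoint blocks of
  identifiers give the same output.  Splitting the pumped path at this output yields \<open>g\<close>, and running the
  algorithm on a tree assembled from pumped paths shows that \<open>g\<close> is feasible for trees up to any given size, hence,
  as there are finitely many \<open>g\<close>, that some \<open>g\<close> is feasible for all of them.
\<close>

section \<open>Darts and branches of trees\<close>

text \<open>Sublinearity enters at one place. The number N of nodes of the assembled tree is linear
  in the length n of the pumped paths, and the middle of a path is hidden from everything else once
  n exceeds about twice t(N); that t is o(n) is what makes such an n exist. The output also depends
  on N and on the identifiers, so N and the blocks of identifiers are fixed before the tree is
  known, and surplus identifiers are spent on a path attached behind a spine, where the middle
  cannot see it. Once all copies of the pumped path of a word w that are used have the same state s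
  in the middle, \<open>g w\<close> consists of the states at either end that the half word on that
  side links to s. Any two of them are linked to each other through s, which is the compatibility
  demanded of \<open>g\<close>. Words have length 2L + 1, where L is the number of relations on edge
  states, so that pumping applies; an odd length gives each segment a centre, which represents it in
  the colouring. A single colour reduction step is enough, since a power of the logarithm is already
  below sqrt n.\<close>

text \<open>The directed edges at \<open>k\<close> non-backtracking steps from the directed edge \<open>(x, y)\<close>.\<close>

primrec darts_at :: "('v \<Rightarrow> 'v set) \<Rightarrow> nat \<Rightarrow> 'v \<Rightarrow> 'v \<Rightarrow> ('v \<times> 'v) set" where
  "darts_at nb 0 x y = {(x, y)}"
| "darts_at nb (Suc k) x y = {(w, z) | p w z. (p, w) \<in> darts_at nb k x y \<and> z \<in> nb w - {p}}"

definition darts :: "('v \<Rightarrow> 'v set) \<Rightarrow> 'v \<Rightarrow> 'v \<Rightarrow> ('v \<times> 'v) set" where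
  "darts nb x y = (\<Union>k. darts_at nb k x y)"

definition branch :: "('v \<Rightarrow> 'v set) \<Rightarrow> 'v \<Rightarrow> 'v \<Rightarrow> 'v set" where
  "branch nb x y = snd ` darts nb x y"

lemma darts_at_add:
  "darts_at nb (i + j) x y = (\<Union>(a, b)\<in>darts_at nb i x y. darts_at nb j a b)"
proof (induction j)
  case 0
  then show ?case by auto
next
  case (Suc j)
  have "darts_at nb (i + Suc j) x y
      = {(w, z) | p w z. (p, w) \<in> darts_at nb (i + j) x y \<and> z \<in> nb w - {p}}" by simp
  also have "\<dots> = (\<Union>(a, b)\<in>darts_at nb i x y. darts_at nb (Suc j) a b)"
    unfolding Suc.IH by fastforce
  finally show ?case .
qed

lemma darts_at_Suc_left:
  "darts_at nb (Suc k) x y = (\<Union>z\<in>nb y - {x}. darts_at nb k y z)"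
proof -
  have "darts_at nb (1 + k) x y = (\<Union>(a, b)\<in>darts_at nb 1 x y. darts_at nb k a b)"
    by (rule darts_at_add)
  then show ?thesis by auto
qed

lemma darts_trans:
  "(a, b) \<in> darts nb x y \<Longrightarrow> d \<in> darts nb a b \<Longrightarrow> d \<in> darts nb x y"
proof -
  assume "(a, b) \<in> darts nb x y" "d \<in> darts nb a b"
  then obtain i j where "(a, b) \<in> darts_at nb i x y" "d \<in> darts_at nb j a b"
    unfolding darts_def by auto
  then have "d \<in> darts_at nb (i + j) x y" unfolding darts_at_add[of nb i j x y] by auto
  then show ?thesis unfolding darts_def by auto
qed

lemma darts_self [simp]: "(x, y) \<in> darts nb x y"
  unfolding darts_def by (auto intro: exI[of _ 0])

lemma darts_step:
  "(p, w) \<in> darts nb x y \<Longrightarrow> z \<in> nb w \<Longrightarrow> z \<noteq> p \<Longrightarrow> (w, z) \<in> darts nb x y"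
proof -
  assume "(p, w) \<in> darts nb x y" "z \<in> nb w" "z \<noteq> p"
  then obtain k where "(w, z) \<in> darts_at nb (Suc k) x y"
    unfolding darts_def darts_at.simps by auto
  then show ?thesis unfolding darts_def by blast
qed

lemma darts_induct [consumes 1, case_names self step]:
  assumes "(p, w) \<in> darts nb x y"
    and "P x y"
    and "\<And>p w z. (p, w) \<in> darts nb x y \<Longrightarrow> P p w \<Longrightarrow> z \<in> nb w \<Longrightarrow> z \<noteq> p \<Longrightarrow> P w z"
  shows "P p w"
proof -
  have "(p, w) \<in> darts_at nb k x y \<Longrightarrow> P p w" for k p w
  proof (induction k arbitrary: p w)
    case 0
    then show ?case using assms(2) by simp
  next
    case (Suc k)
    then obtain q where "(q, p) \<in> darts_at nb k x y" "w \<in> nb p - {q}" by auto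
    then show ?case using Suc.IH assms(3)[of q p w] unfolding darts_def by auto
  qed
  then show ?thesis using assms(1) unfolding darts_def by auto
qed

lemma darts_unfold:
  "darts nb x y = insert (x, y) (\<Union>z\<in>nb y - {x}. darts nb y z)"
proof -
  have "darts nb x y = darts_at nb 0 x y \<union> (\<Union>k. darts_at nb (Suc k) x y)"
    unfolding darts_def by (subst UNIV_nat_eq) auto
  also have "(\<Union>k. darts_at nb (Suc k) x y) = (\<Union>z\<in>nb y - {x}. darts nb y z)"
    unfolding darts_at_Suc_left darts_def by auto
  finally show ?thesis by simp
qed

lemma branch_unfold:
  "branch nb x y = insert y (\<Union>z\<in>nb y - {x}. branch nb y z)"
  unfolding branch_def by (subst darts_unfold) auto

lemma branch_self [simp]: "y \<in> branch nb x y"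
  by (subst branch_unfold) simp

lemma branch_mono: "(a, b) \<in> darts nb x y \<Longrightarrow> branch nb a b \<subseteq> branch nb x y"
  unfolding branch_def using darts_trans by fast

text \<open>Heaviness asks for depth rather than size: depth is decided within distance
  \<open>k\<close>, and in a tree it still forces more than \<open>k\<close> nodes
  (\<open>heavy_card\<close>).\<close>

definition heavy :: "('v \<Rightarrow> 'v set) \<Rightarrow> nat \<Rightarrow> 'v \<Rightarrow> 'v \<Rightarrow> bool" where
  "heavy nb k x y \<longleftrightarrow> darts_at nb k x y \<noteq> {}"

lemma heavy_Suc: "heavy nb (Suc k) x y \<longleftrightarrow> (\<exists>z\<in>nb y - {x}. heavy nb k y z)"
  unfolding heavy_def darts_at_Suc_left by auto

lemma heavy_antimono:
  assumes "heavy nb k x y" "j \<le> k" shows "heavy nb j x y"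
proof -
  obtain i where "k = j + i" using assms(2) le_Suc_ex by blast
  then show ?thesis using assms(1) darts_at_add[of nb j i x y] unfolding heavy_def by auto
qed

lemma heavy_shift:
  assumes "(a, b) \<in> darts nb x y" "heavy nb k a b" shows "heavy nb k x y"
proof -
  obtain i where "(a, b) \<in> darts_at nb i x y" using assms(1) unfolding darts_def by auto
  then have "heavy nb (i + k) x y"
    using assms(2) unfolding heavy_def darts_at_add[of nb i k x y] by auto
  then show ?thesis by (rule heavy_antimono) simp
qed

text \<open>No dart survives \<open>k\<close> steps, so a light branch can be seen as a whole from
  its root. This is what makes the words on segments locally computable.\<close>

lemma darts_at_light:
  assumes "\<not> heavy nb k x y"
  shows "darts nb x y = (\<Union>j<k. darts_at nb j x y)"
proof -
  have "darts_at nb j x y = {}" if "k \<le> j" for j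
    using assms heavy_antimono[OF _ that, of nb x y] unfolding heavy_def by blast
  then have "j < k" if "d \<in> darts_at nb j x y" for d j
    using that by (metis empty_iff not_less)
  then show ?thesis unfolding darts_def by blast
qed

section \<open>Finite trees given by neighbourhood sets\<close>

definition edge_rel :: "('v \<Rightarrow> 'v set) \<Rightarrow> ('v \<times> 'v) set" where
  "edge_rel nb = {(a, b). b \<in> nb a}"

text \<open>Acyclicity is stated at a node: two neighbours of \<open>y\<close> are not connected off
  \<open>y\<close>. This form gives disjoint branches at once and is easy to keep when trees are
  glued. Symmetry and \<open>nb_sub\<close> together leave everything outside \<open>V\<close>
  without neighbours.\<close>

locale utree =
  fixes V :: "'v set" and nb :: "'v \<Rightarrow> 'v set"
  assumes fin: "finite V"
    and nonempty: "V \<noteq> {}"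
    and nb_sub: "\<And>v. nb v \<subseteq> V"
    and irrefl: "\<And>v. v \<notin> nb v"
    and nb_sym: "\<And>u v. u \<in> nb v \<Longrightarrow> v \<in> nb u"
    and conn: "\<And>u v. u \<in> V \<Longrightarrow> v \<in> V \<Longrightarrow> (u, v) \<in> (edge_rel nb)\<^sup>*"
    and acyc: "\<And>y z z'. z \<in> nb y \<Longrightarrow> z' \<in> nb y \<Longrightarrow> z \<noteq> z' \<Longrightarrow>
       (z, z') \<notin> {(a, b). b \<in> nb a \<and> a \<noteq> y \<and> b \<noteq> y}\<^sup>*"
begin

lemma nb_V: "u \<in> nb v \<Longrightarrow> v \<in> V"
  using nb_sub nb_sym by blast

lemma fin_nb [simp]: "finite (nb v)"
  using fin nb_sub finite_subset by blast

abbreviation away :: "'v \<Rightarrow> ('v \<times> 'v) set" where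
  "away y \<equiv> {(a, b). b \<in> nb a \<and> a \<noteq> y \<and> b \<noteq> y}\<^sup>*"

lemma away_sym: "(a, b) \<in> away y \<Longrightarrow> (b, a) \<in> away y"
proof -
  assume "(a, b) \<in> away y"
  moreover have "sym (away y)" by (rule sym_rtrancl) (auto simp: sym_def nb_sym)
  ultimately show ?thesis by (auto simp: sym_def)
qed

lemma darts_arc: "y \<in> nb x \<Longrightarrow> (p, w) \<in> darts nb x y \<Longrightarrow> w \<in> nb p"
  by (erule darts_induct) auto

text \<open>A first return to \<open>x\<close> comes from a neighbour \<open>p\<close> of
  \<open>x\<close> that is connected to \<open>y\<close> off \<open>x\<close>, so acyclicity forces
  \<open>p = y\<close>. Then the walk has come back to \<open>y\<close> after leaving it, which is a
  shorter return.\<close>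

lemma no_return: "y \<in> nb x \<Longrightarrow> (p, x) \<notin> darts_at nb k x y"
proof (induction k arbitrary: x y p rule: less_induct)
  case (less k)
  show ?case
  proof
    assume ret: "(p, x) \<in> darts_at nb k x y"
    have xy: "x \<noteq> y" using less.prems irrefl by auto
    have avoid: "w \<noteq> x \<and> (y, w) \<in> away x" if "(q, w) \<in> darts_at nb j x y" "j < k" for j q w
      using that
    proof (induction j arbitrary: q w)
      case 0
      then show ?case using xy by auto
    next
      case (Suc j)
      then obtain r where r: "(r, q) \<in> darts_at nb j x y" "w \<in> nb q - {r}" by auto
      have q: "q \<noteq> x" "(y, q) \<in> away x" using Suc.IH[OF r(1)] Suc.prems by auto
      have "w \<noteq> x" using less.IH[OF Suc.prems(2) less.prems] Suc.prems(1) by blast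
      then have "(q, w) \<in> {(a, b). b \<in> nb a \<and> a \<noteq> x \<and> b \<noteq> x}" using r q by auto
      then show ?case using q(2) \<open>w \<noteq> x\<close> by (meson rtrancl.rtrancl_into_rtrancl)
    qed
    have "k \<noteq> 0" using ret xy by (cases k) auto
    then obtain k' where k': "k = Suc k'" using not0_implies_Suc by blast
    then obtain q where q: "(q, p) \<in> darts_at nb k' x y" "x \<in> nb p - {q}" using ret by auto
    have "(y, p) \<in> away x" using avoid[OF q(1)] k' by simp
    moreover have "p \<in> nb x" using q(2) nb_sym by blast
    ultimately have py: "p = y" using acyc[OF less.prems, of p] by auto
    show False
    proof (cases k')
      case 0
      then show False using q by auto
    next
      case (Suc j)
      have "(q, y) \<in> (\<Union>z\<in>nb y - {x}. darts_at nb j y z)"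
        using q(1) unfolding Suc darts_at_Suc_left py .
      then obtain z where "z \<in> nb y" "(q, y) \<in> darts_at nb j y z" by auto
      then show False using less.IH[of j z y] Suc k' by auto
    qed
  qed
qed

lemma not_in_branch: "y \<in> nb x \<Longrightarrow> x \<notin> branch nb x y"
  unfolding branch_def darts_def using no_return by force

lemma branch_away:
  assumes "y \<in> nb x" "u \<in> branch nb x y" shows "(y, u) \<in> away x"
proof -
  have "(p, w) \<in> darts nb x y \<Longrightarrow> (y, w) \<in> away x" for p w
  proof (induction rule: darts_induct)
    case (step p w z)
    have "w \<in> branch nb x y" "z \<in> branch nb x y"
      using step.hyps(1) darts_step[OF step.hyps] unfolding branch_def by force+
    then have "w \<noteq> x" "z \<noteq> x" using not_in_branch[OF assms(1)] by auto
    then show ?case using step by (auto intro: rtrancl_into_rtrancl)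
  qed simp
  then show ?thesis using assms(2) unfolding branch_def by force
qed

lemma branch_disjoint:
  assumes "z \<in> nb y" "z' \<in> nb y" "z \<noteq> z'"
  shows "branch nb y z \<inter> branch nb y z' = {}"
proof (rule ccontr)
  assume "\<not> ?thesis"
  then obtain u where "u \<in> branch nb y z" "u \<in> branch nb y z'" by auto
  then have "(z, u) \<in> away y" "(u, z') \<in> away y"
    using branch_away assms away_sym by auto
  then show False using acyc[OF assms] rtrancl_trans by fast
qed

text \<open>A node of the branch is entered along some dart. Its other neighbours are reached by
  continuing, and the tail of that dart is again in the branch unless the dart is the root
  dart.\<close>

lemma branch_closed:
  assumes "u \<in> branch nb y z" "v \<in> nb u"
  shows "v \<in> branch nb y z \<or> u = z \<and> v = y"
proof -
  have "(p, w) \<in> darts nb y z \<Longrightarrow> p \<in> branch nb y z \<or> (p, w) = (y, z)" for p w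
    by (induction rule: darts_induct) (force simp: branch_def)+
  moreover obtain p where "(p, u) \<in> darts nb y z" using assms(1) unfolding branch_def by auto
  moreover have "v \<noteq> p \<Longrightarrow> (u, v) \<in> darts nb y z" using calculation assms(2) darts_step by metis
  ultimately show ?thesis unfolding branch_def by force
qed

lemma V_branches:
  assumes "y \<in> V" shows "V = insert y (\<Union>z\<in>nb y. branch nb y z)"
proof -
  have "u \<in> insert y (\<Union>z\<in>nb y. branch nb y z)" if "(y, u) \<in> (edge_rel nb)\<^sup>*" for u
    using that
  proof induction
    case (step u v)
    then have "v \<in> nb u" by (simp add: edge_rel_def)
    show ?case
    proof (cases "u = y")
      case True
      then show ?thesis using \<open>v \<in> nb u\<close> branch_self by fast
    next
      case False
      then show ?thesis using \<open>v \<in> nb u\<close> step.IH branch_closed[of u y _ v] by blast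
    qed
  qed simp
  moreover have "branch nb y z \<subseteq> V" if "z \<in> nb y" for z
  proof
    fix u assume "u \<in> branch nb y z"
    then obtain p where "(p, u) \<in> darts nb y z" unfolding branch_def by auto
    then show "u \<in> V" using darts_arc[OF that] nb_sub by blast
  qed
  ultimately show ?thesis using conn[OF assms] assms by (intro equalityI subsetI) (blast, auto)
qed

lemma branch_sub_V: "z \<in> nb y \<Longrightarrow> branch nb y z \<subseteq> V"
  using V_branches[of y] nb_V by blast

lemma fin_branch: "z \<in> nb y \<Longrightarrow> finite (branch nb y z)"
  using branch_sub_V fin finite_subset by blast

lemma branch_psubset:
  assumes "y \<in> nb x" "z \<in> nb y - {x}"
  shows "branch nb y z \<subset> branch nb x y"
proof -
  have "branch nb y z \<subseteq> branch nb x y" using assms(2) branch_unfold[of nb x y] by blast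
  moreover have "y \<notin> branch nb y z" using not_in_branch assms(2) by auto
  ultimately show ?thesis using branch_self[of y nb x] by blast
qed

lemma heavy_card: "y \<in> nb x \<Longrightarrow> heavy nb k x y \<Longrightarrow> k < card (branch nb x y)"
proof (induction k arbitrary: x y)
  case 0
  then show ?case using fin_branch branch_self by (metis card_gt_0_iff empty_iff)
next
  case (Suc k)
  then obtain z where z: "z \<in> nb y - {x}" "heavy nb k y z" using heavy_Suc by metis
  then have "k < card (branch nb y z)" using Suc.IH by auto
  moreover have "card (branch nb y z) < card (branch nb x y)"
    using branch_psubset[OF Suc.prems(1) z(1)] fin_branch[OF Suc.prems(1)] by (rule psubset_card_mono[rotated])
  ultimately show ?case by simp
qed

text \<open>Branches of a tree shrink strictly along darts, so their size is a measure for induction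
  from the leaves upwards.\<close>

lemma branch_induct [consumes 1, case_names arc]:
  assumes "y \<in> nb x"
    and "\<And>x y. y \<in> nb x \<Longrightarrow> (\<And>z. z \<in> nb y - {x} \<Longrightarrow> P y z) \<Longrightarrow> P x y"
  shows "P x y"
  using assms(1)
proof (induction "card (branch nb x y)" arbitrary: x y rule: less_induct)
  case less
  show ?case
  proof (rule assms(2)[OF less.prems])
    fix z assume z: "z \<in> nb y - {x}"
    have "card (branch nb y z) < card (branch nb x y)"
      using branch_psubset[OF less.prems z] fin_branch[OF less.prems] psubset_card_mono by blast
    then show "P y z" using less.hyps z by auto
  qed
qed

end

subsection \<open>Non-backtracking walks\<close>

definition nb_walk :: "('v \<Rightarrow> 'v set) \<Rightarrow> 'v list \<Rightarrow> bool" where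
  "nb_walk nb p \<longleftrightarrow> (\<forall>i. Suc i < length p \<longrightarrow> p ! Suc i \<in> nb (p ! i)) \<and>
     (\<forall>i. Suc (Suc i) < length p \<longrightarrow> p ! i \<noteq> p ! Suc (Suc i))"

lemma nb_walk_darts_at:
  assumes "nb_walk nb p" "Suc (i + j) < length p"
  shows "(p ! (i + j), p ! Suc (i + j)) \<in> darts_at nb j (p ! i) (p ! Suc i)"
  using assms(2)
proof (induction j)
  case (Suc j)
  then have "(p ! (i + j), p ! Suc (i + j)) \<in> darts_at nb j (p ! i) (p ! Suc i)" by simp
  moreover have "p ! Suc (Suc (i + j)) \<in> nb (p ! Suc (i + j)) - {p ! (i + j)}"
    using assms(1) Suc.prems unfolding nb_walk_def by auto
  ultimately show ?case by auto
qed simp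

lemma nb_walk_darts:
  assumes "nb_walk nb p" "i \<le> j" "Suc j < length p"
  shows "(p ! j, p ! Suc j) \<in> darts nb (p ! i) (p ! Suc i)"
  using nb_walk_darts_at[OF assms(1), of i "j - i"] assms(2,3) unfolding darts_def by auto

lemma nb_walk_heavy:
  assumes "nb_walk nb p" "Suc (i + k) < length p"
  shows "heavy nb k (p ! i) (p ! Suc i)"
  using nb_walk_darts_at[OF assms] unfolding heavy_def by auto

lemma (in utree) nb_walk_rev:
  assumes "nb_walk nb p" shows "nb_walk nb (rev p)"
proof -
  have "rev p ! Suc i \<in> nb (rev p ! i)" if "Suc i < length p" for i
  proof -
    have "p ! Suc (length p - Suc (Suc i)) \<in> nb (p ! (length p - Suc (Suc i)))"
      using assms that unfolding nb_walk_def by auto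
    moreover have "Suc (length p - Suc (Suc i)) = length p - Suc i" using that by simp
    ultimately show ?thesis using that nb_sym by (simp add: rev_nth)
  qed
  moreover have "rev p ! i \<noteq> rev p ! Suc (Suc i)" if "Suc (Suc i) < length p" for i
  proof -
    define j where "j = length p - Suc (Suc (Suc i))"
    have "Suc (Suc j) < length p" "rev p ! i = p ! Suc (Suc j)" "rev p ! Suc (Suc i) = p ! j"
      using that by (auto simp: j_def rev_nth Suc_diff_Suc)
    then show ?thesis using assms unfolding nb_walk_def by metis
  qed
  ultimately show ?thesis unfolding nb_walk_def by auto
qed

text \<open>A repeated node would be a return to the tail of a dart, which \<open>no_return\<close>
  excludes.\<close>

lemma (in utree) nb_walk_distinct:
  assumes "nb_walk nb p" shows "distinct p"
proof -
  have "p ! i \<noteq> p ! j" if ij: "i < j" "j < length p" for i j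
  proof
    assume eq: "p ! i = p ! j"
    obtain k where k: "j = Suc (i + k)" using ij(1) less_iff_Suc_add[of i j] by auto
    then have "(p ! (i + k), p ! i) \<in> darts_at nb k (p ! i) (p ! Suc i)"
      using nb_walk_darts_at[OF assms, of i k] ij eq by auto
    moreover have "p ! Suc i \<in> nb (p ! i)" using assms ij unfolding nb_walk_def by auto
    ultimately show False using no_return by blast
  qed
  then show ?thesis unfolding distinct_conv_nth by (metis nat_neq_iff)
qed

text \<open>With \<open>a\<close> and \<open>b\<close> the neighbours of \<open>v\<close> on a path,
  this is what stays attached to \<open>v\<close> when the path is taken apart.\<close>

definition hanging :: "('v \<Rightarrow> 'v set) \<Rightarrow> 'v \<Rightarrow> 'v \<Rightarrow> 'v \<Rightarrow> 'v set" where
  "hanging nb a v b = insert v (\<Union>z\<in>nb v - {a, b}. branch nb v z)"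

context utree begin

text \<open>What hangs at the later node lies in the branch that the walk enters right after the
  earlier node, and what hangs at the earlier node avoids that branch.\<close>

lemma hanging_disjoint:
  assumes p: "nb_walk nb p" and ij: "0 < i" "i < j" "Suc j < length p"
  shows "hanging nb (p ! (i-1)) (p ! i) (p ! Suc i) \<inter> hanging nb (p ! (j-1)) (p ! j) (p ! Suc j) = {}"
proof -
  have arc: "p ! Suc i \<in> nb (p ! i)" using p ij unfolding nb_walk_def by auto
  obtain j' where j': "j = Suc j'" using ij by (cases j) auto
  have d: "(p ! j', p ! j) \<in> darts nb (p ! i) (p ! Suc i)"
    using nb_walk_darts[OF p, of i j'] ij j' by auto
  have "branch nb (p ! j) z \<subseteq> branch nb (p ! i) (p ! Suc i)"
    if "z \<in> nb (p ! j) - {p ! j', p ! Suc j}" for z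
    using branch_mono darts_step[OF d] that by fast
  moreover have "p ! j \<in> branch nb (p ! i) (p ! Suc i)" using d unfolding branch_def by force
  ultimately have "hanging nb (p ! (j-1)) (p ! j) (p ! Suc j) \<subseteq> branch nb (p ! i) (p ! Suc i)"
    unfolding hanging_def j' by auto
  moreover have "hanging nb (p ! (i-1)) (p ! i) (p ! Suc i) \<inter> branch nb (p ! i) (p ! Suc i) = {}"
    using branch_disjoint[OF arc] not_in_branch[OF arc] unfolding hanging_def by blast
  ultimately show ?thesis by blast
qed

lemma hanging_closed:
  assumes "u \<in> hanging nb a v b" "w \<in> nb u"
  shows "w \<in> hanging nb a v b \<or> u = v \<and> (w = a \<or> w = b)"
proof (cases "u = v")
  case True
  then show ?thesis using assms(2) branch_self[of w nb v] unfolding hanging_def by blast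
next
  case False
  then obtain z where "z \<in> nb v - {a, b}" "u \<in> branch nb v z"
    using assms(1) unfolding hanging_def by auto
  then show ?thesis using branch_closed[OF _ assms(2), of v z] unfolding hanging_def by auto
qed

end

section \<open>Edge problems and types of branches\<close>

text \<open>Every edge carries one state per direction; this is the pair of states as seen from \<open>u\<close>.\<close>

definition es :: "('v \<Rightarrow> 'v \<Rightarrow> 's) \<Rightarrow> 'v \<Rightarrow> 'v \<Rightarrow> 's \<times> 's" where
  "es \<sigma> u v = (\<sigma> u v, \<sigma> v u)"

lemma es_swap: "es \<sigma> v u = prod.swap (es \<sigma> u v)"
  by (simp add: es_def)

lemma es_eq_swap: "es \<sigma> u v = es \<sigma>' u v \<longleftrightarrow> es \<sigma> v u = es \<sigma>' v u"
  by (auto simp: es_def)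

primrec rel_of :: "('e \<times> 'e) set list \<Rightarrow> ('e \<times> 'e) set" where
  "rel_of [] = Id"
| "rel_of (\<rho> # w) = \<rho> O rel_of w"

lemma rel_of_append: "rel_of (u @ w) = rel_of u O rel_of w"
  by (induction u) auto

text \<open>\<open>E\<close> is a run of the word, with one state per path edge; this is the form in
  which states are put on a path and read off it.\<close>

lemma rel_of_chain:
  "(a, b) \<in> rel_of w \<longleftrightarrow>
     (\<exists>E. E 0 = a \<and> E (length w) = b \<and> (\<forall>i<length w. (E i, E (Suc i)) \<in> w ! i))"
proof (induction w arbitrary: a)
  case Nil
  then show ?case by (auto intro: exI[of _ "\<lambda>_. a"])
next
  case (Cons \<rho> w)
  show ?case
  proof
    assume "(a, b) \<in> rel_of (\<rho> # w)"
    then obtain c where c: "(a, c) \<in> \<rho>" "(c, b) \<in> rel_of w" by auto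
    then obtain E where E: "E 0 = c" "E (length w) = b" "\<forall>i<length w. (E i, E (Suc i)) \<in> w ! i"
      using Cons.IH[of c] by auto
    let ?E = "\<lambda>i. case i of 0 \<Rightarrow> a | Suc j \<Rightarrow> E j"
    have "(?E i, ?E (Suc i)) \<in> (\<rho> # w) ! i" if "i < Suc (length w)" for i
      using c E that by (cases i) auto
    then show "\<exists>E. E 0 = a \<and> E (length (\<rho> # w)) = b \<and>
        (\<forall>i<length (\<rho> # w). (E i, E (Suc i)) \<in> (\<rho> # w) ! i)"
      using E by (intro exI[of _ ?E]) auto
  next
    assume "\<exists>E. E 0 = a \<and> E (length (\<rho> # w)) = b \<and>
        (\<forall>i<length (\<rho> # w). (E i, E (Suc i)) \<in> (\<rho> # w) ! i)"
    then obtain E where E: "E 0 = a" "E (Suc (length w)) = b"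
      "\<And>i. i < Suc (length w) \<Longrightarrow> (E i, E (Suc i)) \<in> (\<rho> # w) ! i" by auto
    have "(E (Suc 0), b) \<in> rel_of w"
      unfolding Cons.IH using E(2) E(3)[of "Suc _"] by (intro exI[of _ "\<lambda>i. E (Suc i)"]) auto
    then show "(a, b) \<in> rel_of (\<rho> # w)" using E(1) E(3)[of 0] by auto
  qed
qed

text \<open>\<open>nok i out M\<close> constrains a node with input \<open>i\<close>, output
  \<open>out\<close> and edge states \<open>M\<close>, each read away from the node.
  \<open>M\<close> is a multiset because the neighbours of a node carry no order.\<close>

locale edge_problem =
  fixes nok :: "'i \<Rightarrow> 'o \<Rightarrow> ('s \<times> 's) multiset \<Rightarrow> bool"
    and Inp :: "'i set" and Sg :: "'s set" and \<Delta> :: nat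
begin

text \<open>
  The type of a branch is the set of states of its root edge, seen from outside the branch, that extend
  to a solution in the branch.  Likewise a letter relates the states of the two path edges at an inner node of a path,
  both read along the path; hence the edge towards the predecessor is swapped when it is seen from the node.
\<close>

definition branch_type :: "'i \<Rightarrow> ('s \<times> 's) set list \<Rightarrow> ('s \<times> 's) set" where
  "branch_type i ts = {e \<in> Sg \<times> Sg. \<exists>out l. list_all2 (\<in>) l ts \<and> nok i out (mset (prod.swap e # l))}"

definition letter :: "'i \<Rightarrow> ('s \<times> 's) set list \<Rightarrow> (('s \<times> 's) \<times> ('s \<times> 's)) set" where
  "letter i ts = {(e, e'). e \<in> Sg \<times> Sg \<and> e' \<in> Sg \<times> Sg \<and>
     (\<exists>out l. list_all2 (\<in>) l ts \<and> nok i out (mset (prod.swap e # e' # l)))}"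

text \<open>\<open>A\<close> holds the types granted to cut edges, and \<open>A = {}\<close> gives
  the types of uncut branches. A node of a branch spends one of its edges on its parent, hence the
  strict bound by \<open>\<Delta>\<close>.\<close>

inductive_set gen :: "('s \<times> 's) set set \<Rightarrow> ('s \<times> 's) set set" for A where
  base: "t \<in> A \<Longrightarrow> t \<in> gen A"
| node: "i \<in> Inp \<Longrightarrow> (\<And>t. t \<in> set ts \<Longrightarrow> t \<in> gen A) \<Longrightarrow> length ts < \<Delta> \<Longrightarrow> branch_type i ts \<in> gen A"

text \<open>Only uncut branches hang from the inner nodes of a segment, hence \<open>gen {}\<close>;
  the two path edges account for the \<open>+ 2\<close>.\<close>

definition letters :: "(('s \<times> 's) \<times> ('s \<times> 's)) set set" where
  "letters = {letter i ts | i ts. i \<in> Inp \<and> set ts \<subseteq> gen {} \<and> length ts + 2 \<le> \<Delta>}"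

definition words :: "nat \<Rightarrow> (('s \<times> 's) \<times> ('s \<times> 's)) set list set" where
  "words l = {w. set w \<subseteq> letters \<and> length w = l}"

definition closable :: "'i \<Rightarrow> ('s \<times> 's) set list \<Rightarrow> bool" where
  "closable i ts \<longleftrightarrow> (\<exists>out l. list_all2 (\<in>) l ts \<and> nok i out (mset l))"

definition cut_types :: "nat \<Rightarrow> ((('s \<times> 's) \<times> ('s \<times> 's)) set list \<Rightarrow> ('s \<times> 's) set \<times> ('s \<times> 's) set) \<Rightarrow>
    ('s \<times> 's) set set" where
  "cut_types l g = fst ` g ` words l \<union> snd ` g ` words l"

text \<open>
  \<open>g\<close> prescribes for a path that spells \<open>w\<close> the types under which its two end edges are cut.  The
  second one is seen from the far end, so it is swapped to be read along the path.
\<close>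

definition feasible :: "nat \<Rightarrow> ((('s \<times> 's) \<times> ('s \<times> 's)) set list \<Rightarrow> ('s \<times> 's) set \<times> ('s \<times> 's) set) \<Rightarrow> bool" where
  "feasible l g \<longleftrightarrow>
     (\<forall>w\<in>words l. \<forall>a\<in>fst (g w). \<forall>b\<in>snd (g w). (a, prod.swap b) \<in> rel_of w) \<and>
     (\<forall>i\<in>Inp. \<forall>ts. set ts \<subseteq> gen (cut_types l g) \<longrightarrow> length ts \<le> \<Delta> \<longrightarrow> closable i ts)"

definition ok :: "('v \<Rightarrow> 'v set) \<Rightarrow> ('v \<Rightarrow> 'i) \<Rightarrow> 'v \<Rightarrow> ('v \<Rightarrow> 'v \<Rightarrow> 's) \<Rightarrow> bool" where
  "ok nb inp v \<sigma> \<longleftrightarrow> (\<exists>out. nok (inp v) out (image_mset (es \<sigma> v) (mset_set (nb v))))"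

lemma ok_cong:
  assumes "\<And>u. u \<in> nb v \<Longrightarrow> es \<sigma> v u = es \<sigma>' v u" "finite (nb v)"
  shows "ok nb inp v \<sigma> \<longleftrightarrow> ok nb inp v \<sigma>'"
proof -
  have "image_mset (es \<sigma> v) (mset_set (nb v)) = image_mset (es \<sigma>' v) (mset_set (nb v))"
    by (rule image_mset_cong) (use assms in auto)
  then show ?thesis unfolding ok_def by simp
qed

end

context edge_problem begin

text \<open>The relation that the actual tree imposes between two path edges at \<open>v\<close>. It
  depends on the labelled tree alone, not on an order of the children, so the algorithm can choose a
  letter below it consistently.\<close>

definition node_rel :: "('v \<Rightarrow> 'v set) \<Rightarrow> ('v \<Rightarrow> 'i) \<Rightarrow> 'v \<Rightarrow> 'v \<Rightarrow> 'v \<Rightarrow> (('s \<times> 's) \<times> ('s \<times> 's)) set" where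
  "node_rel nb inp a v b =
     {(e, e'). \<exists>\<sigma>. es \<sigma> a v = e \<and> es \<sigma> v b = e' \<and> (\<forall>u\<in>hanging nb a v b. ok nb inp u \<sigma>)}"

end

text \<open>Darts reachable from a dart without passing through a blocked one, which itself still counts.\<close>

inductive_set until :: "('v \<Rightarrow> 'v set) \<Rightarrow> ('v \<times> 'v) set \<Rightarrow> 'v \<Rightarrow> 'v \<Rightarrow> ('v \<times> 'v) set"
  for nb Blk x y where
  until_self: "(x, y) \<in> until nb Blk x y"
| until_step: "(p, w) \<in> until nb Blk x y \<Longrightarrow> (p, w) \<notin> Blk \<Longrightarrow> z \<in> nb w \<Longrightarrow> z \<noteq> p \<Longrightarrow>
    (w, z) \<in> until nb Blk x y"

lemma until_darts: "(p, w) \<in> until nb Blk x y \<Longrightarrow> (p, w) \<in> darts nb x y"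
  by (induction rule: until.induct) (auto intro: darts_step)

lemma until_blocked: "(x, y) \<in> Blk \<Longrightarrow> until nb Blk x y = {(x, y)}"
proof -
  assume xy: "(x, y) \<in> Blk"
  have "(p, w) \<in> until nb Blk x y \<Longrightarrow> (p, w) = (x, y)" for p w
    by (induction rule: until.induct) (use xy in auto)
  then show ?thesis by (auto intro: until.intros)
qed

lemma until_unfold:
  "(p, w) \<in> until nb Blk x y \<Longrightarrow> (p, w) = (x, y) \<or> (\<exists>z\<in>nb y - {x}. (p, w) \<in> until nb Blk y z)"
proof (induction rule: until.induct)
  case (until_step p w z)
  show ?case
  proof (cases "(p, w) = (x, y)")
    case True
    then show ?thesis using until_step by (auto intro: until.intros)
  next
    case False
    then show ?thesis using until_step by (auto intro: until.intros)
  qed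
qed simp

lemma until_empty: "until nb {} x y = darts nb x y"
proof -
  have "(p, w) \<in> darts nb x y \<Longrightarrow> (p, w) \<in> until nb {} x y" for p w
    by (induction rule: darts_induct) (auto intro: until.intros)
  then show ?thesis using until_darts by fast
qed

lemma map_graph_ex: "distinct zs \<Longrightarrow> length l = length zs \<Longrightarrow> \<exists>f. map f zs = l"
  by (rule exI[of _ "\<lambda>z. the (map_of (zip zs l) z)"])
    (auto intro!: nth_equalityI simp: map_of_zip_nth)

section \<open>Solutions assembled from types of branches\<close>

locale edge_problem_tree = edge_problem nok Inp Sg \<Delta> + utree V nb
  for nok :: "'i \<Rightarrow> 'o \<Rightarrow> ('s \<times> 's) multiset \<Rightarrow> bool" and Inp Sg \<Delta>
    and V :: "'v set" and nb +
  fixes inp :: "'v \<Rightarrow> 'i"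
  assumes inp: "\<And>v. v \<in> V \<Longrightarrow> inp v \<in> Inp"
    and deg: "\<And>v. v \<in> V \<Longrightarrow> card (nb v) \<le> \<Delta>"
begin

abbreviation "okv \<equiv> ok nb inp"

text \<open>The branches at \<open>y\<close> are disjoint and touch the rest of the tree only in
  their root edges, where the given solutions already carry the states \<open>e\<close>.\<close>

lemma node_merge:
  assumes Z: "Z \<subseteq> nb y" and s: "\<And>z. z \<in> Z \<Longrightarrow> es (s z) y z = e z"
  obtains \<sigma> where "\<And>z. z \<in> nb y \<Longrightarrow> es \<sigma> y z = e z"
    and "\<And>z u v. z \<in> Z \<Longrightarrow> u \<in> branch nb y z \<Longrightarrow> v \<in> nb u \<Longrightarrow> es \<sigma> u v = es (s z) u v"
proof
  \<comment> \<open>Away from \<open>y\<close> the tail of a dart selects the solution; by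
    disjointness \<open>SOME\<close> has only one candidate.\<close>
  define \<sigma> where "\<sigma> u v = (if u = y then fst (e v) else if v = y then snd (e u)
      else s (SOME z. z \<in> Z \<and> u \<in> branch nb y z) u v)" for u v
  show 1: "es \<sigma> y z = e z" if "z \<in> nb y" for z
    using that irrefl unfolding es_def \<sigma>_def by auto
  show "es \<sigma> u v = es (s z) u v" if z: "z \<in> Z" and u: "u \<in> branch nb y z" and v: "v \<in> nb u" for z u v
  proof -
    have zn: "z \<in> nb y" using z Z by auto
    consider "v \<in> branch nb y z" | "u = z" "v = y" using branch_closed[OF u v] by blast
    then show ?thesis
    proof cases
      case 1
      have uy: "u \<noteq> y" "v \<noteq> y" using u 1 not_in_branch[OF zn] by auto
      have "(SOME z'. z' \<in> Z \<and> a \<in> branch nb y z') = z" if "a \<in> branch nb y z" for a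
        using that z Z zn branch_disjoint[of z y] by (intro some_equality) blast+
      then show ?thesis using uy u 1 unfolding es_def \<sigma>_def by simp
    next
      case 2
      then show ?thesis using 1[OF zn] s[OF z] es_eq_swap by metis
    qed
  qed
qed

text \<open>At a blocked dart the branch behind it is replaced by its prescribed type, so only the
  state of the edge is demanded. At any other dart the node it enters has to be solved.\<close>

definition good :: "('v \<times> 'v) set \<Rightarrow> ('v \<times> 'v \<Rightarrow> ('s \<times> 's) set) \<Rightarrow> 'v \<times> 'v \<Rightarrow> ('v \<Rightarrow> 'v \<Rightarrow> 's) \<Rightarrow> bool" where
  "good Blk it d \<sigma> \<longleftrightarrow> (if d \<in> Blk then es \<sigma> (fst d) (snd d) \<in> it d else okv (snd d) \<sigma>)"

definition realised :: "('v \<times> 'v) set \<Rightarrow> ('v \<times> 'v \<Rightarrow> ('s \<times> 's) set) \<Rightarrow> ('s \<times> 's) set \<Rightarrow> 'v \<Rightarrow> 'v \<Rightarrow> bool" where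
  "realised Blk it t x y \<longleftrightarrow>
     (\<forall>e\<in>t. \<exists>\<sigma>. es \<sigma> x y = e \<and> (\<forall>d\<in>until nb Blk x y. good Blk it d \<sigma>))"

text \<open>One gluing step for three uses: the children in \<open>zs\<close> contribute states
  through their types, and the edges left over carry the states \<open>e\<close>. At a root no edge
  is left over, in a branch the parent edge, at a path node the two path edges.\<close>

lemma node_solution:
  assumes Z: "distinct zs" "set zs \<subseteq> nb y"
    and real: "\<And>z. z \<in> set zs \<Longrightarrow> realised Blk it (t z) y z"
    and l: "list_all2 (\<in>) l (map t zs)"
    and nok: "nok (inp y) out (mset l + image_mset e (mset_set (nb y - set zs)))"
  obtains \<sigma> where "okv y \<sigma>" "\<And>z. z \<in> nb y - set zs \<Longrightarrow> es \<sigma> y z = e z"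
    "\<And>z d. z \<in> set zs \<Longrightarrow> d \<in> until nb Blk y z \<Longrightarrow> good Blk it d \<sigma>"
proof -
  have len: "length l = length zs" using l by (auto dest: list_all2_lengthD)
  obtain f where f: "map f zs = l" using map_graph_ex[OF Z(1) len] by auto
  have "f z \<in> t z" if "z \<in> set zs" for z
    using l that unfolding f[symmetric] by (auto simp: list_all2_conv_all_nth in_set_conv_nth)
  then have "\<forall>z\<in>set zs. \<exists>\<sigma>. es \<sigma> y z = f z \<and> (\<forall>d\<in>until nb Blk y z. good Blk it d \<sigma>)"
    using real unfolding realised_def by blast
  then obtain s where s: "\<And>z. z \<in> set zs \<Longrightarrow> es (s z) y z = f z"
    "\<And>z d. z \<in> set zs \<Longrightarrow> d \<in> until nb Blk y z \<Longrightarrow> good Blk it d (s z)"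
    by (metis (no_types))
  define e' where "e' z = (if z \<in> set zs then f z else e z)" for z
  have "es (s z) y z = e' z" if "z \<in> set zs" for z using s(1) that by (simp add: e'_def)
  then obtain \<sigma> where \<sigma>: "\<And>z. z \<in> nb y \<Longrightarrow> es \<sigma> y z = e' z"
    "\<And>z u v. z \<in> set zs \<Longrightarrow> u \<in> branch nb y z \<Longrightarrow> v \<in> nb u \<Longrightarrow> es \<sigma> u v = es (s z) u v"
    using node_merge[OF Z(2), of s e'] by metis
  have "mset_set (nb y) = mset_set (set zs) + mset_set (nb y - set zs)"
    using Z(2) mset_set_Union[of "set zs" "nb y - set zs"] by (simp add: Un_absorb1)
  then have "image_mset (es \<sigma> y) (mset_set (nb y))
      = image_mset e' (mset_set (set zs) + mset_set (nb y - set zs))"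
    using \<sigma>(1) by (metis (no_types, lifting) fin_nb finite_set_mset_mset_set image_mset_cong)
  also have "\<dots> = mset l + image_mset e (mset_set (nb y - set zs))"
  proof -
    have "image_mset e' (mset_set (set zs)) = mset (map f zs)"
      using Z(1) by (auto simp: mset_set_set e'_def intro!: image_mset_cong)
    moreover have "image_mset e' (mset_set (nb y - set zs)) = image_mset e (mset_set (nb y - set zs))"
      by (rule image_mset_cong) (simp add: e'_def)
    ultimately show ?thesis using f by simp
  qed
  finally have "okv y \<sigma>" unfolding ok_def using nok by auto
  moreover have "good Blk it d \<sigma>" if z: "z \<in> set zs" and d: "d \<in> until nb Blk y z" for z d
  proof -
    obtain p w where pw: "d = (p, w)" by force
    have dd: "(p, w) \<in> darts nb y z" using until_darts d pw by fast
    then have w: "w \<in> branch nb y z" unfolding branch_def by force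
    have "w \<in> nb p" using darts_arc[OF _ dd] z Z(2) by auto
    then have "es \<sigma> p w = es (s z) p w" using \<sigma>(2)[OF z w] nb_sym es_eq_swap by metis
    moreover have "okv w \<sigma> \<longleftrightarrow> okv w (s z)" using \<sigma>(2)[OF z w] by (intro ok_cong) auto
    ultimately show ?thesis using s(2)[OF z d] unfolding good_def pw fst_conv snd_conv by presburger
  qed
  ultimately show thesis using that[of \<sigma>] \<sigma>(1) e'_def by auto
qed

lemma realised_node:
  assumes xy: "y \<in> nb x" and nB: "(x, y) \<notin> Blk"
    and zs: "distinct zs" "set zs = nb y - {x}"
    and real: "\<And>z. z \<in> set zs \<Longrightarrow> realised Blk it (t z) y z"
  shows "realised Blk it (branch_type (inp y) (map t zs)) x y"
  unfolding realised_def
proof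
  fix e assume "e \<in> branch_type (inp y) (map t zs)"
  then obtain out l where l: "list_all2 (\<in>) l (map t zs)" "nok (inp y) out (mset (prod.swap e # l))"
    unfolding branch_type_def by blast
  have x: "x \<in> nb y" using nb_sym xy by auto
  then have "nb y - set zs = {x}" using zs by auto
  then have nk: "nok (inp y) out (mset l + image_mset (\<lambda>_. prod.swap e) (mset_set (nb y - set zs)))"
    using l(2) by simp
  have sub: "set zs \<subseteq> nb y" using zs(2) by auto
  obtain \<sigma> where \<sigma>: "okv y \<sigma>" "\<And>z. z \<in> nb y - set zs \<Longrightarrow> es \<sigma> y z = prod.swap e"
    "\<And>z d. z \<in> set zs \<Longrightarrow> d \<in> until nb Blk y z \<Longrightarrow> good Blk it d \<sigma>"
    by (rule node_solution[OF zs(1) sub real l(1) nk], assumption, rule that) blast+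
  have "good Blk it d \<sigma>" if d: "d \<in> until nb Blk x y" for d
  proof -
    obtain p w where pw: "d = (p, w)" by force
    show ?thesis
    using until_unfold[OF d[unfolded pw]]
    proof
      assume "(p, w) = (x, y)"
      then show ?thesis using nB \<sigma>(1) pw unfolding good_def by simp
    qed (use \<sigma>(3) zs(2) pw in auto)
  qed
  moreover have "es \<sigma> x y = e" using \<sigma>(2)[of x] x zs(2) es_swap[of \<sigma> x y] by simp
  ultimately show "\<exists>\<sigma>. es \<sigma> x y = e \<and> (\<forall>d\<in>until nb Blk x y. good Blk it d \<sigma>)" by blast
qed

text \<open>Induction from the leaves: a blocked dart has its prescribed type, any other dart the
  type computed from its children. So all types that occur are generated from \<open>A\<close>,
  whatever the tree looks like, and a condition on \<open>gen A\<close> covers all trees.\<close>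

lemma realised_ex:
  assumes it: "\<And>d. d \<in> Blk \<Longrightarrow> it d \<in> A" and "y \<in> nb x"
  shows "\<exists>t\<in>gen A. realised Blk it t x y"
  using assms(2)
proof (induction rule: branch_induct)
  case (arc x y)
  show ?case
  proof (cases "(x, y) \<in> Blk")
    case True
    \<comment> \<open>Behind a blocked dart nothing has to be solved, so any state is simply put on
      the edge.\<close>
    have "\<exists>\<sigma>. es \<sigma> x y = e" for e :: "'s \<times> 's"
      using arc(1) irrefl
      by (intro exI[of _ "\<lambda>u v. if (u, v) = (x, y) then fst e else snd e"]) (auto simp: es_def)
    then have "realised Blk it (it (x, y)) x y"
      using True unfolding realised_def until_blocked[OF True] good_def by (metis fst_conv snd_conv singletonD)
    then show ?thesis using it[OF True] gen.base by blast
  next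
    case False
    obtain zs where zs: "distinct zs" "set zs = nb y - {x}"
      using finite_distinct_list[of "nb y - {x}"] by auto
    obtain t where t: "\<And>z. z \<in> set zs \<Longrightarrow> t z \<in> gen A \<and> realised Blk it (t z) y z"
      using arc.IH zs(2) by metis
    have "x \<in> nb y" "y \<in> V" using arc(1) nb_sym nb_sub by auto
    then have "length (map t zs) < \<Delta>"
      using deg[of y] zs distinct_card[OF zs(1)] card_Diff1_less[of "nb y" x] by auto
    then have "branch_type (inp y) (map t zs) \<in> gen A"
      using t inp[OF \<open>y \<in> V\<close>] by (intro gen.node) auto
    then show ?thesis using realised_node[OF arc(1) False zs] t by blast
  qed
qed

lemma root_solution:
  assumes it: "\<And>d. d \<in> Blk \<Longrightarrow> it d \<in> A" and v: "v \<in> V"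
    and cl: "\<And>i ts. i \<in> Inp \<Longrightarrow> set ts \<subseteq> gen A \<Longrightarrow> length ts \<le> \<Delta> \<Longrightarrow> closable i ts"
  obtains \<sigma> where "okv v \<sigma>" "\<And>z d. z \<in> nb v \<Longrightarrow> d \<in> until nb Blk v z \<Longrightarrow> good Blk it d \<sigma>"
proof -
  obtain zs where zs: "distinct zs" "set zs = nb v"
    using finite_distinct_list[of "nb v"] by auto
  have "\<exists>t. t \<in> gen A \<and> realised Blk it t v z" if "z \<in> set zs" for z
  proof -
    have "z \<in> nb v" using that zs(2) by simp
    then have "\<exists>t\<in>gen A. realised Blk it t v z" by (rule realised_ex[rotated]) (rule it)
    then show ?thesis by blast
  qed
  then have "\<forall>z\<in>set zs. \<exists>t. t \<in> gen A \<and> realised Blk it t v z" by blast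
  from bchoice[OF this] obtain t where
    t: "\<And>z. z \<in> set zs \<Longrightarrow> t z \<in> gen A \<and> realised Blk it (t z) v z" by blast
  have "length (map t zs) \<le> \<Delta>" using deg[OF v] zs distinct_card[OF zs(1)] by auto
  then obtain out l where l: "list_all2 (\<in>) l (map t zs)" "nok (inp v) out (mset l)"
    using cl[OF inp[OF v], of "map t zs"] t unfolding closable_def by auto
  \<comment> \<open>No edge is left over at the root, so the default state is never read.\<close>
  have "nok (inp v) out (mset l + image_mset undefined (mset_set (nb v - set zs)))"
    using l(2) zs(2) by simp
  then obtain \<sigma> where "okv v \<sigma>" "\<And>z. z \<in> nb v - set zs \<Longrightarrow> es \<sigma> v z = undefined z"
    "\<And>z d. z \<in> set zs \<Longrightarrow> d \<in> until nb Blk v z \<Longrightarrow> good Blk it d \<sigma>"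
    using node_solution[OF zs(1) eq_refl[OF zs(2)] conjunct2[OF t] l(1)] by blast
  then show thesis using that zs(2) by blast
qed

abbreviation "node_relation \<equiv> node_rel nb inp"

text \<open>The branches off the path are taken uncut, with types in \<open>gen {}\<close>. Gluing
  at \<open>v\<close> with the two path edges left over turns each pair in the letter into a
  solution of the hanging part.\<close>

lemma letter_ex:
  assumes ab: "a \<in> nb v" "b \<in> nb v" "a \<noteq> b"
  shows "\<exists>\<rho>\<in>letters. \<rho> \<subseteq> node_relation a v b"
proof -
  have v: "v \<in> V" using ab nb_V by auto
  obtain zs where zs: "distinct zs" "set zs = nb v - {a, b}"
    using finite_distinct_list[of "nb v - {a, b}"] by auto
  obtain t where t: "\<And>z. z \<in> set zs \<Longrightarrow> t z \<in> gen {} \<and> realised {} undefined (t z) v z"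
    using realised_ex[of "{}" undefined "{}" _ v] zs(2)
    by (metis (no_types, lifting) DiffD1 equals0D)
  have "length zs + 2 = card (nb v)"
    using ab card_Diff_subset[of "{a, b}" "nb v"] card_mono[of "nb v" "{a, b}"] distinct_card[OF zs(1)] zs(2) by auto
  then have "letter (inp v) (map t zs) \<in> letters"
    unfolding letters_def using inp[OF v] deg[OF v] t by fastforce
  moreover have "letter (inp v) (map t zs) \<subseteq> node_relation a v b"
  proof
    fix d assume "d \<in> letter (inp v) (map t zs)"
    then obtain e e' out l where d: "d = (e, e')" and l: "list_all2 (\<in>) l (map t zs)"
      "nok (inp v) out (mset (prod.swap e # e' # l))" unfolding letter_def by blast
    let ?e = "\<lambda>z. if z = a then prod.swap e else e'"
    have "nb v - set zs = {a, b}" using zs ab by auto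
    then have "nok (inp v) out (mset l + image_mset ?e (mset_set (nb v - set zs)))"
      using l(2) ab by simp
    moreover have "set zs \<subseteq> nb v" using zs(2) by auto
    ultimately obtain \<sigma> where "okv v \<sigma>" "\<And>z. z \<in> nb v - set zs \<Longrightarrow> es \<sigma> v z = ?e z"
      "\<And>z d. z \<in> set zs \<Longrightarrow> d \<in> until nb {} v z \<Longrightarrow> good {} undefined d \<sigma>"
      using node_solution[OF zs(1) _ conjunct2[OF t] l(1)] by blast
    then have \<sigma>: "okv v \<sigma>" "\<And>z. z \<in> {a, b} \<Longrightarrow> es \<sigma> v z = ?e z"
      "\<And>z d. z \<in> set zs \<Longrightarrow> d \<in> until nb {} v z \<Longrightarrow> good {} undefined d \<sigma>"
      unfolding \<open>nb v - set zs = {a, b}\<close> by blast+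
    have "okv u \<sigma>" if "u \<in> hanging nb a v b" for u
    proof (cases "u = v")
      case False
      then have "\<exists>z\<in>set zs. u \<in> branch nb v z"
        using that zs(2) unfolding hanging_def by auto
      then obtain z where z: "z \<in> set zs" "u \<in> branch nb v z" by blast
      then obtain p where "(p, u) \<in> until nb {} v z" unfolding branch_def until_empty by force
      then show ?thesis using \<sigma>(3)[OF z(1)] unfolding good_def by fastforce
    qed (use \<sigma>(1) in simp)
    moreover have "es \<sigma> a v = e" using \<sigma>(2)[of a] es_swap[of \<sigma> a v] by simp
    moreover have "es \<sigma> v b = e'" using \<sigma>(2)[of b] ab(3) by simp
    ultimately show "d \<in> node_relation a v b" unfolding node_rel_def d by blast
  qed
  ultimately show ?thesis by blast
qed

text \<open>Consecutive hanging parts share only the path edge between them, and there both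
  solutions carry the state given by \<open>E\<close>.\<close>

lemma path_merge:
  assumes p: "nb_walk nb p" and len: "length p = n + 2"
    and s: "\<And>i. i < n \<Longrightarrow> es (s i) (p ! i) (p ! Suc i) = E i \<and> es (s i) (p ! Suc i) (p ! (i + 2)) = E (Suc i)"
  obtains \<sigma> where "\<And>i u v. i < n \<Longrightarrow> u \<in> hanging nb (p ! i) (p ! Suc i) (p ! (i + 2)) \<Longrightarrow> v \<in> nb u \<Longrightarrow>
     es \<sigma> u v = es (s i) u v"
proof -
  define K where "K i = hanging nb (p ! i) (p ! Suc i) (p ! (i + 2))" for i
  \<comment> \<open>The tail of a dart decides which solution is used. At the two end edges of the
    walk the tail may lie in no part, and then the head decides.\<close>
  define \<sigma> where "\<sigma> u v = (if \<exists>i<n. u \<in> K i then s (SOME i. i < n \<and> u \<in> K i) u v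
     else s (SOME i. i < n \<and> v \<in> K i) u v)" for u v
  have disj: "K i \<inter> K j = {}" if "i < j" "j < n" for i j
    using hanging_disjoint[OF p, of "Suc i" "Suc j"] that len unfolding K_def by simp
  have uniq: "i = j" if "i < n" "j < n" "u \<in> K i" "u \<in> K j" for i j u
    using disj[of i j] disj[of j i] that by (cases i j rule: linorder_cases) auto
  have some: "(SOME i. i < n \<and> u \<in> K i) = i" if "i < n" "u \<in> K i" for i u
    using that uniq by (intro some_equality) blast+
  have pK: "p ! Suc i \<in> K i" for i unfolding K_def hanging_def by simp
  have "es \<sigma> u v = es (s i) u v" if i: "i < n" and u: "u \<in> K i" and v: "v \<in> nb u" for i u v
  proof -
    have 1: "\<sigma> u v = s i u v" unfolding \<sigma>_def using some[OF i u] i u by auto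
    have "\<sigma> v u = s i v u"
    proof (cases "\<exists>j<n. v \<in> K j")
      case True
      then obtain j where j: "j < n" "v \<in> K j" by auto
      then have 2: "\<sigma> v u = s j v u" unfolding \<sigma>_def using some[OF j] by auto
      show ?thesis
      proof (cases "i = j")
        case False
        then have "v \<notin> K i" using uniq i j by blast
        then have uv: "u = p ! Suc i" "v = p ! i \<or> v = p ! (i + 2)"
          using hanging_closed u v unfolding K_def by blast+
        then show ?thesis
        proof (elim disjE)
          assume vi: "v = p ! i"
          show ?thesis
          proof (cases i)
            \<comment> \<open>The first node of the walk lies in no part, since all parts are
              contained in the branch behind the first edge.\<close>
            case 0
            have arcs: "p ! Suc 0 \<in> nb (p ! 0)" "p ! Suc j \<in> nb (p ! j)" "p ! (j+2) \<in> nb (p ! Suc j)"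
              using p len j(1) i unfolding nb_walk_def by auto
            have "j > 0" using False 0 by auto
            have "v \<in> branch nb (p ! 0) (p ! Suc 0)"
            proof -
              have d: "(p ! j, p ! Suc j) \<in> darts nb (p ! 0) (p ! Suc 0)"
                using nb_walk_darts[OF p, of 0 j] j len by auto
              then have "K j \<subseteq> branch nb (p ! 0) (p ! Suc 0)"
                using branch_mono[OF darts_step[OF d]] branch_mono[OF d] branch_self[of "p ! Suc j" nb "p ! j"]
                unfolding K_def hanging_def by auto
              then show ?thesis using j by blast
            qed
            then show ?thesis using not_in_branch[OF arcs(1)] vi 0 by auto
          next
            case (Suc i')
            then have "j = i'" using uniq[OF j(1) _ j(2), of i'] pK[of i'] vi i by auto
            then have "es (s j) v u = es (s i) v u"
              using s[of j] s[of i] j i Suc uv vi by simp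
            then show ?thesis using 2 by (simp add: es_def)
          qed
        next
          assume vi: "v = p ! (i + 2)"
          \<comment> \<open>Likewise the last node lies in no part: seen from an earlier part it is
            in the branch that continues the walk.\<close>
          have "Suc i < n"
          proof (rule ccontr)
            assume "\<not> Suc i < n"
            then have "j < i" using j(1) False i by auto
            have "p ! Suc (Suc j) \<in> nb (p ! Suc j)" using p len j(1) unfolding nb_walk_def by auto
            then have "K j \<inter> branch nb (p ! Suc j) (p ! Suc (Suc j)) = {}"
              using branch_disjoint not_in_branch unfolding K_def hanging_def by fastforce
            moreover have "(p ! Suc i, p ! Suc (Suc i)) \<in> darts nb (p ! Suc j) (p ! Suc (Suc j))"
              using nb_walk_darts[OF p, of "Suc j" "Suc i"] \<open>j < i\<close> i len by auto
            then have "v \<in> branch nb (p ! Suc j) (p ! Suc (Suc j))"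
              unfolding branch_def vi by force
            ultimately show False using j(2) by blast
          qed
          then have "j = Suc i" using uniq[OF j(1) _ j(2), of "Suc i"] pK[of "Suc i"] vi by auto
          then have "es (s j) u v = es (s i) u v"
            using s[of j] s[of i] j i uv vi by simp
          then show ?thesis using 2 by (simp add: es_def)
        qed
      qed (use 2 in simp)
    next
      case False
      then show ?thesis unfolding \<sigma>_def using some[OF i u] by auto
    qed
    then show ?thesis using 1 by (simp add: es_def)
  qed
  then show thesis using that unfolding K_def by blast
qed

lemma path_solution:
  assumes p: "nb_walk nb p" and len: "length p = length w + 2" "w \<noteq> []"
    and w: "\<And>i. i < length w \<Longrightarrow> w ! i \<subseteq> node_relation (p ! i) (p ! Suc i) (p ! (i + 2))"
    and ab: "(a, b) \<in> rel_of w"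
  obtains \<sigma> where "es \<sigma> (p ! 0) (p ! 1) = a" "es \<sigma> (p ! length w) (p ! Suc (length w)) = b"
    "\<And>i u. i < length w \<Longrightarrow> u \<in> hanging nb (p ! i) (p ! Suc i) (p ! (i + 2)) \<Longrightarrow> okv u \<sigma>"
proof -
  obtain E where E: "E 0 = a" "E (length w) = b" "\<And>i. i < length w \<Longrightarrow> (E i, E (Suc i)) \<in> w ! i"
    using ab unfolding rel_of_chain by auto
  have "\<forall>i. \<exists>\<sigma>. i < length w \<longrightarrow> es \<sigma> (p ! i) (p ! Suc i) = E i \<and> es \<sigma> (p ! Suc i) (p ! (i + 2)) = E (Suc i)
     \<and> (\<forall>u\<in>hanging nb (p ! i) (p ! Suc i) (p ! (i + 2)). okv u \<sigma>)"
  proof (intro allI)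
    fix i
    show "\<exists>\<sigma>. i < length w \<longrightarrow> es \<sigma> (p ! i) (p ! Suc i) = E i \<and> es \<sigma> (p ! Suc i) (p ! (i + 2)) = E (Suc i)
     \<and> (\<forall>u\<in>hanging nb (p ! i) (p ! Suc i) (p ! (i + 2)). okv u \<sigma>)"
    proof (cases "i < length w")
      case True
      then have "(E i, E (Suc i)) \<in> node_relation (p ! i) (p ! Suc i) (p ! (i + 2))"
        using E(3) w by blast
      then show ?thesis unfolding node_rel_def by auto
    qed simp
  qed
  from choice[OF this] obtain s where s0: "\<forall>i. i < length w \<longrightarrow> es (s i) (p ! i) (p ! Suc i) = E i \<and>
     es (s i) (p ! Suc i) (p ! (i + 2)) = E (Suc i) \<and>
     (\<forall>u\<in>hanging nb (p ! i) (p ! Suc i) (p ! (i + 2)). okv u (s i))" ..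
  have s: "es (s i) (p ! i) (p ! Suc i) = E i \<and> es (s i) (p ! Suc i) (p ! (i + 2)) = E (Suc i)"
    "u \<in> hanging nb (p ! i) (p ! Suc i) (p ! (i + 2)) \<Longrightarrow> okv u (s i)" if "i < length w" for i u
    using s0 that by simp_all
  obtain \<sigma> where \<sigma>: "\<And>i u v. i < length w \<Longrightarrow> u \<in> hanging nb (p ! i) (p ! Suc i) (p ! (i + 2)) \<Longrightarrow>
     v \<in> nb u \<Longrightarrow> es \<sigma> u v = es (s i) u v"
    by (rule path_merge[OF p len(1) s(1)], assumption, rule that) blast
  have ok: "okv u \<sigma>" if "i < length w" "u \<in> hanging nb (p ! i) (p ! Suc i) (p ! (i + 2))" for i u
    using s(2)[OF that] \<sigma>[OF that] ok_cong[of nb u \<sigma> "s i"] by auto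
  have arcs: "p ! Suc i \<in> nb (p ! i)" if "i \<le> length w" for i
    using p len that unfolding nb_walk_def by auto
  obtain n where n: "length w = Suc n" using len(2) by (cases w) auto
  have "es \<sigma> (p ! 1) (p ! 0) = es (s 0) (p ! 1) (p ! 0)"
    using \<sigma>[of 0 "p ! 1" "p ! 0"] arcs[of 0] nb_sym n unfolding hanging_def by auto
  then have 1: "es \<sigma> (p ! 0) (p ! 1) = a" using s(1)[of 0] E(1) n es_eq_swap[of \<sigma> "p ! 0" "p ! 1" "s 0"] by simp
  have "es \<sigma> (p ! Suc n) (p ! (n + 2)) = es (s n) (p ! Suc n) (p ! (n + 2))"
    using \<sigma>[of n "p ! Suc n" "p ! (n+2)"] arcs[of "Suc n"] n unfolding hanging_def by auto
  then have 2: "es \<sigma> (p ! length w) (p ! Suc (length w)) = b" using s(1)[of n] E(2) n by simp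
  show thesis using that[OF 1 2 ok] .
qed

end

section \<open>Cutting a tree along paths\<close>

text \<open>In \<open>ct u z t\<close> the node \<open>u\<close> lies outside and \<open>z\<close>
  on the segment that is cut out; \<open>t\<close> is the type granted to the edge as seen from
  \<open>u\<close>.\<close>

definition cut_arcs :: "('v \<Rightarrow> 'v \<Rightarrow> 't \<Rightarrow> bool) \<Rightarrow> ('v \<times> 'v) set" where
  "cut_arcs ct = {(u, z). \<exists>t. ct u z t \<or> ct z u t}"

definition uncut :: "('v \<Rightarrow> 'v set) \<Rightarrow> ('v \<Rightarrow> 'v \<Rightarrow> 't \<Rightarrow> bool) \<Rightarrow> ('v \<times> 'v) set" where
  "uncut nb ct = {(a, b). b \<in> nb a \<and> (a, b) \<notin> cut_arcs ct}"

definition comp :: "('v \<Rightarrow> 'v set) \<Rightarrow> ('v \<Rightarrow> 'v \<Rightarrow> 't \<Rightarrow> bool) \<Rightarrow> 'v \<Rightarrow> 'v set" where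
  "comp nb ct v = {u. (v, u) \<in> (uncut nb ct)\<^sup>*}"

definition inner :: "('v \<Rightarrow> 'v set) \<Rightarrow> ('v \<Rightarrow> 'v \<Rightarrow> 't \<Rightarrow> bool) \<Rightarrow> 'v \<Rightarrow> bool" where
  "inner nb ct v \<longleftrightarrow> (\<exists>u\<in>comp nb ct v. \<exists>z t. ct z u t)"

context edge_problem begin

text \<open>
  Components outside the cut paths are solved first, every cut edge being treated as a branch of the
  prescribed type; feasibility then lets the components inside match the states chosen on the cut edges.
\<close>

definition outer_sol where
  "outer_sol nb inp ct v = (SOME \<sigma>. (\<forall>u\<in>comp nb ct v. ok nb inp u \<sigma>) \<and>
     (\<forall>u\<in>comp nb ct v. \<forall>z t. ct u z t \<longrightarrow> es \<sigma> u z \<in> t))"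

definition inner_sol where
  "inner_sol nb inp ct v = (SOME \<sigma>. (\<forall>u\<in>comp nb ct v. ok nb inp u \<sigma>) \<and>
     (\<forall>u\<in>comp nb ct v. \<forall>z t. ct z u t \<longrightarrow> es \<sigma> z u = es (outer_sol nb inp ct z) z u))"

definition sol where
  "sol nb inp ct v = (if inner nb ct v then inner_sol nb inp ct v else outer_sol nb inp ct v)"

end

text \<open>\<open>disj\<close> and \<open>hang\<close> keep every path out of the inside of any
  other, so the inside of a path meets no cut edges but the two ends of that path. This limits the
  dependency between components to two levels.\<close>

locale cut_tree = edge_problem_tree nok Inp Sg \<Delta> V nb inp
  for nok :: "'i \<Rightarrow> 'o \<Rightarrow> ('s \<times> 's) multiset \<Rightarrow> bool" and Inp Sg \<Delta>
    and V :: "'v set" and nb inp +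
  fixes l :: nat and g and M :: "'m set" and pl :: "'m \<Rightarrow> 'v list" and wd
  assumes feas: "feasible l g" and l_pos: "0 < l"
    and walk: "\<And>m. m \<in> M \<Longrightarrow> nb_walk nb (pl m)"
    and len: "\<And>m. m \<in> M \<Longrightarrow> length (pl m) = l + 2"
    and wd: "\<And>m. m \<in> M \<Longrightarrow> wd m \<in> words l"
    and wd_sub: "\<And>m i. m \<in> M \<Longrightarrow> i < l \<Longrightarrow>
       wd m ! i \<subseteq> node_relation (pl m ! i) (pl m ! Suc i) (pl m ! (i + 2))"
    and disj: "\<And>m m'. m \<in> M \<Longrightarrow> m' \<in> M \<Longrightarrow> m \<noteq> m' \<Longrightarrow> set (pl m) \<inter> set (pl m') = {}"
    and hang: "\<And>m m' i z. m \<in> M \<Longrightarrow> m' \<in> M \<Longrightarrow> i < l \<Longrightarrow>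
       z \<in> nb (pl m ! Suc i) - {pl m ! i, pl m ! (i + 2)} \<Longrightarrow>
       branch nb (pl m ! Suc i) z \<inter> set (pl m') = {}"
begin

definition ct :: "'v \<Rightarrow> 'v \<Rightarrow> ('s \<times> 's) set \<Rightarrow> bool" where
  "ct u z t \<longleftrightarrow> (\<exists>m\<in>M. (u, z, t) = (pl m ! 0, pl m ! 1, fst (g (wd m))) \<or>
     (u, z, t) = (pl m ! (l + 1), pl m ! l, snd (g (wd m))))"

abbreviation "cmp \<equiv> comp nb ct"

definition inside :: "'m \<Rightarrow> 'v set" where
  "inside m = (\<Union>i<l. hanging nb (pl m ! i) (pl m ! Suc i) (pl m ! (i + 2)))"

section \<open>Components of the cut tree\<close>

lemma cmp_refl [simp]: "v \<in> cmp v"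
  by (simp add: comp_def)

lemma cmp_eq: assumes "u \<in> cmp v" shows "cmp u = cmp v"
proof -
  have "sym (uncut nb ct)" unfolding uncut_def cut_arcs_def by (auto simp: sym_def nb_sym)
  then have "sym ((uncut nb ct)\<^sup>*)" by (rule sym_rtrancl)
  moreover have "(v, u) \<in> (uncut nb ct)\<^sup>*" using assms by (simp add: comp_def)
  ultimately show ?thesis unfolding comp_def by (auto simp: sym_def intro: rtrancl_trans)
qed

lemma sol_cong: "cmp u = cmp v \<Longrightarrow> sol nb inp ct u = sol nb inp ct v"
  by (simp only: sol_def inner_def inner_sol_def outer_sol_def)

lemma inside_path:
  assumes m: "m \<in> M" "m' \<in> M" and u: "u \<in> inside m" "u \<in> set (pl m')"
  shows "m = m'" "u \<noteq> pl m ! 0" "u \<noteq> pl m ! (l + 1)"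
proof -
  obtain i where i: "i < l" "u \<in> hanging nb (pl m ! i) (pl m ! Suc i) (pl m ! (i + 2))"
    using u(1) unfolding inside_def by auto
  then have ui: "u = pl m ! Suc i" using hang[OF m i(1)] u(2) unfolding hanging_def by auto
  then have "u \<in> set (pl m)" using i(1) len[OF m(1)] by auto
  then show "m = m'" using disj[OF m] u(2) by auto
  have "distinct (pl m)" using nb_walk_distinct walk m by blast
  then show "u \<noteq> pl m ! 0" "u \<noteq> pl m ! (l + 1)"
    using ui i(1) len[OF m(1)] by (auto simp: nth_eq_iff_index_eq)
qed

lemma ct_path:
  assumes "ct u z t" obtains m where "m \<in> M" "u \<in> set (pl m)" "z \<in> set (pl m)"
    "(u, z) = (pl m ! 0, pl m ! 1) \<or> (u, z) = (pl m ! (l + 1), pl m ! l)"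
proof -
  obtain m where "m \<in> M" "(u, z) = (pl m ! 0, pl m ! 1) \<or> (u, z) = (pl m ! (l + 1), pl m ! l)"
    using assms unfolding ct_def by auto
  moreover then have "u \<in> set (pl m)" "z \<in> set (pl m)" using len by auto
  ultimately show thesis using that by blast
qed

lemma ends_inside:
  assumes m: "m \<in> M" shows "pl m ! 1 \<in> inside m" "pl m ! l \<in> inside m"
proof -
  obtain k where "l = Suc k" using l_pos by (cases l) auto
  then show "pl m ! 1 \<in> inside m" "pl m ! l \<in> inside m"
    unfolding inside_def hanging_def by (auto intro: bexI[of _ 0] bexI[of _ k])
qed

lemma ct_unique: "ct u z t \<Longrightarrow> ct u z t' \<Longrightarrow> t = t'"
proof -
  assume a: "ct u z t" "ct u z t'"
  obtain m where m: "m \<in> M" "(u, z, t) = (pl m ! 0, pl m ! 1, fst (g (wd m))) \<or>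
     (u, z, t) = (pl m ! (l + 1), pl m ! l, snd (g (wd m)))" using a(1) unfolding ct_def by blast
  obtain m' where m': "m' \<in> M" "(u, z, t') = (pl m' ! 0, pl m' ! 1, fst (g (wd m'))) \<or>
     (u, z, t') = (pl m' ! (l + 1), pl m' ! l, snd (g (wd m')))" using a(2) unfolding ct_def by blast
  have ends: "pl k ! 0 \<in> set (pl k)" "pl k ! (l + 1) \<in> set (pl k)" if "k \<in> M" for k
    using len[OF that] by auto
  have "u = pl m ! 0 \<or> u = pl m ! (l + 1)" "u = pl m' ! 0 \<or> u = pl m' ! (l + 1)"
    using m(2) m'(2) by auto
  then have "u \<in> set (pl m)" "u \<in> set (pl m')" using ends[OF m(1)] ends[OF m'(1)] by metis+
  then have eq: "m' = m" using disj m(1) m'(1) by blast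
  have "distinct (pl m)" using nb_walk_distinct walk m by blast
  then have "pl m ! 0 \<noteq> pl m ! (l + 1)" using len[OF m(1)] by (simp add: nth_eq_iff_index_eq)
  then show ?thesis using m m' unfolding eq by auto
qed

lemma inside_cut:
  assumes m: "m \<in> M" and u: "u \<in> inside m" and c: "(u, z) \<in> cut_arcs ct"
  shows "(z, u) = (pl m ! 0, pl m ! 1) \<or> (z, u) = (pl m ! (l + 1), pl m ! l)"
proof -
  obtain t where "ct u z t \<or> ct z u t" using c unfolding cut_arcs_def by auto
  then show ?thesis
  proof
    assume "ct u z t"
    then obtain m' where m': "m' \<in> M" "u \<in> set (pl m')"
      "(u, z) = (pl m' ! 0, pl m' ! 1) \<or> (u, z) = (pl m' ! (l + 1), pl m' ! l)" by (rule ct_path)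
    then show ?thesis using inside_path[OF m m'(1) u m'(2)] by auto
  next
    assume "ct z u t"
    then obtain m' where m': "m' \<in> M" "u \<in> set (pl m')"
      "(z, u) = (pl m' ! 0, pl m' ! 1) \<or> (z, u) = (pl m' ! (l + 1), pl m' ! l)" by (rule ct_path)
    then show ?thesis using inside_path[OF m m'(1) u m'(2)] by auto
  qed
qed

text \<open>The only edges leaving the inside of a path are its two end edges, and these are
  cut.\<close>

lemma cmp_inside:
  assumes m: "m \<in> M" and v: "v \<in> inside m" shows "cmp v \<subseteq> inside m"
proof
  fix u assume "u \<in> cmp v"
  then have "(v, u) \<in> (uncut nb ct)\<^sup>*" by (simp add: comp_def)
  then show "u \<in> inside m"
  proof induction
    case (step u w)
    then have w: "w \<in> nb u" "(u, w) \<notin> cut_arcs ct" by (auto simp: uncut_def)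
    obtain i where i: "i < l" "u \<in> hanging nb (pl m ! i) (pl m ! Suc i) (pl m ! (i + 2))"
      using step.IH unfolding inside_def by auto
    from hanging_closed[OF i(2) w(1)] show ?case
    proof (elim disjE conjE)
      assume "w \<in> hanging nb (pl m ! i) (pl m ! Suc i) (pl m ! (i + 2))"
      then show ?thesis using i(1) unfolding inside_def by blast
    next
      assume e: "u = pl m ! Suc i" "w = pl m ! i"
      show ?thesis
      proof (cases i)
        case 0
        then have "ct w u (fst (g (wd m)))" using e m unfolding ct_def by auto
        then show ?thesis using w(2) unfolding cut_arcs_def by blast
      next
        case (Suc j)
        then have "w \<in> hanging nb (pl m ! j) (pl m ! Suc j) (pl m ! (j + 2))"
          using e unfolding hanging_def by simp
        then show ?thesis using i(1) Suc unfolding inside_def by auto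
      qed
    next
      assume e: "u = pl m ! Suc i" "w = pl m ! (i + 2)"
      show ?thesis
      proof (cases "Suc i < l")
        case False
        then have "l = Suc i" using i(1) by simp
        then have "ct w u (snd (g (wd m)))" using e m unfolding ct_def by auto
        then show ?thesis using w(2) unfolding cut_arcs_def by blast
      next
        case True
        have "w \<in> hanging nb (pl m ! Suc i) (pl m ! Suc (Suc i)) (pl m ! (Suc i + 2))"
          using e unfolding hanging_def by simp
        then show ?thesis using True unfolding inside_def by blast
      qed
    qed
  qed (use v in simp)
qed

lemma inner_inside:
  assumes "inner nb ct v" obtains m where "m \<in> M" "v \<in> inside m"
proof -
  obtain u z t where u: "u \<in> cmp v" "ct z u t" using assms unfolding inner_def by blast
  from u(2) obtain m where m0: "m \<in> M" "(z, u) = (pl m ! 0, pl m ! 1) \<or> (z, u) = (pl m ! (l + 1), pl m ! l)"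
    by (rule ct_path)
  then have m: "m \<in> M" "u \<in> inside m" using ends_inside[OF m0(1)] by auto
  have "v \<in> cmp u" using cmp_eq[OF u(1)] by simp
  then show thesis using cmp_inside[OF m] m that by blast
qed

text \<open>The outer end of a cut edge is the first or last node of a path, which belongs to no
  inside. Hence inner solutions refer to outer ones only, and there is no circularity.\<close>

lemma cut_source_outer:
  assumes "ct u z t" shows "\<not> inner nb ct u"
proof
  assume "inner nb ct u"
  then obtain m where m: "m \<in> M" "u \<in> inside m" by (rule inner_inside)
  from assms obtain m' where m': "m' \<in> M" "u \<in> set (pl m')"
    "(u, z) = (pl m' ! 0, pl m' ! 1) \<or> (u, z) = (pl m' ! (l + 1), pl m' ! l)" by (rule ct_path)
  show False using inside_path[OF m(1) m'(1) m(2) m'(2)] m'(3) by auto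
qed

lemma cut_target_inner: "ct u z t \<Longrightarrow> inner nb ct z"
  unfolding inner_def using cmp_refl by blast

text \<open>An exploration from \<open>v\<close> that stops at cut edges sees a tree some of whose
  branches are replaced by cut types. Feasibility then closes the root, whatever types its branches
  turn out to have.\<close>

lemma outer_sol:
  assumes v: "v \<in> V" and out: "\<not> inner nb ct v"
  shows "\<forall>u\<in>cmp v. okv u (outer_sol nb inp ct v)"
    and "\<forall>u\<in>cmp v. \<forall>z t. ct u z t \<longrightarrow> es (outer_sol nb inp ct v) u z \<in> t"
proof -
  \<comment> \<open>A cut edge read from the inside has no prescribed type; it receives an arbitrary
    cut type so that \<open>it\<close> is total on \<open>cut_arcs\<close>.\<close>
  define it where "it d = (SOME t. t \<in> cut_types l g \<and> (\<forall>t'. ct (fst d) (snd d) t' \<longrightarrow> t' = t))" for d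
  have ct_types: "t \<in> cut_types l g" if "ct u z t" for u z t
    using that wd unfolding ct_def cut_types_def by auto
  have it: "it d \<in> cut_types l g \<and> (\<forall>t'. ct (fst d) (snd d) t' \<longrightarrow> t' = it d)" if "d \<in> cut_arcs ct" for d
  proof -
    have "\<exists>t. t \<in> cut_types l g \<and> (\<forall>t'. ct (fst d) (snd d) t' \<longrightarrow> t' = t)"
    proof (cases "\<exists>t. ct (fst d) (snd d) t")
      case True
      then obtain t where "ct (fst d) (snd d) t" by blast
      then show ?thesis using ct_types ct_unique by blast
    next
      case False
      then obtain t where "ct (snd d) (fst d) t" using \<open>d \<in> cut_arcs ct\<close> unfolding cut_arcs_def by force
      then show ?thesis using ct_types False by blast
    qed
    then show ?thesis unfolding it_def by (rule someI_ex)
  qed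
  have cl: "closable i ts" if "i \<in> Inp" "set ts \<subseteq> gen (cut_types l g)" "length ts \<le> \<Delta>" for i ts
    using feas that unfolding feasible_def by blast
  have itc: "it d \<in> cut_types l g" if "d \<in> cut_arcs ct" for d using it[OF that] by blast
  obtain \<sigma> where \<sigma>: "okv v \<sigma>" "\<And>z d. z \<in> nb v \<Longrightarrow> d \<in> until nb (cut_arcs ct) v z \<Longrightarrow> good (cut_arcs ct) it d \<sigma>"
    using root_solution[where Blk = "cut_arcs ct" and it = it and A = "cut_types l g", OF itc v cl] by metis
  have reach: "u = v \<or> (\<exists>z\<in>nb v. \<exists>p. (p, u) \<in> until nb (cut_arcs ct) v z \<and> (p, u) \<notin> cut_arcs ct)"
    if "(v, u) \<in> (uncut nb ct)\<^sup>*" for u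
    using that
  proof induction
    case (step u w)
    then have w: "w \<in> nb u" "(u, w) \<notin> cut_arcs ct" by (auto simp: uncut_def)
    from step.IH show ?case
    proof
      assume "u = v"
      then show ?thesis using w until_self[of v w] by blast
    next
      assume "\<exists>z\<in>nb v. \<exists>p. (p, u) \<in> until nb (cut_arcs ct) v z \<and> (p, u) \<notin> cut_arcs ct"
      then obtain z p where z: "z \<in> nb v" and p: "(p, u) \<in> until nb (cut_arcs ct) v z" "(p, u) \<notin> cut_arcs ct"
        by blast
      show ?thesis
      proof (cases "w = p")
        case False
        then show ?thesis using until_step[OF p w(1)] w(2) z by blast
      next
        case True
        from p(1) show ?thesis
        proof cases
          case until_self
          then show ?thesis using True by simp
        next
          case (until_step q)
          then show ?thesis using True z by blast
        qed
      qed
    qed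
  qed simp
  have "(\<forall>u\<in>cmp v. okv u \<sigma>) \<and> (\<forall>u\<in>cmp v. \<forall>z t. ct u z t \<longrightarrow> es \<sigma> u z \<in> t)"
  proof (intro conjI ballI allI impI)
    fix u assume u: "u \<in> cmp v"
    then consider "u = v" | z p where "z \<in> nb v" "(p, u) \<in> until nb (cut_arcs ct) v z" "(p, u) \<notin> cut_arcs ct"
      using reach unfolding comp_def by blast
    then show "okv u \<sigma>"
    proof cases
      case 2
      then show ?thesis using \<sigma>(2)[OF 2(1,2)] unfolding good_def by simp
    qed (use \<sigma>(1) in simp)
    fix z t assume c: "ct u z t"
    have arc: "z \<in> nb u"
    proof -
      from c obtain m where m: "m \<in> M" "(u, z) = (pl m ! 0, pl m ! 1) \<or> (u, z) = (pl m ! (l + 1), pl m ! l)"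
        by (rule ct_path)
      have "pl m ! 1 \<in> nb (pl m ! 0)" "pl m ! (l + 1) \<in> nb (pl m ! l)"
        using walk[OF m(1)] len[OF m(1)] unfolding nb_walk_def by auto
      then show ?thesis using m(2) nb_sym by blast
    qed
    have "\<exists>z'\<in>nb v. (u, z) \<in> until nb (cut_arcs ct) v z'"
      using \<open>u \<in> cmp v\<close> reach[of u] unfolding comp_def
    proof (clarsimp, elim disjE bexE exE conjE)
      assume "u = v"
      then show ?thesis using arc until_self[of v z] by blast
    next
      fix z' p assume z': "z' \<in> nb v" and p: "(p, u) \<in> until nb (cut_arcs ct) v z'" "(p, u) \<notin> cut_arcs ct"
      have "p \<in> nb u"
        using darts_arc[OF z'] until_darts[OF p(1)] nb_sym by blast
      then have "(u, p) \<in> uncut nb ct" using p(2) unfolding uncut_def cut_arcs_def by blast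
      then have "p \<in> cmp u" unfolding comp_def by blast
      then have "p \<in> cmp v" using cmp_eq[OF u] by simp
      \<comment> \<open>If the dart led back to \<open>p\<close>, this component would contain
        \<open>z\<close>, the inner end of a cut edge, although it is an outer one.\<close>
      then have "z \<noteq> p" using out c unfolding inner_def by blast
      then show ?thesis using until_step[OF p arc] z' by blast
    qed
    then have "good (cut_arcs ct) it (u, z) \<sigma>" using \<sigma>(2) by blast
    moreover have "(u, z) \<in> cut_arcs ct" using c unfolding cut_arcs_def by blast
    moreover have "t = it (u, z)" using it[OF \<open>(u, z) \<in> cut_arcs ct\<close>] c by simp
    ultimately show "es \<sigma> u z \<in> t" unfolding good_def by simp
  qed
  then have "(\<forall>u\<in>cmp v. okv u (outer_sol nb inp ct v)) \<and>
     (\<forall>u\<in>cmp v. \<forall>z t. ct u z t \<longrightarrow> es (outer_sol nb inp ct v) u z \<in> t)"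
    unfolding outer_sol_def
    by (rule someI[where P = "\<lambda>\<sigma>. (\<forall>u\<in>cmp v. okv u \<sigma>) \<and> (\<forall>u\<in>cmp v. \<forall>z t. ct u z t \<longrightarrow> es \<sigma> u z \<in> t)"])
  then show "\<forall>u\<in>cmp v. okv u (outer_sol nb inp ct v)"
    "\<forall>u\<in>cmp v. \<forall>z t. ct u z t \<longrightarrow> es (outer_sol nb inp ct v) u z \<in> t" by blast+
qed

text \<open>The outer components have put states from the two types of \<open>g\<close> on the end
  edges. The first clause of feasibility links these states by the word, and a run of the word
  solves the inside.\<close>

lemma inner_sol:
  assumes inn: "inner nb ct v"
  shows "\<forall>u\<in>cmp v. okv u (inner_sol nb inp ct v)"
    and "\<forall>u\<in>cmp v. \<forall>z t. ct z u t \<longrightarrow> es (inner_sol nb inp ct v) z u = es (outer_sol nb inp ct z) z u"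
proof -
  from inn obtain m where m: "m \<in> M" "v \<in> inside m" by (rule inner_inside)
  let ?p = "pl m" and ?w = "wd m"
  have lw: "length ?w = l" using wd[OF m(1)] unfolding words_def by simp
  have c0: "ct (?p ! 0) (?p ! 1) (fst (g ?w))" and c1: "ct (?p ! (l + 1)) (?p ! l) (snd (g ?w))"
    using m(1) unfolding ct_def by blast+
  have arcs: "?p ! 1 \<in> nb (?p ! 0)" "?p ! (l + 1) \<in> nb (?p ! l)"
    using walk[OF m(1)] len[OF m(1)] unfolding nb_walk_def by auto
  have V: "?p ! 0 \<in> V" "?p ! (l + 1) \<in> V" using arcs nb_V nb_sub by blast+
  define a where "a = es (outer_sol nb inp ct (?p ! 0)) (?p ! 0) (?p ! 1)"
  define b where "b = es (outer_sol nb inp ct (?p ! (l + 1))) (?p ! (l + 1)) (?p ! l)"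
  have "a \<in> fst (g ?w)" unfolding a_def
    using outer_sol(2)[OF V(1) cut_source_outer[OF c0]] c0 cmp_refl by blast
  moreover have "b \<in> snd (g ?w)" unfolding b_def
    using outer_sol(2)[OF V(2) cut_source_outer[OF c1]] c1 cmp_refl by blast
  ultimately have "(a, prod.swap b) \<in> rel_of ?w"
    using feas wd[OF m(1)] unfolding feasible_def by blast
  moreover have "length ?p = length ?w + 2" "?w \<noteq> []" using len[OF m(1)] lw l_pos by auto
  moreover have "?w ! i \<subseteq> node_relation (?p ! i) (?p ! Suc i) (?p ! (i + 2))" if "i < length ?w" for i
    using wd_sub[OF m(1)] that lw by simp
  ultimately obtain \<sigma> where \<sigma>: "es \<sigma> (?p ! 0) (?p ! 1) = a" "es \<sigma> (?p ! length ?w) (?p ! Suc (length ?w)) = prod.swap b"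
    "\<And>i u. i < length ?w \<Longrightarrow> u \<in> hanging nb (?p ! i) (?p ! Suc i) (?p ! (i + 2)) \<Longrightarrow> okv u \<sigma>"
    using path_solution[OF walk[OF m(1)]] by blast
  have okK: "okv u \<sigma>" if "u \<in> inside m" for u using \<sigma>(3) that lw unfolding inside_def by blast
  have b': "es \<sigma> (?p ! (l + 1)) (?p ! l) = b"
    using \<sigma>(2) lw es_swap[of \<sigma> "?p ! (l + 1)" "?p ! l"] by simp
  have "(\<forall>u\<in>cmp v. okv u \<sigma>) \<and> (\<forall>u\<in>cmp v. \<forall>z t. ct z u t \<longrightarrow> es \<sigma> z u = es (outer_sol nb inp ct z) z u)"
  proof (intro conjI ballI allI impI)
    fix u assume "u \<in> cmp v"
    then have u: "u \<in> inside m" using cmp_inside[OF m] by blast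
    then show "okv u \<sigma>" by (rule okK)
    fix z t assume "ct z u t"
    then have "(u, z) \<in> cut_arcs ct" unfolding cut_arcs_def by blast
    then have "(z, u) = (?p ! 0, ?p ! 1) \<or> (z, u) = (?p ! (l + 1), ?p ! l)" using inside_cut[OF m(1) u] by blast
    then show "es \<sigma> z u = es (outer_sol nb inp ct z) z u" using \<sigma>(1) b' a_def b_def by auto
  qed
  then have "(\<forall>u\<in>cmp v. okv u (inner_sol nb inp ct v)) \<and>
     (\<forall>u\<in>cmp v. \<forall>z t. ct z u t \<longrightarrow> es (inner_sol nb inp ct v) z u = es (outer_sol nb inp ct z) z u)"
    unfolding inner_sol_def
    by (rule someI[where P = "\<lambda>\<sigma>. (\<forall>u\<in>cmp v. okv u \<sigma>) \<and>
      (\<forall>u\<in>cmp v. \<forall>z t. ct z u t \<longrightarrow> es \<sigma> z u = es (outer_sol nb inp ct z) z u)"])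
  then show "\<forall>u\<in>cmp v. okv u (inner_sol nb inp ct v)"
    "\<forall>u\<in>cmp v. \<forall>z t. ct z u t \<longrightarrow> es (inner_sol nb inp ct v) z u = es (outer_sol nb inp ct z) z u" by blast+
qed

lemma sol_ok: "v \<in> V \<Longrightarrow> okv v (sol nb inp ct v)"
  using outer_sol(1) inner_sol(1) cmp_refl unfolding sol_def by (cases "inner nb ct v") auto

lemma sol_agree:
  assumes "u \<in> nb v" shows "es (sol nb inp ct v) v u = es (sol nb inp ct u) v u"
proof -
  have cut: "es (sol nb inp ct v) v u = es (sol nb inp ct u) v u" if "ct v u t" for u v t
  proof -
    have "es (inner_sol nb inp ct u) v u = es (outer_sol nb inp ct v) v u"
      using inner_sol(2)[OF cut_target_inner[OF that]] that cmp_refl[of u] by blast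
    then show ?thesis using cut_source_outer[OF that] cut_target_inner[OF that] unfolding sol_def by simp
  qed
  show ?thesis
  proof (cases "(v, u) \<in> cut_arcs ct")
    case True
    then obtain t where "ct v u t \<or> ct u v t" unfolding cut_arcs_def by blast
    then show ?thesis using cut es_eq_swap by metis
  next
    case False
    then have "u \<in> cmp v" using assms unfolding comp_def uncut_def by blast
    then show ?thesis using sol_cong[OF cmp_eq] by simp
  qed
qed

end

section \<open>Balls and agreement of neighbourhoods\<close>

primrec ball :: "('v \<Rightarrow> 'v set) \<Rightarrow> nat \<Rightarrow> 'v \<Rightarrow> 'v set" where
  "ball nb 0 v = {v}"
| "ball nb (Suc k) v = ball nb k v \<union> (\<Union>u\<in>ball nb k v. nb u)"

lemma ball_mono: "j \<le> k \<Longrightarrow> ball nb j v \<subseteq> ball nb k v"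
  by (induction rule: dec_induct) auto

lemma ball_self [simp]: "v \<in> ball nb k v"
  using ball_mono[of 0 k nb v] by auto

lemma ball_add: "u \<in> ball nb i v \<Longrightarrow> w \<in> ball nb j u \<Longrightarrow> w \<in> ball nb (i + j) v"
  by (induction j arbitrary: w) auto

lemma ball_Suc_left: "ball nb (Suc k) v = insert v (\<Union>u\<in>nb v. ball nb k u)"
proof (induction k)
  case (Suc k)
  have "ball nb (Suc (Suc k)) v = ball nb (Suc k) v \<union> (\<Union>u\<in>ball nb (Suc k) v. nb u)" by simp
  also have "\<dots> = insert v (\<Union>u\<in>nb v. ball nb (Suc k) u)"
    unfolding Suc.IH by auto
  finally show ?case .
qed auto

lemma (in utree) card_ball:
  assumes "\<And>v. v \<in> V \<Longrightarrow> card (nb v) \<le> d" "v \<in> V"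
  shows "finite (ball nb k v) \<and> ball nb k v \<subseteq> V \<and> card (ball nb k v) \<le> (d + 1) ^ k"
proof (induction k)
  case (Suc k)
  have "ball nb (Suc k) v = (\<Union>u\<in>ball nb k v. insert u (nb u))" by auto
  moreover have "card (\<Union>u\<in>ball nb k v. insert u (nb u)) \<le> (\<Sum>u\<in>ball nb k v. card (insert u (nb u)))"
    using Suc by (intro card_UN_le) auto
  moreover have "(\<Sum>u\<in>ball nb k v. card (insert u (nb u))) \<le> (\<Sum>u\<in>ball nb k v. d + 1)"
  proof (rule sum_mono)
    fix u assume "u \<in> ball nb k v"
    then have "card (nb u) \<le> d" using Suc assms(1) by blast
    then show "card (insert u (nb u)) \<le> d + 1" using irrefl[of u] by simp
  qed
  moreover have "(\<Sum>u\<in>ball nb k v. d + 1) \<le> (d + 1) ^ k * (d + 1)"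
    using Suc mult_le_mono1[of "card (ball nb k v)" "(d + 1) ^ k" "d + 1"] by simp
  ultimately show ?case using Suc nb_sub by (auto simp: mult.commute)
qed (use assms in auto)

text \<open>Two trees on the same names that look alike around \<open>v\<close>. Agreement covers
  distances below \<open>t\<close> only, since a view of radius \<open>t\<close> does not show all
  edges at its rim.\<close>

definition agree :: "nat \<Rightarrow> 'v \<Rightarrow> ('v \<Rightarrow> 'v set) \<Rightarrow> ('v \<Rightarrow> 'i) \<Rightarrow> ('v \<Rightarrow> 'v set) \<Rightarrow> ('v \<Rightarrow> 'i) \<Rightarrow> bool" where
  "agree t v nb inp nb' inp' \<longleftrightarrow> (\<forall>k<t. \<forall>u\<in>ball nb k v. nb u = nb' u \<and> inp u = inp' u)"

lemma agreeD: "agree t v nb inp nb' inp' \<Longrightarrow> k < t \<Longrightarrow> u \<in> ball nb k v \<Longrightarrow> nb u = nb' u \<and> inp u = inp' u"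
  unfolding agree_def by blast

lemma agree_mono: "agree t v nb inp nb' inp' \<Longrightarrow> s \<le> t \<Longrightarrow> agree s v nb inp nb' inp'"
  unfolding agree_def by (meson order_less_le_trans)

lemma agree_nb: "agree t v nb inp nb' inp' \<Longrightarrow> 0 < t \<Longrightarrow> nb v = nb' v \<and> inp v = inp' v"
  unfolding agree_def by force

lemma agree_shift:
  "agree t v nb inp nb' inp' \<Longrightarrow> u \<in> ball nb s v \<Longrightarrow> agree (t - s) u nb inp nb' inp'"
  unfolding agree_def using ball_add by (metis less_diff_conv add.commute)

lemma agree_ball:
  assumes "agree t v nb inp nb' inp'" "k \<le> t" shows "ball nb k v = ball nb' k v"
  using assms(2)
proof (induction k)
  case (Suc k)
  then have "(\<Union>u\<in>ball nb k v. nb u) = (\<Union>u\<in>ball nb k v. nb' u)"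
    using agreeD[OF assms(1), of k] by (intro SUP_cong) auto
  then show ?case using Suc by simp
qed simp

lemma agree_sym:
  assumes "agree t v nb inp nb' inp'" shows "agree t v nb' inp' nb inp"
  unfolding agree_def
proof (intro allI impI ballI)
  fix k u assume "k < t" "u \<in> ball nb' k v"
  then show "nb' u = nb u \<and> inp' u = inp u"
    using assms agree_ball[OF assms, of k] unfolding agree_def by auto
qed

lemma agree_step: "agree (Suc t) v nb inp nb' inp' \<Longrightarrow> u \<in> nb v \<Longrightarrow> agree t u nb inp nb' inp'"
  using agree_shift[of "Suc t" v nb inp nb' inp' u 1] by simp

lemma darts_at_ball: "(p, w) \<in> darts_at nb k x y \<Longrightarrow> w \<in> ball nb k y"
  by (induction k arbitrary: p w) auto

lemma agree_darts_at:
  assumes "agree t y nb inp nb' inp'" "k \<le> t"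
  shows "darts_at nb k x y = darts_at nb' k x y"
  using assms(2)
proof (induction k)
  case (Suc k)
  have "nb w = nb' w" if "(p, w) \<in> darts_at nb k x y" for p w
    using agreeD[OF assms(1) _ darts_at_ball[OF that]] Suc.prems by simp
  moreover have "darts_at nb k x y = darts_at nb' k x y" using Suc by simp
  ultimately show ?case by fastforce
qed simp

lemma agree_heavy:
  assumes "agree k y nb inp nb' inp'" shows "heavy nb k x y \<longleftrightarrow> heavy nb' k x y"
  using agree_darts_at[OF assms order_refl] unfolding heavy_def by simp

section \<open>Straight paths\<close>

definition heavy_nb :: "('v \<Rightarrow> 'v set) \<Rightarrow> nat \<Rightarrow> 'v \<Rightarrow> 'v set" where
  "heavy_nb nb \<tau> x = {z \<in> nb x. heavy nb \<tau> x z}"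

lemma agree_heavy_nb:
  assumes "agree (Suc \<tau>) x nb inp nb' inp'" shows "heavy_nb nb \<tau> x = heavy_nb nb' \<tau> x"
proof -
  have "nb x = nb' x" using agree_nb[OF assms] by simp
  then show ?thesis
    using agree_heavy[OF agree_step[OF assms]] unfolding heavy_nb_def by auto
qed

text \<open>The two end nodes carry no condition, so a path is determined only from inner positions.
  This is why positions are kept strictly inside throughout.\<close>

definition straight :: "('v \<Rightarrow> 'v set) \<Rightarrow> nat \<Rightarrow> 'v list \<Rightarrow> bool" where
  "straight nb \<tau> q \<longleftrightarrow> (\<forall>i. i + 2 < length q \<longrightarrow>
     q ! i \<noteq> q ! (i + 2) \<and> heavy_nb nb \<tau> (q ! Suc i) = {q ! i, q ! (i + 2)})"

lemma straight_arc:
  assumes "straight nb \<tau> q" "0 < i" "Suc i < length q"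
  shows "q ! Suc i \<in> nb (q ! i)" "q ! (i - 1) \<in> nb (q ! i)"
proof -
  obtain j where "i = Suc j" using assms(2) by (cases i) auto
  then have "heavy_nb nb \<tau> (q ! i) = {q ! (i - 1), q ! Suc i}"
    using assms unfolding straight_def by auto
  then show "q ! Suc i \<in> nb (q ! i)" "q ! (i - 1) \<in> nb (q ! i)" unfolding heavy_nb_def by auto
qed

lemma straight_rev:
  assumes "straight nb \<tau> q" shows "straight nb \<tau> (rev q)"
  unfolding straight_def
proof (intro allI impI)
  fix i assume i: "i + 2 < length (rev q)"
  define j where "j = length q - Suc (i + 2)"
  have "j + 2 < length q" "rev q ! i = q ! (j + 2)" "rev q ! Suc i = q ! Suc j" "rev q ! (i + 2) = q ! j"
    using i by (auto simp: j_def rev_nth Suc_diff_Suc)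
  then show "rev q ! i \<noteq> rev q ! (i + 2) \<and> heavy_nb nb \<tau> (rev q ! Suc i) = {rev q ! i, rev q ! (i + 2)}"
    using assms unfolding straight_def by (metis insert_commute)
qed

lemma straight_ball:
  assumes "straight nb \<tau> q" "0 < i" "Suc i < length q" "j < length q"
  shows "q ! j \<in> ball nb (nat \<bar>int i - int j\<bar>) (q ! i)"
proof -
  have up: "i + k < length q \<Longrightarrow> q ! (i + k) \<in> ball nb k (q ! i)" for k
  proof (induction k)
    case (Suc k)
    then have "q ! Suc (i + k) \<in> nb (q ! (i + k))" using straight_arc(1)[OF assms(1), of "i + k"] assms(2) by simp
    then show ?case using Suc by auto
  qed simp
  have down: "k \<le> i \<Longrightarrow> q ! (i - k) \<in> ball nb k (q ! i)" for k
  proof (induction k)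
    case (Suc k)
    then have "q ! (i - k - 1) \<in> nb (q ! (i - k))" using straight_arc(2)[OF assms(1), of "i - k"] assms(3) by auto
    then show ?case using Suc by (auto simp: Suc_diff_Suc intro!: bexI[of _ "q ! (i - k)"])
  qed simp
  show ?thesis
  proof (cases "i \<le> j")
    case True
    then show ?thesis using up[of "j - i"] assms(4) by (simp add: nat_diff_distrib' le_nat_iff)
  next
    case False
    then show ?thesis using down[of "i - j"] by (simp add: nat_diff_distrib')
  qed
qed

text \<open>All inner nodes lie within distance \<open>r\<close> of the one at position
  \<open>c\<close>, and \<open>Suc \<tau>\<close> further steps decide which of their neighbours are
  heavy.\<close>

lemma agree_straight:
  assumes ag: "agree (Suc \<tau> + r) (q ! c) nb inp nb' inp'"
    and c: "0 < c" "Suc c < length q" "c \<le> r + 1" "length q \<le> c + r + 2"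
    and st: "straight nb \<tau> q"
  shows "straight nb' \<tau> q"
  unfolding straight_def
proof (intro allI impI)
  fix i assume i: "i + 2 < length q"
  have "q ! Suc i \<in> ball nb (nat \<bar>int c - int (Suc i)\<bar>) (q ! c)"
    using straight_ball[OF st c(1,2), of "Suc i"] i by auto
  moreover have "nat \<bar>int c - int (Suc i)\<bar> \<le> r" using i c by linarith
  ultimately have "q ! Suc i \<in> ball nb r (q ! c)" using ball_mono[of _ r nb "q ! c"] by blast
  then have "heavy_nb nb \<tau> (q ! Suc i) = heavy_nb nb' \<tau> (q ! Suc i)"
    using agree_heavy_nb[of \<tau> "q ! Suc i"] agree_shift[OF ag, of "q ! Suc i" r] by simp
  then show "q ! i \<noteq> q ! (i + 2) \<and> heavy_nb nb' \<tau> (q ! Suc i) = {q ! i, q ! (i + 2)}"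
    using st i unfolding straight_def by auto
qed

text \<open>At an inner node the next node is the heavy neighbour other than the previous one, so
  two consecutive common nodes fix the path in both directions.\<close>

lemma straight_determined:
  assumes q: "straight nb \<tau> q" and q': "straight nb \<tau> q'"
    and ij: "0 < i" "Suc i < length q" "0 < j" "Suc j < length q'"
    and eq: "q ! i = q' ! j" "q ! Suc i = q' ! Suc j"
    and ab: "a < length q" "b < length q'" "a + j = b + i"
  shows "q ! a = q' ! b"
proof -
  have up: "i + s + 1 < length q \<Longrightarrow> j + s + 1 < length q' \<Longrightarrow>
      q ! (i + s) = q' ! (j + s) \<and> q ! (i + s + 1) = q' ! (j + s + 1)" for s
  proof (induction s)
    case (Suc s)
    then have IH: "q ! (i + s) = q' ! (j + s)" "q ! (i + s + 1) = q' ! (j + s + 1)" by auto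
    have "{q ! (i + s), q ! (i + s + 2)} = {q' ! (j + s), q' ! (j + s + 2)}"
      using q q' IH Suc.prems unfolding straight_def by (metis Suc_eq_plus1 add_Suc_right one_add_one plus_1_eq_Suc add.assoc)
    moreover have "q ! (i + s) \<noteq> q ! (i + s + 2)" "q' ! (j + s) \<noteq> q' ! (j + s + 2)"
      using q q' Suc.prems unfolding straight_def by auto
    ultimately have "q ! (i + s + 2) = q' ! (j + s + 2)" using IH by (auto simp: doubleton_eq_iff)
    then show ?case using IH by simp
  qed (use eq in simp)
  have down: "s \<le> i \<Longrightarrow> s \<le> j \<Longrightarrow> q ! (i - s) = q' ! (j - s) \<and> q ! (Suc i - s) = q' ! (Suc j - s)" for s
  proof (induction s)
    case (Suc s)
    define i' j' where "i' = i - Suc s" "j' = j - Suc s"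
    have e: "i - s = Suc i'" "j - s = Suc j'" "Suc i - s = i' + 2" "Suc j - s = j' + 2"
      "i - Suc s = i'" "j - Suc s = j'" "Suc i - Suc s = Suc i'" "Suc j - Suc s = Suc j'"
      using Suc.prems unfolding i'_j'_def by auto
    have IH: "q ! Suc i' = q' ! Suc j'" "q ! (i' + 2) = q' ! (j' + 2)" using Suc e by auto
    have len: "i' + 2 < length q" "j' + 2 < length q'" using ij Suc.prems unfolding i'_j'_def by auto
    have "{q ! i', q ! (i' + 2)} = {q' ! j', q' ! (j' + 2)}"
      using q q' IH(1) len unfolding straight_def by metis
    moreover have "q ! i' \<noteq> q ! (i' + 2)" "q' ! j' \<noteq> q' ! (j' + 2)"
      using q q' len unfolding straight_def by auto
    ultimately have "q ! i' = q' ! j'" using IH by (auto simp: doubleton_eq_iff)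
    then show ?case using IH e by simp
  qed (use eq in simp)
  show ?thesis
  proof (cases "i < a")
    case True
    then obtain s where s: "a = i + s + 1" using less_iff_Suc_add[of i a] by auto
    have b: "b = j + s + 1" using ab s by simp
    show ?thesis using up[of s] ab(1,2) unfolding s b by simp
  next
    case False
    then have s: "a = i - (i - a)" "b = j - (i - a)" "i - a \<le> j" using ab by auto
    then show ?thesis using down[of "i - a"] by (metis diff_le_self)
  qed
qed

text \<open>A common inner node has only two heavy neighbours, so the two paths traverse it in the
  same or in opposite direction; reversing one path reduces the second case to the first.\<close>

lemma straight_meet:
  assumes q: "straight nb \<tau> q" and q': "straight nb \<tau> q'"
    and ij: "0 < i" "Suc i < length q" "0 < j" "Suc j < length q'"
    and eq: "q ! i = q' ! j"
  obtains "\<And>a b. a < length q \<Longrightarrow> b < length q' \<Longrightarrow> a + j = b + i \<Longrightarrow> q ! a = q' ! b"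
  | "\<And>a b. a < length q \<Longrightarrow> b < length q' \<Longrightarrow> a + b = i + j \<Longrightarrow> q ! a = q' ! b"
proof -
  obtain i' where i': "i = Suc i'" using ij by (cases i) auto
  obtain j' where j': "j = Suc j'" using ij by (cases j) auto
  have "{q ! i', q ! (i' + 2)} = {q' ! j', q' ! (j' + 2)}"
    using q q' eq ij i' j' unfolding straight_def by (metis Suc_eq_plus1 add_2_eq_Suc')
  then consider "q ! Suc i = q' ! Suc j" | "q ! Suc i = q' ! (j - 1)"
    using i' j' by (auto simp: doubleton_eq_iff)
  then show thesis
  proof cases
    case 1
    then show ?thesis using that(1) straight_determined[OF q q' ij eq 1] by blast
  next
    case 2
    let ?r = "rev q'" and ?k = "length q' - Suc j"
    have k: "0 < ?k" "Suc ?k < length ?r" "?r ! ?k = q' ! j" "?r ! Suc ?k = q' ! (j - 1)"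
      using ij j' by (auto simp: rev_nth Suc_diff_Suc)
    have "q ! a = q' ! b" if ab: "a < length q" "b < length q'" "a + b = i + j" for a b
    proof -
      have "a + ?k = (length q' - Suc b) + i" using ab ij by auto
      then have "q ! a = ?r ! (length q' - Suc b)"
        using straight_determined[OF q straight_rev[OF q'] ij(1,2) k(1,2) _ _ ab(1)] eq 2 k ab(2) by simp
      then show ?thesis using ab(2) by (simp add: rev_nth)
    qed
    then show ?thesis using that(2) by blast
  qed
qed

lemma (in utree) straight_nb_walk:
  assumes st: "straight nb \<tau> q" and len: "3 \<le> length q" shows "nb_walk nb q"
  unfolding nb_walk_def
proof (intro conjI allI impI)
  fix i assume i: "Suc i < length q"
  show "q ! Suc i \<in> nb (q ! i)"
  proof (cases i)
    case 0
    then show ?thesis using straight_arc(2)[OF st, of 1] len nb_sym by auto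
  next
    case (Suc k)
    then show ?thesis using straight_arc(1)[OF st, of i] i by simp
  qed
next
  fix i assume "Suc (Suc i) < length q"
  then show "q ! i \<noteq> q ! Suc (Suc i)" using st unfolding straight_def by auto
qed

text \<open>A heavy dart deeper in the branch would make the whole branch heavy. So the way back is
  the only possible heavy neighbour, and no straight path has an inner node in a light
  branch.\<close>

lemma light_branch_heavy_nb:
  assumes light: "\<not> heavy nb \<tau> x y" and u: "(p, u) \<in> darts nb x y"
  shows "heavy_nb nb \<tau> u \<subseteq> {p}"
proof
  fix z assume z: "z \<in> heavy_nb nb \<tau> u"
  show "z \<in> {p}"
  proof (rule ccontr)
    assume "z \<notin> {p}"
    then have "(u, z) \<in> darts nb x y" using darts_step[OF u] z unfolding heavy_nb_def by auto
    then show False using heavy_shift z light unfolding heavy_nb_def by fast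
  qed
qed

section \<open>The local algorithm\<close>

text \<open>Position \<open>2 * L + 3\<close> is the middle. The core will occupy positions
  \<open>L + 2\<close> to \<open>3 * L + 4\<close>, and the margins of \<open>L + 2\<close> nodes on
  both sides are what \<open>central_near\<close> needs.\<close>

definition central :: "('v \<Rightarrow> 'v set) \<Rightarrow> nat \<Rightarrow> nat \<Rightarrow> 'v \<Rightarrow> 'v list \<Rightarrow> bool" where
  "central nb \<tau> L m q \<longleftrightarrow> straight nb \<tau> q \<and> length q = 4 * L + 7 \<and> q ! (2 * L + 3) = m"

definition conflict :: "('v \<Rightarrow> 'v set) \<Rightarrow> nat \<Rightarrow> nat \<Rightarrow> 'v \<Rightarrow> 'v \<Rightarrow> bool" where
  "conflict nb \<tau> L m m' \<longleftrightarrow> m \<noteq> m' \<and> (\<exists>q i j. straight nb \<tau> q \<and> length q = 4 * L + 7 \<and>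
     0 < i \<and> i < 4 * L + 6 \<and> 0 < j \<and> j < 4 * L + 6 \<and> q ! i = m \<and> q ! j = m')"

definition diff_bit :: "nat \<Rightarrow> nat \<Rightarrow> nat" where
  "diff_bit u v = (LEAST i. bit u i \<noteq> bit v i)"

text \<open>
  One step of Cole-Vishkin colour reduction: the colours of conflicting nodes differ because both
  record the position of a bit in which the two identifiers differ.
\<close>

definition colour :: "(nat \<Rightarrow> nat set) \<Rightarrow> nat \<Rightarrow> nat \<Rightarrow> nat \<Rightarrow> (nat \<times> bool) set" where
  "colour nb \<tau> L v = {(diff_bit u v, bit v (diff_bit u v)) | u. conflict nb \<tau> L v u}"

text \<open>Colour classes, numbered by \<open>enc\<close>, join one after another. Nodes of one
  class may join simultaneously because the colouring is proper, so no ties have to be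
  broken.\<close>

primrec chosen :: "((nat \<times> bool) set \<Rightarrow> nat) \<Rightarrow> (nat \<Rightarrow> nat set) \<Rightarrow> nat \<Rightarrow> nat \<Rightarrow> nat \<Rightarrow> nat set" where
  "chosen enc nb \<tau> L 0 = {}"
| "chosen enc nb \<tau> L (Suc k) = chosen enc nb \<tau> L k \<union> {v. (\<exists>q. central nb \<tau> L v q) \<and>
     enc (colour nb \<tau> L v) = k \<and> \<not> (\<exists>u\<in>chosen enc nb \<tau> L k. conflict nb \<tau> L v u)}"

text \<open>Up to reversal there is only one such list. Which of them \<open>SOME\<close> takes does
  not matter, as long as trees that look alike around \<open>m\<close> make the same choice; they
  do, because the predicate is the same.\<close>

definition segment :: "('v \<Rightarrow> 'v set) \<Rightarrow> nat \<Rightarrow> nat \<Rightarrow> 'v \<Rightarrow> 'v list" where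
  "segment nb \<tau> L m = (SOME q. central nb \<tau> L m q)"

definition core :: "('v \<Rightarrow> 'v set) \<Rightarrow> nat \<Rightarrow> nat \<Rightarrow> 'v \<Rightarrow> 'v list" where
  "core nb \<tau> L m = map (\<lambda>i. segment nb \<tau> L m ! (L + 2 + i)) [0..<2 * L + 3]"

context edge_problem begin

definition word_at where
  "word_at nb inp \<tau> L m = (let p = core nb \<tau> L m in
     map (\<lambda>i. SOME \<rho>. \<rho> \<in> letters \<and> \<rho> \<subseteq> node_rel nb inp (p ! i) (p ! Suc i) (p ! (i + 2))) [0..<2 * L + 1])"

definition cuts where
  "cuts enc g nb inp \<tau> L K u z t \<longleftrightarrow> (\<exists>m\<in>chosen enc nb \<tau> L K.
     (u, z, t) = (core nb \<tau> L m ! 0, core nb \<tau> L m ! 1, fst (g (word_at nb inp \<tau> L m))) \<or>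
     (u, z, t) = (core nb \<tau> L m ! (2 * L + 1 + 1), core nb \<tau> L m ! (2 * L + 1), snd (g (word_at nb inp \<tau> L m))))"

end

section \<open>Cores, conflicts and colours\<close>

lemma core_length [simp]: "length (core nb \<tau> L m) = 2 * L + 3"
  by (simp add: core_def)

lemma core_nth: "i < 2 * L + 3 \<Longrightarrow> core nb \<tau> L m ! i = segment nb \<tau> L m ! (L + 2 + i)"
  unfolding core_def by (simp del: upt_Suc)

lemma segment_central: "central nb \<tau> L m q \<Longrightarrow> central nb \<tau> L m (segment nb \<tau> L m)"
  unfolding segment_def by (rule someI)

lemma conflict_sym: "conflict nb \<tau> L u v \<Longrightarrow> conflict nb \<tau> L v u"
  unfolding conflict_def by blast

lemma conflict_ball: assumes "conflict nb \<tau> L m m'" shows "m' \<in> ball nb (4 * L + 4) m"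
proof -
  obtain q i j where q: "straight nb \<tau> q" "length q = 4 * L + 7"
    "0 < i" "i < 4 * L + 6" "0 < j" "j < 4 * L + 6" "q ! i = m" "q ! j = m'"
    using assms unfolding conflict_def by blast
  have "m' \<in> ball nb (nat \<bar>int i - int j\<bar>) m" using straight_ball[OF q(1,3), of j] q by simp
  moreover have "nat \<bar>int i - int j\<bar> \<le> 4 * L + 4" using q by linarith
  ultimately show ?thesis using ball_mono[of _ "4 * L + 4" nb m] by blast
qed

lemma core_heavy_nb:
  assumes c: "central nb \<tau> L m (segment nb \<tau> L m)" and i: "i < 2 * L + 3"
  defines "p \<equiv> segment nb \<tau> L m"
  shows "heavy_nb nb \<tau> (core nb \<tau> L m ! i) = {p ! (L + 1 + i), p ! (L + 3 + i)}"
    "p ! (L + 1 + i) \<noteq> p ! (L + 3 + i)"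
proof -
  have "straight nb \<tau> p" "length p = 4 * L + 7" using c unfolding central_def p_def by auto
  then have "p ! (L+1+i) \<noteq> p ! (L+1+i+2) \<and> heavy_nb nb \<tau> (p ! Suc (L+1+i)) = {p ! (L+1+i), p ! (L+1+i+2)}"
    using \<open>straight nb \<tau> p\<close>[unfolded straight_def, rule_format, of "L + 1 + i"] i by simp
  then show "heavy_nb nb \<tau> (core nb \<tau> L m ! i) = {p ! (L + 1 + i), p ! (L + 3 + i)}"
    "p ! (L + 1 + i) \<noteq> p ! (L + 3 + i)"
    using core_nth[OF i, of nb \<tau> m] unfolding p_def by (simp_all add: numeral_eq_Suc)
qed

lemma diff_bit: "u \<noteq> v \<Longrightarrow> bit u (diff_bit u v) \<noteq> bit v (diff_bit u v)"
proof -
  assume "u \<noteq> v"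
  then have "\<exists>i. bit u i \<noteq> bit v i" using bit_eq_iff by blast
  then show ?thesis unfolding diff_bit_def by (rule LeastI_ex)
qed

lemma diff_bit_less:
  assumes "u \<noteq> v" "u < 2 ^ n" "v < 2 ^ n" shows "diff_bit u v < n"
proof (rule ccontr)
  assume "\<not> diff_bit u v < n"
  then have "\<not> bit u (diff_bit u v)" "\<not> bit v (diff_bit u v)"
    using assms(2,3) by (metis bit_take_bit_iff take_bit_nat_eq_self)+
  then show False using diff_bit[OF assms(1)] by simp
qed

lemma colour_proper: assumes "conflict nb \<tau> L v u" shows "colour nb \<tau> L v \<noteq> colour nb \<tau> L u"
proof
  assume eq: "colour nb \<tau> L v = colour nb \<tau> L u"
  let ?i = "diff_bit u v"
  have "(?i, bit v ?i) \<in> colour nb \<tau> L v" using assms unfolding colour_def by blast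
  then have "(?i, bit v ?i) \<in> colour nb \<tau> L u" unfolding eq .
  then have "bit v ?i = bit u ?i" unfolding colour_def by auto
  moreover have "u \<noteq> v" using assms unfolding conflict_def by blast
  ultimately show False using diff_bit[of u v] by simp
qed

lemma chosen_central: "m \<in> chosen enc nb \<tau> L k \<Longrightarrow> central nb \<tau> L m (segment nb \<tau> L m)"
  by (induction k) (auto intro: segment_central)

lemma chosen_mono: "j \<le> k \<Longrightarrow> chosen enc nb \<tau> L j \<subseteq> chosen enc nb \<tau> L k"
  by (induction rule: dec_induct) auto

text \<open>Nodes chosen in different rounds do not conflict by construction. Nodes of the same
  round have the same code, hence the same colour, while conflicting nodes have different
  colours.\<close>

lemma chosen_independent:
  assumes inj: "\<And>u v. u \<in> chosen enc nb \<tau> L k \<Longrightarrow> v \<in> chosen enc nb \<tau> L k \<Longrightarrow>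
      enc (colour nb \<tau> L u) = enc (colour nb \<tau> L v) \<Longrightarrow> colour nb \<tau> L u = colour nb \<tau> L v"
    and u: "u \<in> chosen enc nb \<tau> L k" and v: "v \<in> chosen enc nb \<tau> L k"
  shows "\<not> conflict nb \<tau> L u v"
  using assms
proof (induction k)
  case (Suc k)
  have inj': "enc (colour nb \<tau> L u) = enc (colour nb \<tau> L v) \<Longrightarrow> colour nb \<tau> L u = colour nb \<tau> L v"
    using Suc.prems by blast
  show ?case
  proof (cases "u \<in> chosen enc nb \<tau> L k \<longleftrightarrow> v \<in> chosen enc nb \<tau> L k")
    case True
    show ?thesis
    proof (cases "u \<in> chosen enc nb \<tau> L k")
      case True
      moreover have "v \<in> chosen enc nb \<tau> L k" using True \<open>_ \<longleftrightarrow> _\<close> by simp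
      ultimately show ?thesis using Suc.IH Suc.prems(1) by auto
    next
      case False
      then have "enc (colour nb \<tau> L u) = k" "enc (colour nb \<tau> L v) = k"
        using \<open>_ \<longleftrightarrow> _\<close> Suc.prems(2,3) by auto
      then show ?thesis using inj' colour_proper by metis
    qed
  next
    case False
    then show ?thesis using Suc.prems(2,3) conflict_sym[of nb \<tau> L u v] by auto
  qed
qed simp

lemma chosen_maximal:
  assumes "central nb \<tau> L v q" "enc (colour nb \<tau> L v) < k"
  shows "v \<in> chosen enc nb \<tau> L k \<or> (\<exists>u\<in>chosen enc nb \<tau> L k. conflict nb \<tau> L v u)"
proof -
  let ?j = "enc (colour nb \<tau> L v)"
  have "v \<in> chosen enc nb \<tau> L (Suc ?j) \<or> (\<exists>u\<in>chosen enc nb \<tau> L ?j. conflict nb \<tau> L v u)"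
    using assms(1) by auto
  moreover have "chosen enc nb \<tau> L (Suc ?j) \<subseteq> chosen enc nb \<tau> L k"
    "chosen enc nb \<tau> L ?j \<subseteq> chosen enc nb \<tau> L k"
    using assms(2) chosen_mono[of "Suc ?j" k enc nb \<tau> L] chosen_mono[of ?j k enc nb \<tau> L]
    by (simp_all del: chosen.simps)
  ultimately show ?thesis by blast
qed

text \<open>When the cores meet, the two paths coincide on their overlap up to direction. The bounds
  on \<open>i\<close> and \<open>j\<close> put the centre of \<open>q'\<close> at a position between
  \<open>1\<close> and \<open>4 * L + 5\<close> of \<open>q\<close>, just inside its ends.\<close>

lemma central_near:
  assumes m: "central nb \<tau> L m q" and m': "central nb \<tau> L m' q'"
    and i: "L + 2 \<le> i" "i \<le> 3 * L + 4" and j: "L + 2 \<le> j" "j \<le> 3 * L + 4"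
    and eq: "q ! i = q' ! j"
  shows "m = m' \<or> conflict nb \<tau> L m m'"
proof -
  have q: "straight nb \<tau> q" "length q = 4 * L + 7" "q ! (2 * L + 3) = m"
    and q': "straight nb \<tau> q'" "length q' = 4 * L + 7" "q' ! (2 * L + 3) = m'"
    using m m' unfolding central_def by auto
  have "\<exists>a. 0 < a \<and> a < 4 * L + 6 \<and> q ! a = m'"
  proof (rule straight_meet[OF q(1) q'(1), of i j])
    assume h: "\<And>a b. a < length q \<Longrightarrow> b < length q' \<Longrightarrow> a + j = b + i \<Longrightarrow> q ! a = q' ! b"
    have "q ! (i + (2 * L + 3) - j) = m'"
      using h[of "i + (2 * L + 3) - j" "2 * L + 3"] q q' i j by simp
    then show ?thesis using i j by (intro exI[of _ "i + (2 * L + 3) - j"]) auto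
  next
    assume h: "\<And>a b. a < length q \<Longrightarrow> b < length q' \<Longrightarrow> a + b = i + j \<Longrightarrow> q ! a = q' ! b"
    have "q ! (i + j - (2 * L + 3)) = m'"
      using h[of "i + j - (2 * L + 3)" "2 * L + 3"] q q' i j by simp
    then show ?thesis using i j by (intro exI[of _ "i + j - (2 * L + 3)"]) auto
  qed (use q q' i j eq in auto)
  then obtain a where "0 < a" "a < 4 * L + 6" "q ! a = m'" by blast
  then have "\<exists>q i j. straight nb \<tau> q \<and> length q = 4 * L + 7 \<and>
     0 < i \<and> i < 4 * L + 6 \<and> 0 < j \<and> j < 4 * L + 6 \<and> q ! i = m \<and> q ! j = m'"
    using q by (intro exI[of _ q] exI[of _ "2 * L + 3"] exI[of _ a]) simp
  then show ?thesis unfolding conflict_def by blast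
qed

text \<open>The nodes are the identifiers here, because colours read their bits. \<open>K\<close>
  bounds the codes of the colours and thus the number of greedy rounds.\<close>

locale algorithm_tree = edge_problem_tree nok Inp Sg \<Delta> V nb inp
  for nok :: "'i \<Rightarrow> 'o \<Rightarrow> ('s \<times> 's) multiset \<Rightarrow> bool" and Inp Sg \<Delta>
    and V :: "nat set" and nb inp +
  fixes L \<tau> K :: nat and g and enc :: "(nat \<times> bool) set \<Rightarrow> nat"
  assumes feasible: "feasible (2 * L + 1) g"
    and enc_inj: "\<And>u v. u \<in> V \<Longrightarrow> v \<in> V \<Longrightarrow>
       enc (colour nb \<tau> L u) = enc (colour nb \<tau> L v) \<Longrightarrow> colour nb \<tau> L u = colour nb \<tau> L v"
    and enc_less: "\<And>u. u \<in> V \<Longrightarrow> enc (colour nb \<tau> L u) < K"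
begin

abbreviation "Ms \<equiv> chosen enc nb \<tau> L K"

lemma central_V: assumes "central nb \<tau> L m q" shows "m \<in> V"
proof -
  have "q ! Suc (2 * L + 3) \<in> nb (q ! (2 * L + 3))"
    using assms straight_arc(1)[of nb \<tau> q "2 * L + 3"] unfolding central_def by auto
  then show ?thesis using assms nb_V unfolding central_def by auto
qed

lemma segment_walk: assumes "central nb \<tau> L m q" shows "nb_walk nb q"
  using straight_nb_walk[of \<tau> q] assms unfolding central_def by simp

lemma core_walk: assumes "central nb \<tau> L m (segment nb \<tau> L m)" shows "nb_walk nb (core nb \<tau> L m)"
proof -
  have w: "nb_walk nb (segment nb \<tau> L m)" using segment_walk assms by blast
  have l: "length (segment nb \<tau> L m) = 4 * L + 7" using assms unfolding central_def by blast
  show ?thesis unfolding nb_walk_def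
  proof (intro conjI allI impI)
    fix i assume i: "Suc i < length (core nb \<tau> L m)"
    have "segment nb \<tau> L m ! Suc (L + 2 + i) \<in> nb (segment nb \<tau> L m ! (L + 2 + i))"
      using w i l unfolding nb_walk_def by (simp del: add_Suc_right)
    then show "core nb \<tau> L m ! Suc i \<in> nb (core nb \<tau> L m ! i)"
      using i by (simp add: core_nth)
  next
    fix i assume i: "Suc (Suc i) < length (core nb \<tau> L m)"
    have "segment nb \<tau> L m ! (L + 2 + i) \<noteq> segment nb \<tau> L m ! Suc (Suc (L + 2 + i))"
      using w i l unfolding nb_walk_def by (simp del: add_Suc_right)
    then show "core nb \<tau> L m ! i \<noteq> core nb \<tau> L m ! Suc (Suc i)"
      using i by (simp add: core_nth)
  qed
qed

lemma word_at_nth: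
  assumes c: "central nb \<tau> L m (segment nb \<tau> L m)" and i: "i < 2 * L + 1"
  defines "p \<equiv> core nb \<tau> L m"
  shows "word_at nb inp \<tau> L m ! i \<in> letters"
    "word_at nb inp \<tau> L m ! i \<subseteq> node_relation (p ! i) (p ! Suc i) (p ! (i + 2))"
proof -
  have w: "nb_walk nb p" using core_walk[OF c] p_def by simp
  have "p ! Suc i \<in> nb (p ! i)" "p ! (i + 2) \<in> nb (p ! Suc i)" "p ! i \<noteq> p ! (i + 2)"
    using w i unfolding nb_walk_def p_def by auto
  then have "\<exists>\<rho>. \<rho> \<in> letters \<and> \<rho> \<subseteq> node_relation (p ! i) (p ! Suc i) (p ! (i + 2))"
    using letter_ex nb_sym by blast
  from someI_ex[OF this]
  show "word_at nb inp \<tau> L m ! i \<in> letters"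
    "word_at nb inp \<tau> L m ! i \<subseteq> node_relation (p ! i) (p ! Suc i) (p ! (i + 2))"
    using i unfolding word_at_def Let_def p_def by (simp_all del: upt_Suc)
qed

lemma word_at_words:
  assumes "central nb \<tau> L m (segment nb \<tau> L m)" shows "word_at nb inp \<tau> L m \<in> words (2 * L + 1)"
proof -
  have l: "length (word_at nb inp \<tau> L m) = 2 * L + 1" unfolding word_at_def Let_def by simp
  moreover have "set (word_at nb inp \<tau> L m) \<subseteq> letters"
    using word_at_nth(1)[OF assms] l by (auto simp: in_set_conv_nth)
  ultimately show ?thesis unfolding words_def by simp
qed

lemma chosen_V: "m \<in> Ms \<Longrightarrow> m \<in> V"
  using chosen_central central_V by blast

lemma core_disjoint:
  assumes m: "m \<in> Ms" "m' \<in> Ms" "m \<noteq> m'"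
  shows "set (core nb \<tau> L m) \<inter> set (core nb \<tau> L m') = {}"
proof (rule ccontr)
  assume "\<not> ?thesis"
  then obtain x where "x \<in> set (core nb \<tau> L m)" "x \<in> set (core nb \<tau> L m')" by blast
  then obtain i j where ij: "i < 2 * L + 3" "j < 2 * L + 3" "core nb \<tau> L m ! i = core nb \<tau> L m' ! j"
    unfolding in_set_conv_nth core_length by metis
  have "conflict nb \<tau> L m m'"
    using central_near[OF chosen_central[OF m(1)] chosen_central[OF m(2)], of "L + 2 + i" "L + 2 + j"]
      ij m(3) by (simp add: core_nth)
  moreover have "\<not> conflict nb \<tau> L m m'"
    using chosen_independent[of enc nb \<tau> L K m m'] enc_inj chosen_V m by blast
  ultimately show False by simp
qed

text \<open>A branch off a core is light, so its nodes have at most one heavy neighbour, whereas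
  every core node has two.\<close>

lemma core_hanging:
  assumes m: "m \<in> Ms" "m' \<in> Ms" and i: "i < 2 * L + 1"
    and z: "z \<in> nb (core nb \<tau> L m ! Suc i) - {core nb \<tau> L m ! i, core nb \<tau> L m ! (i + 2)}"
  shows "branch nb (core nb \<tau> L m ! Suc i) z \<inter> set (core nb \<tau> L m') = {}"
proof -
  let ?x = "core nb \<tau> L m ! Suc i"
  have "heavy_nb nb \<tau> ?x = {core nb \<tau> L m ! i, core nb \<tau> L m ! (i + 2)}"
  proof -
    have "core nb \<tau> L m ! i = segment nb \<tau> L m ! (L + 1 + Suc i)"
      "core nb \<tau> L m ! (i + 2) = segment nb \<tau> L m ! (L + 3 + Suc i)"
      using core_nth[of i L nb \<tau> m] core_nth[of "i + 2" L nb \<tau> m] i by (simp_all add: numeral_eq_Suc)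
    then show ?thesis using core_heavy_nb(1)[OF chosen_central[OF m(1)], of "Suc i"] i by simp
  qed
  then have light: "\<not> heavy nb \<tau> ?x z" using z unfolding heavy_nb_def by auto
  show ?thesis
  proof (rule ccontr)
    assume "\<not> ?thesis"
    then obtain p j where p: "(p, core nb \<tau> L m' ! j) \<in> darts nb ?x z" and j: "j < 2 * L + 3"
      unfolding branch_def by (auto simp: in_set_conv_nth)
    show False
      using light_branch_heavy_nb[OF light p] core_heavy_nb[OF chosen_central[OF m(2)] j] by auto
  qed
qed

sublocale cut_tree nok Inp Sg \<Delta> V nb inp "2 * L + 1" g Ms "core nb \<tau> L" "word_at nb inp \<tau> L"
proof
  show "feasible (2 * L + 1) g" by (rule feasible)
  fix m assume m: "m \<in> Ms"
  note c = chosen_central[OF m]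
  show "nb_walk nb (core nb \<tau> L m)" by (rule core_walk[OF c])
  show "length (core nb \<tau> L m) = 2 * L + 1 + 2" by simp
  show "word_at nb inp \<tau> L m \<in> words (2 * L + 1)" by (rule word_at_words[OF c])
  show "word_at nb inp \<tau> L m ! i \<subseteq> node_relation (core nb \<tau> L m ! i) (core nb \<tau> L m ! Suc i) (core nb \<tau> L m ! (i + 2))"
    if "i < 2 * L + 1" for i by (rule word_at_nth(2)[OF c that])
  fix m' assume m': "m' \<in> Ms"
  show "set (core nb \<tau> L m) \<inter> set (core nb \<tau> L m') = {}" if "m \<noteq> m'" by (rule core_disjoint[OF m m' that])
  show "branch nb (core nb \<tau> L m ! Suc i) z \<inter> set (core nb \<tau> L m') = {}"
    if "i < 2 * L + 1" "z \<in> nb (core nb \<tau> L m ! Suc i) - {core nb \<tau> L m ! i, core nb \<tau> L m ! (i + 2)}" for i z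
    by (rule core_hanging[OF m m' that])
qed simp

lemma ct_cuts: "ct = cuts enc g nb inp \<tau> L K"
  by (intro ext) (simp only: ct_def cuts_def)

subsection \<open>Components have small diameter\<close>

lemma hanging_card:
  assumes "z \<in> nb v - {a, b}" "heavy nb \<tau> v z" shows "\<tau> < card (hanging nb a v b)"
proof -
  have "finite (hanging nb a v b)" using fin_branch unfolding hanging_def by auto
  moreover have "branch nb v z \<subseteq> hanging nb a v b" using assms(1) unfolding hanging_def by auto
  ultimately have "card (branch nb v z) \<le> card (hanging nb a v b)" by (rule card_mono)
  then show ?thesis using heavy_card[of z v \<tau>] assms by auto
qed

lemma hanging_V: "v \<in> V \<Longrightarrow> hanging nb a v b \<subseteq> V"
  using branch_sub_V unfolding hanging_def by blast

text \<open>
  Along a non-backtracking walk, every inner node away from the ends that is not straight carries a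
  branch with more than \<open>\<tau>\<close> nodes, and these branches are disjoint.
\<close>

lemma straight_block:
  assumes p: "nb_walk nb p" and len: "length p = k + 1" and D: "0 < D"
    and k: "2 * \<tau> + 1 + (card V div (\<tau> + 1) + 1) * D \<le> k"
  obtains a where "a + D + 2 \<le> length p" "straight nb \<tau> (take (D + 2) (drop a p))"
proof -
  \<comment> \<open>\<open>B\<close> consecutive stretches of \<open>D\<close> positions fit where
    both ends of the walk are more than \<open>\<tau>\<close> steps away, so that both path
    neighbours are heavy. A third heavy neighbour in every stretch would require
    \<open>B * (\<tau> + 1)\<close> nodes, more than \<open>card V\<close>.\<close>
  define B where "B = card V div (\<tau> + 1) + 1"
  define brn where "brn i \<longleftrightarrow> heavy_nb nb \<tau> (p ! i) \<noteq> {p ! (i - 1), p ! Suc i}" for i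
  have arc: "p ! Suc i \<in> nb (p ! i)" if "i < k" for i using p len that unfolding nb_walk_def by auto
  have pV: "p ! i \<in> V" if "i < k" for i using arc[OF that] nb_V by blast
  have sup: "{p ! (i - 1), p ! Suc i} \<subseteq> heavy_nb nb \<tau> (p ! i)" if i: "\<tau> + 1 \<le> i" "i + \<tau> < k" for i
  proof -
    have "heavy nb \<tau> (p ! i) (p ! Suc i)" using nb_walk_heavy[OF p, of i \<tau>] i len by simp
    moreover have "heavy nb \<tau> (rev p ! (k - i)) (rev p ! Suc (k - i))"
      using nb_walk_heavy[OF nb_walk_rev[OF p], of "k - i" \<tau>] i len by simp
    moreover have "rev p ! (k - i) = p ! i" "rev p ! Suc (k - i) = p ! (i - 1)"
      using i len by (auto simp: rev_nth)
    moreover have "p ! (i - 1) \<in> nb (p ! i)" using arc[of "i - 1"] i nb_sym by auto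
    ultimately show ?thesis using arc[of i] i unfolding heavy_nb_def by auto
  qed
  have "\<exists>b<B. \<forall>i. \<tau> + 1 + b * D \<le> i \<and> i < \<tau> + 1 + b * D + D \<longrightarrow> \<not> brn i"
  proof (rule ccontr)
    assume "\<not> ?thesis"
    then have "\<forall>b. \<exists>i. b < B \<longrightarrow> \<tau> + 1 + b * D \<le> i \<and> i < \<tau> + 1 + b * D + D \<and> brn i" by blast
    from choice[OF this] obtain f where
      f: "b < B \<Longrightarrow> \<tau> + 1 + b * D \<le> f b \<and> f b < \<tau> + 1 + b * D + D \<and> brn (f b)" for b by blast
    have bound: "\<tau> + 1 + b * D + D \<le> k - \<tau>" if "b < B" for b
    proof -
      have "Suc b * D \<le> B * D" using that by (intro mult_le_mono1) simp
      then show ?thesis using k unfolding B_def[symmetric] by simp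
    qed
    have mono: "f b < f c" if "b < c" "c < B" for b c
    proof -
      have "Suc b * D \<le> c * D" using that by (intro mult_le_mono1) simp
      then show ?thesis using f[of b] f[of c] that by simp
    qed
    let ?K = "\<lambda>b. hanging nb (p ! (f b - 1)) (p ! f b) (p ! Suc (f b))"
    have fk: "0 < f b" "f b + \<tau> < k" "\<tau> + 1 \<le> f b" if "b < B" for b using f[OF that] bound[OF that] by auto
    have card: "\<tau> + 1 \<le> card (?K b)" if bB: "b < B" for b
    proof -
      have "brn (f b)" using f[OF bB] by blast
      then obtain z where "z \<in> heavy_nb nb \<tau> (p ! f b)" "z \<notin> {p ! (f b - 1), p ! Suc (f b)}"
        using sup[OF fk(3)[OF bB] fk(2)[OF bB]] unfolding brn_def by blast
      then have "\<tau> < card (?K b)"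
        by (intro hanging_card[of z]) (auto simp: heavy_nb_def)
      then show ?thesis by simp
    qed
    have "B * (\<tau> + 1) = (\<Sum>b<B. \<tau> + 1)" by simp
    also have "\<dots> \<le> (\<Sum>b<B. card (?K b))" using card by (intro sum_mono) auto
    also have "\<dots> = card (\<Union>b<B. ?K b)"
    proof (rule card_UN_disjoint[symmetric])
      show "\<forall>b\<in>{..<B}. finite (?K b)" using fin_branch unfolding hanging_def by auto
      show "\<forall>b\<in>{..<B}. \<forall>c\<in>{..<B}. b \<noteq> c \<longrightarrow> ?K b \<inter> ?K c = {}"
      proof (intro ballI impI)
        fix b c assume bc: "b \<in> {..<B}" "c \<in> {..<B}" "b \<noteq> c"
        have d: "?K b \<inter> ?K c = {}" if "b < c" "c < B" for b c
          using hanging_disjoint[OF p fk(1) mono[OF that]] fk(2)[of c] that len by simp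
        show "?K b \<inter> ?K c = {}" using d[of b c] d[of c b] bc by (cases "b < c") auto
      qed
    qed simp
    also have "\<dots> \<le> card V"
    proof (rule card_mono[OF fin])
      have "?K b \<subseteq> V" if "b < B" for b using hanging_V pV fk[OF that] by (meson add_lessD1)
      then show "(\<Union>b<B. ?K b) \<subseteq> V" by blast
    qed
    finally have "B * (\<tau> + 1) \<le> card V" .
    moreover have "card V < B * (\<tau> + 1)"
      using dividend_less_div_times[of "\<tau> + 1" "card V"] unfolding B_def by simp
    ultimately show False by simp
  qed
  then obtain b where b: "b < B" "\<And>i. \<tau> + 1 + b * D \<le> i \<Longrightarrow> i < \<tau> + 1 + b * D + D \<Longrightarrow> \<not> brn i" by blast
  have "Suc b * D \<le> B * D" using b(1) by (intro mult_le_mono1) simp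
  then have bk: "\<tau> + b * D + D + \<tau> + 1 \<le> k" using k unfolding B_def[symmetric] by simp
  let ?a = "\<tau> + b * D"
  have 1: "?a + D + 2 \<le> length p" using bk len by simp
  moreover have "straight nb \<tau> (take (D + 2) (drop ?a p))"
    unfolding straight_def
  proof (intro allI impI)
    fix i assume "i + 2 < length (take (D + 2) (drop ?a p))"
    then have i: "i < D" by simp
    have n: "take (D + 2) (drop ?a p) ! j = p ! (?a + j)" if "j < D + 2" for j
      using 1 that by simp
    have "\<not> brn (?a + i + 1)" using b(2)[of "?a + i + 1"] i by simp
    then have "heavy_nb nb \<tau> (p ! (?a + Suc i)) = {p ! (?a + i), p ! (?a + (i + 2))}"
      unfolding brn_def by simp
    moreover have "p ! (?a + i) \<noteq> p ! (?a + (i + 2))" using p 1 i unfolding nb_walk_def by auto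
    ultimately show "take (D + 2) (drop ?a p) ! i \<noteq> take (D + 2) (drop ?a p) ! (i + 2) \<and>
        heavy_nb nb \<tau> (take (D + 2) (drop ?a p) ! Suc i)
        = {take (D + 2) (drop ?a p) ! i, take (D + 2) (drop ?a p) ! (i + 2)}"
      using n[of i] n[of "Suc i"] n[of "i + 2"] i by simp
  qed
  ultimately show thesis by (rule that)
qed

text \<open>The middle node is central, so it or a node in conflict with it was chosen. That node is
  at most \<open>4 * L + 4\<close> positions from the middle, and an end of its core at most
  \<open>L + 1\<close> further; \<open>5 * L + 7\<close> nodes on each side leave enough
  room.\<close>

lemma straight_cut:
  assumes st: "straight nb \<tau> S" and len: "length S = 10 * L + 15"
  obtains i where "Suc i < length S" "(S ! i, S ! Suc i) \<in> cut_arcs ct"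
proof -
  let ?x = "S ! (5 * L + 7)"
  define q where "q = take (4 * L + 7) (drop (3 * L + 4) S)"
  have qn: "q ! i = S ! (3 * L + 4 + i)" if "i < 4 * L + 7" for i
    using that len unfolding q_def by simp
  have "central nb \<tau> L ?x q" unfolding central_def
  proof (intro conjI)
    show lq: "length q = 4 * L + 7" unfolding q_def using len by simp
    show "q ! (2 * L + 3) = ?x" using qn[of "2 * L + 3"] by (simp add: algebra_simps)
    show "straight nb \<tau> q" unfolding straight_def
    proof (intro allI impI)
      fix i assume "i + 2 < length q"
      then have i: "i + 2 < 4 * L + 7" using lq by simp
      have "S ! (3 * L + 4 + i) \<noteq> S ! (3 * L + 4 + i + 2) \<and>
        heavy_nb nb \<tau> (S ! Suc (3 * L + 4 + i)) = {S ! (3 * L + 4 + i), S ! (3 * L + 4 + i + 2)}"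
        using st[unfolded straight_def, rule_format, of "3 * L + 4 + i"] i len by simp
      then show "q ! i \<noteq> q ! (i + 2) \<and> heavy_nb nb \<tau> (q ! Suc i) = {q ! i, q ! (i + 2)}"
        using qn[of i] qn[of "i + 2"] qn[of "Suc i"] i by simp
    qed
  qed
  then have "?x \<in> Ms \<or> (\<exists>u\<in>Ms. conflict nb \<tau> L ?x u)"
    using chosen_maximal enc_less central_V by blast
  then obtain m where m: "m \<in> Ms" and xm: "?x = m \<or> conflict nb \<tau> L ?x m" by blast
  have "\<exists>c. L + 3 \<le> c \<and> c \<le> 9 * L + 11 \<and> S ! c = m"
    using xm
  proof
    assume "conflict nb \<tau> L ?x m"
    then obtain r i j where r: "straight nb \<tau> r" "length r = 4 * L + 7"
      "0 < i" "i < 4 * L + 6" "0 < j" "j < 4 * L + 6" "r ! i = ?x" "r ! j = m"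
      unfolding conflict_def by blast
    show ?thesis
    proof (rule straight_meet[OF st r(1), of "5 * L + 7" i])
      assume h: "\<And>a b. a < length S \<Longrightarrow> b < length r \<Longrightarrow> a + i = b + (5 * L + 7) \<Longrightarrow> S ! a = r ! b"
      have "S ! (j + (5 * L + 7) - i) = m" using h[of "j + (5 * L + 7) - i" j] r len by simp
      then show ?thesis using r by (intro exI[of _ "j + (5 * L + 7) - i"]) auto
    next
      assume h: "\<And>a b. a < length S \<Longrightarrow> b < length r \<Longrightarrow> a + b = 5 * L + 7 + i \<Longrightarrow> S ! a = r ! b"
      have "S ! (5 * L + 7 + i - j) = m" using h[of "5 * L + 7 + i - j" j] r len by simp
      then show ?thesis using r by (intro exI[of _ "5 * L + 7 + i - j"]) auto
    qed (use r len in auto)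
  qed (intro exI[of _ "5 * L + 7"], simp)
  then obtain c where c: "L + 3 \<le> c" "c \<le> 9 * L + 11" "S ! c = m" by blast
  let ?q = "segment nb \<tau> L m"
  have q: "straight nb \<tau> ?q" "length ?q = 4 * L + 7" "?q ! (2 * L + 3) = m"
    using chosen_central[OF m] unfolding central_def by auto
  have cut: "(?q ! (L + 2), ?q ! (L + 3)) \<in> cut_arcs ct" "(?q ! (L + 3), ?q ! (L + 2)) \<in> cut_arcs ct"
  proof -
    have "ct (core nb \<tau> L m ! 0) (core nb \<tau> L m ! 1) (fst (g (word_at nb inp \<tau> L m)))"
      using m unfolding ct_def by blast
    then have "ct (?q ! (L + 2)) (?q ! (L + 3)) (fst (g (word_at nb inp \<tau> L m)))"
    proof -
      have "core nb \<tau> L m ! 0 = ?q ! (L + 2)" by (simp add: core_nth)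
      moreover have "core nb \<tau> L m ! 1 = ?q ! (L + 3)"
        using core_nth[of 1 L nb \<tau> m] by (simp add: numeral_3_eq_3)
      ultimately show "ct (core nb \<tau> L m ! 0) (core nb \<tau> L m ! 1) t \<Longrightarrow> ct (?q ! (L + 2)) (?q ! (L + 3)) t" for t
        by (simp only:)
    qed
    then show "(?q ! (L + 2), ?q ! (L + 3)) \<in> cut_arcs ct" "(?q ! (L + 3), ?q ! (L + 2)) \<in> cut_arcs ct"
      unfolding cut_arcs_def by blast+
  qed
  show thesis
  proof (rule straight_meet[OF st q(1), of c "2 * L + 3"])
    assume h: "\<And>a b. a < length S \<Longrightarrow> b < length ?q \<Longrightarrow> a + (2 * L + 3) = b + c \<Longrightarrow> S ! a = ?q ! b"
    have "S ! (c - L - 1) = ?q ! (L + 2)" "S ! Suc (c - L - 1) = ?q ! (L + 3)"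
      using h[of "c - L - 1" "L + 2"] h[of "Suc (c - L - 1)" "L + 3"] c q len by auto
    then show thesis using that[of "c - L - 1"] cut c len by auto
  next
    assume h: "\<And>a b. a < length S \<Longrightarrow> b < length ?q \<Longrightarrow> a + b = c + (2 * L + 3) \<Longrightarrow> S ! a = ?q ! b"
    have "S ! (c + L) = ?q ! (L + 3)" "S ! Suc (c + L) = ?q ! (L + 2)"
      using h[of "c + L" "L + 3"] h[of "Suc (c + L)" "L + 2"] c q len by auto
    then show thesis using that[of "c + L"] cut c len by auto
  qed (use c q len in auto)
qed

text \<open>A shortest connection does not backtrack, since going back and forth over an edge could
  be omitted.\<close>

lemma rtrancl_nb_walk:
  assumes "u \<in> comp nb ct v"
  obtains p where "p \<noteq> []" "hd p = v" "last p = u" "nb_walk nb p"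
    "\<And>i. Suc i < length p \<Longrightarrow> (p ! i, p ! Suc i) \<in> uncut nb ct"
proof -
  have "(v, u) \<in> (uncut nb ct)\<^sup>*" using assms unfolding comp_def by simp
  then have "\<exists>k. (v, u) \<in> (uncut nb ct) ^^ k" using rtrancl_imp_relpow by blast
  then have least: "(v, u) \<in> (uncut nb ct) ^^ (LEAST k. (v, u) \<in> (uncut nb ct) ^^ k)" by (rule LeastI_ex)
  define k where "k = (LEAST k. (v, u) \<in> (uncut nb ct) ^^ k)"
  have "(v, u) \<in> uncut nb ct ^^ k" using least unfolding k_def .
  then obtain f where f: "f 0 = v" "f k = u" "\<And>i. i < k \<Longrightarrow> (f i, f (Suc i)) \<in> uncut nb ct"
    unfolding relpow_fun_conv by auto
  define p where "p = map f [0..<k + 1]"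
  have pn: "p ! i = f i" if "i \<le> k" for i using that unfolding p_def by (simp del: upt_Suc)
  have lp: "length p = k + 1" by (simp add: p_def)
  have nobt: "f i \<noteq> f (i + 2)" if i: "i + 2 \<le> k" for i
  proof
    assume eq: "f i = f (i + 2)"
    have "(f 0, f i) \<in> uncut nb ct ^^ i" using f(3) i unfolding relpow_fun_conv by (intro exI[of _ f]) auto
    moreover obtain d where d: "k = i + 2 + d" using i le_Suc_ex by blast
    moreover have "(f (i + 2), f k) \<in> uncut nb ct ^^ d"
      using f(3) unfolding relpow_fun_conv d by (intro exI[of _ "\<lambda>j. f (i + 2 + j)"]) auto
    ultimately have "(f 0, f k) \<in> uncut nb ct ^^ i O uncut nb ct ^^ d"
      using eq by (metis relcomp.relcompI)
    then have "(v, u) \<in> uncut nb ct ^^ (i + d)" by (simp only: relpow_add f(1,2))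
    then have "k \<le> i + d" unfolding k_def by (rule Least_le)
    then show False using d by simp
  qed
  show thesis
  proof (rule that[of p])
    show "p \<noteq> []" using lp by auto
    show "hd p = v" using pn[of 0] f(1) lp by (simp add: hd_conv_nth \<open>p \<noteq> []\<close>)
    show "last p = u" using pn[of k] f(2) lp by (simp add: last_conv_nth \<open>p \<noteq> []\<close>)
    show unc: "(p ! i, p ! Suc i) \<in> uncut nb ct" if "Suc i < length p" for i
      using f(3)[of i] that lp pn[of i] pn[of "Suc i"] by simp
    show "nb_walk nb p" unfolding nb_walk_def
    proof (intro conjI allI impI)
      show "p ! Suc i \<in> nb (p ! i)" if "Suc i < length p" for i using unc[OF that] unfolding uncut_def by auto
      show "p ! i \<noteq> p ! Suc (Suc i)" if "Suc (Suc i) < length p" for i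
        using nobt[of i] that lp pn[of i] pn[of "Suc (Suc i)"] by simp
    qed
  qed
qed

text \<open>A longer non-backtracking walk inside a component would contain a straight stretch of
  \<open>10 * L + 15\<close> nodes, and \<open>straight_cut\<close> finds a cut edge on it.\<close>

lemma comp_ball:
  "comp nb ct v \<subseteq> ball nb (2 * \<tau> + 1 + (card V div (\<tau> + 1) + 1) * (10 * L + 13)) v"
proof
  fix u assume "u \<in> comp nb ct v"
  then obtain p where p: "p \<noteq> []" "hd p = v" "last p = u" "nb_walk nb p"
    "\<And>i. Suc i < length p \<Longrightarrow> (p ! i, p ! Suc i) \<in> uncut nb ct" by (rule rtrancl_nb_walk) blast
  let ?R = "2 * \<tau> + 1 + (card V div (\<tau> + 1) + 1) * (10 * L + 13)"
  obtain k where k: "length p = k + 1" using p(1) by (cases p) auto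
  have "k \<le> ?R"
  proof (rule ccontr)
    assume "\<not> k \<le> ?R"
    then have "?R \<le> k" by simp
    then obtain a where a: "a + (10 * L + 13) + 2 \<le> length p"
      "straight nb \<tau> (take (10 * L + 13 + 2) (drop a p))"
      using straight_block[OF p(4) k, of "10 * L + 13"] by auto
    let ?S = "take (10 * L + 13 + 2) (drop a p)"
    have l: "length ?S = 10 * L + 15" using a(1) by simp
    obtain i where i: "Suc i < length ?S" "(?S ! i, ?S ! Suc i) \<in> cut_arcs ct"
      by (rule straight_cut[OF a(2) l])
    have "?S ! i = p ! (a + i)" "?S ! Suc i = p ! Suc (a + i)" using i(1) l a(1) by auto
    then show False using p(5)[of "a + i"] i l a(1) unfolding uncut_def by auto
  qed
  moreover have "p ! i \<in> ball nb i v" if "i \<le> k" for i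
    using that
  proof (induction i)
    case 0
    then show ?case using p(1,2) by (simp add: hd_conv_nth)
  next
    case (Suc i)
    have "p ! Suc i \<in> nb (p ! i)" using p(4) k Suc.prems unfolding nb_walk_def by auto
    then show ?case using Suc by auto
  qed
  from this[of k] have "u \<in> ball nb k v" using p(1,3) k by (simp add: last_conv_nth)
  ultimately show "u \<in> ball nb ?R v" using ball_mono[of k ?R nb v] by blast
qed

end

section \<open>Locality of the algorithm\<close>

lemma agree_central:
  assumes "agree (\<tau> + 4 * L + 6) m nb inp nb' inp'" "central nb \<tau> L m q"
  shows "central nb' \<tau> L m q"
proof -
  have "agree (Suc \<tau> + (4 * L + 5)) m nb inp nb' inp'" using assms(1) by (rule agree_mono) simp
  then show ?thesis
    using agree_straight[of \<tau> "4 * L + 5" q "2 * L + 3" nb inp nb' inp'] assms(2) unfolding central_def by auto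
qed

lemma agree_central_iff:
  assumes "agree (\<tau> + 4 * L + 6) m nb inp nb' inp'"
  shows "central nb \<tau> L m = central nb' \<tau> L m"
  using agree_central[OF assms] agree_central[OF agree_sym[OF assms]] by blast

lemma agree_conflict:
  assumes "agree (\<tau> + 4 * L + 6) m nb inp nb' inp'" "conflict nb \<tau> L m m'"
  shows "conflict nb' \<tau> L m m'"
proof -
  obtain q i j where q: "straight nb \<tau> q" "length q = 4 * L + 7"
    "0 < i" "i < 4 * L + 6" "0 < j" "j < 4 * L + 6" "q ! i = m" "q ! j = m'" "m \<noteq> m'"
    using assms(2) unfolding conflict_def by blast
  moreover have "agree (Suc \<tau> + (4 * L + 5)) m nb inp nb' inp'" using assms(1) by (rule agree_mono) simp
  ultimately have "straight nb' \<tau> q"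
    using agree_straight[of \<tau> "4 * L + 5" q i nb inp nb' inp'] by auto
  then show ?thesis using q unfolding conflict_def by blast
qed

lemma agree_conflict_iff:
  assumes "agree (\<tau> + 4 * L + 6) m nb inp nb' inp'"
  shows "conflict nb \<tau> L m m' \<longleftrightarrow> conflict nb' \<tau> L m m'"
  using agree_conflict[OF assms] agree_conflict[OF agree_sym[OF assms]] by blast

lemma agree_colour:
  assumes "agree (\<tau> + 4 * L + 6) m nb inp nb' inp'"
  shows "colour nb \<tau> L m = colour nb' \<tau> L m"
  unfolding colour_def using agree_conflict_iff[OF assms] by simp

text \<open>A round asks only about conflicting nodes, which are at distance at most
  \<open>4 * L + 4\<close>; this is the price of one colour.\<close>

lemma agree_chosen:
  assumes "agree (\<tau> + 4 * L + 6 + k * (4 * L + 4)) v nb inp nb' inp'"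
  shows "v \<in> chosen enc nb \<tau> L k \<longleftrightarrow> v \<in> chosen enc nb' \<tau> L k"
  using assms
proof (induction k arbitrary: v)
  case (Suc k)
  have ag: "agree (\<tau> + 4 * L + 6) v nb inp nb' inp'" "agree (\<tau> + 4 * L + 6 + k * (4 * L + 4)) v nb inp nb' inp'"
    by (rule agree_mono[OF Suc.prems], simp)+
  have "u \<in> chosen enc nb \<tau> L k \<longleftrightarrow> u \<in> chosen enc nb' \<tau> L k" if "conflict nb \<tau> L v u" for u
  proof (rule Suc.IH)
    have "agree (\<tau> + 4 * L + 6 + Suc k * (4 * L + 4) - (4 * L + 4)) u nb inp nb' inp'"
      by (rule agree_shift[OF Suc.prems conflict_ball[OF that]])
    then show "agree (\<tau> + 4 * L + 6 + k * (4 * L + 4)) u nb inp nb' inp'" by (rule agree_mono) simp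
  qed
  then have "(\<exists>u\<in>chosen enc nb \<tau> L k. conflict nb \<tau> L v u) \<longleftrightarrow>
      (\<exists>u\<in>chosen enc nb' \<tau> L k. conflict nb' \<tau> L v u)"
    using agree_conflict_iff[OF ag(1)] by blast
  then show ?case
    unfolding chosen.simps Un_iff mem_Collect_eq Suc.IH[OF ag(2)] agree_central_iff[OF ag(1)] agree_colour[OF ag(1)]
    by blast
qed simp

lemma agree_segment:
  assumes "agree (\<tau> + 4 * L + 6) m nb inp nb' inp'"
  shows "segment nb \<tau> L m = segment nb' \<tau> L m"
  unfolding segment_def agree_central_iff[OF assms] ..

lemma agree_core:
  assumes "agree (\<tau> + 4 * L + 6) m nb inp nb' inp'"
  shows "core nb \<tau> L m = core nb' \<tau> L m"
  unfolding core_def agree_segment[OF assms] ..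

lemma central_ball:
  assumes "central nb \<tau> L m q" "0 < i" "i < 4 * L + 6"
  shows "q ! i \<in> ball nb (nat \<bar>int (2 * L + 3) - int i\<bar>) m" "m \<in> ball nb (nat \<bar>int i - int (2 * L + 3)\<bar>) (q ! i)"
  using straight_ball[of nb \<tau> q "2 * L + 3" i] straight_ball[of nb \<tau> q i "2 * L + 3"] assms
  unfolding central_def by auto

context edge_problem begin

lemma ok_local: "nb u = nb' u \<Longrightarrow> inp u = inp' u \<Longrightarrow> ok nb inp u \<sigma> \<longleftrightarrow> ok nb' inp' u \<sigma>"
  unfolding ok_def by simp

text \<open>The branches other than those at \<open>a\<close> and \<open>b\<close> are light, so
  they end within \<open>\<tau>\<close> steps and the hanging part is seen completely.\<close>

lemma agree_node_rel:
  assumes ag: "agree (\<tau> + 2) v nb inp nb' inp'" and h: "heavy_nb nb \<tau> v = {a, b}"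
  shows "node_rel nb inp a v b = node_rel nb' inp' a v b"
proof -
  have nbv: "nb v = nb' v" "inp v = inp' v" using agree_nb[OF ag] by auto
  have br: "branch nb v z = branch nb' v z \<and> (\<forall>u\<in>branch nb v z. nb u = nb' u \<and> inp u = inp' u)"
    if z: "z \<in> nb v - {a, b}" for z
  proof -
    have "agree (Suc (\<tau> + 1)) v nb inp nb' inp'" using ag by simp
    then have agz: "agree (\<tau> + 1) z nb inp nb' inp'" using agree_step z by fast
    have light: "\<not> heavy nb \<tau> v z" using z h unfolding heavy_nb_def by auto
    have same: "darts_at nb j v z = darts_at nb' j v z" if "j \<le> \<tau>" for j
      using agree_darts_at[OF agz, of j v] that by simp
    then have "\<not> heavy nb' \<tau> v z" using light unfolding heavy_def by simp
    then have "darts nb v z = darts nb' v z"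
      unfolding darts_at_light[OF light] darts_at_light[OF \<open>\<not> heavy nb' \<tau> v z\<close>] using same by simp
    moreover have "nb u = nb' u \<and> inp u = inp' u" if pu: "(p, u) \<in> darts nb v z" for p u
    proof -
      obtain j where "j < \<tau>" "(p, u) \<in> darts_at nb j v z"
        using pu unfolding darts_at_light[OF light] by blast
      then show ?thesis using agreeD[OF agz, of j u] darts_at_ball[of p u nb j v z] by simp
    qed
    ultimately show ?thesis unfolding branch_def by auto
  qed
  have hang: "hanging nb a v b = hanging nb' a v b" unfolding hanging_def using br nbv by simp
  have loc: "\<forall>u\<in>hanging nb a v b. nb u = nb' u \<and> inp u = inp' u"
    unfolding hanging_def using br nbv by blast
  have "ok nb inp u \<sigma> \<longleftrightarrow> ok nb' inp' u \<sigma>" if "u \<in> hanging nb a v b" for u \<sigma>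
    by (rule ok_local) (use loc that in blast)+
  then have "(\<forall>u\<in>hanging nb a v b. ok nb inp u \<sigma>) \<longleftrightarrow> (\<forall>u\<in>hanging nb' a v b. ok nb' inp' u \<sigma>)" for \<sigma>
    unfolding hang[symmetric] by simp
  then show ?thesis unfolding node_rel_def by simp
qed

lemma agree_word_at:
  assumes ag: "agree (\<tau> + 4 * L + 6) m nb inp nb' inp'"
    and c: "central nb \<tau> L m (segment nb \<tau> L m)"
  shows "word_at nb inp \<tau> L m = word_at nb' inp' \<tau> L m"
proof -
  let ?p = "core nb \<tau> L m"
  have "node_rel nb inp (?p ! i) (?p ! Suc i) (?p ! (i + 2)) = node_rel nb' inp' (?p ! i) (?p ! Suc i) (?p ! (i + 2))"
    if i: "i < 2 * L + 1" for i
  proof (rule agree_node_rel)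
    have "?p ! Suc i = segment nb \<tau> L m ! (L + 3 + i)"
      using core_nth[of "Suc i" L nb \<tau> m] i by (simp add: numeral_eq_Suc)
    then have "?p ! Suc i \<in> ball nb (nat \<bar>int (2 * L + 3) - int (L + 3 + i)\<bar>) m"
      using central_ball(1)[OF c, of "L + 3 + i"] i by simp
    moreover have "nat \<bar>int (2 * L + 3) - int (L + 3 + i)\<bar> \<le> L" using i by linarith
    ultimately have "?p ! Suc i \<in> ball nb L m" using ball_mono[of _ L nb m] by blast
    from agree_shift[OF ag this] show "agree (\<tau> + 2) (?p ! Suc i) nb inp nb' inp'"
      by (rule agree_mono) simp
    have "?p ! i = segment nb \<tau> L m ! (L + 1 + Suc i)" "?p ! (i + 2) = segment nb \<tau> L m ! (L + 3 + Suc i)"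
      using core_nth[of i L nb \<tau> m] core_nth[of "i + 2" L nb \<tau> m] i by (simp_all add: numeral_eq_Suc)
    then show "heavy_nb nb \<tau> (?p ! Suc i) = {?p ! i, ?p ! (i + 2)}"
      using core_heavy_nb(1)[OF c, of "Suc i"] i by simp
  qed
  then show ?thesis unfolding word_at_def Let_def agree_core[OF ag, symmetric]
    by (intro map_cong) auto
qed

text \<open>A cut edge lies on the core of a chosen node, so that node is within distance
  \<open>L + 1\<close> of either end of the edge. Both orientations are needed, because membership
  in \<open>cut_arcs\<close> and being inner look at the edge from different ends.\<close>

lemma agree_cuts:
  assumes ag: "agree (\<tau> + 4 * L + 6 + K * (4 * L + 4) + L + 1) u nb inp nb' inp'"
  shows "cuts enc g nb inp \<tau> L K u z t \<Longrightarrow> cuts enc g nb' inp' \<tau> L K u z t"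
    and "cuts enc g nb inp \<tau> L K z u t \<Longrightarrow> cuts enc g nb' inp' \<tau> L K z u t"
proof -
  have key: "m \<in> chosen enc nb' \<tau> L K \<and> core nb \<tau> L m = core nb' \<tau> L m \<and> word_at nb inp \<tau> L m = word_at nb' inp' \<tau> L m"
    if m: "m \<in> chosen enc nb \<tau> L K" and u: "u \<in> set (core nb \<tau> L m)" for m
  proof -
    note c = chosen_central[OF m]
    obtain i where i: "i < 2 * L + 3" "u = core nb \<tau> L m ! i" using u by (auto simp: in_set_conv_nth)
    then have "m \<in> ball nb (nat \<bar>int (L + 2 + i) - int (2 * L + 3)\<bar>) u"
      using central_ball(2)[OF c, of "L + 2 + i"] core_nth[OF i(1), of nb \<tau> m] by simp
    moreover have "nat \<bar>int (L + 2 + i) - int (2 * L + 3)\<bar> \<le> L + 1" using i by linarith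
    ultimately have "m \<in> ball nb (L + 1) u" using ball_mono[of _ "L + 1" nb u] by blast
    from agree_shift[OF ag this] have "agree (\<tau> + 4 * L + 6 + K * (4 * L + 4)) m nb inp nb' inp'"
      by (rule agree_mono) simp
    moreover from this have "agree (\<tau> + 4 * L + 6) m nb inp nb' inp'" by (rule agree_mono) simp
    ultimately show ?thesis using agree_chosen[of \<tau> L K m] agree_core[of \<tau> L m] agree_word_at[of \<tau> L m] c m
      by metis
  qed
  have mem: "core nb \<tau> L m ! 0 \<in> set (core nb \<tau> L m)" "core nb \<tau> L m ! 1 \<in> set (core nb \<tau> L m)"
    "core nb \<tau> L m ! (2 * L + 1 + 1) \<in> set (core nb \<tau> L m)" "core nb \<tau> L m ! (2 * L + 1) \<in> set (core nb \<tau> L m)"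
    for m by (auto intro!: nth_mem)
  show "cuts enc g nb' inp' \<tau> L K u z t" if h: "cuts enc g nb inp \<tau> L K u z t"
  proof -
    obtain m where m: "m \<in> chosen enc nb \<tau> L K"
     "(u, z, t) = (core nb \<tau> L m ! 0, core nb \<tau> L m ! 1, fst (g (word_at nb inp \<tau> L m))) \<or>
      (u, z, t) = (core nb \<tau> L m ! (2 * L + 1 + 1), core nb \<tau> L m ! (2 * L + 1), snd (g (word_at nb inp \<tau> L m)))"
      using h unfolding cuts_def by blast
    then have "u \<in> set (core nb \<tau> L m)" using mem by blast
    from key[OF m(1) this] show ?thesis using m(2) unfolding cuts_def by (intro bexI[of _ m]) simp_all
  qed
  show "cuts enc g nb' inp' \<tau> L K z u t" if h: "cuts enc g nb inp \<tau> L K z u t"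
  proof -
    obtain m where m: "m \<in> chosen enc nb \<tau> L K"
     "(z, u, t) = (core nb \<tau> L m ! 0, core nb \<tau> L m ! 1, fst (g (word_at nb inp \<tau> L m))) \<or>
      (z, u, t) = (core nb \<tau> L m ! (2 * L + 1 + 1), core nb \<tau> L m ! (2 * L + 1), snd (g (word_at nb inp \<tau> L m)))"
      using h unfolding cuts_def by blast
    then have "u \<in> set (core nb \<tau> L m)" using mem by blast
    from key[OF m(1) this] show ?thesis using m(2) unfolding cuts_def by (intro bexI[of _ m]) simp_all
  qed
qed

lemma agree_cuts_iff:
  assumes "agree (\<tau> + 4 * L + 6 + K * (4 * L + 4) + L + 1) u nb inp nb' inp'"
  shows "cuts enc g nb inp \<tau> L K u z t \<longleftrightarrow> cuts enc g nb' inp' \<tau> L K u z t"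
    and "cuts enc g nb inp \<tau> L K z u t \<longleftrightarrow> cuts enc g nb' inp' \<tau> L K z u t"
  by (rule iffI, (rule agree_cuts[OF assms], assumption), (rule agree_cuts[OF agree_sym[OF assms]], assumption))+

end

section \<open>Locality of the solutions on components\<close>

lemma comp_cong:
  assumes loc: "\<And>w. w \<in> comp nb ct v \<Longrightarrow> nb w = nb' w \<and> ct w = ct' w \<and> (\<forall>z. ct z w = ct' z w)"
  shows "comp nb ct v = comp nb' ct' v"
proof -
  have one: "(w, x) \<in> uncut nb ct \<longleftrightarrow> (w, x) \<in> uncut nb' ct'" if "w \<in> comp nb ct v" for w x
    using loc[OF that] unfolding uncut_def cut_arcs_def by auto
  have "(v, u) \<in> (uncut nb ct)\<^sup>* \<Longrightarrow> (v, u) \<in> (uncut nb' ct')\<^sup>*" for u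
  proof (induction rule: rtrancl_induct)
    case (step y z)
    then have "(y, z) \<in> uncut nb' ct'" using one[of y z] unfolding comp_def by simp
    then show ?case using step.IH by (rule rtrancl_into_rtrancl[rotated])
  qed simp
  moreover have "(v, u) \<in> (uncut nb' ct')\<^sup>* \<Longrightarrow> (v, u) \<in> (uncut nb ct)\<^sup>*" for u
  proof (induction rule: rtrancl_induct)
    case (step y z)
    then have "(y, z) \<in> uncut nb ct" using one[of y z] unfolding comp_def by simp
    then show ?case using step.IH by (rule rtrancl_into_rtrancl[rotated])
  qed simp
  ultimately show ?thesis unfolding comp_def by blast
qed

context edge_problem begin

text \<open>The reach \<open>2 * R + 1\<close> belongs to an inner solution: \<open>R\<close> for
  its own component, one cut edge, and \<open>R\<close> again for the outer component behind that
  edge.\<close>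

lemma sol_local:
  assumes loc: "\<And>w. w \<in> ball nb (2 * R + 1) v \<Longrightarrow>
      nb w = nb' w \<and> inp w = inp' w \<and> ct w = ct' w \<and> (\<forall>z. ct z w = ct' z w)"
    and cb: "\<And>w. comp nb ct w \<subseteq> ball nb R w"
    and arcs: "\<And>z u t. ct z u t \<Longrightarrow> z \<in> nb u"
  shows "sol nb inp ct v = sol nb' inp' ct' v"
proof -
  have sub: "comp nb ct w \<subseteq> ball nb (2 * R + 1) v" if "w \<in> ball nb (R + 1) v" for w
  proof
    fix x assume "x \<in> comp nb ct w"
    then have "x \<in> ball nb ((R + 1) + R) v" using ball_add[OF that] cb by blast
    then show "x \<in> ball nb (2 * R + 1) v" by (simp add: mult_2)
  qed
  have comp: "comp nb ct w = comp nb' ct' w" if "w \<in> ball nb (R + 1) v" for w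
    using sub[OF that] loc by (intro comp_cong) blast
  have ok: "ok nb inp u \<sigma> = ok nb' inp' u \<sigma>" if "w \<in> ball nb (R + 1) v" "u \<in> comp nb ct w" for w u \<sigma>
    using ok_local loc sub that by (metis (no_types, opaque_lifting) subsetD)
  have cts: "ct u = ct' u" "ct z u = ct' z u" if "w \<in> ball nb (R + 1) v" "u \<in> comp nb ct w" for w u z
    using loc sub that by blast+
  have outer: "outer_sol nb inp ct w = outer_sol nb' inp' ct' w" if "w \<in> ball nb (R + 1) v" for w
    unfolding outer_sol_def comp[OF that, symmetric] using ok[OF that] cts(1)[OF that]
    by (intro arg_cong[of _ _ Eps] ext) (metis (no_types, lifting))
  have v: "v \<in> ball nb (R + 1) v" by simp
  have inn: "inner nb ct v = inner nb' ct' v"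
    unfolding inner_def comp[OF v, symmetric] using cts(2)[OF v] by simp
  have "outer_sol nb inp ct z = outer_sol nb' inp' ct' z" if "u \<in> comp nb ct v" "ct z u t" for z u t
  proof (rule outer)
    have "u \<in> ball nb R v" using cb that(1) by blast
    then show "z \<in> ball nb (R + 1) v" using arcs[OF that(2)] by auto
  qed
  then have "inner_sol nb inp ct v = inner_sol nb' inp' ct' v"
    unfolding inner_sol_def comp[OF v, symmetric] using ok[OF v] cts(2)[OF v]
    by (intro arg_cong[of _ _ Eps] ext) (metis (no_types, lifting))
  then show ?thesis unfolding sol_def using inn outer[OF v] by simp
qed

definition local_out where
  "local_out enc g \<tau> L K nb inp v = (SOME out. nok (inp v) out
     (image_mset (es (sol nb inp (cuts enc g nb inp \<tau> L K) v) v) (mset_set (nb v))))"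

end

definition comp_radius :: "nat \<Rightarrow> nat \<Rightarrow> nat \<Rightarrow> nat" where
  "comp_radius n \<tau> L = 2 * \<tau> + 1 + (n div (\<tau> + 1) + 1) * (10 * L + 13)"

definition local_radius :: "nat \<Rightarrow> nat \<Rightarrow> nat \<Rightarrow> nat \<Rightarrow> nat" where
  "local_radius n \<tau> L K = 2 * comp_radius n \<tau> L + 1 + (\<tau> + 4 * L + 6 + K * (4 * L + 4) + L + 1)"

context algorithm_tree begin

lemma ct_arc: assumes "ct z u t" shows "z \<in> nb u"
proof -
  from assms obtain m where m: "m \<in> Ms"
    "(z, u) = (core nb \<tau> L m ! 0, core nb \<tau> L m ! 1) \<or>
     (z, u) = (core nb \<tau> L m ! (2 * L + 1 + 1), core nb \<tau> L m ! (2 * L + 1))" by (rule ct_path)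
  have "core nb \<tau> L m ! 1 \<in> nb (core nb \<tau> L m ! 0)"
    "core nb \<tau> L m ! (2 * L + 1 + 1) \<in> nb (core nb \<tau> L m ! (2 * L + 1))"
    using core_walk[OF chosen_central[OF m(1)]] unfolding nb_walk_def by auto
  then show ?thesis using m(2) nb_sym by blast
qed

lemma local_out_agree:
  assumes ag: "agree (local_radius (card V) \<tau> L K) v nb inp nb' inp'"
  shows "local_out enc g \<tau> L K nb inp v = local_out enc g \<tau> L K nb' inp' v"
proof -
  let ?R = "comp_radius (card V) \<tau> L" and ?c = "\<tau> + 4 * L + 6 + K * (4 * L + 4) + L + 1"
  have "sol nb inp ct v = sol nb' inp' (cuts enc g nb' inp' \<tau> L K) v"
  proof (rule sol_local[where R = ?R])
    show "comp nb ct w \<subseteq> ball nb ?R w" for w using comp_ball unfolding comp_radius_def .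
    show "z \<in> nb u" if "ct z u t" for z u t by (rule ct_arc[OF that])
    fix w assume "w \<in> ball nb (2 * ?R + 1) v"
    from agree_shift[OF ag this] have ag': "agree ?c w nb inp nb' inp'"
      unfolding local_radius_def by simp
    show "nb w = nb' w \<and> inp w = inp' w \<and> ct w = cuts enc g nb' inp' \<tau> L K w \<and>
        (\<forall>z. ct z w = cuts enc g nb' inp' \<tau> L K z w)"
      using agree_nb[OF ag'] unfolding ct_cuts by (auto intro!: ext simp: agree_cuts_iff[OF ag'])
  qed
  moreover have "nb v = nb' v \<and> inp v = inp' v"
    using agree_nb[OF ag] unfolding local_radius_def by simp
  ultimately show ?thesis unfolding local_out_def ct_cuts by simp
qed

text \<open>Each node reads the states of its edges from its own solution; by
  \<open>sol_agree\<close> the two ends of an edge read the same.\<close>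

lemma local_out_solution:
  obtains \<sigma> where "\<And>v. v \<in> V \<Longrightarrow>
    nok (inp v) (local_out enc g \<tau> L K nb inp v) (image_mset (es \<sigma> v) (mset_set (nb v)))"
proof
  define \<sigma> where "\<sigma> u z = sol nb inp ct u u z" for u z
  fix v assume v: "v \<in> V"
  have "es \<sigma> v z = es (sol nb inp ct v) v z" if "z \<in> nb v" for z
    using sol_agree[OF that] unfolding es_def \<sigma>_def by simp
  then have e: "image_mset (es \<sigma> v) (mset_set (nb v)) = image_mset (es (sol nb inp ct v) v) (mset_set (nb v))"
    by (intro image_mset_cong) simp
  show "nok (inp v) (local_out enc g \<tau> L K nb inp v) (image_mset (es \<sigma> v) (mset_set (nb v)))"
    unfolding e local_out_def ct_cuts[symmetric] using sol_ok[OF v] unfolding ok_def by (rule someI_ex)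
qed

end

section \<open>Unfolding labelled trees\<close>

datatype 'a unrolled = Unf 'a "'a unrolled multiset"

primrec trunc :: "nat \<Rightarrow> 'a unrolled \<Rightarrow> 'a unrolled" where
  "trunc 0 t = (case t of Unf l M \<Rightarrow> Unf l {#})"
| "trunc (Suc d) t = (case t of Unf l M \<Rightarrow> Unf l (image_mset (trunc d) M))"

text \<open>\<open>p\<close> is the neighbour from which \<open>v\<close> was entered. The call with
  \<open>p = v\<close> unfolds at a root, since no node is its own neighbour.\<close>

primrec unf :: "nat \<Rightarrow> ('v \<Rightarrow> 'v set) \<Rightarrow> ('v \<Rightarrow> 'a) \<Rightarrow> 'v \<Rightarrow> 'v \<Rightarrow> 'a unrolled" where
  "unf 0 nb lab v p = Unf (lab v) {#}"
| "unf (Suc d) nb lab v p = Unf (lab v) (image_mset (\<lambda>z. unf d nb lab z v) (mset_set (nb v - {p})))"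

lemma trunc_trunc: "d \<le> k \<Longrightarrow> trunc d (trunc k t) = trunc d t"
proof (induction d arbitrary: k t)
  case 0
  then show ?case by (cases k; cases t) auto
next
  case (Suc d)
  then obtain k' where "k = Suc k'" "d \<le> k'" using Suc_le_D by blast
  then show ?case using Suc.IH by (cases t) (auto simp: multiset.map_comp intro!: image_mset_cong)
qed

lemma trunc_unf: "d \<le> k \<Longrightarrow> trunc d (unf k nb lab v p) = unf d nb lab v p"
proof (induction d arbitrary: k v p)
  case 0
  then show ?case by (cases k) auto
next
  case (Suc d)
  then obtain k' where "k = Suc k'" "d \<le> k'" using Suc_le_D by blast
  then show ?case using Suc.IH by (auto simp: multiset.map_comp intro!: image_mset_cong)
qed

section \<open>Equal unfoldings and isomorphic balls\<close>

primrec rball :: "('v \<Rightarrow> 'v set) \<Rightarrow> nat \<Rightarrow> 'v \<Rightarrow> 'v \<Rightarrow> 'v set" where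
  "rball nb 0 v p = {v}"
| "rball nb (Suc d) v p = insert v (\<Union>z\<in>nb v - {p}. rball nb d z v)"

lemma rball_self [simp]: "v \<in> rball nb d v p"
  by (cases d) auto

lemma rball_step:
  assumes "u \<in> rball nb k v p" "w \<in> nb u"
  shows "w \<in> rball nb (Suc k) v p \<or> u = v \<and> w = p"
  using assms(1)
proof (induction k arbitrary: v p)
  case 0
  then show ?case using assms(2) by auto
next
  case (Suc k)
  consider "u = v" | z where "z \<in> nb v - {p}" "u \<in> rball nb k z v" using Suc.prems by auto
  then show ?case
  proof cases
    case 1
    show ?thesis
    proof (cases "w = p")
      case False
      then have "w \<in> (\<Union>z\<in>nb v - {p}. rball nb (Suc k) z v)"
        using 1 assms(2) rball_self[of w nb "Suc k" v] by blast
      then show ?thesis unfolding rball.simps(2)[of nb "Suc k" v p] by blast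
    qed (use 1 in simp)
  next
    case 2
    then have "w \<in> rball nb (Suc k) z v \<or> u = z \<and> w = v" using Suc.IH by blast
    then show ?thesis using 2(1) unfolding rball.simps(2)[of nb "Suc k" v p] by blast
  qed
qed

lemma rball_mono: "rball nb k v p \<subseteq> rball nb (Suc k) v p"
proof (induction k arbitrary: v p)
  case (Suc k)
  then show ?case unfolding rball.simps(2)[of nb "Suc k" v p] rball.simps(2)[of nb k v p] by blast
qed simp

lemma ball_rball: assumes "v \<notin> nb v" shows "ball nb k v = rball nb k v v"
proof (rule subset_antisym)
  show "ball nb k v \<subseteq> rball nb k v v"
  proof (induction k)
    case (Suc k)
    show ?case
    proof
      fix w assume "w \<in> ball nb (Suc k) v"
      then consider "w \<in> ball nb k v" | u where "u \<in> ball nb k v" "w \<in> nb u" by auto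
      then show "w \<in> rball nb (Suc k) v v"
      proof cases
        case 1
        then show ?thesis using Suc.IH rball_mono[of nb k v v] by blast
      next
        case 2
        then have "u \<in> rball nb k v v" using Suc.IH by blast
        from rball_step[OF this 2(2)] show ?thesis by auto
      qed
    qed
  qed simp
  have "rball nb k v p \<subseteq> ball nb k v" for p v
  proof (induction k arbitrary: v p)
    case (Suc k)
    then show ?case unfolding ball_Suc_left by auto
  qed simp
  then show "rball nb k v v \<subseteq> ball nb k v" .
qed

lemma (in utree) rball_branch: "v \<in> nb p \<Longrightarrow> rball nb k v p \<subseteq> branch nb p v"
proof (induction k arbitrary: v p)
  case (Suc k)
  have "rball nb k z v \<subseteq> branch nb v z" if "z \<in> nb v - {p}" for z using Suc.IH that by blast
  then show ?case unfolding rball.simps branch_unfold[of nb p v] by blast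
qed simp

lemma image_mset_eq_bij:
  assumes "finite A" "finite B" "image_mset f (mset_set A) = image_mset g (mset_set B)"
  shows "\<exists>h. bij_betw h A B \<and> (\<forall>a\<in>A. g (h a) = f a)"
  using assms
proof (induction A arbitrary: B rule: finite_induct)
  case empty
  then have "B = {}" using mset_set_empty_iff[of B] by auto
  then show ?case by (auto simp: bij_betw_def)
next
  case (insert a A)
  then have "f a \<in># image_mset g (mset_set B)" by (metis image_mset_add_mset mset_set.insert union_single_eq_member)
  then obtain b where b: "b \<in> B" "g b = f a" using insert.prems(1) by auto
  have "mset_set B = add_mset b (mset_set (B - {b}))"
    using b(1) insert.prems(1) by (simp add: mset_set.remove)
  then have "image_mset f (mset_set A) = image_mset g (mset_set (B - {b}))"
    using insert b(2) by simp
  then obtain h where h: "bij_betw h A (B - {b})" "\<forall>a\<in>A. g (h a) = f a"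
    using insert.IH[of "B - {b}"] insert.prems(1) by auto
  have "bij_betw (h(a := b)) A (B - {b})"
    using h(1) insert.hyps(2) by (auto intro: bij_betw_cong[THEN iffD1, rotated])
  then have "bij_betw (h(a := b)) (insert a A) (insert b (B - {b}))"
    using notIn_Un_bij_betw[of a A "h(a := b)" "B - {b}"] insert.hyps(2) by simp
  moreover have "insert b (B - {b}) = B" using b(1) by auto
  ultimately have "bij_betw (h(a := b)) (insert a A) B" by simp
  moreover have "\<forall>c\<in>insert a A. g ((h(a := b)) c) = f c" using h(2) b(2) by auto
  ultimately show ?case by blast
qed

definition ball_iso where
  "ball_iso S nb lab S' nb' lab' f \<longleftrightarrow> bij_betw f S S' \<and>
     (\<forall>u\<in>S. \<forall>w\<in>S. w \<in> nb u \<longleftrightarrow> f w \<in> nb' (f u)) \<and> (\<forall>u\<in>S. lab u = lab' (f u))"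

text \<open>In a tree the unfolding forgets only the names. Children with equal unfoldings are
  matched by a bijection, and the isomorphisms of their branches can be glued because distinct
  branches are disjoint and have no edges between them.\<close>

lemma unf_iso:
  assumes "utree V nb" "utree V' nb'"
    and "unf d nb lab v p = unf d nb' lab' v' p'"
    and "v \<in> nb p \<or> v = p" "v' \<in> nb' p' \<or> v' = p'"
  shows "\<exists>f. ball_iso (rball nb d v p) nb lab (rball nb' d v' p') nb' lab' f \<and> f v = v'"
  using assms(3-5)
proof (induction d arbitrary: v p v' p')
  case 0
  interpret T: utree V nb by fact
  interpret T': utree V' nb' by fact
  show ?case using 0 T.irrefl T'.irrefl
    by (intro exI[of _ "\<lambda>_. v'"]) (auto simp: ball_iso_def bij_betw_def)
next
  case (Suc d)
  interpret T: utree V nb by fact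
  interpret T': utree V' nb' by fact
  let ?A = "nb v - {p}" and ?B = "nb' v' - {p'}"
  have lab: "lab v = lab' v'" and
    "image_mset (\<lambda>z. unf d nb lab z v) (mset_set ?A) = image_mset (\<lambda>z. unf d nb' lab' z v') (mset_set ?B)"
    using Suc.prems(1) by auto
  then obtain h where h: "bij_betw h ?A ?B" "\<And>z. z \<in> ?A \<Longrightarrow> unf d nb' lab' (h z) v' = unf d nb lab z v"
    using image_mset_eq_bij[of ?A ?B "\<lambda>z. unf d nb lab z v" "\<lambda>z. unf d nb' lab' z v'"] by auto
  have hB: "h z \<in> ?B" if "z \<in> ?A" for z using h(1) that by (auto simp: bij_betw_def)
  have "\<forall>z. \<exists>f. z \<in> ?A \<longrightarrow> ball_iso (rball nb d z v) nb lab (rball nb' d (h z) v') nb' lab' f \<and> f z = h z"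
    using Suc.IH h(2) hB by (metis DiffD1)
  from choice[OF this] obtain F where
    F: "\<And>z. z \<in> ?A \<Longrightarrow> ball_iso (rball nb d z v) nb lab (rball nb' d (h z) v') nb' lab' (F z)"
      "\<And>z. z \<in> ?A \<Longrightarrow> F z z = h z" by blast
  define f where "f u = (if u = v then v' else F (THE z. z \<in> ?A \<and> u \<in> rball nb d z v) u)" for u
  have sub: "rball nb d z v \<subseteq> branch nb v z" if "z \<in> ?A" for z using T.rball_branch that by auto
  have sub': "rball nb' d z v' \<subseteq> branch nb' v' z" if "z \<in> ?B" for z using T'.rball_branch that by auto
  have nv: "u \<noteq> v" if "z \<in> ?A" "u \<in> rball nb d z v" for z u
    using sub[OF that(1)] that T.not_in_branch[of z v] by auto
  have nv': "u \<noteq> v'" if "z \<in> ?B" "u \<in> rball nb' d z v'" for z u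
    using sub'[OF that(1)] that T'.not_in_branch[of z v'] by auto
  have dis: "z = y" if "z \<in> ?A" "y \<in> ?A" "u \<in> branch nb v z" "u \<in> branch nb v y" for z y u
    using that T.branch_disjoint[of z v y] by blast
  have dis': "z = y" if "z \<in> ?B" "y \<in> ?B" "u \<in> branch nb' v' z" "u \<in> branch nb' v' y" for z y u
    using that T'.branch_disjoint[of z v' y] by blast
  have f: "f u = F z u" if "z \<in> ?A" "u \<in> rball nb d z v" for z u
  proof -
    have "(THE z. z \<in> ?A \<and> u \<in> rball nb d z v) = z"
      using that dis sub by (intro the_equality) blast+
    then show ?thesis using nv[OF that] unfolding f_def by simp
  qed
  have fv: "f v = v'" by (simp add: f_def)
  have fim: "f u \<in> rball nb' d (h z) v'" if "z \<in> ?A" "u \<in> rball nb d z v" for z u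
    using F(1)[OF that(1)] that f[OF that] unfolding ball_iso_def bij_betw_def by auto
  have fbr: "f u \<in> branch nb' v' (h z)" if "z \<in> ?A" "u \<in> rball nb d z v" for z u
    using fim[OF that] sub'[OF hB[OF that(1)]] by blast
  have inj: "inj_on f (rball nb (Suc d) v p)"
  proof (rule inj_onI)
    fix x y assume xy: "x \<in> rball nb (Suc d) v p" "y \<in> rball nb (Suc d) v p" "f x = f y"
    show "x = y"
    proof (cases "x = v \<or> y = v")
      case True
      then show ?thesis using xy fv fim nv' hB by fastforce
    next
      case False
      then obtain z w where zw: "z \<in> ?A" "x \<in> rball nb d z v" "w \<in> ?A" "y \<in> rball nb d w v"
        using xy by auto
      have "h z = h w" using dis'[OF hB[OF zw(1)] hB[OF zw(3)] fbr[OF zw(1,2)]] fbr[OF zw(3,4)] xy(3) by simp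
      then have "z = w" using h(1) zw by (auto simp: bij_betw_def inj_on_def)
      then show ?thesis using F(1)[OF zw(1)] zw f xy(3) unfolding ball_iso_def bij_betw_def inj_on_def by metis
    qed
  qed
  have im: "f ` rball nb (Suc d) v p = rball nb' (Suc d) v' p'"
  proof -
    have "f ` rball nb d z v = rball nb' d (h z) v'" if "z \<in> ?A" for z
      using F(1)[OF that] f[OF that] unfolding ball_iso_def bij_betw_def by (metis image_cong)
    then have "f ` (\<Union>z\<in>?A. rball nb d z v) = (\<Union>z\<in>?A. rball nb' d (h z) v')" by (simp add: image_UN)
    also have "\<dots> = (\<Union>z\<in>?B. rball nb' d z v')"
    proof -
      have "?B = h ` ?A" using h(1) by (simp add: bij_betw_def)
      then show ?thesis by simp
    qed
    finally show ?thesis using fv by simp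
  qed
  have adj_v: "u \<in> nb v \<longleftrightarrow> f u \<in> nb' v'" if zu: "z \<in> ?A" "u \<in> rball nb d z v" for z u
  proof -
    have "u \<in> nb v \<longleftrightarrow> u = z"
    proof
      assume "u \<in> nb v"
      then have "v \<in> nb u" using T.nb_sym by simp
      then show "u = z" using T.branch_closed[of u v z v] sub zu T.not_in_branch[of z v] by blast
    qed (use zu in auto)
    moreover have "f u \<in> nb' v' \<longleftrightarrow> f u = h z"
    proof
      assume "f u \<in> nb' v'"
      then have "v' \<in> nb' (f u)" using T'.nb_sym by simp
      then show "f u = h z" using T'.branch_closed[of "f u" v' "h z" v'] fbr[OF zu] hB[OF zu(1)] T'.not_in_branch[of "h z" v'] by blast
    qed (use hB[OF zu(1)] in auto)
    moreover have "f u = h z \<longleftrightarrow> u = z"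
    proof -
      have "f z = h z" using f[of z z] F(2) zu(1) by simp
      moreover have "z \<in> rball nb (Suc d) v p" "u \<in> rball nb (Suc d) v p"
        using zu rball_self[of z nb d v] unfolding rball.simps by blast+
      ultimately show ?thesis using inj unfolding inj_on_def by metis
    qed
    ultimately show ?thesis by simp
  qed
  have "w \<in> nb u \<longleftrightarrow> f w \<in> nb' (f u)" if uw: "u \<in> rball nb (Suc d) v p" "w \<in> rball nb (Suc d) v p" for u w
  proof -
    consider "u = v" "w = v" | z where "u = v" "z \<in> ?A" "w \<in> rball nb d z v"
      | z where "w = v" "z \<in> ?A" "u \<in> rball nb d z v"
      | z y where "z \<in> ?A" "y \<in> ?A" "u \<in> rball nb d z v" "w \<in> rball nb d y v" using uw by auto
    then show ?thesis
    proof cases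
      case 1
      then show ?thesis using T.irrefl T'.irrefl fv by auto
    next
      case 2
      then show ?thesis using adj_v[OF 2(2,3)] fv by simp
    next
      case 3
      have "v \<in> nb u \<longleftrightarrow> u \<in> nb v" by (rule iffI; rule T.nb_sym)
      moreover have "v' \<in> nb' (f u) \<longleftrightarrow> f u \<in> nb' v'" by (rule iffI; rule T'.nb_sym)
      ultimately show ?thesis using adj_v[OF 3(2,3)] unfolding 3(1) fv by (simp only:)
    next
      case 4
      show ?thesis
      proof (cases "z = y")
        case True
        then show ?thesis using F(1)[OF 4(1)] 4 f unfolding ball_iso_def by metis
      next
        case False
        have hy: "h z \<noteq> h y" using False h(1) 4 by (auto simp: bij_betw_def inj_on_def)
        have "w \<notin> nb u"
        proof
          assume "w \<in> nb u"
          then have "w \<in> branch nb v z \<or> w = v" using T.branch_closed[of u v z w] sub 4 by blast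
          then show False using dis[OF 4(1,2), of w] sub[OF 4(2)] 4 False nv by blast
        qed
        moreover have "f w \<notin> nb' (f u)"
        proof
          assume "f w \<in> nb' (f u)"
          then have "f w \<in> branch nb' v' (h z) \<or> f w = v'"
            using T'.branch_closed[of "f u" v' "h z" "f w"] fbr[OF 4(1,3)] by blast
          then show False using dis'[OF hB[OF 4(1)] hB[OF 4(2)], of "f w"] fbr[OF 4(2,4)] hy
              nv'[OF hB[OF 4(2)] fim[OF 4(2,4)]] by blast
        qed
        ultimately show ?thesis by simp
      qed
    qed
  qed
  moreover have "lab u = lab' (f u)" if uS: "u \<in> rball nb (Suc d) v p" for u
  proof (cases "u = v")
    case False
    then obtain z where "z \<in> ?A" "u \<in> rball nb d z v" using uS by auto
    then show ?thesis using F(1) f unfolding ball_iso_def by metis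
  qed (use lab fv in simp)
  ultimately have "ball_iso (rball nb (Suc d) v p) nb lab (rball nb' (Suc d) v' p') nb' lab' f"
    using inj im unfolding ball_iso_def bij_betw_def by blast
  then show ?case using fv by blast
qed

text \<open>Depth \<open>Suc d\<close> of a state is fixed by depth \<open>d\<close> of the states
  arriving at its node, so conditions that involve one node at a time already force the true
  unfolding.\<close>

lemma (in utree) consistent_unf:
  assumes c: "\<And>v z. v \<in> V \<Longrightarrow> z \<in> nb v \<Longrightarrow>
     \<sigma> v z = trunc r (Unf (lab v) (image_mset (\<lambda>u. \<sigma> u v) (mset_set (nb v - {z}))))"
    and "v \<in> V" "z \<in> nb v"
  shows "\<sigma> v z = unf r nb lab v z"
proof -
  have "d \<le> r \<Longrightarrow> v \<in> V \<Longrightarrow> z \<in> nb v \<Longrightarrow> trunc d (\<sigma> v z) = unf d nb lab v z" for d v z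
  proof (induction d arbitrary: v z)
    case 0
    have "trunc 0 (\<sigma> v z) = trunc 0 (Unf (lab v) (image_mset (\<lambda>u. \<sigma> u v) (mset_set (nb v - {z}))))"
      by (subst c[OF 0(2,3)]) (rule trunc_trunc[OF le0])
    then show ?case by simp
  next
    case (Suc d)
    have "trunc (Suc d) (\<sigma> v z) = trunc (Suc d) (Unf (lab v) (image_mset (\<lambda>u. \<sigma> u v) (mset_set (nb v - {z}))))"
      by (subst c[OF Suc.prems(2,3)]) (rule trunc_trunc[OF Suc.prems(1)])
    also have "\<dots> = Unf (lab v) (image_mset (\<lambda>u. trunc d (\<sigma> u v)) (mset_set (nb v - {z})))"
      by (simp add: multiset.map_comp o_def)
    also have "image_mset (\<lambda>u. trunc d (\<sigma> u v)) (mset_set (nb v - {z}))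
        = image_mset (\<lambda>u. unf d nb lab u v) (mset_set (nb v - {z}))"
      using Suc nb_sub nb_sym by (intro image_mset_cong) (auto simp: subset_iff)
    finally show ?case by simp
  qed
  from this[of r v z] have "trunc r (\<sigma> v z) = unf r nb lab v z" using assms by simp
  moreover have "trunc r (\<sigma> v z) = \<sigma> v z" using c[OF assms(2,3)] trunc_trunc[of r r] by simp
  ultimately show ?thesis by simp
qed

section \<open>Trees as pair digraphs\<close>

definition nbr :: "'v pair_pre_digraph \<Rightarrow> 'v \<Rightarrow> 'v set" where
  "nbr T v = {u. (v, u) \<in> parcs T}"

lemma nbr_iff: "u \<in> nbr T v \<longleftrightarrow> (v, u) \<in> parcs T"
  by (simp add: nbr_def)

definition digraph_of :: "'v set \<Rightarrow> ('v \<Rightarrow> 'v set) \<Rightarrow> 'v pair_pre_digraph" where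
  "digraph_of V nb = \<lparr>pverts = V, parcs = {(u, v). v \<in> nb u}\<rparr>"

lemma nbr_digraph_of [simp]: "nbr (digraph_of V nb) = nb" "pverts (digraph_of V nb) = V"
  by (auto simp: nbr_def digraph_of_def)

lemma awalk_iff:
  "pre_digraph.awalk (with_proj T) u p v \<longleftrightarrow> u \<in> pverts T \<and> set p \<subseteq> parcs T \<and> pcas u p v"
  by (simp add: pre_digraph.awalk_def cas_with_proj_eq)

text \<open>A connection between two neighbours of \<open>y\<close> off \<open>y\<close> contains a
  path, which the two edges at \<open>y\<close> close to a cycle of length at least 3.\<close>

lemma is_tree_utree:
  assumes "is_tree T" shows "utree (pverts T) (nbr T)"
proof -
  have pg: "pair_graph T" and con: "Digraph_Component.connected (with_proj T)"
    and nocyc: "\<And>p. \<lbrakk>pre_digraph.cycle (with_proj T) p; 3 \<le> length p\<rbrakk> \<Longrightarrow> False"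
    using assms unfolding is_tree_def by auto
  interpret pair_graph T by fact
  have sym: "(u, v) \<in> parcs T \<Longrightarrow> (v, u) \<in> parcs T" for u v
    using pair_sym_arcs unfolding symmetric_def by (auto simp: sym_def)
  show ?thesis
  proof
    show "finite (pverts T)" by (rule pair_finite_verts)
    show "nbr T v \<subseteq> pverts T" for v using in_arcsD2 unfolding nbr_def by blast
    show "v \<notin> nbr T v" for v using no_loops' unfolding nbr_def by blast
    show "u \<in> nbr T v \<Longrightarrow> v \<in> nbr T u" for u v using sym unfolding nbr_def by blast
    have ms: "parcs (mk_symmetric (with_proj T)) \<subseteq> edge_rel (nbr T)"
      using sym unfolding mk_symmetric_def edge_rel_def nbr_def by auto
    have sc: "strongly_connected (with_proj (mk_symmetric (with_proj T)))"
      using con unfolding Digraph_Component.connected_def .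
    have pv: "pverts (mk_symmetric (with_proj T)) = pverts T" unfolding mk_symmetric_def by simp
    show "pverts T \<noteq> {}" using sc pv unfolding strongly_connected_def by simp
    show "(u, v) \<in> (edge_rel (nbr T))\<^sup>*" if "u \<in> pverts T" "v \<in> pverts T" for u v
    proof -
      have "(u, v) \<in> rtrancl_on (pverts T) (parcs (mk_symmetric (with_proj T)))"
        using sc that pv unfolding strongly_connected_def reachable_def by simp
      then show ?thesis
        by (induction rule: rtrancl_on_induct) (use ms in \<open>auto intro: rtrancl_into_rtrancl\<close>)
    qed
    fix y z z' assume z: "z \<in> nbr T y" "z' \<in> nbr T y" "z \<noteq> z'"
    show "(z, z') \<notin> {(a, b). b \<in> nbr T a \<and> a \<noteq> y \<and> b \<noteq> y}\<^sup>*"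
    proof
      assume "(z, z') \<in> {(a, b). b \<in> nbr T a \<and> a \<noteq> y \<and> b \<noteq> y}\<^sup>*"
      then have "\<exists>p. awalk z p z' \<and> y \<notin> set (pawalk_verts z p)"
      proof (induction rule: converse_rtrancl_induct)
        case base
        have "awalk z' [] z'" using z in_arcsD2 unfolding awalk_Nil_iff nbr_def by blast
        moreover have "y \<noteq> z'" using z no_loops' unfolding nbr_def by blast
        ultimately show ?case by (intro exI[of _ "[]"]) simp
      next
        case (step a b)
        then obtain p where "awalk b p z'" "y \<notin> set (pawalk_verts b p)" by blast
        then show ?case using step(1) by (intro exI[of _ "(a, b) # p"]) (auto simp: awalk_Cons_iff nbr_def)
      qed
      then obtain p where p: "awalk z p z'" "y \<notin> set (pawalk_verts z p)" by blast
      define q where "q = awalk_to_apath p"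
      have q: "apath z q z'" "set q \<subseteq> set p"
        using apath_awalk_to_apath[OF p(1)] awalk_to_apath_subset[OF p(1)] unfolding q_def by auto
      have qw: "awalk z q z'" "distinct (pawalk_verts z q)" using q(1) unfolding apath_def by auto
      have yq: "y \<notin> set (pawalk_verts z q)"
        using set_awalk_verts[OF qw(1)] set_awalk_verts[OF p(1)] p(2) q(2) by auto
      have ne: "q \<noteq> []" using qw(1) z(3) by (auto simp: awalk_Nil_iff)
      have zy: "(y, z) \<in> parcs T" "(z', y) \<in> parcs T" using z sym unfolding nbr_def by auto
      have "awalk z' [(z', y)] y" using zy(2) in_arcsD2[OF zy(2)] by (simp add: awalk_Cons_iff awalk_Nil_iff)
      then have aw: "awalk z (q @ [(z', y)]) y" by (rule awalk_appendI[OF qw(1)])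
      have "pawalk_verts z (q @ [(z', y)]) = pawalk_verts z q @ [y]"
        using awalk_verts_append[OF aw] by simp
      moreover have "awalk y ((y, z) # q @ [(z', y)]) y"
        unfolding awalk_Cons_iff[of y "(y, z)"] fst_conv snd_conv using aw zy(1) by blast
      ultimately have "cycle ((y, z) # q @ [(z', y)])"
        unfolding cycle_def using qw(2) yq by (intro exI[of _ y]) simp
      moreover have "3 \<le> length ((y, z) # q @ [(z', y)])" using ne by (cases q) auto
      ultimately show False using nocyc by blast
    qed
  qed
qed

lemma utree_pair_graph:
  assumes "utree V nb" shows "pair_graph (digraph_of V nb)"
proof -
  interpret utree V nb by fact
  have sub: "{(u, v). v \<in> nb u} \<subseteq> V \<times> V" using nb_sub nb_V by blast
  show ?thesis
  proof
    show "finite (pverts (digraph_of V nb))" using fin by simp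
    show "finite (parcs (digraph_of V nb))"
      using finite_subset[OF sub] fin unfolding digraph_of_def by simp
    show "symmetric (with_proj (digraph_of V nb))"
      unfolding symmetric_def digraph_of_def using nb_sym by (auto simp: sym_def)
  next
    fix e assume "e \<in> parcs (digraph_of V nb)"
    then have "snd e \<in> nb (fst e)" unfolding digraph_of_def by auto
    then show "fst e \<in> pverts (digraph_of V nb)" "snd e \<in> pverts (digraph_of V nb)" "fst e \<noteq> snd e"
      using nb_V nb_sub irrefl[of "fst e"] by auto
  qed
qed

text \<open>Without its first and last edge a cycle of length at least 3 is a nonempty path that
  connects two distinct neighbours of its base point off that point.\<close>

lemma utree_is_tree:
  assumes "utree V nb" shows "is_tree (digraph_of V nb)"
proof -
  interpret utree V nb by fact
  let ?T = "digraph_of V nb"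
  interpret G: pair_graph ?T by (rule utree_pair_graph) fact
  have arcs: "parcs ?T = {(u, v). v \<in> nb u}" by (simp add: digraph_of_def)
  have ms: "mk_symmetric (with_proj ?T) = ?T"
    unfolding mk_symmetric_def using nb_sym by (auto simp: digraph_of_def)
  have "(u, v) \<in> rtrancl_on V (parcs ?T)" if "u \<in> V" "v \<in> V" for u v
    using conn[OF that]
  proof (induction rule: rtrancl_induct)
    case base
    then show ?case using that by simp
  next
    case (step a b)
    then have "b \<in> nb a" by (simp add: edge_rel_def)
    then have "(a, b) \<in> parcs ?T" "b \<in> V" using arcs nb_sub by auto
    then show ?case by (rule rtrancl_on_into_rtrancl_on[OF step.IH])
  qed
  then have con: "Digraph_Component.connected (with_proj ?T)"
    unfolding Digraph_Component.connected_def ms strongly_connected_def reachable_def using nonempty by simp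
  have "False" if c: "pre_digraph.cycle (with_proj ?T) p" "3 \<le> length p" for p
  proof -
    obtain u where u: "G.awalk u p u" "distinct (tl (pawalk_verts u p))" using c(1) unfolding G.cycle_def by blast
    obtain e p' where p': "p = e # p'" using c(2) by (cases p) auto
    obtain q e' where q: "p' = q @ [e']" using c(2) p' by (cases p' rule: rev_cases) auto
    obtain z where e: "e = (u, z)" "z \<in> nb u" and aw: "G.awalk z p' u"
      using u(1) arcs unfolding p' by (cases e) (auto simp: G.awalk_Cons_iff)
    have "G.awalk z q (last (pawalk_verts z q))" "G.awalk (last (pawalk_verts z q)) [e'] u"
      using aw unfolding q G.awalk_append_iff by blast+
    moreover from this(2) have "last (pawalk_verts z q) = fst e'" "snd e' = u" "e' \<in> parcs ?T"
      unfolding G.awalk_Cons_iff G.awalk_Nil_iff by blast+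
    ultimately obtain z' where z': "G.awalk z q z'" "e' = (z', u)" "u \<in> nb z'"
      using arcs by (metis (no_types, lifting) case_prodD mem_Collect_eq prod.collapse)
    have "pawalk_verts z p' = pawalk_verts z q @ [u]"
      using G.awalk_verts_append[of z q "[e']" u] aw z' unfolding q by simp
    then have d: "distinct (pawalk_verts z q)" "u \<notin> set (pawalk_verts z q)" using u(2) unfolding p' e by auto
    have ne: "q \<noteq> []" using c(2) p' q by auto
    have "G.apath z q z'" using z'(1) d(1) unfolding G.apath_def by simp
    then have "z \<noteq> z'" using G.apath_nonempty_ends ne by blast
    have "(z, z') \<in> away u"
      using z'(1) d(2)
    proof (induction q arbitrary: z)
      case Nil
      then show ?case by (simp add: G.awalk_Nil_iff)
    next
      case (Cons e q)
      obtain x where x: "e = (z, x)" "x \<in> nb z" "G.awalk x q z'"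
        using Cons.prems(1) arcs by (cases e) (auto simp: G.awalk_Cons_iff)
      have "x \<in> set (pawalk_verts x q)" using G.hd_in_awalk_verts(1)[OF x(3)] .
      then have "(z, x) \<in> {(a, b). b \<in> nb a \<and> a \<noteq> u \<and> b \<noteq> u}" using Cons.prems(2) x by auto
      moreover have "(x, z') \<in> away u" using Cons.IH[OF x(3)] Cons.prems(2) x(1) by simp
      ultimately show ?case by (rule converse_rtrancl_into_rtrancl)
    qed
    then show False using acyc[OF e(2) nb_sym[OF z'(3)] \<open>z \<noteq> z'\<close>] by simp
  qed
  then show ?thesis unfolding is_tree_def using G.pair_graph_axioms con by blast
qed

lemma degree_nbr: "degree T v = card (nbr T v)"
proof -
  have "out_arcs (with_proj T) v = Pair v ` nbr T v" by (auto simp: out_arcs_def nbr_def)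
  then show ?thesis unfolding out_degree_def by (simp add: card_image inj_on_def)
qed

section \<open>Distances and balls\<close>

lemma pcas_append: "pcas u (p @ q) v \<longleftrightarrow> (\<exists>w. pcas u p w \<and> pcas w q v)"
  by (induction p arbitrary: u) auto

lemma awalk_ball: "set p \<subseteq> parcs T \<Longrightarrow> pcas v p u \<Longrightarrow> u \<in> ball (nbr T) (length p) v"
proof (induction p arbitrary: v)
  case (Cons e p)
  then have "u \<in> ball (nbr T) (length p) (snd e)" "snd e \<in> nbr T v" by (auto simp: nbr_iff)
  then show ?case unfolding list.size add_0_right add_Suc_right ball_Suc_left by blast
qed simp

lemma ball_awalk: "u \<in> ball (nbr T) k v \<Longrightarrow> \<exists>p. set p \<subseteq> parcs T \<and> pcas v p u \<and> length p \<le> k"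
proof (induction k arbitrary: u)
  case 0
  then show ?case by (intro exI[of _ "[]"]) auto
next
  case (Suc k)
  show ?case
  proof (cases "u \<in> ball (nbr T) k v")
    case True
    then show ?thesis using Suc.IH le_SucI by blast
  next
    case False
    then obtain w where w: "w \<in> ball (nbr T) k v" "(w, u) \<in> parcs T" using Suc.prems by (auto simp: nbr_iff)
    obtain p where "set p \<subseteq> parcs T" "pcas v p w" "length p \<le> k" using Suc.IH[OF w(1)] by blast
    then show ?thesis using w(2) by (intro exI[of _ "p @ [(w, u)]"]) (auto simp: pcas_append)
  qed
qed

lemma gdist_le:
  assumes "v \<in> pverts T" shows "gdist T v u \<le> enat k \<longleftrightarrow> u \<in> ball (nbr T) k v"
proof
  assume le: "gdist T v u \<le> enat k"
  let ?A = "(\<lambda>p. enat (length p)) ` {p. pre_digraph.awalk (with_proj T) v p u}"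
  have "?A \<noteq> {}"
  proof
    assume "?A = {}"
    then have "gdist T v u = \<infinity>" unfolding gdist_def by (simp only: Inf_enat_def if_True simp_thms)
    then show False using le by simp
  qed
  then have "Inf ?A \<in> ?A" by (auto simp: Inf_enat_def intro: LeastI)
  then obtain p where "pre_digraph.awalk (with_proj T) v p u" "enat (length p) \<le> enat k"
    using le unfolding gdist_def by auto
  then have "u \<in> ball (nbr T) (length p) v" "length p \<le> k" using awalk_ball unfolding awalk_iff by auto
  then show "u \<in> ball (nbr T) k v" using ball_mono[of "length p" k "nbr T" v] by blast
next
  assume "u \<in> ball (nbr T) k v"
  then obtain p where p: "set p \<subseteq> parcs T" "pcas v p u" "length p \<le> k" using ball_awalk[of u T k v] by blast
  have "pre_digraph.awalk (with_proj T) v p u" unfolding awalk_iff using p assms by simp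
  then have "gdist T v u \<le> enat (length p)" unfolding gdist_def by (intro INF_lower) simp
  also have "\<dots> \<le> enat k" using p(3) by simp
  finally show "gdist T v u \<le> enat k" .
qed

lemma gdist_less:
  assumes "v \<in> pverts T" shows "gdist T v u < enat t \<longleftrightarrow> (\<exists>k<t. u \<in> ball (nbr T) k v)"
proof -
  have "gdist T v u < enat t \<longleftrightarrow> (\<exists>k<t. gdist T v u \<le> enat k)"
    by (cases "gdist T v u") (auto intro: le_less_trans)
  then show ?thesis using gdist_le[OF assms] by simp
qed

lemma nodes_within_ball:
  assumes "utree (pverts T) (nbr T)" "v \<in> pverts T"
  shows "nodes_within T k v = ball (nbr T) k v"
proof -
  interpret utree "pverts T" "nbr T" by fact
  have "ball (nbr T) k v \<subseteq> pverts T"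
    using nb_sub assms(2) by (induction k) auto
  then show ?thesis unfolding nodes_within_def gdist_le[OF assms(2)] by auto
qed

section \<open>Locally checkable labellings as edge problems\<close>

definition ball_ok :: "('i, 'o) lcl \<Rightarrow> 'v pair_pre_digraph \<Rightarrow> ('v \<Rightarrow> 'i) \<Rightarrow> ('v \<Rightarrow> 'o) \<Rightarrow> 'v \<Rightarrow> bool" where
  "ball_ok P T inp out v \<longleftrightarrow> out v \<in> out_labels P \<and>
     (\<exists>H\<in>constraints P. centred_iso (labelled_ball T inp out (radius P) v) H)"

text \<open>A node sees edge states of depth \<open>radius P\<close>, so its own unfolding has one
  level more. Equal unfoldings give isomorphic balls of radius \<open>radius P\<close>, so it does
  not matter in which tree the correct node is found.\<close>

definition allowed :: "('i, 'o) lcl \<Rightarrow> ('i \<times> 'o) unrolled set" where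
  "allowed P = {unf (Suc (radius P)) (nbr T) (\<lambda>u. (inp u, out u)) v v | (T :: nat pair_pre_digraph) inp out v.
     is_tree T \<and> v \<in> pverts T \<and> ball_ok P T inp out v}"

text \<open>
  The state of the edge from \<open>v\<close> to \<open>z\<close> is meant to be the unfolding at \<open>v\<close>, truncated at
  depth \<open>radius P\<close>, of the tree without the branch at \<open>z\<close>.
\<close>

definition lcl_nok :: "('i, 'o) lcl \<Rightarrow> 'i \<Rightarrow> 'o \<Rightarrow> (('i \<times> 'o) unrolled \<times> ('i \<times> 'o) unrolled) multiset \<Rightarrow> bool" where
  "lcl_nok P i out M \<longleftrightarrow>
     (\<forall>p\<in>#M. fst p = trunc (radius P) (Unf (i, out) (image_mset snd (M - {#p#})))) \<and>
     Unf (i, out) (image_mset snd M) \<in> allowed P"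

lemma centred_iso_trans:
  assumes "centred_iso H K" "centred_iso K L" shows "centred_iso H L"
proof -
  from assms(1) obtain f where f: "bij_betw f (pverts (cgraph H)) (pverts (cgraph K))"
    "\<forall>u\<in>pverts (cgraph H). \<forall>v\<in>pverts (cgraph H). (u, v) \<in> parcs (cgraph H) \<longleftrightarrow> (f u, f v) \<in> parcs (cgraph K)"
    "f (centre H) = centre K" "\<forall>u\<in>pverts (cgraph H). labels H u = labels K (f u)"
    unfolding centred_iso_def by blast
  from assms(2) obtain g where g: "bij_betw g (pverts (cgraph K)) (pverts (cgraph L))"
    "\<forall>u\<in>pverts (cgraph K). \<forall>v\<in>pverts (cgraph K). (u, v) \<in> parcs (cgraph K) \<longleftrightarrow> (g u, g v) \<in> parcs (cgraph L)"
    "g (centre K) = centre L" "\<forall>u\<in>pverts (cgraph K). labels K u = labels L (g u)"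
    unfolding centred_iso_def by blast
  have mem: "f u \<in> pverts (cgraph K)" if "u \<in> pverts (cgraph H)" for u using f(1) that by (auto simp: bij_betw_def)
  show ?thesis unfolding centred_iso_def
  proof (intro exI[of _ "g \<circ> f"] conjI)
    show "bij_betw (g \<circ> f) (pverts (cgraph H)) (pverts (cgraph L))" using f(1) g(1) by (rule bij_betw_trans)
  qed (use f g mem in auto)
qed

lemma unf_labelled_ball_iso:
  assumes T: "utree (pverts T) (nbr T)" "v \<in> pverts T"
    and T': "utree (pverts T') (nbr T')" "v' \<in> pverts T'"
    and eq: "unf r (nbr T) (\<lambda>u. (inp u, out u)) v v = unf r (nbr T') (\<lambda>u. (inp' u, out' u)) v' v'"
  shows "centred_iso (labelled_ball T inp out r v) (labelled_ball T' inp' out' r v')"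
proof -
  interpret T: utree "pverts T" "nbr T" by fact
  interpret T': utree "pverts T'" "nbr T'" by fact
  obtain f where f: "ball_iso (rball (nbr T) r v v) (nbr T) (\<lambda>u. (inp u, out u))
      (rball (nbr T') r v' v') (nbr T') (\<lambda>u. (inp' u, out' u)) f" "f v = v'"
    using unf_iso[OF T(1) T'(1) eq] by blast
  have b: "nodes_within T r v = rball (nbr T) r v v" "nodes_within T' r v' = rball (nbr T') r v' v'"
    using nodes_within_ball[OF T] nodes_within_ball[OF T'] ball_rball T.irrefl T'.irrefl by metis+
  have fm: "f u \<in> rball (nbr T') r v' v'" if "u \<in> rball (nbr T) r v v" for u
    using f(1) that unfolding ball_iso_def bij_betw_def by auto
  show ?thesis unfolding centred_iso_def labelled_ball_def b
    using f fm unfolding ball_iso_def by (intro exI[of _ f]) (auto simp: nbr_def)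
qed

text \<open>Consistency turns the states into unfoldings. The unfolding at each node is then that of
  a correct node of some tree, and the two balls are isomorphic.\<close>

lemma lcl_nok_valid:
  assumes T: "utree (pverts T) (nbr T)"
    and ok: "\<And>v. v \<in> pverts T \<Longrightarrow> lcl_nok P (inp v) (out v) (image_mset (es \<sigma> v) (mset_set (nbr T v)))"
  shows "valid_labelling P T inp out"
proof -
  interpret utree "pverts T" "nbr T" by fact
  let ?lab = "\<lambda>u. (inp u, out u)" and ?r = "radius P"
  have snd_es: "image_mset snd (image_mset (es \<sigma> v) M) = image_mset (\<lambda>u. \<sigma> u v) M" for v M
    by (simp add: multiset.map_comp o_def es_def)
  have c: "\<sigma> v z = trunc ?r (Unf (?lab v) (image_mset (\<lambda>u. \<sigma> u v) (mset_set (nbr T v - {z}))))"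
    if vz: "v \<in> pverts T" "z \<in> nbr T v" for v z
  proof -
    have mem: "es \<sigma> v z \<in># image_mset (es \<sigma> v) (mset_set (nbr T v))" using vz by simp
    have "image_mset (es \<sigma> v) (mset_set (nbr T v)) - {#es \<sigma> v z#} = image_mset (es \<sigma> v) (mset_set (nbr T v - {z}))"
      using vz(2) by (simp add: mset_set.remove)
    moreover have "fst (es \<sigma> v z) = trunc ?r (Unf (?lab v)
        (image_mset snd (image_mset (es \<sigma> v) (mset_set (nbr T v)) - {#es \<sigma> v z#})))"
      using ok[OF vz(1)] mem unfolding lcl_nok_def by blast
    ultimately have "fst (es \<sigma> v z) = trunc ?r (Unf (?lab v) (image_mset (\<lambda>u. \<sigma> u v) (mset_set (nbr T v - {z}))))"
      by (simp only: snd_es)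
    then show ?thesis by (simp add: es_def)
  qed
  have st: "\<sigma> z v = unf ?r (nbr T) ?lab z v" if "z \<in> nbr T v" for z v
    using consistent_unf[where \<sigma> = \<sigma> and lab = ?lab and r = ?r, OF c] that nb_sub nb_sym by blast
  show ?thesis unfolding valid_labelling_def
  proof
    fix v assume v: "v \<in> pverts T"
    have "Unf (?lab v) (image_mset (\<lambda>u. \<sigma> u v) (mset_set (nbr T v))) = unf (Suc ?r) (nbr T) ?lab v v"
      using irrefl[of v] st by (auto intro!: image_mset_cong)
    then have "unf (Suc ?r) (nbr T) ?lab v v \<in> allowed P"
      using ok[OF v] snd_es unfolding lcl_nok_def by metis
    then obtain T' :: "nat pair_pre_digraph" and inp' out' v' where T': "is_tree T'" "v' \<in> pverts T'" "ball_ok P T' inp' out' v'"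
      and eq: "unf (Suc ?r) (nbr T) ?lab v v = unf (Suc ?r) (nbr T') (\<lambda>u. (inp' u, out' u)) v' v'"
      unfolding allowed_def by blast
    have eq': "unf ?r (nbr T) ?lab v v = unf ?r (nbr T') (\<lambda>u. (inp' u, out' u)) v' v'"
      using arg_cong[OF eq, of "trunc ?r"] by (simp only: trunc_unf[of ?r "Suc ?r"] le_SucI order_refl)
    have "out v = out' v'" using eq by simp
    moreover have "centred_iso (labelled_ball T inp out ?r v) (labelled_ball T' inp' out' ?r v')"
      by (rule unf_labelled_ball_iso[OF T v is_tree_utree[OF T'(1)] T'(2) eq'])
    ultimately show "out v \<in> out_labels P \<and> (\<exists>H\<in>constraints P. centred_iso (labelled_ball T inp out ?r v) H)"
      using T'(3) centred_iso_trans unfolding ball_ok_def by metis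
  qed
qed

lemma valid_lcl_nok:
  fixes T :: "nat pair_pre_digraph"
  assumes T: "is_tree T" and val: "valid_labelling P T inp out" and v: "v \<in> pverts T"
  defines "\<sigma> \<equiv> unf (radius P) (nbr T) (\<lambda>u. (inp u, out u))"
  shows "lcl_nok P (inp v) (out v) (image_mset (es \<sigma> v) (mset_set (nbr T v)))"
proof -
  interpret utree "pverts T" "nbr T" by (rule is_tree_utree[OF T])
  let ?lab = "\<lambda>u. (inp u, out u)" and ?r = "radius P"
  have snd_es: "image_mset snd (image_mset (es \<sigma> v) M) = image_mset (\<lambda>u. \<sigma> u v) M" for M
    by (simp add: multiset.map_comp o_def es_def)
  have "fst p = trunc ?r (Unf (?lab v) (image_mset snd (image_mset (es \<sigma> v) (mset_set (nbr T v)) - {#p#})))"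
    if p: "p \<in># image_mset (es \<sigma> v) (mset_set (nbr T v))" for p
  proof -
    obtain z where z: "z \<in> nbr T v" "p = es \<sigma> v z" using p by auto
    have "image_mset (es \<sigma> v) (mset_set (nbr T v)) - {#p#} = image_mset (es \<sigma> v) (mset_set (nbr T v - {z}))"
      using z by (simp add: mset_set.remove)
    moreover have "Unf (?lab v) (image_mset (\<lambda>u. \<sigma> u v) (mset_set (nbr T v - {z}))) = unf (Suc ?r) (nbr T) ?lab v z"
      unfolding \<sigma>_def by simp
    ultimately show ?thesis using trunc_unf[of ?r "Suc ?r" "nbr T" ?lab v z] z(2) snd_es
      by (simp add: es_def \<sigma>_def del: unf.simps trunc.simps)
  qed
  moreover have "Unf (?lab v) (image_mset (\<lambda>u. \<sigma> u v) (mset_set (nbr T v))) = unf (Suc ?r) (nbr T) ?lab v v"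
    using irrefl[of v] unfolding \<sigma>_def by simp
  moreover have "unf (Suc ?r) (nbr T) ?lab v v \<in> allowed P"
    unfolding allowed_def using T v val unfolding valid_labelling_def ball_ok_def by blast
  ultimately show ?thesis unfolding lcl_nok_def snd_es by simp
qed

text \<open>A finite set containing all unfoldings of depth \<open>d\<close> under the degree bound;
  its finiteness makes types, letters and words finite.\<close>

primrec states :: "('i, 'o) lcl \<Rightarrow> nat \<Rightarrow> nat \<Rightarrow> ('i \<times> 'o) unrolled set" where
  "states P \<Delta> 0 = {Unf l {#} | l. l \<in> in_labels P \<times> out_labels P}"
| "states P \<Delta> (Suc d) = {Unf l (mset ts) | l ts. l \<in> in_labels P \<times> out_labels P \<and> set ts \<subseteq> states P \<Delta> d \<and> length ts \<le> \<Delta>}"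

lemma finite_states: assumes "is_lcl P" shows "finite (states P \<Delta> d)"
proof (induction d)
  case 0
  have "states P \<Delta> 0 = (\<lambda>l. Unf l {#}) ` (in_labels P \<times> out_labels P)" by auto
  then show ?case using assms unfolding is_lcl_def by simp
next
  case (Suc d)
  have "states P \<Delta> (Suc d) = (\<lambda>(l, ts). Unf l (mset ts)) `
      ((in_labels P \<times> out_labels P) \<times> {ts. set ts \<subseteq> states P \<Delta> d \<and> length ts \<le> \<Delta>})" by auto
  then show ?case using assms finite_lists_length_le[OF Suc.IH] unfolding is_lcl_def by simp
qed

lemma (in utree) unf_states:
  assumes deg: "\<And>v. v \<in> V \<Longrightarrow> card (nb v) \<le> \<Delta>"
    and lab: "\<And>v. v \<in> V \<Longrightarrow> lab v \<in> in_labels P \<times> out_labels P"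
  shows "v \<in> V \<Longrightarrow> unf d nb lab v p \<in> states P \<Delta> d"
proof (induction d arbitrary: v p)
  case (Suc d)
  obtain zs where zs: "distinct zs" "set zs = nb v - {p}" using finite_distinct_list[of "nb v - {p}"] by auto
  have "length zs \<le> \<Delta>"
    using deg[OF Suc.prems] distinct_card[OF zs(1)] zs(2) card_Diff1_le[of "nb v" p] by simp
  moreover have "set (map (\<lambda>z. unf d nb lab z v) zs) \<subseteq> states P \<Delta> d" using Suc.IH zs(2) nb_sub by (auto simp: subset_iff)
  moreover have "mset_set (nb v - {p}) = mset zs" using zs mset_set_set by metis
  ultimately have "length (map (\<lambda>z. unf d nb lab z v) zs) \<le> \<Delta>"
    "set (map (\<lambda>z. unf d nb lab z v) zs) \<subseteq> states P \<Delta> d"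
    "unf (Suc d) nb lab v p = Unf (lab v) (mset (map (\<lambda>z. unf d nb lab z v) zs))" by simp_all
  then show ?case unfolding states.simps using lab[OF Suc.prems]
    by (intro CollectI exI[of _ "lab v"] exI[of _ "map (\<lambda>z. unf d nb lab z v) zs"] conjI)
next
  case 0
  then show ?case using lab[of v] by (cases "lab v") auto
qed

section \<open>Views\<close>

text \<open>The tree carried over to its identifiers, so that trees with different node names can be
  compared by \<open>agree\<close>.\<close>

definition img_nb :: "('v \<Rightarrow> 'w) \<Rightarrow> ('v \<Rightarrow> 'v set) \<Rightarrow> 'w \<Rightarrow> 'w set" where
  "img_nb f nb a = {f w | v w. w \<in> nb v \<and> f v = a}"

lemma (in utree) img_nb: assumes "inj_on f V" "v \<in> V" shows "img_nb f nb (f v) = f ` nb v"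
  unfolding img_nb_def using assms nb_V by (auto simp: inj_on_def)

lemma (in utree) utree_img:
  assumes inj: "inj_on f V" shows "utree (f ` V) (img_nb f nb)"
proof
  show "finite (f ` V)" "f ` V \<noteq> {}" using fin nonempty by auto
  show "img_nb f nb a \<subseteq> f ` V" for a unfolding img_nb_def using nb_sub by blast
  show "a \<notin> img_nb f nb a" for a
    unfolding img_nb_def using inj nb_V nb_sub irrefl by (auto simp: inj_on_def subset_iff) metis
  show "b \<in> img_nb f nb a \<Longrightarrow> a \<in> img_nb f nb b" for a b unfolding img_nb_def using nb_sym by blast
  show "(a, b) \<in> (edge_rel (img_nb f nb))\<^sup>*" if ab: "a \<in> f ` V" "b \<in> f ` V" for a b
  proof -
    obtain u v where uv: "a = f u" "b = f v" "u \<in> V" "v \<in> V" using ab by auto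
    have "(u, v) \<in> (edge_rel nb)\<^sup>*" using conn uv by blast
    then have "(f u, f v) \<in> (edge_rel (img_nb f nb))\<^sup>*"
    proof induction
      case (step y z)
      then have "(f y, f z) \<in> edge_rel (img_nb f nb)" unfolding edge_rel_def img_nb_def by blast
      then show ?case using step.IH by simp
    qed simp
    then show ?thesis using uv by simp
  qed
  fix b c c' assume c: "c \<in> img_nb f nb b" "c' \<in> img_nb f nb b" "c \<noteq> c'"
  obtain y z where yz: "b = f y" "c = f z" "z \<in> nb y" using c(1) unfolding img_nb_def by blast
  have yV: "y \<in> V" using yz nb_V by blast
  obtain z' where z': "c' = f z'" "z' \<in> nb y" using c(2) img_nb[OF inj yV] yz(1) by auto
  show "(c, c') \<notin> {(a, d). d \<in> img_nb f nb a \<and> a \<noteq> b \<and> d \<noteq> b}\<^sup>*"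
  proof
    assume "(c, c') \<in> {(a, d). d \<in> img_nb f nb a \<and> a \<noteq> b \<and> d \<noteq> b}\<^sup>*"
    then have "\<exists>w\<in>V. c' = f w \<and> (z, w) \<in> away y"
    proof (induction rule: rtrancl_induct)
      case base
      then show ?case using yz nb_sub by blast
    next
      case (step a d)
      then obtain w where w: "w \<in> V" "a = f w" "(z, w) \<in> away y" by blast
      have "d \<in> f ` nb w" using step(2) img_nb[OF inj w(1)] w(2) by auto
      then obtain x where x: "x \<in> nb w" "d = f x" by blast
      have "w \<noteq> y" "x \<noteq> y" using step(2) w(2) x(2) yz(1) by auto
      then have "(z, x) \<in> away y" using w(3) x(1) by (auto intro: rtrancl_into_rtrancl)
      then show ?case using x nb_sub by blast
    qed
    then obtain w where "w \<in> V" "c' = f w" "(z, w) \<in> away y" by blast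
    moreover have "w = z'" using calculation z' inj nb_sub unfolding inj_on_def by blast
    moreover have "z \<noteq> z'" using c(3) yz z' by auto
    ultimately show False using acyc[OF yz(3) z'(2)] by simp
  qed
qed

lemma (in utree) ball_img:
  assumes inj: "inj_on f V" and v: "v \<in> V"
  shows "ball (img_nb f nb) k (f v) = f ` ball nb k v"
proof (induction k)
  case (Suc k)
  have "ball nb k v \<subseteq> V" using nb_sub v by (induction k) auto
  then have "(\<Union>u\<in>ball nb k v. img_nb f nb (f u)) = (\<Union>u\<in>ball nb k v. f ` nb u)"
    using img_nb[OF inj] by (intro SUP_cong) auto
  then show ?case using Suc.IH by (simp add: image_Un image_UN)
qed simp

definition img_inp :: "'v set \<Rightarrow> ('v \<Rightarrow> 'w) \<Rightarrow> ('v \<Rightarrow> 'i) \<Rightarrow> 'w \<Rightarrow> 'i" where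
  "img_inp V f inp a = inp (inv_into V f a)"

lemma img_inp: "inj_on f V \<Longrightarrow> v \<in> V \<Longrightarrow> img_inp V f inp (f v) = inp v"
  by (simp add: img_inp_def)

lemma view_arcs:
  assumes T: "utree (pverts T) (nbr T)" and inj: "inj_on ident (pverts T)" and v: "v \<in> pverts T"
  shows "(a, b) \<in> parcs (view_graph (view_of T ident inp t v)) \<longleftrightarrow>
     b \<in> img_nb ident (nbr T) a \<and> (\<exists>k<t. a \<in> ball (img_nb ident (nbr T)) k (ident v) \<or>
       b \<in> ball (img_nb ident (nbr T)) k (ident v))"
proof -
  interpret utree "pverts T" "nbr T" by fact
  have bV: "ball (nbr T) k v \<subseteq> pverts T" for k using nb_sub v by (induction k) auto
  have mem: "ident x \<in> ball (img_nb ident (nbr T)) k (ident v) \<longleftrightarrow> x \<in> ball (nbr T) k v" if "x \<in> pverts T" for x k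
    unfolding ball_img[OF inj v] using inj_on_image_mem_iff[OF inj that bV] .
  have xy: "x \<in> pverts T" "y \<in> pverts T" if "y \<in> nbr T x" for x y using that nb_V nb_sub by blast+
  have "(a, b) \<in> parcs (view_graph (view_of T ident inp t v)) \<longleftrightarrow>
    (\<exists>x y. a = ident x \<and> b = ident y \<and> y \<in> nbr T x \<and> (\<exists>k<t. x \<in> ball (nbr T) k v \<or> y \<in> ball (nbr T) k v))"
    unfolding view_of_def by (auto simp: gdist_less[OF v] nbr_def)
  also have "\<dots> \<longleftrightarrow> (\<exists>x y. a = ident x \<and> b = ident y \<and> y \<in> nbr T x \<and>
     (\<exists>k<t. ident x \<in> ball (img_nb ident (nbr T)) k (ident v) \<or> ident y \<in> ball (img_nb ident (nbr T)) k (ident v)))"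
    using mem xy by (metis (no_types, lifting))
  also have "\<dots> \<longleftrightarrow> b \<in> img_nb ident (nbr T) a \<and> (\<exists>k<t. a \<in> ball (img_nb ident (nbr T)) k (ident v) \<or>
       b \<in> ball (img_nb ident (nbr T)) k (ident v))"
    unfolding img_nb_def by blast
  finally show ?thesis .
qed

text \<open>A view shows the edges with an end at distance below \<open>t\<close>, the distance
  being measured in its own tree. That both trees measure the same distances comes out by induction
  on the radius.\<close>

lemma view_eq_agree:
  assumes T: "utree (pverts T) (nbr T)" "inj_on ident (pverts T)" "v \<in> pverts T"
    and T': "utree (pverts T') (nbr T')" "inj_on ident' (pverts T')" "v' \<in> pverts T'"
    and eq: "view_of T ident inp t v = view_of T' ident' inp' t v'"
  shows "ident v = ident' v'" "card (pverts T) = card (pverts T')"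
    "agree t (ident v) (img_nb ident (nbr T)) (img_inp (pverts T) ident inp)
       (img_nb ident' (nbr T')) (img_inp (pverts T') ident' inp')"
proof -
  interpret T: utree "pverts T" "nbr T" by fact
  interpret T': utree "pverts T'" "nbr T'" by fact
  show c: "ident v = ident' v'" and "card (pverts T) = card (pverts T')"
    using eq unfolding view_of_def by auto
  let ?n = "img_nb ident (nbr T)" and ?n' = "img_nb ident' (nbr T')"
  let ?i = "img_inp (pverts T) ident inp" and ?i' = "img_inp (pverts T') ident' inp'"
  have arcs: "b \<in> ?n a \<and> (\<exists>k<t. a \<in> ball ?n k (ident v) \<or> b \<in> ball ?n k (ident v)) \<longleftrightarrow>
     b \<in> ?n' a \<and> (\<exists>k<t. a \<in> ball ?n' k (ident v) \<or> b \<in> ball ?n' k (ident v))" for a b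
    using view_arcs[OF T, of a b inp t] view_arcs[OF T', of a b inp' t] eq c by simp
  have nb: "?n a = ?n' a" if "a \<in> ball ?n k (ident v)" "a \<in> ball ?n' k (ident v)" "k < t" for a k
    using arcs[of _ a] that by blast
  have ball: "k \<le> t \<Longrightarrow> ball ?n k (ident v) = ball ?n' k (ident v)" for k
  proof (induction k)
    case (Suc k)
    then have "(\<Union>u\<in>ball ?n k (ident v). ?n u) = (\<Union>u\<in>ball ?n k (ident v). ?n' u)"
      using nb[of _ k] by (intro SUP_cong) auto
    then show ?case using Suc by simp
  qed simp
  have info: "(\<lambda>u. (ident u, degree T u, inp u)) ` nodes_within T t v
      = (\<lambda>u. (ident' u, degree T' u, inp' u)) ` nodes_within T' t v'"
    using eq unfolding view_of_def by simp
  show "agree t (ident v) ?n ?i ?n' ?i'"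
    unfolding agree_def
  proof (intro allI impI ballI conjI)
    fix k a assume k: "k < t" and a: "a \<in> ball ?n k (ident v)"
    then have "a \<in> ball ?n' k (ident v)" using ball[of k] by simp
    then show "?n a = ?n' a" by (rule nb[OF a _ k])
    have "a \<in> ball ?n t (ident v)" using a ball_mono[of k t ?n "ident v"] k by auto
    then obtain u where u: "u \<in> ball (nbr T) t v" "a = ident u" unfolding T.ball_img[OF T(2,3)] by blast
    then have uw: "u \<in> nodes_within T t v" using nodes_within_ball[OF T(1,3)] by simp
    then have "(ident u, degree T u, inp u) \<in> (\<lambda>u. (ident' u, degree T' u, inp' u)) ` nodes_within T' t v'"
      unfolding info[symmetric] by blast
    then obtain u' where u': "u' \<in> nodes_within T' t v'" "ident u = ident' u'" "inp u = inp' u'" by auto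
    have "u \<in> pverts T" "u' \<in> pverts T'" using uw u'(1) unfolding nodes_within_def by auto
    then have "?i a = inp u" "?i' a = inp' u'"
      using img_inp[OF T(2)] img_inp[OF T'(2)] u(2) u'(2) by metis+
    then show "?i a = ?i' a" using u'(3) by simp
  qed
qed

section \<open>Rooted trees as terms\<close>

datatype 'i rt = Rt (rid: nat) 'i "'i rt list"

primrec ids :: "'i rt \<Rightarrow> nat list" where
  "ids (Rt x i ts) = x # concat (map ids ts)"

primrec arcs :: "'i rt \<Rightarrow> (nat \<times> nat) set" where
  "arcs (Rt x i ts) = \<Union>(set (map (\<lambda>t. insert (x, rid t) (arcs t)) ts))"

primrec labs :: "'i rt \<Rightarrow> (nat \<times> 'i) set" where
  "labs (Rt x i ts) = insert (x, i) (\<Union>(set (map labs ts)))"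

definition rnb :: "'i rt \<Rightarrow> nat \<Rightarrow> nat set" where
  "rnb t u = {v. (u, v) \<in> arcs t \<or> (v, u) \<in> arcs t}"

definition rinp :: "'i rt \<Rightarrow> nat \<Rightarrow> 'i" where
  "rinp t u = (THE i. (u, i) \<in> labs t)"

section \<open>Gluing two trees by an edge\<close>

definition join :: "('v \<Rightarrow> 'v set) \<Rightarrow> ('v \<Rightarrow> 'v set) \<Rightarrow> 'v \<Rightarrow> 'v \<Rightarrow> 'v \<Rightarrow> 'v set" where
  "join nb nb' a b u = nb u \<union> nb' u \<union> (if u = a then {b} else {}) \<union> (if u = b then {a} else {})"

lemma join_commute: "join nb nb' a b = join nb' nb b a"
  unfolding join_def by auto

text \<open>A walk off \<open>y\<close> can leave \<open>V\<close> only over the edge between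
  \<open>a\<close> and \<open>b\<close> and can come back only to \<open>a\<close>. While it is in
  \<open>V'\<close>, the invariant remembers that \<open>a\<close> was reached off \<open>y\<close>;
  so inside \<open>V\<close> it connects no more than the first tree does.\<close>

lemma join_acyclic:
  assumes T: "utree V nb" "utree V' nb'" and dis: "V \<inter> V' = {}" and a: "a \<in> V" and b: "b \<in> V'"
    and y: "y \<in> V" and z: "z \<in> join nb nb' a b y" "z' \<in> join nb nb' a b y" "z \<noteq> z'"
  shows "(z, z') \<notin> {(c, d). d \<in> join nb nb' a b c \<and> c \<noteq> y \<and> d \<noteq> y}\<^sup>*"
proof -
  interpret T: utree V nb by fact
  interpret T': utree V' nb' by fact
  let ?J = "join nb nb' a b" and ?R = "{(c, d). d \<in> join nb nb' a b c \<and> c \<noteq> y \<and> d \<noteq> y}"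
  have out: "nb' c = {}" if "c \<in> V" for c using T'.nb_V[of _ c] dis that by blast
  have out': "nb c = {}" if "c \<in> V'" for c using T.nb_V[of _ c] dis that by blast
  have inv: "w \<in> V \<and> (x, w) \<in> T.away y \<or> w \<in> V' \<and> y \<noteq> a \<and> (x, a) \<in> T.away y"
    if x: "x \<in> nb y" and "(x, w) \<in> ?R\<^sup>*" for x w
    using that(2)
  proof induction
    case base
    then show ?case using x T.nb_sub by blast
  next
    case (step w u)
    then have wu: "u \<in> ?J w" "w \<noteq> y" "u \<noteq> y" by auto
    from step.IH show ?case
    proof (elim disjE conjE)
      assume w: "w \<in> V" "(x, w) \<in> T.away y"
      then have "w \<noteq> b" using b dis by blast
      then consider "u \<in> nb w" | "w = a" "u = b" using wu(1) out[OF w(1)] unfolding join_def by (auto split: if_splits)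
      then show ?thesis
      proof cases
        case 1
        then have "(x, u) \<in> T.away y" using w(2) wu by (auto intro: rtrancl_into_rtrancl)
        then show ?thesis using 1 T.nb_sub by blast
      qed (use w wu b in auto)
    next
      assume w: "w \<in> V'" "y \<noteq> a" "(x, a) \<in> T.away y"
      then have "w \<noteq> a" using a dis by blast
      then consider "u \<in> nb' w" | "u = a" using wu(1) out'[OF w(1)] unfolding join_def by (auto split: if_splits)
      then show ?thesis using w a T'.nb_sub by cases auto
    qed
  qed
  have Jy: "?J y = nb y \<union> (if y = a then {b} else {})" using y b dis out[OF y] unfolding join_def by auto
  have main: "(x, x') \<notin> ?R\<^sup>*" if x: "x \<in> nb y" and x': "x' \<in> ?J y" "x \<noteq> x'" for x x'
  proof
    assume "(x, x') \<in> ?R\<^sup>*"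
    from inv[OF x this] x' show False
      using T.acyc[OF x, of x'] T.nb_sub b dis unfolding Jy by (auto split: if_splits)
  qed
  have "sym (?R\<^sup>*)" using T.nb_sym T'.nb_sym by (intro sym_rtrancl) (auto simp: sym_def join_def)
  show ?thesis
  proof (cases "z \<in> nb y")
    case True
    then show ?thesis using main z(2,3) by blast
  next
    case False
    then have "z' \<in> nb y" using z unfolding Jy by (auto split: if_splits)
    then have "(z', z) \<notin> ?R\<^sup>*" using main z(1,3) by blast
    then show ?thesis using \<open>sym (?R\<^sup>*)\<close> symD[of "?R\<^sup>*" z z'] by blast
  qed
qed

lemma join_utree:
  assumes T: "utree V nb" "utree V' nb'" and dis: "V \<inter> V' = {}" and a: "a \<in> V" and b: "b \<in> V'"
  shows "utree (V \<union> V') (join nb nb' a b)"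
proof -
  interpret T: utree V nb by fact
  interpret T': utree V' nb' by fact
  let ?J = "join nb nb' a b"
  have ab: "a \<noteq> b" using a b dis by blast
  have sym: "v \<in> ?J u" if "u \<in> ?J v" for u v
    using that T.nb_sym T'.nb_sym ab unfolding join_def by (auto split: if_splits)
  have sub: "edge_rel nb \<subseteq> edge_rel ?J" "edge_rel nb' \<subseteq> edge_rel ?J"
    unfolding edge_rel_def join_def by auto
  have toa: "(u, a) \<in> (edge_rel ?J)\<^sup>*" if u: "u \<in> V \<union> V'" for u
    using u
  proof
    assume "u \<in> V"
    then show ?thesis using T.conn[OF _ a] rtrancl_mono[OF sub(1)] by blast
  next
    assume "u \<in> V'"
    then have "(u, b) \<in> (edge_rel ?J)\<^sup>*" using T'.conn[OF _ b] rtrancl_mono[OF sub(2)] by blast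
    moreover have "(b, a) \<in> edge_rel ?J" unfolding edge_rel_def join_def by simp
    ultimately show ?thesis by (rule rtrancl_into_rtrancl)
  qed
  have "sym ((edge_rel ?J)\<^sup>*)" using sym by (intro sym_rtrancl) (auto simp: sym_def edge_rel_def)
  then have froma: "(a, u) \<in> (edge_rel ?J)\<^sup>*" if "u \<in> V \<union> V'" for u using toa[OF that] by (auto simp: sym_def)
  show ?thesis
  proof
    show "finite (V \<union> V')" "V \<union> V' \<noteq> {}" using T.fin T'.fin T.nonempty by auto
    show "?J v \<subseteq> V \<union> V'" for v using T.nb_sub T'.nb_sub a b unfolding join_def by auto
    show "v \<notin> ?J v" for v using T.irrefl T'.irrefl ab unfolding join_def by auto
    show "u \<in> ?J v \<Longrightarrow> v \<in> ?J u" for u v by (rule sym)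
    show "(u, v) \<in> (edge_rel ?J)\<^sup>*" if "u \<in> V \<union> V'" "v \<in> V \<union> V'" for u v
      using toa[OF that(1)] froma[OF that(2)] by (rule rtrancl_trans)
    fix y z z' assume z: "z \<in> ?J y" "z' \<in> ?J y" "z \<noteq> z'"
    have "y \<in> V \<union> V'" using z(1) T.nb_V T'.nb_V a b unfolding join_def by (auto split: if_splits)
    then show "(z, z') \<notin> {(c, d). d \<in> ?J c \<and> c \<noteq> y \<and> d \<noteq> y}\<^sup>*"
    proof
      assume "y \<in> V"
      then show ?thesis using join_acyclic[OF T dis a b _ z] by blast
    next
      assume "y \<in> V'"
      moreover have "V' \<inter> V = {}" using dis by blast
      ultimately show ?thesis
        using join_acyclic[OF T(2,1) _ b a, of y z z'] z unfolding join_commute[of nb nb' a b] by blast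
    qed
  qed
qed

lemma rid_ids [simp]: "rid t \<in> set (ids t)"
  by (cases t) auto

lemma arcs_ids: "arcs t \<subseteq> set (ids t) \<times> set (ids t)"
proof (induction t)
  case (Rt x i ts)
  then show ?case by fastforce
qed

lemma rnb_ids: "v \<in> rnb t u \<Longrightarrow> u \<in> set (ids t) \<and> v \<in> set (ids t)"
  using arcs_ids[of t] unfolding rnb_def by blast

lemma rt_utree: "distinct (ids t) \<Longrightarrow> utree (set (ids t)) (rnb t)"
proof (induction t)
  case (Rt x i ts)
  have "set ss \<subseteq> set ts \<Longrightarrow> distinct (ids (Rt x i ss)) \<Longrightarrow> utree (set (ids (Rt x i ss))) (rnb (Rt x i ss))" for ss
  proof (induction ss)
    case Nil
    have "rnb (Rt x i []) = (\<lambda>_. {})" by (auto simp: rnb_def)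
    then show ?case by unfold_locales auto
  next
    case (Cons s ss)
    have "rnb (Rt x i (s # ss)) = join (rnb (Rt x i ss)) (rnb s) x (rid s)"
    proof (intro ext set_eqI)
      fix u v
      show "v \<in> rnb (Rt x i (s # ss)) u \<longleftrightarrow> v \<in> join (rnb (Rt x i ss)) (rnb s) x (rid s) u"
        by (auto simp: rnb_def join_def split: if_splits)
    qed
    moreover have "set (ids (Rt x i (s # ss))) = set (ids (Rt x i ss)) \<union> set (ids s)" by auto
    moreover have "utree (set (ids (Rt x i ss)) \<union> set (ids s)) (join (rnb (Rt x i ss)) (rnb s) x (rid s))"
    proof (rule join_utree)
      show "utree (set (ids (Rt x i ss))) (rnb (Rt x i ss))" using Cons by auto
      show "utree (set (ids s)) (rnb s)" using Rt.IH[of s] Cons.prems by auto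
    qed (use Cons.prems(2) in auto)
    ultimately show ?case by simp
  qed
  then show ?case using Rt.prems by blast
qed

text \<open>The term occurs as the branch behind the edge from \<open>x\<close> to its root.
  Complete neighbourhoods are demanded, so nothing else is attached anywhere in that branch.\<close>

fun placed :: "(nat \<Rightarrow> nat set) \<Rightarrow> (nat \<Rightarrow> 'i) \<Rightarrow> nat \<Rightarrow> 'i rt \<Rightarrow> bool" where
  "placed nb inp x (Rt y i ts) \<longleftrightarrow> nb y = insert x (rid ` set ts) \<and> x \<notin> rid ` set ts \<and>
     distinct (map rid ts) \<and> inp y = i \<and> (\<forall>t\<in>set ts. placed nb inp y t)"

lemma distinct_rids:
  assumes "distinct (concat (map ids ts))" shows "distinct (map rid ts)"
  using assms
proof (induction ts)
  case (Cons t ts)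
  then show ?case using rid_ids by (auto simp: disjoint_iff) (metis rid_ids)
qed simp

lemma distinct_child:
  assumes "distinct (concat (map ids ts))" "t \<in> set ts" "s \<in> set ts" "u \<in> set (ids t)" "u \<in> set (ids s)"
  shows "t = s"
  using assms by (induction ts) auto

lemma distinct_ids_child: "distinct (concat (map ids ts)) \<Longrightarrow> t \<in> set ts \<Longrightarrow> distinct (ids t)"
  by (induction ts) auto

lemma rnb_child:
  assumes d: "distinct (ids (Rt x i ts))" and t: "t \<in> set ts" and u: "u \<in> set (ids t)"
  shows "rnb (Rt x i ts) u = rnb t u \<union> (if u = rid t then {x} else {})"
proof -
  have ux: "u \<noteq> x" using d t u by auto
  have other: "v \<notin> rnb s u" if "s \<in> set ts" "s \<noteq> t" for s v
    using rnb_ids[of v s u] distinct_child[of ts t s u] d t u that by auto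
  have "v \<in> rnb (Rt x i ts) u \<longleftrightarrow> (\<exists>s\<in>set ts. v \<in> rnb s u \<or> v = x \<and> u = rid s)" for v
    using ux by (auto simp: rnb_def)
  moreover have "u = rid s \<longleftrightarrow> s = t \<and> u = rid t" if "s \<in> set ts" for s
    using distinct_child[of ts t s u] d t u that by auto
  ultimately have one: "v \<in> rnb (Rt x i ts) u \<longleftrightarrow> (\<exists>s\<in>set ts. v \<in> rnb s u) \<or> v = x \<and> u = rid t" for v
    using t by blast
  have two: "(\<exists>s\<in>set ts. v \<in> rnb s u) \<longleftrightarrow> v \<in> rnb t u" for v
    using other[of _ v] t by blast
  show ?thesis
  proof (rule set_eqI)
    fix v
    show "v \<in> rnb (Rt x i ts) u \<longleftrightarrow> v \<in> rnb t u \<union> (if u = rid t then {x} else {})"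
      unfolding one two by (cases "u = rid t") auto
  qed
qed

lemma placed_rt:
  assumes "distinct (ids t)" "x \<notin> set (ids t)"
    and "\<And>u. u \<in> set (ids t) \<Longrightarrow> nb u = rnb t u \<union> (if u = rid t then {x} else {})"
    and "\<And>u i. (u, i) \<in> labs t \<Longrightarrow> inp u = i"
  shows "placed nb inp x t"
  using assms
proof (induction t arbitrary: x)
  case (Rt y i ts)
  have "rnb (Rt y i ts) y = rid ` set ts"
  proof -
    have "\<not> (v, y) \<in> arcs s \<and> \<not> (y, v) \<in> arcs s" if "s \<in> set ts" for s v
      using arcs_ids[of s] Rt.prems(1) that by auto
    moreover have "y \<noteq> rid s" if "s \<in> set ts" for s using rid_ids[of s] Rt.prems(1) that by auto
    ultimately show ?thesis by (auto simp: rnb_def)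
  qed
  then have "nb y = insert x (rid ` set ts)" using Rt.prems(3)[of y] by simp
  moreover have "x \<notin> rid ` set ts" using Rt.prems(2) rid_ids by auto
  moreover have "distinct (map rid ts)" using distinct_rids Rt.prems(1) by auto
  moreover have "inp y = i" using Rt.prems(4) by simp
  moreover have "placed nb inp y t" if t: "t \<in> set ts" for t
  proof (rule Rt.IH[OF t])
    show "distinct (ids t)" "y \<notin> set (ids t)" using Rt.prems(1) t by (auto dest: distinct_ids_child)
    show "nb u = rnb t u \<union> (if u = rid t then {y} else {})" if u: "u \<in> set (ids t)" for u
    proof -
      have "u \<noteq> y" "u \<in> set (ids (Rt y i ts))" using Rt.prems(1) t u by auto
      then show ?thesis using Rt.prems(3)[of u] rnb_child[OF Rt.prems(1) t u] by simp
    qed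
    show "inp u = j" if "(u, j) \<in> labs t" for u j using Rt.prems(4) t that by auto
  qed
  ultimately show ?case by simp
qed

lemma labs_ids: "(u, i) \<in> labs t \<Longrightarrow> u \<in> set (ids t)"
  by (induction t) auto

lemma labs_unique: "distinct (ids t) \<Longrightarrow> (u, i) \<in> labs t \<Longrightarrow> (u, j) \<in> labs t \<Longrightarrow> i = j"
proof (induction t)
  case (Rt x k ts)
  show ?case
  proof (cases "u = x")
    case True
    have "(x, j') \<notin> labs t" if "t \<in> set ts" for t j' using labs_ids[of x j' t] Rt.prems(1) that by auto
    then show ?thesis using Rt.prems(2,3) True by auto
  next
    case False
    then obtain t s where ts: "t \<in> set ts" "s \<in> set ts" "(u, i) \<in> labs t" "(u, j) \<in> labs s"
      using Rt.prems(2,3) by auto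
    then have "t = s" using distinct_child[of ts t s u] labs_ids[OF ts(3)] labs_ids[OF ts(4)] Rt.prems(1) by auto
    moreover have "distinct (ids t)" using Rt.prems(1) ts by (auto dest: distinct_ids_child)
    ultimately show ?thesis using Rt.IH ts by blast
  qed
qed

lemma rinp_labs: "distinct (ids t) \<Longrightarrow> (u, i) \<in> labs t \<Longrightarrow> rinp t u = i"
  unfolding rinp_def by (rule the_equality, assumption, rule labs_unique)

lemma placed_children:
  assumes d: "distinct (ids (Rt x i ts))" and t: "t \<in> set ts"
  shows "placed (rnb (Rt x i ts)) (rinp (Rt x i ts)) x t"
proof (rule placed_rt)
  show "distinct (ids t)" "x \<notin> set (ids t)" using d t by (auto dest: distinct_ids_child)
  show "rnb (Rt x i ts) u = rnb t u \<union> (if u = rid t then {x} else {})" if "u \<in> set (ids t)" for u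
    by (rule rnb_child[OF d t that])
  show "rinp (Rt x i ts) u = j" if "(u, j) \<in> labs t" for u j
    by (rule rinp_labs[OF d]) (use t that in auto)
qed

lemma root_nb:
  assumes d: "distinct (ids (Rt x i ts))" shows "rnb (Rt x i ts) x = rid ` set ts" "rinp (Rt x i ts) x = i"
proof -
  have "\<not> (v, x) \<in> arcs s \<and> \<not> (x, v) \<in> arcs s" if "s \<in> set ts" for s v
    using arcs_ids[of s] d that by auto
  moreover have "x \<noteq> rid s" if "s \<in> set ts" for s using rid_ids[of s] d that by auto
  ultimately show "rnb (Rt x i ts) x = rid ` set ts" by (auto simp: rnb_def)
  show "rinp (Rt x i ts) x = i" by (rule rinp_labs[OF d]) simp
qed

lemma placed_determined:
  "placed nb inp x t \<Longrightarrow> placed nb' inp' x t \<Longrightarrow> u \<in> set (ids t) \<Longrightarrow> nb u = nb' u \<and> inp u = inp' u"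
proof (induction t arbitrary: x)
  case (Rt y i ts)
  then show ?case by auto
qed

lemma placed_nb: "placed nb inp x t \<Longrightarrow> u \<in> set (ids t) \<Longrightarrow> nb u \<subseteq> insert x (set (ids t))"
proof (induction t arbitrary: x)
  case (Rt y i ts)
  show ?case
  proof (cases "u = y")
    case True
    then show ?thesis using Rt.prems rid_ids by fastforce
  next
    case False
    then obtain t where t: "t \<in> set ts" "u \<in> set (ids t)" using Rt.prems(2) by auto
    then have "nb u \<subseteq> insert y (set (ids t))" using Rt.IH[OF t(1), of y] Rt.prems(1) by auto
    then show ?thesis using t by auto
  qed
qed

lemma card_rnb_root: assumes "distinct (ids (Rt x i ts))" shows "card (rnb (Rt x i ts) x) = length ts"
proof -
  have "distinct (map rid ts)" using distinct_rids assms by auto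
  then show ?thesis using root_nb(1)[OF assms] distinct_card[of "map rid ts"] by simp
qed

subsection \<open>Types of rooted trees\<close>

context edge_problem begin

primrec rok :: "'i rt \<Rightarrow> bool" where
  "rok (Rt x i ts) \<longleftrightarrow> i \<in> Inp \<and> length ts < \<Delta> \<and> list_all (\<lambda>b. b) (map rok ts)"

primrec ty :: "'i rt \<Rightarrow> ('s \<times> 's) set" where
  "ty (Rt x i ts) = branch_type i (map ty ts)"

lemma placed_deg:
  "rok t \<Longrightarrow> placed nb inp x t \<Longrightarrow> u \<in> set (ids t) \<Longrightarrow> card (nb u) \<le> \<Delta> \<and> inp u \<in> Inp"
proof (induction t arbitrary: x)
  case (Rt y i ts)
  show ?case
  proof (cases "u = y")
    case True
    have "card (insert x (rid ` set ts)) \<le> Suc (card (set (map rid ts)))" by (simp add: card_insert_le_m1 card_insert_if)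
    also have "card (set (map rid ts)) \<le> length ts" using card_length[of "map rid ts"] by simp
    finally show ?thesis using Rt.prems True by auto
  next
    case False
    then obtain t where t: "t \<in> set ts" "u \<in> set (ids t)" using Rt.prems(3) by auto
    then show ?thesis using Rt.IH[OF t(1), of y] Rt.prems by (auto simp: list_all_iff)
  qed
qed

definition solution :: "nat set \<Rightarrow> (nat \<Rightarrow> nat set) \<Rightarrow> (nat \<Rightarrow> 'i) \<Rightarrow> (nat \<Rightarrow> 'o) \<Rightarrow> (nat \<Rightarrow> nat \<Rightarrow> 's) \<Rightarrow> bool" where
  "solution U nb inp out \<sigma> \<longleftrightarrow> (\<forall>u\<in>U. nok (inp u) (out u) (image_mset (es \<sigma> u) (mset_set (nb u))) \<and>
     (\<forall>v\<in>nb u. es \<sigma> u v \<in> Sg \<times> Sg))"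

lemma solution_mono: "solution U nb inp out \<sigma> \<Longrightarrow> W \<subseteq> U \<Longrightarrow> solution W nb inp out \<sigma>"
  unfolding solution_def by blast

lemma node_in_branch_type:
  assumes sol: "solution {y} nb inp out \<sigma>"
    and nb: "nb y = insert x (rid ` set ts)" "x \<notin> rid ` set ts" "distinct (map rid ts)"
    and ty: "\<And>t. t \<in> set ts \<Longrightarrow> es \<sigma> y (rid t) \<in> T t"
  shows "es \<sigma> x y \<in> branch_type (inp y) (map T ts)"
proof -
  have "mset_set (nb y) = add_mset x (mset (map rid ts))"
    using nb mset_set_set[OF nb(3)] by simp
  then have "nok (inp y) (out y) (mset (prod.swap (es \<sigma> x y) # map (\<lambda>t. es \<sigma> y (rid t)) ts))"
    using sol unfolding solution_def by (simp add: es_swap[of \<sigma> y x] multiset.map_comp o_def)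
  moreover have "list_all2 (\<in>) (map (\<lambda>t. es \<sigma> y (rid t)) ts) (map T ts)"
    using ty by (auto simp: list_all2_conv_all_nth)
  moreover have "es \<sigma> x y \<in> Sg \<times> Sg" using sol nb(1) unfolding solution_def es_def by auto
  ultimately show ?thesis unfolding branch_type_def by blast
qed

lemma node_in_letter:
  assumes sol: "solution {y} nb inp out \<sigma>"
    and nb: "nb y = {a, b} \<union> rid ` set ts" "a \<noteq> b" "a \<notin> rid ` set ts" "b \<notin> rid ` set ts" "distinct (map rid ts)"
    and ty: "\<And>t. t \<in> set ts \<Longrightarrow> es \<sigma> y (rid t) \<in> T t"
  shows "(es \<sigma> a y, es \<sigma> y b) \<in> letter (inp y) (map T ts)"
proof -
  have "mset_set (nb y) = add_mset a (add_mset b (mset (map rid ts)))"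
    using nb mset_set_set[OF nb(5)] by simp
  then have "nok (inp y) (out y) (mset (prod.swap (es \<sigma> a y) # es \<sigma> y b # map (\<lambda>t. es \<sigma> y (rid t)) ts))"
    using sol unfolding solution_def by (simp add: es_swap[of \<sigma> y a] multiset.map_comp o_def)
  moreover have "list_all2 (\<in>) (map (\<lambda>t. es \<sigma> y (rid t)) ts) (map T ts)"
    using ty by (auto simp: list_all2_conv_all_nth)
  moreover have "es \<sigma> a y \<in> Sg \<times> Sg" "es \<sigma> y b \<in> Sg \<times> Sg" using sol nb(1) unfolding solution_def es_def by auto
  ultimately show ?thesis unfolding letter_def by blast
qed

text \<open>The direction opposite to \<open>realised_ex\<close>: any solution on the branch puts a
  state of the type on the root edge, since it supplies suitable states for the children
  itself.\<close>

lemma placed_type: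
  "placed nb inp x t \<Longrightarrow> solution (set (ids t)) nb inp out \<sigma> \<Longrightarrow> es \<sigma> x (rid t) \<in> ty t"
proof (induction t arbitrary: x)
  case (Rt y i ts)
  have "es \<sigma> x y \<in> branch_type (inp y) (map ty ts)"
  proof (rule node_in_branch_type)
    show "solution {y} nb inp out \<sigma>" by (rule solution_mono[OF Rt.prems(2)]) simp
    show "es \<sigma> y (rid t) \<in> ty t" if "t \<in> set ts" for t
      using Rt.IH[OF that] Rt.prems that solution_mono[OF Rt.prems(2), of "set (ids t)"] by auto
  qed (use Rt.prems(1) in auto)
  then show ?case using Rt.prems(1) by simp
qed

text \<open>Types of uncut branches come from actual trees, on which the given algorithm can be
  run.\<close>

lemma gen_rt: "t \<in> gen {} \<Longrightarrow> \<exists>r. rok r \<and> ty r = t"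
proof (induction rule: gen.induct)
  case (node i ts)
  then have "\<forall>t\<in>set ts. \<exists>r. rok r \<and> ty r = t" by blast
  then obtain f where f: "\<And>t. t \<in> set ts \<Longrightarrow> rok (f t) \<and> ty (f t) = t" by metis
  have "rok (Rt 0 i (map f ts))" using node f by (auto simp: list_all_iff)
  moreover have "ty (Rt 0 i (map f ts)) = branch_type i ts"
    using f by (simp add: map_idI cong: map_cong)
  ultimately show ?case by blast
qed simp

end

fun renum :: "nat \<Rightarrow> 'i rt \<Rightarrow> 'i rt" and renums :: "nat \<Rightarrow> 'i rt list \<Rightarrow> 'i rt list" where
  "renum k (Rt x i ts) = Rt k i (renums (Suc k) ts)"
| "renums k [] = []"
| "renums k (t # ts) = renum k t # renums (k + length (ids t)) ts"

lemma upt_append_add: "[k..<k + a] @ [k + a..<k + a + b] = [k..<k + a + (b::nat)]"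
  using upt_add_eq_append[of k "k + a" b] by simp

lemma fixes t :: "'i rt" and ts :: "'i rt list"
  shows ids_renum: "ids (renum k t) = [k..<k + length (ids t)]"
    and ids_renums: "concat (map ids (renums k ts)) = [k..<k + length (concat (map ids ts))]"
proof (induction k t and k ts rule: renum_renums.induct)
  case (1 k x i ts)
  then show ?case by (simp add: upt_conv_Cons del: upt_Suc)
next
  case (3 k t ts)
  then show ?case using upt_append_add[of k "length (ids t)" "length (concat (map ids ts))"] by (simp add: add.assoc)
qed simp

lemma length_renums [simp]: "length (renums k ts) = length ts"
  by (induction ts arbitrary: k) auto

context edge_problem begin

lemma ty_renum: "ty (renum k t) = ty t" and ty_renums: "map ty (renums k ts) = map ty ts"
  by (induction k t and k ts rule: renum_renums.induct) auto

lemma rok_renum: "rok (renum k t) = rok t" and rok_renums: "map rok (renums k ts) = map rok ts"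
  by (induction k t and k ts rule: renum_renums.induct) auto

end

section \<open>Spines\<close>

text \<open>A spine lists the nodes of a path (name, input label, hanging trees).\<close>

type_synonym 'i spine = "(nat \<times> 'i \<times> 'i rt list) list"

text \<open>\<open>rs\<close> is attached behind the last node. Lists are used instead of trees so
  that the empty spine can return \<open>rs\<close>.\<close>

fun chain :: "'i spine \<Rightarrow> 'i rt list \<Rightarrow> 'i rt list" where
  "chain [] rs = rs"
| "chain ((x, i, hs) # sp) rs = [Rt x i (hs @ chain sp rs)]"

definition block :: "nat \<times> 'i \<times> 'i rt list \<Rightarrow> nat list" where
  "block e = fst e # concat (map ids (snd (snd e)))"

definition sids :: "'i spine \<Rightarrow> nat list" where
  "sids sp = concat (map block sp)"

lemma sids_Cons: "sids (e # sp) = block e @ sids sp"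
  by (simp add: sids_def)

lemma ids_chain: "concat (map ids (chain sp rs)) = sids sp @ concat (map ids rs)"
proof (induction sp)
  case (Cons e sp)
  then show ?case by (cases e) (simp add: sids_Cons block_def)
qed (simp add: sids_def)

lemma mset_sids_rev: "mset (sids (rev sp)) = mset (sids sp)"
  by (induction sp) (auto simp: sids_def)

lemma chain_single: "sp \<noteq> [] \<Longrightarrow> \<exists>t. chain sp rs = [t] \<and> rid t = fst (hd sp)"
  by (cases sp) auto

text \<open>The neighbours of the two end nodes are left open: there the spine is attached to the
  rest, and padding may follow.\<close>

definition spined :: "(nat \<Rightarrow> nat set) \<Rightarrow> (nat \<Rightarrow> 'i) \<Rightarrow> 'i spine \<Rightarrow> bool" where
  "spined nb inp sp \<longleftrightarrow> (\<forall>j<length sp. inp (fst (sp ! j)) = fst (snd (sp ! j)) \<and>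
     (\<forall>t\<in>set (snd (snd (sp ! j))). placed nb inp (fst (sp ! j)) t) \<and>
     (0 < j \<and> Suc j < length sp \<longrightarrow>
        nb (fst (sp ! j)) = {fst (sp ! (j - 1)), fst (sp ! Suc j)} \<union> rid ` set (snd (snd (sp ! j)))))"

lemma spined_rev: assumes "spined nb inp sp" shows "spined nb inp (rev sp)"
  unfolding spined_def
proof (intro allI impI)
  fix j assume j: "j < length (rev sp)"
  define k where "k = length sp - Suc j"
  have k: "k < length sp" "rev sp ! j = sp ! k" using j by (auto simp: k_def rev_nth)
  have "nb (fst (sp ! k)) = {fst (rev sp ! (j - 1)), fst (rev sp ! Suc j)} \<union> rid ` set (snd (snd (sp ! k)))"
    if jj: "0 < j" "Suc j < length (rev sp)"
  proof -
    have "rev sp ! (j - 1) = sp ! Suc k" "rev sp ! Suc j = sp ! (k - 1)" "0 < k" "Suc k < length sp"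
      using jj by (auto simp: k_def rev_nth Suc_diff_Suc)
    then show ?thesis using assms k(1) unfolding spined_def by (simp add: insert_commute)
  qed
  then show "inp (fst (rev sp ! j)) = fst (snd (rev sp ! j)) \<and>
     (\<forall>t\<in>set (snd (snd (rev sp ! j))). placed nb inp (fst (rev sp ! j)) t) \<and>
     (0 < j \<and> Suc j < length (rev sp) \<longrightarrow>
        nb (fst (rev sp ! j)) = {fst (rev sp ! (j - 1)), fst (rev sp ! Suc j)} \<union> rid ` set (snd (snd (rev sp ! j))))"
    using assms k unfolding spined_def by simp
qed

definition chain_prev :: "nat \<Rightarrow> 'i spine \<Rightarrow> nat \<Rightarrow> nat" where
  "chain_prev x sp j = (if j = 0 then x else fst (sp ! (j - 1)))"

definition chain_next :: "'i spine \<Rightarrow> 'i rt list \<Rightarrow> nat \<Rightarrow> nat set" where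
  "chain_next sp rs j = (if Suc j < length sp then {fst (sp ! Suc j)} else rid ` set rs)"

lemma placed_chain:
  assumes "chain sp rs = [t]" "placed nb inp x t" "j < length sp"
  shows "inp (fst (sp ! j)) = fst (snd (sp ! j)) \<and>
    (\<forall>t\<in>set (snd (snd (sp ! j))). placed nb inp (fst (sp ! j)) t) \<and>
    nb (fst (sp ! j)) = insert (chain_prev x sp j) (chain_next sp rs j \<union> rid ` set (snd (snd (sp ! j)))) \<and>
    distinct (map rid (snd (snd (sp ! j)))) \<and>
    chain_prev x sp j \<notin> chain_next sp rs j \<union> rid ` set (snd (snd (sp ! j))) \<and>
    chain_next sp rs j \<inter> rid ` set (snd (snd (sp ! j))) = {}"
  using assms
proof (induction sp arbitrary: x t j)
  case (Cons e sp)
  obtain y i hs where e: "e = (y, i, hs)" using prod_cases3 by blast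
  have t: "t = Rt y i (hs @ chain sp rs)" using Cons.prems(1) e by simp
  have nxt: "rid ` set (chain sp rs) = chain_next (e # sp) rs 0"
    using chain_single[of sp rs] by (cases sp) (auto simp: chain_next_def)
  show ?case
  proof (cases j)
    case 0
    then show ?thesis using Cons.prems(2) nxt[symmetric] unfolding t e
      by (auto simp: chain_prev_def)
  next
    case (Suc k)
    then have "sp \<noteq> []" using Cons.prems(3) by auto
    then obtain s where s: "chain sp rs = [s]" using chain_single by blast
    have "placed nb inp y s" using Cons.prems(2) s unfolding t by simp
    moreover have "chain_prev x (e # sp) j = chain_prev y sp k" "chain_next (e # sp) rs j = chain_next sp rs k"
      unfolding Suc chain_prev_def chain_next_def e by (cases k; simp)+
    ultimately show ?thesis using Cons.IH[OF s, of y k] Cons.prems(3) Suc by simp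
  qed
qed simp

lemma placed_spined:
  assumes "chain sp rs = [t]" "placed nb inp x t" shows "spined nb inp sp"
  unfolding spined_def using placed_chain[OF assms] by (auto simp: chain_prev_def chain_next_def)

text \<open>A step changes the block by at most one, since a hanging tree can be left only through
  its path node.\<close>

lemma spined_ball:
  assumes sp: "spined nb inp sp" and k: "k \<le> h" "h + k < length sp" and u: "u \<in> ball nb k (fst (sp ! h))"
  shows "\<exists>j. h \<le> j + k \<and> j \<le> h + k \<and> u \<in> set (block (sp ! j))"
  using k u
proof (induction k arbitrary: u)
  case 0
  then show ?case by (intro exI[of _ h]) (simp add: block_def)
next
  case (Suc k)
  show ?case
  proof (cases "u \<in> ball nb k (fst (sp ! h))")
    case True
    then obtain j where "h \<le> j + k" "j \<le> h + k" "u \<in> set (block (sp ! j))" using Suc by auto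
    then show ?thesis by (intro exI[of _ j]) simp
  next
    case False
    then obtain w where w: "w \<in> ball nb k (fst (sp ! h))" "u \<in> nb w" using Suc.prems(3) by auto
    then obtain j where j: "h \<le> j + k" "j \<le> h + k" "w \<in> set (block (sp ! j))" using Suc by auto
    have jj: "0 < j" "Suc j < length sp" using j Suc.prems by auto
    have s: "\<forall>t\<in>set (snd (snd (sp ! j))). placed nb inp (fst (sp ! j)) t"
      "nb (fst (sp ! j)) = {fst (sp ! (j - 1)), fst (sp ! Suc j)} \<union> rid ` set (snd (snd (sp ! j)))"
      using sp jj unfolding spined_def by auto
    consider "w = fst (sp ! j)" | t where "t \<in> set (snd (snd (sp ! j)))" "w \<in> set (ids t)"
      using j(3) unfolding block_def by auto
    then show ?thesis
    proof cases
      case 1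
      then consider "u = fst (sp ! (j - 1))" | "u = fst (sp ! Suc j)" | t where "t \<in> set (snd (snd (sp ! j)))" "u = rid t"
        using w(2) s(2) by auto
      then show ?thesis
      proof cases
        case 1
        then show ?thesis using j jj by (intro exI[of _ "j - 1"]) (auto simp: block_def)
      next
        case 2
        then show ?thesis using j jj by (intro exI[of _ "Suc j"]) (auto simp: block_def)
      next
        case 3
        then have "u \<in> (\<Union>s\<in>set (snd (snd (sp ! j))). set (ids s))" using rid_ids[of t] by blast
        then show ?thesis using j by (intro exI[of _ j]) (auto simp: block_def)
      qed
    next
      case 2
      then have "u \<in> insert (fst (sp ! j)) (set (ids t))" using placed_nb[of nb inp "fst (sp ! j)" t w] s(1) w(2) by blast
      then show ?thesis using j 2(1) by (intro exI[of _ j]) (auto simp: block_def)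
    qed
  qed
qed

text \<open>Within the distances compared only inner blocks are met, and the spine fixes all their
  neighbourhoods and inputs. Hence the surrounding tree is invisible from the middle.\<close>

lemma spined_agree:
  assumes sp: "spined nb inp sp" "spined nb' inp' sp" and t: "t \<le> h" "h + t < length sp"
  shows "agree t (fst (sp ! h)) nb inp nb' inp'"
  unfolding agree_def
proof (intro allI impI ballI)
  fix k u assume k: "k < t" and u: "u \<in> ball nb k (fst (sp ! h))"
  obtain j where j: "h \<le> j + k" "j \<le> h + k" "u \<in> set (block (sp ! j))"
    using spined_ball[OF sp(1) _ _ u] k t by auto
  have jj: "0 < j" "Suc j < length sp" using j k t by auto
  consider "u = fst (sp ! j)" | s where "s \<in> set (snd (snd (sp ! j)))" "u \<in> set (ids s)"
    using j(3) unfolding block_def by auto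
  then show "nb u = nb' u \<and> inp u = inp' u"
  proof cases
    case 1
    then show ?thesis using sp jj unfolding spined_def by auto
  next
    case 2
    then have "placed nb inp (fst (sp ! j)) s" "placed nb' inp' (fst (sp ! j)) s"
      using sp jj unfolding spined_def by auto
    then show ?thesis using placed_determined 2(2) by blast
  qed
qed

context edge_problem begin

definition spells :: "'i spine \<Rightarrow> (('s \<times> 's) \<times> ('s \<times> 's)) set list \<Rightarrow> bool" where
  "spells sp w \<longleftrightarrow> length sp = length w \<and> (\<forall>j<length sp.
     w ! j = letter (fst (snd (sp ! j))) (map ty (snd (snd (sp ! j)))) \<and> fst (snd (sp ! j)) \<in> Inp \<and>
     length (snd (snd (sp ! j))) + 2 \<le> \<Delta> \<and> (\<forall>t\<in>set (snd (snd (sp ! j))). rok t))"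

lemma rok_chain:
  assumes "\<And>e. e \<in> set sp \<Longrightarrow> fst (snd e) \<in> Inp \<and> length (snd (snd e)) + 2 \<le> \<Delta> \<and> (\<forall>t\<in>set (snd (snd e)). rok t)"
    and "\<And>t. t \<in> set rs \<Longrightarrow> rok t" "length rs \<le> 1"
  shows "length (chain sp rs) \<le> 1 \<and> (\<forall>t\<in>set (chain sp rs). rok t)"
  using assms(1)
proof (induction sp)
  case (Cons e sp)
  obtain y i hs where e: "e = (y, i, hs)" using prod_cases3 by blast
  have "length (chain sp rs) \<le> 1 \<and> (\<forall>t\<in>set (chain sp rs). rok t)"
    by (rule Cons.IH) (use Cons.prems in auto)
  moreover have "i \<in> Inp" "length hs + 2 \<le> \<Delta>" "\<forall>t\<in>set hs. rok t" using Cons.prems[of e] e by auto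
  ultimately show ?case unfolding e by (auto simp: list_all_iff)
qed (use assms(2,3) in auto)

lemma spells_node:
  assumes w: "spells sp w" and j: "j < length sp"
    and sol: "solution (set (sids sp)) nb inp out \<sigma>"
    and inp: "inp (fst (sp ! j)) = fst (snd (sp ! j))"
    and pl: "\<forall>t\<in>set (snd (snd (sp ! j))). placed nb inp (fst (sp ! j)) t"
    and nb: "nb (fst (sp ! j)) = {a, b} \<union> rid ` set (snd (snd (sp ! j)))" "a \<noteq> b"
      "a \<notin> rid ` set (snd (snd (sp ! j)))" "b \<notin> rid ` set (snd (snd (sp ! j)))" "distinct (map rid (snd (snd (sp ! j))))"
  shows "(es \<sigma> a (fst (sp ! j)), es \<sigma> (fst (sp ! j)) b) \<in> w ! j"
proof -
  have sub: "set (block (sp ! j)) \<subseteq> set (sids sp)" using nth_mem[OF j] unfolding sids_def by auto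
  have "w ! j = letter (inp (fst (sp ! j))) (map ty (snd (snd (sp ! j))))"
    using w j inp unfolding spells_def by auto
  moreover have "(es \<sigma> a (fst (sp ! j)), es \<sigma> (fst (sp ! j)) b)
      \<in> letter (inp (fst (sp ! j))) (map ty (snd (snd (sp ! j))))"
  proof (rule node_in_letter)
    show "solution {fst (sp ! j)} nb inp out \<sigma>"
      by (rule solution_mono[OF sol]) (use sub in \<open>auto simp: block_def\<close>)
    show "es \<sigma> (fst (sp ! j)) (rid t) \<in> ty t" if "t \<in> set (snd (snd (sp ! j)))" for t
    proof (rule placed_type)
      show "placed nb inp (fst (sp ! j)) t" using pl that by blast
      have "set (ids t) \<subseteq> set (block (sp ! j))" using that unfolding block_def by auto
      then show "solution (set (ids t)) nb inp out \<sigma>" using solution_mono[OF sol] sub by blast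
    qed
  qed (use nb in auto)
  ultimately show ?thesis by simp
qed

text \<open>The states on the path edges up to the middle form a run of the first
  \<open>Suc h\<close> letters. In \<open>chain_right\<close> the path is entered from its far end,
  so the root state appears swapped.\<close>

lemma chain_left:
  assumes w: "spells sp w" and t: "chain sp rs = [t]" "placed nb inp x t"
    and sol: "solution (set (sids sp)) nb inp out \<sigma>" and h: "Suc h < length sp"
  shows "(es \<sigma> x (rid t), es \<sigma> (fst (sp ! h)) (fst (sp ! Suc h))) \<in> rel_of (take (Suc h) w)"
proof -
  have lw: "length w = length sp" using w unfolding spells_def by simp
  define E where "E j = es \<sigma> (chain_prev x sp j) (fst (sp ! j))" for j
  have "(E j, E (Suc j)) \<in> take (Suc h) w ! j" if j: "j < Suc h" for j
  proof -
    have jl: "j < length sp" "Suc j < length sp" using j h by auto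
    have nx: "chain_next sp rs j = {fst (sp ! Suc j)}" using jl by (simp add: chain_next_def)
    note p = placed_chain[OF t jl(1), unfolded nx]
    have "(es \<sigma> (chain_prev x sp j) (fst (sp ! j)), es \<sigma> (fst (sp ! j)) (fst (sp ! Suc j))) \<in> w ! j"
      by (rule spells_node[OF w jl(1) sol]) (use p in auto)
    then show ?thesis using j by (simp add: E_def chain_prev_def)
  qed
  moreover have "E 0 = es \<sigma> x (rid t)"
  proof -
    have "sp \<noteq> []" using h by auto
    then have "rid t = fst (sp ! 0)" using chain_single[of sp rs] t(1) by (auto simp: hd_conv_nth)
    then show ?thesis by (simp add: E_def chain_prev_def)
  qed
  moreover have "E (Suc h) = es \<sigma> (fst (sp ! h)) (fst (sp ! Suc h))" by (simp add: E_def chain_prev_def)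
  moreover have "length (take (Suc h) w) = Suc h" using h lw by simp
  ultimately show ?thesis unfolding rel_of_chain by (intro exI[of _ E]) auto
qed

lemma chain_right:
  assumes w: "spells sp w" and t: "chain (rev sp) rs = [t]" "placed nb inp x t"
    and sol: "solution (set (sids sp)) nb inp out \<sigma>" and h: "Suc h < length sp"
  shows "(es \<sigma> (fst (sp ! h)) (fst (sp ! Suc h)), prod.swap (es \<sigma> x (rid t))) \<in> rel_of (drop (Suc h) w)"
proof -
  let ?n = "length sp"
  have lw: "length w = ?n" using w unfolding spells_def by simp
  define Y where "Y j = (if j < ?n then fst (sp ! j) else x)" for j
  define E where "E i = es \<sigma> (Y (h + i)) (Y (Suc (h + i)))" for i
  have node: "(es \<sigma> (Y (j - 1)) (Y j), es \<sigma> (Y j) (Y (Suc j))) \<in> w ! j" if j: "0 < j" "j < ?n" for j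
  proof -
    define k where "k = ?n - Suc j"
    have k: "k < length (rev sp)" "rev sp ! k = sp ! j" using j by (auto simp: k_def rev_nth)
    have nx: "chain_next (rev sp) rs k = {Y (j - 1)}"
    proof -
      have "Suc k < length (rev sp)" "?n - Suc (Suc k) = j - 1" using j by (auto simp: k_def)
      moreover from this have "rev sp ! Suc k = sp ! (j - 1)" by (simp add: rev_nth)
      moreover have "j - 1 < ?n" using j by simp
      ultimately show ?thesis unfolding chain_next_def Y_def by simp
    qed
    have pv: "chain_prev x (rev sp) k = Y (Suc j)"
    proof (cases "Suc j < ?n")
      case True
      then have "k \<noteq> 0" "rev sp ! (k - 1) = sp ! Suc j" using j by (auto simp: k_def rev_nth Suc_diff_Suc)
      then show ?thesis using True unfolding chain_prev_def Y_def by simp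
    next
      case False
      then have "k = 0" using j by (simp add: k_def)
      then show ?thesis using False unfolding chain_prev_def Y_def by simp
    qed
    note p = placed_chain[OF t k(1), unfolded nx pv k(2)]
    have "(es \<sigma> (Y (j - 1)) (fst (sp ! j)), es \<sigma> (fst (sp ! j)) (Y (Suc j))) \<in> w ! j"
      by (rule spells_node[OF w j(2) sol]) (use p in auto)
    then show ?thesis using j by (simp add: Y_def)
  qed
  have "(E i, E (Suc i)) \<in> drop (Suc h) w ! i" if "i < length (drop (Suc h) w)" for i
    using node[of "Suc (h + i)"] that lw h unfolding E_def by simp
  moreover have "E 0 = es \<sigma> (fst (sp ! h)) (fst (sp ! Suc h))" using h unfolding E_def Y_def by simp
  moreover have "E (length (drop (Suc h) w)) = prod.swap (es \<sigma> x (rid t))"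
  proof -
    have "rev sp \<noteq> []" using h by auto
    then have "rid t = fst (sp ! (?n - 1))" using chain_single[of "rev sp" rs] t(1) h
      by (auto simp: hd_rev last_conv_nth)
    moreover have "h + length (drop (Suc h) w) = ?n - 1" using h lw by simp
    ultimately show ?thesis using h unfolding E_def Y_def by (auto simp: es_def)
  qed
  ultimately show ?thesis unfolding rel_of_chain by (intro exI[of _ E]) auto
qed

subsection \<open>Spelling a word\<close>

definition wit :: "(('s \<times> 's) \<times> ('s \<times> 's)) set \<Rightarrow> 'i \<times> 'i rt list" where
  "wit \<rho> = (SOME p. fst p \<in> Inp \<and> (\<forall>t\<in>set (snd p). rok t) \<and> length (snd p) + 2 \<le> \<Delta> \<and>
     \<rho> = letter (fst p) (map ty (snd p)))"

lemma wit:
  assumes "\<rho> \<in> letters"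
  shows "fst (wit \<rho>) \<in> Inp \<and> (\<forall>t\<in>set (snd (wit \<rho>)). rok t) \<and> length (snd (wit \<rho>)) + 2 \<le> \<Delta> \<and>
     \<rho> = letter (fst (wit \<rho>)) (map ty (snd (wit \<rho>)))"
proof -
  obtain i ts where its: "i \<in> Inp" "set ts \<subseteq> gen {}" "length ts + 2 \<le> \<Delta>" "\<rho> = letter i ts"
    using assms unfolding letters_def by blast
  have "\<forall>t\<in>set ts. \<exists>r. rok r \<and> ty r = t" using gen_rt its(2) by blast
  then obtain f where f: "\<And>t. t \<in> set ts \<Longrightarrow> rok (f t) \<and> ty (f t) = t" by metis
  have "map ty (map f ts) = ts" using f by (simp add: map_idI)
  then have "\<exists>p. fst p \<in> Inp \<and> (\<forall>t\<in>set (snd p). rok t) \<and> length (snd p) + 2 \<le> \<Delta> \<and>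
     \<rho> = letter (fst p) (map ty (snd p))"
    using its f by (intro exI[of _ "(i, map f ts)"]) auto
  then show ?thesis unfolding wit_def by (rule someI_ex)
qed

definition wsize :: "(('s \<times> 's) \<times> ('s \<times> 's)) set \<Rightarrow> nat" where
  "wsize \<rho> = Suc (length (concat (map ids (snd (wit \<rho>)))))"

text \<open>Every letter is replaced by a fixed witness whose block takes the next free names.
  Different starting values \<open>k\<close> thus give copies of one path on different
  identifiers.\<close>

primrec spine :: "nat \<Rightarrow> (('s \<times> 's) \<times> ('s \<times> 's)) set list \<Rightarrow> 'i spine" where
  "spine k [] = []"
| "spine k (\<rho> # w) = (k, fst (wit \<rho>), renums (Suc k) (snd (wit \<rho>))) # spine (k + wsize \<rho>) w"

lemma length_spine [simp]: "length (spine k w) = length w"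
  by (induction w arbitrary: k) auto

lemma block_spine: "block (k, fst (wit \<rho>), renums (Suc k) (snd (wit \<rho>))) = [k..<k + wsize \<rho>]"
  unfolding block_def wsize_def using ids_renums[of "Suc k" "snd (wit \<rho>)"]
  by (simp add: upt_conv_Cons del: upt_Suc)

lemma sids_spine: "sids (spine k w) = [k..<k + sum_list (map wsize w)]"
proof (induction w arbitrary: k)
  case (Cons \<rho> w)
  then show ?case using upt_append_add[of k "wsize \<rho>" "sum_list (map wsize w)"]
    by (simp add: sids_Cons block_spine add.assoc)
qed (simp add: sids_def)

lemma spells_spine: "set w \<subseteq> letters \<Longrightarrow> spells (spine k w) w"
proof (induction w arbitrary: k)
  case Nil
  then show ?case by (simp add: spells_def)
next
  case (Cons \<rho> w)
  have IH: "spells (spine (k + wsize \<rho>) w) w" using Cons by simp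
  have rk: "(\<forall>t\<in>set (renums (Suc k) (snd (wit \<rho>))). rok t) \<longleftrightarrow> (\<forall>t\<in>set (snd (wit \<rho>)). rok t)"
  proof -
    have "(\<forall>b\<in>set (map rok (renums (Suc k) (snd (wit \<rho>)))). b) \<longleftrightarrow> (\<forall>b\<in>set (map rok (snd (wit \<rho>))). b)"
      by (simp only: rok_renums)
    then show ?thesis by simp
  qed
  show ?case unfolding spells_def
  proof (intro conjI allI impI ballI)
    fix j assume j: "j < length (spine k (\<rho> # w))"
    have "(\<rho> # w) ! j = letter (fst (snd (spine k (\<rho> # w) ! j))) (map ty (snd (snd (spine k (\<rho> # w) ! j)))) \<and>
      fst (snd (spine k (\<rho> # w) ! j)) \<in> Inp \<and> length (snd (snd (spine k (\<rho> # w) ! j))) + 2 \<le> \<Delta> \<and>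
      (\<forall>t\<in>set (snd (snd (spine k (\<rho> # w) ! j))). rok t)"
    proof (cases j)
      case 0
      then show ?thesis using wit[of \<rho>] Cons.prems rk ty_renums[of "Suc k" "snd (wit \<rho>)"] by simp
    next
      case (Suc i)
      then show ?thesis using IH j unfolding spells_def by simp
    qed
    then show "(\<rho> # w) ! j = letter (fst (snd (spine k (\<rho> # w) ! j))) (map ty (snd (snd (spine k (\<rho> # w) ! j))))"
      "fst (snd (spine k (\<rho> # w) ! j)) \<in> Inp" "length (snd (snd (spine k (\<rho> # w) ! j))) + 2 \<le> \<Delta>"
      "t \<in> set (snd (snd (spine k (\<rho> # w) ! j))) \<Longrightarrow> rok t" for t by blast+
  qed simp
qed

subsection \<open>Pumping\<close>

lemma letters_sub: "\<rho> \<in> letters \<Longrightarrow> \<rho> \<subseteq> (Sg \<times> Sg) \<times> (Sg \<times> Sg)"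
  unfolding letters_def letter_def by auto

lemma rel_of_sub: "set w \<subseteq> letters \<Longrightarrow> w \<noteq> [] \<Longrightarrow> rel_of w \<subseteq> (Sg \<times> Sg) \<times> (Sg \<times> Sg)"
proof (induction w)
  case (Cons \<rho> w)
  have "\<rho> \<subseteq> (Sg \<times> Sg) \<times> (Sg \<times> Sg)" using letters_sub Cons.prems by simp
  then show ?case using Cons by (cases "w = []") auto
qed simp

text \<open>Two nonempty prefixes of \<open>w\<close> have the same relation, so the factor between
  them can be repeated without changing the relation of the word. The empty prefix is left out
  because its relation \<open>Id\<close> is not confined to pairs over \<open>Sg\<close>.\<close>

lemma pumping:
  assumes fin: "finite Sg" and w: "set w \<subseteq> letters" and l: "card (Pow ((Sg \<times> Sg) \<times> (Sg \<times> Sg))) < length w"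
  obtains pw where "set pw \<subseteq> letters" "rel_of pw = rel_of w" "n \<le> length pw" "length pw \<le> (n + 1) * length w"
proof -
  let ?f = "\<lambda>i. rel_of (take i w)"
  have "?f ` {1..length w} \<subseteq> Pow ((Sg \<times> Sg) \<times> (Sg \<times> Sg))"
  proof (intro subsetI)
    fix R assume "R \<in> ?f ` {1..length w}"
    then obtain i where i: "1 \<le> i" "i \<le> length w" "R = ?f i" by auto
    have "take i w \<noteq> []" using i by auto
    moreover have "set (take i w) \<subseteq> letters" using w set_take_subset[of i w] by blast
    ultimately show "R \<in> Pow ((Sg \<times> Sg) \<times> (Sg \<times> Sg))" using rel_of_sub i(3) by blast
  qed
  then have "card (?f ` {1..length w}) \<le> card (Pow ((Sg \<times> Sg) \<times> (Sg \<times> Sg)))"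
    using fin by (intro card_mono) auto
  then have "\<not> inj_on ?f {1..length w}" using l card_image[of ?f "{1..length w}"] by auto
  then obtain i j where ij: "i < j" "j \<le> length w" "?f i = ?f j"
    unfolding inj_on_def by (metis atLeastAtMost_iff nat_neq_iff)
  define u v z where "u = take i w" and "v = take (j - i) (drop i w)" and "z = drop j w"
  have wj: "take j w = u @ v" unfolding u_def v_def using ij(1) by (metis le_add_diff_inverse less_imp_le take_add)
  have weq: "w = u @ v @ z" using wj append_take_drop_id[of j w] unfolding z_def by simp
  have lv: "length v = j - i" unfolding v_def using ij by simp
  have ruv: "rel_of u O rel_of v = rel_of u" using ij(3) wj unfolding u_def rel_of_append[symmetric] by metis
  define pw where "pw = u @ concat (replicate n v) @ z"
  have rep: "rel_of u O rel_of (concat (replicate n v)) = rel_of u"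
    by (induction n) (simp_all add: rel_of_append O_assoc[symmetric] ruv)
  have "rel_of pw = rel_of u O rel_of z" unfolding pw_def rel_of_append O_assoc[symmetric] rep ..
  moreover have "rel_of w = rel_of u O rel_of z" unfolding weq rel_of_append O_assoc[symmetric] ruv ..
  ultimately have "rel_of pw = rel_of w" by simp
  moreover have "set pw \<subseteq> letters" using w unfolding pw_def weq by auto
  moreover have lpw: "length pw = length u + n * length v + length z"
    unfolding pw_def by (simp add: length_concat sum_list_replicate)
  moreover have "n \<le> n * length v" using lv ij(1) by (cases "length v") simp_all
  then have "n \<le> length pw" using lpw by linarith
  moreover have "length pw \<le> (n + 1) * length w" unfolding lpw weq by (simp add: algebra_simps)
  ultimately show thesis using that by blast
qed

end

section \<open>Trees with pumped branches\<close>

text \<open>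
  Terms whose variables stand for branches cut at a word; the Boolean tells from which end of the word
  the branch hangs.  Every node of a term is numbered in preorder, and \<open>build\<close> names an ordinary node by its number
  (shifted by \<open>base\<close>) and replaces a variable by the spine that is reserved for its word and number.
\<close>

datatype ('i, 'w) gt = GN 'i "('i, 'w) gt list" | GV 'w bool

primrec gsize :: "('i, 'w) gt \<Rightarrow> nat" where
  "gsize (GN i ts) = Suc (sum_list (map gsize ts))"
| "gsize (GV w b) = 1"

fun build :: "nat \<Rightarrow> ('w \<Rightarrow> nat \<Rightarrow> 'i spine) \<Rightarrow> (nat \<Rightarrow> 'i rt list) \<Rightarrow> nat \<Rightarrow> ('i, 'w) gt \<Rightarrow> 'i rt"
  and builds :: "nat \<Rightarrow> ('w \<Rightarrow> nat \<Rightarrow> 'i spine) \<Rightarrow> (nat \<Rightarrow> 'i rt list) \<Rightarrow> nat \<Rightarrow> ('i, 'w) gt list \<Rightarrow> 'i rt list" where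
  "build base spn pad j (GN i ts) = Rt (base + j) i (builds base spn pad (Suc j) ts)"
| "build base spn pad j (GV w b) = hd (chain (if b then spn w j else rev (spn w j)) (pad j))"
| "builds base spn pad j [] = []"
| "builds base spn pad j (t # ts) = build base spn pad j t # builds base spn pad (j + gsize t) ts"

fun vars :: "nat \<Rightarrow> ('i, 'w) gt \<Rightarrow> (nat \<times> 'w) list" and varss :: "nat \<Rightarrow> ('i, 'w) gt list \<Rightarrow> (nat \<times> 'w) list" where
  "vars j (GN i ts) = varss (Suc j) ts"
| "vars j (GV w b) = [(j, w)]"
| "varss j [] = []"
| "varss j (t # ts) = vars j t @ varss (j + gsize t) ts"

lemma
  fixes t :: "('i, 'w) gt" and ts :: "('i, 'w) gt list"
  shows vars_range: "\<forall>p\<in>set (vars j t). j \<le> fst p \<and> fst p < j + gsize t"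
    and varss_range: "\<forall>p\<in>set (varss j ts). j \<le> fst p \<and> fst p < j + sum_list (map gsize ts)"
  by (induction j t and j ts rule: vars_varss.induct) (fastforce simp: add.assoc)+

lemma
  fixes t :: "('i, 'w) gt" and ts :: "('i, 'w) gt list"
  shows distinct_vars: "distinct (map fst (vars j t))" and distinct_varss: "distinct (map fst (varss j ts))"
proof (induction j t and j ts rule: vars_varss.induct)
  case (4 j t ts)
  have "fst p \<noteq> fst q" if "p \<in> set (vars j t)" "q \<in> set (varss (j + gsize t) ts)" for p q
    using vars_range[of j t] varss_range[of "j + gsize t" ts] that by fastforce
  then show ?case using 4 by fastforce
qed simp_all

lemma length_builds [simp]: "length (builds base spn pad j ts) = length ts"
  by (induction ts arbitrary: j) auto

lemma ids_hd_chain: "sp \<noteq> [] \<Longrightarrow> ids (hd (chain sp rs)) = sids sp @ concat (map ids rs)"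
  using chain_single[of sp rs] ids_chain[of sp rs] by auto

lemma mset_ids_chain:
  "sp \<noteq> [] \<Longrightarrow> mset (ids (hd (chain (if b then sp else rev sp) rs))) = mset (sids sp) + mset (concat (map ids rs))"
  by (cases b) (simp_all add: ids_hd_chain mset_sids_rev del: mset_concat)

text \<open>Padding adds its identifiers at the variables and changes nothing else. Multisets are
  compared since it interrupts the preorder and spines may be reversed.\<close>

lemma
  fixes t :: "('i, 'w) gt" and ts :: "('i, 'w) gt list"
  assumes ne: "\<And>w j. spn w j \<noteq> []"
  shows mset_build_pad: "mset (ids (build base spn pad j t)) = mset (ids (build base spn (\<lambda>_. []) j t)) +
      sum_list (map (\<lambda>p. mset (concat (map ids (pad (fst p))))) (vars j t))"
    and mset_builds_pad: "mset (concat (map ids (builds base spn pad j ts))) =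
      mset (concat (map ids (builds base spn (\<lambda>_. []) j ts))) +
      sum_list (map (\<lambda>p. mset (concat (map ids (pad (fst p))))) (varss j ts))"
proof (induction j t and j ts rule: vars_varss.induct)
  case (2 j w b)
  have "mset (ids (hd (chain (if b then spn w j else rev (spn w j)) (pad j)))) =
    mset (ids (hd (chain (if b then spn w j else rev (spn w j)) []))) + mset (concat (map ids (pad j)))"
    unfolding mset_ids_chain[OF ne] by simp
  then show ?case by simp
qed (simp_all add: ac_simps del: mset_concat)

lemma sum_list_single:
  assumes "distinct (map fst ps)" "m \<in> fst ` set ps"
  shows "sum_list (map (\<lambda>p. if fst p = m then Q else {#}) ps) = (Q :: 'a multiset)"
  using assms
proof (induction ps)
  case (Cons p ps)
  show ?case
  proof (cases "fst p = m")
    case True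
    have "\<forall>q\<in>set ps. fst q \<noteq> m"
    proof
      fix q assume "q \<in> set ps"
      then have "fst q \<in> fst ` set ps" by blast
      moreover have "fst p \<notin> fst ` set ps" using Cons.prems(1) by simp
      ultimately show "fst q \<noteq> m" using True by metis
    qed
    then have "map (\<lambda>p. if fst p = m then Q else {#}) ps = map (\<lambda>_. {#}) ps" by (intro map_cong) auto
    then have "sum_list (map (\<lambda>p. if fst p = m then Q else {#}) ps) = {#}" by (simp only: sum_list_0)
    then show ?thesis using True by simp
  next
    case False
    then show ?thesis using Cons by auto
  qed
qed simp

primrec gok :: "('i, 'w) gt \<Rightarrow> 'i set \<Rightarrow> nat \<Rightarrow> 'w set \<Rightarrow> bool" where
  "gok (GN i ts) I d W \<longleftrightarrow> i \<in> I \<and> length ts < d \<and> (\<forall>f\<in>set (map gok ts). f I d W)"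
| "gok (GV w b) I d W \<longleftrightarrow> w \<in> W"

text \<open>For each preorder number one ordinary name and one spine per word are set aside.
  Distinct numbers then use disjoint names, whichever term of the given size is built.\<close>

definition reserved :: "nat \<Rightarrow> ('w \<Rightarrow> nat \<Rightarrow> 'i spine) \<Rightarrow> 'w set \<Rightarrow> nat \<Rightarrow> nat set" where
  "reserved base spn W m = insert (base + m) (\<Union>w\<in>W. set (sids (spn w m)))"

lemma
  fixes t :: "('i, 'w) gt" and ts :: "('i, 'w) gt list"
  assumes ne: "\<And>w j. spn w j \<noteq> []" and d: "\<And>w m. distinct (sids (spn w m))"
    and dis: "\<And>m m'. m < m' \<Longrightarrow> m' < n \<Longrightarrow> reserved base spn W m \<inter> reserved base spn W m' = {}"
  shows build_ids: "gok t I dd W \<Longrightarrow> j + gsize t \<le> n \<Longrightarrow> distinct (ids (build base spn (\<lambda>_. []) j t)) \<and>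
      set (ids (build base spn (\<lambda>_. []) j t)) \<subseteq> (\<Union>m\<in>{j..<j + gsize t}. reserved base spn W m)"
    and builds_ids: "\<forall>t\<in>set ts. gok t I dd W \<Longrightarrow> j + sum_list (map gsize ts) \<le> n \<Longrightarrow>
      distinct (concat (map ids (builds base spn (\<lambda>_. []) j ts))) \<and>
      set (concat (map ids (builds base spn (\<lambda>_. []) j ts))) \<subseteq>
        (\<Union>m\<in>{j..<j + sum_list (map gsize ts)}. reserved base spn W m)"
proof (induction j t and j ts rule: vars_varss.induct)
  case (1 j i ts)
  let ?L = "concat (map ids (builds base spn (\<lambda>_. []) (Suc j) ts))"
  have IH: "distinct ?L" "set ?L \<subseteq> (\<Union>m\<in>{Suc j..<Suc j + sum_list (map gsize ts)}. reserved base spn W m)"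
    using 1 by auto
  have "base + j \<notin> reserved base spn W m" if "m \<in> {Suc j..<Suc j + sum_list (map gsize ts)}" for m
    using dis[of j m] that 1(3) unfolding reserved_def[of _ _ _ j] by auto
  then have "base + j \<notin> set ?L" using IH(2) by blast
  moreover have "set ?L \<subseteq> (\<Union>m\<in>{j..<j + gsize (GN i ts)}. reserved base spn W m)"
    using IH(2) by (rule order_trans) (intro UN_mono, auto)
  moreover have "base + j \<in> (\<Union>m\<in>{j..<j + gsize (GN i ts)}. reserved base spn W m)"
    unfolding reserved_def by auto
  ultimately show ?case using IH(1) by simp
next
  case (2 j w b)
  have "mset (ids (hd (chain (if b then spn w j else rev (spn w j)) []))) = mset (sids (spn w j))"
    using mset_ids_chain[OF ne, of b w j "[]"] by simp
  then have "distinct (ids (build base spn (\<lambda>_. []) j (GV w b)))" "set (ids (build base spn (\<lambda>_. []) j (GV w b))) = set (sids (spn w j))"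
    using d[of w j] mset_eq_imp_distinct_iff mset_eq_setD by (metis build.simps(2))+
  then show ?case using 2 unfolding reserved_def by auto
next
  case (4 j t ts)
  let ?A = "ids (build base spn (\<lambda>_. []) j t)" and ?B = "concat (map ids (builds base spn (\<lambda>_. []) (j + gsize t) ts))"
  have A: "distinct ?A" "set ?A \<subseteq> (\<Union>m\<in>{j..<j + gsize t}. reserved base spn W m)" using 4 by auto
  have B: "distinct ?B" "set ?B \<subseteq> (\<Union>m\<in>{j + gsize t..<j + gsize t + sum_list (map gsize ts)}. reserved base spn W m)"
    using 4 by auto
  have "reserved base spn W m \<inter> reserved base spn W m' = {}"
    if "m \<in> {j..<j + gsize t}" "m' \<in> {j + gsize t..<j + gsize t + sum_list (map gsize ts)}" for m m'
    using dis[of m m'] that 4(4) by auto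
  then have "set ?A \<inter> set ?B = {}" using A(2) B(2) by blast
  moreover have "set ?A \<subseteq> (\<Union>m\<in>{j..<j + sum_list (map gsize (t # ts))}. reserved base spn W m)"
    using A(2) by (rule order_trans) (intro UN_mono, auto)
  moreover have "set ?B \<subseteq> (\<Union>m\<in>{j..<j + sum_list (map gsize (t # ts))}. reserved base spn W m)"
    using B(2) by (rule order_trans) (intro UN_mono, auto)
  ultimately show ?case using A(1) B(1) by simp
qed simp

lemma
  fixes t :: "('i, 'w) gt" and ts :: "('i, 'w) gt list"
  shows build_pure_ids: "vars j t = [] \<Longrightarrow> ids (build base spn pad j t) = [base + j..<base + j + gsize t]"
    and builds_pure_ids: "varss j ts = [] \<Longrightarrow> concat (map ids (builds base spn pad j ts)) =
      [base + j..<base + j + sum_list (map gsize ts)]"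
proof (induction j t and j ts rule: vars_varss.induct)
  case (1 j i ts)
  then show ?case by (simp add: upt_conv_Cons del: upt_Suc)
next
  case (4 j t ts)
  then show ?case using upt_append_add[of "base + j" "gsize t" "sum_list (map gsize ts)"]
    by (simp add: add.assoc)
qed simp_all

context edge_problem begin

lemma
  fixes t :: "('i, 'w) gt" and ts :: "('i, 'w) gt list"
  assumes ne: "\<And>w j. spn w j \<noteq> []"
    and sp: "\<And>w m e. w \<in> W \<Longrightarrow> e \<in> set (spn w m) \<Longrightarrow> fst (snd e) \<in> Inp \<and> length (snd (snd e)) + 2 \<le> \<Delta> \<and>
      (\<forall>t\<in>set (snd (snd e)). rok t)"
    and pad: "\<And>m t. t \<in> set (pad m) \<Longrightarrow> rok t" "\<And>m. length (pad m) \<le> 1"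
  shows build_rok: "gok t Inp \<Delta> W \<Longrightarrow> rok (build base spn pad j t)"
    and builds_rok: "\<forall>t\<in>set ts. gok t Inp \<Delta> W \<Longrightarrow> \<forall>t\<in>set (builds base spn pad j ts). rok t"
proof (induction j t and j ts rule: vars_varss.induct)
  case (1 j i ts)
  then show ?case by (auto simp: list_all_iff)
next
  case (2 j w b)
  let ?sp = "if b then spn w j else rev (spn w j)"
  have "?sp \<noteq> []" using ne[of w j] by auto
  then obtain t where t: "chain ?sp (pad j) = [t]" using chain_single by blast
  have wW: "w \<in> W" using 2 by simp
  have "set ?sp = set (spn w j)" by simp
  then have "fst (snd e) \<in> Inp \<and> length (snd (snd e)) + 2 \<le> \<Delta> \<and> (\<forall>t\<in>set (snd (snd e)). rok t)"
    if "e \<in> set ?sp" for e using sp[OF wW] that by blast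
  then have "\<forall>t\<in>set (chain ?sp (pad j)). rok t"
    by (intro conjunct2[OF rok_chain]) (use pad in blast)+
  then show ?case using t by simp
qed auto

primrec gty :: "('w \<Rightarrow> ('s \<times> 's) set \<times> ('s \<times> 's) set) \<Rightarrow> ('i, 'w) gt \<Rightarrow> ('s \<times> 's) set" where
  "gty g (GN i ts) = branch_type i (map (gty g) ts)"
| "gty g (GV w b) = (if b then fst (g w) else snd (g w))"

text \<open>The induction of \<open>placed_type\<close>, with \<open>H\<close> in place of the
  argument for pumped branches.\<close>

lemma
  fixes t :: "('i, 'w) gt" and ts :: "('i, 'w) gt list"
  assumes H: "\<And>m w b x. w \<in> W \<Longrightarrow> m < n \<Longrightarrow>
      placed nb inp x (hd (chain (if b then spn w m else rev (spn w m)) (pad m))) \<Longrightarrow>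
      solution (set (ids (hd (chain (if b then spn w m else rev (spn w m)) (pad m))))) nb inp out \<sigma> \<Longrightarrow>
      es \<sigma> x (rid (hd (chain (if b then spn w m else rev (spn w m)) (pad m)))) \<in> (if b then fst (g w) else snd (g w))"
  shows build_type: "gok t Inp \<Delta> W \<Longrightarrow> j + gsize t \<le> n \<Longrightarrow> placed nb inp x (build base spn pad j t) \<Longrightarrow>
      solution (set (ids (build base spn pad j t))) nb inp out \<sigma> \<Longrightarrow>
      es \<sigma> x (rid (build base spn pad j t)) \<in> gty g t"
    and builds_type: "\<forall>t\<in>set ts. gok t Inp \<Delta> W \<Longrightarrow> j + sum_list (map gsize ts) \<le> n \<Longrightarrow>
      \<forall>s\<in>set (builds base spn pad j ts). placed nb inp x s \<and> solution (set (ids s)) nb inp out \<sigma> \<Longrightarrow>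
      list_all2 (\<in>) (map (\<lambda>s. es \<sigma> x (rid s)) (builds base spn pad j ts)) (map (gty g) ts)"
proof (induction j t and j ts arbitrary: x and x rule: vars_varss.induct)
  case (1 j i ts)
  let ?ss = "builds base spn pad (Suc j) ts" and ?y = "base + j"
  have p: "nb ?y = insert x (rid ` set ?ss)" "x \<notin> rid ` set ?ss" "distinct (map rid ?ss)" "inp ?y = i"
    "\<forall>s\<in>set ?ss. placed nb inp ?y s" using "1.prems"(3) by auto
  have ss: "\<forall>s\<in>set ?ss. solution (set (ids s)) nb inp out \<sigma>"
    using solution_mono[OF "1.prems"(4)] by auto
  have l: "list_all2 (\<in>) (map (\<lambda>s. es \<sigma> ?y (rid s)) ?ss) (map (gty g) ts)"
    using "1.IH"[of ?y] "1.prems"(1,2) p(5) ss by simp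
  \<comment> \<open>Singletons pin the states of the children down. They can then be matched with
    the types of the terms, which belong to a different list.\<close>
  define T where "T s = {es \<sigma> ?y (rid s)}" for s :: "'i rt"
  have "es \<sigma> x ?y \<in> branch_type (inp ?y) (map T ?ss)"
    by (rule node_in_branch_type[OF solution_mono[OF "1.prems"(4)]]) (use p in \<open>auto simp: T_def\<close>)
  then obtain out' l' where l': "es \<sigma> x ?y \<in> Sg \<times> Sg" "list_all2 (\<in>) l' (map T ?ss)"
    "nok (inp ?y) out' (mset (prod.swap (es \<sigma> x ?y) # l'))"
    unfolding branch_type_def by (elim CollectE conjE exE) (rule that)
  have "l' = map (\<lambda>s. es \<sigma> ?y (rid s)) ?ss"
    using l'(2) unfolding T_def by (auto simp: list_all2_conv_all_nth intro!: nth_equalityI)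
  then have "es \<sigma> x ?y \<in> branch_type i (map (gty g) ts)"
    using l'(1,3) l p(4) unfolding branch_type_def by (intro CollectI conjI exI[of _ out'] exI[of _ l']) auto
  then show ?case by simp
next
  case (2 j w b)
  then show ?case using H[of w j x b] by simp
qed simp_all

lemma gen_gt:
  assumes "t \<in> gen (cut_types l g)" shows "\<exists>\<gamma>. gok \<gamma> Inp \<Delta> (words l) \<and> gty g \<gamma> = t"
  using assms
proof (induction rule: gen.induct)
  case (base t)
  then obtain w where w: "w \<in> words l" "t = fst (g w) \<or> t = snd (g w)" unfolding cut_types_def by auto
  then show ?case
  proof (elim disjE)
    assume "t = fst (g w)"
    then show ?thesis using w(1) by (intro exI[of _ "GV w True"]) simp
  next
    assume "t = snd (g w)"
    then show ?thesis using w(1) by (intro exI[of _ "GV w False"]) simp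
  qed
next
  case (node i ts)
  then have "\<forall>t\<in>set ts. \<exists>\<gamma>. gok \<gamma> Inp \<Delta> (words l) \<and> gty g \<gamma> = t" by blast
  then obtain f where f: "\<And>t. t \<in> set ts \<Longrightarrow> gok (f t) Inp \<Delta> (words l) \<and> gty g (f t) = t" by metis
  have "gok (GN i (map f ts)) Inp \<Delta> (words l)" using node f by auto
  moreover have "gty g (GN i (map f ts)) = branch_type i ts" using f by (simp add: map_idI cong: map_cong)
  ultimately show ?case by blast
qed

end

section \<open>Feasibility from a sublinear algorithm\<close>

text \<open>The view in a tree whose nodes are their own identifiers. It makes sense for any
  neighbourhood function, and \<open>mid_state\<close> uses it where only a spine and symmetry are
  known.\<close>

definition nb_view :: "nat \<Rightarrow> (nat \<Rightarrow> nat set) \<Rightarrow> (nat \<Rightarrow> 'i) \<Rightarrow> nat \<Rightarrow> nat \<Rightarrow> 'i view" where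
  "nb_view n nb inp t v = \<lparr>view_size = n,
     view_graph = \<lparr>pverts = ball nb t v,
       parcs = {(x, y). y \<in> nb x \<and> (\<exists>k<t. x \<in> ball nb k v \<or> y \<in> ball nb k v)}\<rparr>,
     view_centre = v, view_info = (\<lambda>u. (u, card (nb u), inp u)) ` ball nb t v\<rparr>"

lemma view_of_digraph:
  assumes T: "utree V nb" and v: "v \<in> V"
  shows "view_of (digraph_of V nb) (\<lambda>u. u) inp t v = nb_view (card V) nb inp t v"
proof -
  have T': "utree (pverts (digraph_of V nb)) (nbr (digraph_of V nb))" using T by simp
  have v': "v \<in> pverts (digraph_of V nb)" using v by simp
  have "(x, y) \<in> parcs (digraph_of V nb) \<longleftrightarrow> y \<in> nb x" for x y by (simp add: digraph_of_def)
  then show ?thesis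
    unfolding view_of_def nb_view_def nodes_within_ball[OF T' v'] gdist_less[OF v'] degree_nbr by auto
qed

lemma agree_nb_view:
  assumes ag: "agree (Suc t) v nb inp nb' inp'"
    and sym: "\<And>x y. y \<in> nb x \<Longrightarrow> x \<in> nb y" "\<And>x y. y \<in> nb' x \<Longrightarrow> x \<in> nb' y"
  shows "nb_view n nb inp t v = nb_view n nb' inp' t v"
proof -
  have ball: "ball nb k v = ball nb' k v" if "k \<le> t" for k using agree_ball[OF ag] that by simp
  have same: "nb x = nb' x \<and> inp x = inp' x" if "k \<le> t" "x \<in> ball nb k v" for k x
    using agreeD[OF ag _ that(2)] that(1) by simp
  have "y \<in> nb x \<and> (\<exists>k<t. x \<in> ball nb k v \<or> y \<in> ball nb k v) \<longleftrightarrow>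
      y \<in> nb' x \<and> (\<exists>k<t. x \<in> ball nb' k v \<or> y \<in> ball nb' k v)" (is "?l \<longleftrightarrow> ?r") for x y
  proof
    assume ?l
    then obtain k where k: "y \<in> nb x" "k < t" "x \<in> ball nb k v \<or> y \<in> ball nb k v" by blast
    then have "y \<in> nb' x" using same[of k x] same[of k y] sym(1)[of y x] sym(2)[of x y] by auto
    then show ?r using k ball[of k] by auto
  next
    assume ?r
    then obtain k where k: "y \<in> nb' x" "k < t" "x \<in> ball nb k v \<or> y \<in> ball nb k v" using ball by (metis less_imp_le)
    then have "y \<in> nb x" using same[of k x] same[of k y] sym(2)[of y x] sym(1)[of x y] by auto
    then show ?l using k by auto
  qed
  moreover have "(\<lambda>u. (u, card (nb u), inp u)) ` ball nb t v = (\<lambda>u. (u, card (nb' u), inp' u)) ` ball nb' t v"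
    unfolding ball[OF order_refl, symmetric] using same[of t] by (intro image_cong) auto
  ultimately show ?thesis unfolding nb_view_def using ball[of t] by simp
qed

lemma unf_agree:
  assumes "agree d v nb inp nb' inp'" "\<And>u. u \<in> ball nb d v \<Longrightarrow> lab u = lab' u"
  shows "unf d nb lab v p = unf d nb' lab' v p"
  using assms
proof (induction d arbitrary: v p)
  case (Suc d)
  have nbv: "nb v = nb' v" using agree_nb[OF Suc.prems(1)] by simp
  have "unf d nb lab z v = unf d nb' lab' z v" if z: "z \<in> nb v" for z
  proof (rule Suc.IH)
    show "agree d z nb inp nb' inp'" by (rule agree_step[OF Suc.prems(1) z])
    show "lab u = lab' u" if "u \<in> ball nb d z" for u
      using Suc.prems(2) z that unfolding ball_Suc_left by blast
  qed
  then have "image_mset (\<lambda>z. unf d nb lab z v) (mset_set (nb v - {p})) =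
      image_mset (\<lambda>z. unf d nb' lab' z v) (mset_set (nb v - {p}))"
    by (cases "finite (nb v - {p})") (auto intro!: image_mset_cong)
  moreover have "lab v = lab' v" using Suc.prems(2) by simp
  ultimately show ?case using nbv by simp
qed simp

lemma valid_labelling_cong:
  assumes v: "valid_labelling P T inp out" and e: "\<And>v. v \<in> pverts T \<Longrightarrow> out v = out' v"
  shows "valid_labelling P T inp out'"
  unfolding valid_labelling_def
proof (intro ballI conjI)
  fix x assume x: "x \<in> pverts T"
  then show "out' x \<in> out_labels P" using v e[OF x] unfolding valid_labelling_def by auto
  obtain H where H: "H \<in> constraints P" "centred_iso (labelled_ball T inp out (radius P) x) H"
    using v x unfolding valid_labelling_def by blast
  obtain f where "bij_betw f (nodes_within T (radius P) x) (pverts (cgraph H))"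
     "\<forall>u\<in>nodes_within T (radius P) x. \<forall>v\<in>nodes_within T (radius P) x.
        (u, v) \<in> parcs T \<inter> nodes_within T (radius P) x \<times> nodes_within T (radius P) x \<longleftrightarrow> (f u, f v) \<in> parcs (cgraph H)"
     "f x = centre H" and l: "\<forall>u\<in>nodes_within T (radius P) x. (inp u, out u) = labels H (f u)"
    using H(2) unfolding centred_iso_def labelled_ball_def by auto
  moreover have "\<forall>u\<in>nodes_within T (radius P) x. (inp u, out' u) = labels H (f u)"
    using l e unfolding nodes_within_def by fastforce
  ultimately have "centred_iso (labelled_ball T inp out' (radius P) x) H"
    unfolding centred_iso_def labelled_ball_def by (intro exI[of _ f]) simp
  then show "\<exists>H\<in>constraints P. centred_iso (labelled_ball T inp out' (radius P) x) H" using H(1) by blast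
qed

locale lcl_trees =
  fixes P :: "('i, 'o) lcl" and \<Delta> :: nat
  assumes lcl: "is_lcl P"
begin

sublocale edge_problem "lcl_nok P" "in_labels P" "states P \<Delta> (radius P)" \<Delta> .

abbreviation "Sg \<equiv> states P \<Delta> (radius P)"

lemma fin_Sg: "finite Sg" by (rule finite_states[OF lcl])

lemma fin_letters: "finite letters"
proof -
  have "letters \<subseteq> Pow ((Sg \<times> Sg) \<times> (Sg \<times> Sg))" using letters_sub by blast
  then show ?thesis using fin_Sg by (meson finite_Pow_iff finite_SigmaI finite_subset)
qed

lemma fin_words: "finite (words l)"
  unfolding words_def by (rule finite_lists_length_eq[OF fin_letters])

definition run_out where
  "run_out A t n nb inp u = A (nb_view n nb inp t u)"

definition run_states where
  "run_states A t n nb inp = unf (radius P) nb (\<lambda>u. (inp u, run_out A t n nb inp u))"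

lemma run_solution:
  assumes solves: "solves_in c \<Delta> P A t" and c: "1 \<le> c"
    and d: "distinct (ids (Rt x i ts))" and i: "i \<in> in_labels P" "length ts \<le> \<Delta>" "\<And>s. s \<in> set ts \<Longrightarrow> rok s"
    and rng: "set (ids (Rt x i ts)) \<subseteq> {1..length (ids (Rt x i ts))}"
  defines "r \<equiv> Rt x i ts" and "n \<equiv> length (ids (Rt x i ts))"
  shows "solution (set (ids r)) (rnb r) (rinp r) (run_out A (t n) n (rnb r) (rinp r)) (run_states A (t n) n (rnb r) (rinp r))"
proof -
  let ?V = "set (ids r)" and ?nb = "rnb r" and ?inp = "rinp r"
  let ?out = "run_out A (t n) n ?nb ?inp"
  let ?T = "digraph_of ?V ?nb"
  have ut: "utree ?V ?nb" using rt_utree d unfolding r_def by blast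
  interpret utree ?V ?nb by (rule ut)
  have degI: "card (?nb u) \<le> \<Delta> \<and> ?inp u \<in> in_labels P" if u: "u \<in> ?V" for u
  proof (cases "u = x")
    case True
    then show ?thesis using card_rnb_root[OF d] root_nb(2)[OF d] i unfolding r_def by simp
  next
    case False
    then obtain s where s: "s \<in> set ts" "u \<in> set (ids s)" using u unfolding r_def by auto
    show ?thesis using placed_deg[OF i(3)[OF s(1)] placed_children[OF d s(1)] s(2)] unfolding r_def .
  qed
  have n: "card ?V = n" using d distinct_card unfolding r_def n_def by blast
  have tree: "is_tree ?T" by (rule utree_is_tree[OF ut])
  have "?T \<in> trees \<Delta>" unfolding trees_def using tree degI degree_nbr[of ?T] by simp
  moreover have "?inp ` pverts ?T \<subseteq> in_labels P" using degI by auto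
  moreover have "identifiers c ?T (\<lambda>u. u)"
  proof -
    \<comment> \<open>\<open>1 \<le> c\<close> makes the names \<open>1\<close> to \<open>n\<close>
      legal identifiers.\<close>
    have "n \<le> n ^ c" using c by (cases "n = 0") (auto intro: self_le_power)
    then show ?thesis using rng n unfolding identifiers_def r_def n_def by auto
  qed
  ultimately have "valid_labelling P ?T ?inp (\<lambda>v. A (view_of ?T (\<lambda>u. u) ?inp (t (card (pverts ?T))) v))"
    using solves unfolding solves_in_def by blast
  then have "valid_labelling P ?T ?inp (\<lambda>v. A (view_of ?T (\<lambda>u. u) ?inp (t n) v))" using n by simp
  moreover have e: "A (view_of ?T (\<lambda>u. u) ?inp (t n) v) = ?out v" if "v \<in> ?V" for v
    unfolding run_out_def view_of_digraph[OF ut that] n ..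
  ultimately have val: "valid_labelling P ?T ?inp ?out"
    by (intro valid_labelling_cong[OF _ e]) simp_all
  have outl: "?out v \<in> out_labels P" if "v \<in> ?V" for v using val that unfolding valid_labelling_def by simp
  show ?thesis unfolding solution_def
  proof (intro ballI conjI)
    fix u assume u: "u \<in> ?V"
    show "lcl_nok P (?inp u) (?out u) (image_mset (es (run_states A (t n) n ?nb ?inp) u) (mset_set (?nb u)))"
      using valid_lcl_nok[OF tree val, of u] u unfolding run_states_def by simp
    fix v assume v: "v \<in> ?nb u"
    have "v \<in> ?V" using v nb_sub by blast
    then show "es (run_states A (t n) n ?nb ?inp) u v \<in> Sg \<times> Sg"
      unfolding es_def run_states_def using u degI outl by (auto intro!: unf_states)
  qed
qed

text \<open>A state is an unfolding of depth \<open>radius P\<close> labelled with outputs, and each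
  output looks up to distance \<open>t\<close>. The additional step covers the degrees of the nodes
  at the rim of a view.\<close>

lemma run_states_agree:
  assumes ag: "agree (radius P + t + 1) v nb inp nb' inp'"
    and sym: "\<And>x y. y \<in> nb x \<Longrightarrow> x \<in> nb y" "\<And>x y. y \<in> nb' x \<Longrightarrow> x \<in> nb' y"
  shows "run_states A t n nb inp v p = run_states A t n nb' inp' v p"
  unfolding run_states_def
proof (rule unf_agree)
  show "agree (radius P) v nb inp nb' inp'" by (rule agree_mono[OF ag]) simp
  fix u assume u: "u \<in> ball nb (radius P) v"
  have "agree (Suc t) u nb inp nb' inp'" by (rule agree_mono[OF agree_shift[OF ag u]]) simp
  then show "(inp u, run_out A t n nb inp u) = (inp' u, run_out A t n nb' inp' u)"
    using agree_nb_view[OF _ sym] agree_nb[of "Suc t" u nb inp nb' inp'] unfolding run_out_def by fastforce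
qed

text \<open>The edge state that the algorithm produces in the middle of a spine, in any tree containing it.\<close>

definition mid_state where
  "mid_state A t n h sp = (let p = (SOME p. spined (fst p) (snd p) sp \<and> (\<forall>x y. y \<in> fst p x \<longrightarrow> x \<in> fst p y))
     in es (run_states A t n (fst p) (snd p)) (fst (sp ! h)) (fst (sp ! Suc h)))"

text \<open>Around both ends of the middle edge all symmetric structures containing the spine agree,
  so the one taken by \<open>SOME\<close> gives the same state as the tree at hand.\<close>

lemma mid_state:
  assumes sp: "spined nb inp sp" and sym: "\<And>x y. y \<in> nb x \<Longrightarrow> x \<in> nb y"
    and h: "radius P + t + 1 \<le> h" "Suc h + (radius P + t + 1) < length sp"
  shows "es (run_states A t n nb inp) (fst (sp ! h)) (fst (sp ! Suc h)) = mid_state A t n h sp"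
proof -
  define p where "p = (SOME p. spined (fst p) (snd p) sp \<and> (\<forall>x y. y \<in> fst p x \<longrightarrow> x \<in> fst p y))"
  have "\<exists>p. spined (fst p) (snd p) sp \<and> (\<forall>x y. y \<in> fst p x \<longrightarrow> x \<in> fst p y)"
    using sp sym by (intro exI[of _ "(nb, inp)"]) auto
  then have "spined (fst p) (snd p) sp \<and> (\<forall>x y. y \<in> fst p x \<longrightarrow> x \<in> fst p y)"
    unfolding p_def by (rule someI_ex)
  then have p: "spined (fst p) (snd p) sp" "\<And>x y. y \<in> fst p x \<Longrightarrow> x \<in> fst p y" by blast+
  have 1: "agree (radius P + t + 1) (fst (sp ! h)) nb inp (fst p) (snd p)"
    by (rule spined_agree[OF sp p(1)]) (use h in auto)
  have 2: "agree (radius P + t + 1) (fst (sp ! Suc h)) nb inp (fst p) (snd p)"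
    by (rule spined_agree[OF sp p(1)]) (use h in auto)
  have "run_states A t n nb inp (fst (sp ! h)) q = run_states A t n (fst p) (snd p) (fst (sp ! h)) q"
    "run_states A t n nb inp (fst (sp ! Suc h)) q = run_states A t n (fst p) (snd p) (fst (sp ! Suc h)) q" for q
    by (rule run_states_agree[OF 1 sym p(2)] run_states_agree[OF 2 sym p(2)]; assumption)+
  then show ?thesis unfolding mid_state_def Let_def p_def[symmetric] es_def by (intro arg_cong2[of _ _ _ _ Pair])
qed

lemma closable_of_solution:
  assumes d: "distinct (ids (Rt x i ss))"
    and sol: "solution (set (ids (Rt x i ss))) (rnb (Rt x i ss)) (rinp (Rt x i ss)) out \<sigma>"
    and l: "list_all2 (\<in>) (map (\<lambda>s. es \<sigma> x (rid s)) ss) ts"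
  shows "closable i ts"
proof -
  have dr: "distinct (map rid ss)" using distinct_rids d by auto
  have "mset_set (rnb (Rt x i ss) x) = mset (map rid ss)"
    unfolding root_nb(1)[OF d] using mset_set_set[OF dr] by simp
  then have "lcl_nok P i (out x) (mset (map (\<lambda>s. es \<sigma> x (rid s)) ss))"
    using sol root_nb(2)[OF d] unfolding solution_def by (auto simp: multiset.map_comp o_def)
  then show ?thesis using l unfolding closable_def by blast
qed

text \<open>Surplus identifiers are used up by a path, which requires degree 2 only.\<close>

fun pad_path :: "'i \<Rightarrow> nat list \<Rightarrow> 'i rt list" where
  "pad_path i [] = []"
| "pad_path i (q # qs) = [Rt q i (pad_path i qs)]"

lemma ids_pad_path: "concat (map ids (pad_path i qs)) = qs"
  by (induction qs) auto

lemma pad_path_ok: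
  assumes "i \<in> in_labels P" "2 \<le> \<Delta>"
  shows "length (pad_path i qs) \<le> 1 \<and> (\<forall>t\<in>set (pad_path i qs). rok t)"
  using assms by (induction qs) (auto simp: list_all_iff)

end

lemma gok_pure:
  fixes t :: "('i, 'w) gt" and ts :: "('i, 'w) gt list"
  shows "vars j t = [] \<Longrightarrow> gok t I d W \<Longrightarrow> gok t I d {}"
    and "varss j ts = [] \<Longrightarrow> \<forall>t\<in>set ts. gok t I d W \<Longrightarrow> \<forall>t\<in>set ts. gok t I d {}"
  by (induction j t and j ts rule: vars_varss.induct) auto

lemma gok_no_words:
  fixes t :: "('i, 'w) gt" and ts :: "('i, 'w) gt list"
  shows "gok t I d {} \<Longrightarrow> vars j t = []"
    and "\<forall>t\<in>set ts. gok t I d {} \<Longrightarrow> varss j ts = []"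
  by (induction j t and j ts rule: vars_varss.induct) auto

lemma sum_list_le: "(\<And>x. x \<in> set xs \<Longrightarrow> f x \<le> (Z::nat)) \<Longrightarrow> sum_list (map f xs) \<le> Z * length xs"
  by (induction xs) (auto simp: add_mono)

section \<open>Feasibility for terms of bounded size\<close>

context lcl_trees begin

text \<open>The bound on the size, root included, allows the number of nodes of the assembled tree
  and its identifier blocks to be fixed before the term is given.\<close>

definition feasible_upto where
  "feasible_upto l g K0 \<longleftrightarrow>
     (\<forall>w\<in>words l. \<forall>a\<in>fst (g w). \<forall>b\<in>snd (g w). (a, prod.swap b) \<in> rel_of w) \<and>
     (\<forall>i\<in>in_labels P. \<forall>\<gamma>s. (\<forall>\<gamma>\<in>set \<gamma>s. gok \<gamma> (in_labels P) \<Delta> (words l)) \<longrightarrow> length \<gamma>s \<le> \<Delta> \<longrightarrow>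
        Suc (sum_list (map gsize \<gamma>s)) \<le> K0 \<longrightarrow> closable i (map (gty g) \<gamma>s))"

lemma feasible_upto_closable:
  assumes "feasible_upto l g K0" "i \<in> in_labels P" "\<forall>\<gamma>\<in>set \<gamma>s. gok \<gamma> (in_labels P) \<Delta> (words l)" "length \<gamma>s \<le> \<Delta>"
    "Suc (sum_list (map gsize \<gamma>s)) \<le> K0"
  shows "closable i (map (gty g) \<gamma>s)"
  using assms unfolding feasible_upto_def by blast

lemma feasible_upto_antimono: "feasible_upto l g K0 \<Longrightarrow> K1 \<le> K0 \<Longrightarrow> feasible_upto l g K1"
  unfolding feasible_upto_def by (meson order_trans)

lemma feasible_upto_feasible: assumes "\<And>K0. feasible_upto l g K0" shows "feasible l g"
  unfolding feasible_def
proof (intro conjI ballI allI impI)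
  show "(a, prod.swap b) \<in> rel_of w" if "w \<in> words l" "a \<in> fst (g w)" "b \<in> snd (g w)" for w a b
    using assms[of 0] that unfolding feasible_upto_def by blast
  fix i ts assume i: "i \<in> in_labels P" and ts: "set ts \<subseteq> gen (cut_types l g)" "length ts \<le> \<Delta>"
  have "\<forall>t\<in>set ts. \<exists>\<gamma>. gok \<gamma> (in_labels P) \<Delta> (words l) \<and> gty g \<gamma> = t" using gen_gt ts(1) by blast
  then obtain f where f: "\<And>t. t \<in> set ts \<Longrightarrow> gok (f t) (in_labels P) \<Delta> (words l) \<and> gty g (f t) = t" by metis
  have "closable i (map (gty g) (map f ts))"
    by (rule feasible_upto_closable[OF assms i]) (use f ts(2) in auto)
  moreover have "map (gty g) (map f ts) = ts" using f by (simp add: map_idI)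
  ultimately show "closable i ts" by simp
qed

text \<open>Fixing the values outside \<open>words l\<close> leaves only finitely many
  candidates.\<close>

definition cut_pairs where
  "cut_pairs l = {g. (\<forall>w\<in>words l. g w \<in> Pow (Sg \<times> Sg) \<times> Pow (Sg \<times> Sg)) \<and> (\<forall>w. w \<notin> words l \<longrightarrow> g w = ({}, {}))}"

lemma fin_cut_pairs: "finite (cut_pairs l)"
proof -
  have "cut_pairs l = {g. \<forall>w. (w \<in> words l \<longrightarrow> g w \<in> Pow (Sg \<times> Sg) \<times> Pow (Sg \<times> Sg)) \<and>
      (w \<notin> words l \<longrightarrow> g w = ({}, {}))}"
    unfolding cut_pairs_def by blast
  moreover have "finite (Pow (Sg \<times> Sg) \<times> Pow (Sg \<times> Sg))" using fin_Sg by simp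
  ultimately show ?thesis using finite_set_of_finite_funs[OF fin_words] by simp
qed

text \<open>A term without variables has no spine to hide padding behind, but its preorder numbers
  already form an interval starting at 1, and the algorithm can be run on it directly.\<close>

lemma build_closable_pure:
  fixes \<gamma>s :: "('i, 'w) gt list"
  assumes solves: "solves_in c \<Delta> P A t" and c: "1 \<le> c"
    and i: "i \<in> in_labels P" and ok: "\<forall>\<gamma>\<in>set \<gamma>s. gok \<gamma> (in_labels P) \<Delta> W" and len: "length \<gamma>s \<le> \<Delta>"
    and pure: "varss 1 \<gamma>s = []"
  shows "closable i (map (gty g) \<gamma>s)"
proof -
  define spn where "spn = (\<lambda>(_ :: 'w) (_ :: nat). [(0 :: nat, i, [] :: 'i rt list)])"
  let ?ss = "builds 1 spn (\<lambda>_. []) 1 \<gamma>s"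
  let ?r = "Rt 1 i ?ss"
  let ?n = "length (ids ?r)"
  have ids: "ids ?r = [1..<2 + sum_list (map gsize \<gamma>s)]"
    using builds_pure_ids[OF pure, of 1 spn "\<lambda>_. []"] by (simp add: upt_conv_Cons del: upt_Suc)
  have ok': "\<forall>\<gamma>\<in>set \<gamma>s. gok \<gamma> (in_labels P) \<Delta> {}" by (rule gok_pure(2)[OF pure ok])
  have d: "distinct (ids ?r)" unfolding ids by simp
  have rng: "set (ids ?r) \<subseteq> {1..length (ids ?r)}" unfolding ids set_upt length_upt by auto
  have ne: "spn w j \<noteq> []" for w j unfolding spn_def by simp
  have rok: "\<forall>s\<in>set ?ss. rok s"
    by (rule builds_rok[where W = "{}", OF ne _ _ _ ok']) auto
  have sol: "solution (set (ids ?r)) (rnb ?r) (rinp ?r) (run_out A (t ?n) ?n (rnb ?r) (rinp ?r)) (run_states A (t ?n) ?n (rnb ?r) (rinp ?r))"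
    by (rule run_solution[OF solves c d i]) (use rok len rng in auto)
  have "list_all2 (\<in>) (map (\<lambda>s. es (run_states A (t ?n) ?n (rnb ?r) (rinp ?r)) 1 (rid s)) ?ss) (map (gty g) \<gamma>s)"
  proof (rule builds_type[where W = "{}" and n = "1 + sum_list (map gsize \<gamma>s)", OF _ ok'])
    show "\<forall>s\<in>set ?ss. placed (rnb ?r) (rinp ?r) 1 s \<and>
        solution (set (ids s)) (rnb ?r) (rinp ?r) (run_out A (t ?n) ?n (rnb ?r) (rinp ?r)) (run_states A (t ?n) ?n (rnb ?r) (rinp ?r))"
    proof
      fix s assume s: "s \<in> set ?ss"
      have "set (ids s) \<subseteq> set (ids ?r)" using s by auto
      then show "placed (rnb ?r) (rinp ?r) 1 s \<and>
        solution (set (ids s)) (rnb ?r) (rinp ?r) (run_out A (t ?n) ?n (rnb ?r) (rinp ?r)) (run_states A (t ?n) ?n (rnb ?r) (rinp ?r))"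
        using placed_children[OF d s] solution_mono[OF sol] by blast
    qed
  qed auto
  then show ?thesis by (rule closable_of_solution[OF d sol])
qed

lemma feasible_upto_ex:
  assumes solves: "solves_in c \<Delta> P A t" and c: "1 \<le> c"
    and l: "card (Pow ((Sg \<times> Sg) \<times> (Sg \<times> Sg))) < l"
    and big: "\<And>C1 C2. \<exists>n. 2 * (radius P + t (C1 * (n + 1) + C2) + 1) + 3 \<le> n"
  shows "\<exists>g\<in>cut_pairs l. feasible_upto l g K0"
proof -
  let ?W = "words l" and ?E = "Sg \<times> Sg"
  \<comment> \<open>\<open>nE\<close> counts the possible middle states and one failure value. Among
    \<open>K0 * nE\<close> blocks per word, \<open>K0\<close> have a common value, one for each
    preorder number.\<close>
  define nE where "nE = Suc (card ?E)"
  define Z where "Z = Max (insert 1 (wsize ` letters))"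
  define K where "K = K0 * nE"
  obtain n where n0: "2 * (radius P + t ((card ?W * K * Z * l + K0 * Z * l) * (n + 1) + (1 + K0)) + 1) + 3 \<le> n"
    using big by blast
  \<comment> \<open>\<open>Bm\<close> bounds the nodes of any pumped spine. The blocks of all words
    lie below \<open>base\<close>, and ordinary nodes are named from \<open>base\<close> on.
    \<open>N\<close> is linear in \<open>n\<close>, as \<open>big\<close> requires.\<close>
  define Bm where "Bm = Z * ((n + 1) * l)"
  define base where "base = 1 + card ?W * K * Bm"
  define N where "N = base + K0 * Suc Bm"
  define h where "h = radius P + t N + 1"
  have "N = (card ?W * K * Z * l + K0 * Z * l) * (n + 1) + (1 + K0)"
    unfolding N_def base_def Bm_def by (simp add: algebra_simps)
  then have n: "2 * h + 3 \<le> n" using n0 unfolding h_def by simp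
  have Z: "wsize \<rho> \<le> Z" if "\<rho> \<in> letters" for \<rho>
    unfolding Z_def using fin_letters that by (intro Max_ge) auto
  have "\<forall>w\<in>?W. \<exists>pw. set pw \<subseteq> letters \<and> rel_of pw = rel_of w \<and> n \<le> length pw \<and> length pw \<le> (n + 1) * l"
  proof
    fix w assume "w \<in> ?W"
    then have w: "set w \<subseteq> letters" "length w = l" unfolding words_def by auto
    show "\<exists>pw. set pw \<subseteq> letters \<and> rel_of pw = rel_of w \<and> n \<le> length pw \<and> length pw \<le> (n + 1) * l"
      using pumping[OF fin_Sg w(1), of n] l w(2) by metis
  qed
  from bchoice[OF this] obtain pump0 where pump0: "\<forall>w\<in>?W. set (pump0 w) \<subseteq> letters \<and>
    rel_of (pump0 w) = rel_of w \<and> n \<le> length (pump0 w) \<and> length (pump0 w) \<le> (n + 1) * l" ..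
  define pump where "pump w = (if w \<in> ?W then pump0 w else [undefined])" for w
  have pump: "set (pump w) \<subseteq> letters" "rel_of (pump w) = rel_of w" "n \<le> length (pump w)"
    "length (pump w) \<le> (n + 1) * l" if "w \<in> ?W" for w
    using pump0 that unfolding pump_def by auto
  have pump_ne: "pump w \<noteq> []" for w using pump(3)[of w] n by (cases "w \<in> ?W") (auto simp: pump_def)
  obtain hx where hx: "bij_betw hx ?W {0..<card ?W}" using ex_bij_betw_finite_nat[OF fin_words] by blast
  define off where "off w k = 1 + (hx w * K + k) * Bm" for w k
  have wsz: "sum_list (map wsize (pump w)) \<le> Bm" if "w \<in> ?W" for w
  proof -
    have "sum_list (map wsize (pump w)) \<le> Z * length (pump w)" using Z pump(1)[OF that] by (intro sum_list_le) auto
    also have "\<dots> \<le> Bm" unfolding Bm_def using pump(4)[OF that] by (rule mult_le_mono2)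
    finally show ?thesis .
  qed
  \<comment> \<open>\<open>None\<close> marks blocks whose middle state is not in \<open>?E\<close>;
    a block used in a tree that the algorithm solves never has this value.\<close>
  define F where "F w k = (let s = mid_state A (t N) N h (spine (off w k) (pump w)) in if s \<in> ?E then Some s else None)" for w k
  have "\<exists>y f. inj_on f {..<K0} \<and> (\<forall>m<K0. f m < K \<and> F w (f m) = y)" for w
  proof -
    have fE: "finite (insert None (Some ` ?E))" using fin_Sg by simp
    have cE: "card (insert None (Some ` ?E)) = nE" unfolding nE_def using fin_Sg by (subst card_insert_disjoint) (auto simp: card_image)
    have "F w \<in> {..<K} \<rightarrow> insert None (Some ` ?E)" unfolding F_def Let_def by auto
    then obtain y where "card (F w -` {y} \<inter> {..<K}) * nE \<ge> card {..<K}"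
      using pigeonhole_card[of "F w" "{..<K}" "insert None (Some ` ?E)"] fE cE by auto
    then have "K0 * nE \<le> card (F w -` {y} \<inter> {..<K}) * nE" by (simp only: K_def card_lessThan)
    then have "K0 \<le> card (F w -` {y} \<inter> {..<K})" by (simp only: mult_le_cancel2) (simp add: nE_def)
    then obtain f where "inj_on f {..<K0}" "f ` {..<K0} \<subseteq> F w -` {y} \<inter> {..<K}"
      using inj_on_iff_card_le[of "{..<K0}" "F w -` {y} \<inter> {..<K}"] by auto
    then show ?thesis by (intro exI[of _ y] exI[of _ f]) auto
  qed
  then have "\<forall>w. \<exists>y f. inj_on f {..<K0} \<and> (\<forall>m<K0. f m < K \<and> F w (f m) = y)" by blast
  from choice[OF this] obtain val where "\<forall>w. \<exists>f. inj_on f {..<K0} \<and> (\<forall>m<K0. f m < K \<and> F w (f m) = val w)" ..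
  from choice[OF this] obtain kk where kk0: "\<forall>w. inj_on (kk w) {..<K0} \<and> (\<forall>m<K0. kk w m < K \<and> F w (kk w m) = val w)" ..
  have kk: "inj_on (kk w) {..<K0}" "m < K0 \<Longrightarrow> kk w m < K" "m < K0 \<Longrightarrow> F w (kk w m) = val w" for w m
    using kk0 by auto
  \<comment> \<open>The left ends linked to the common middle state by the first part of the word,
    and the right ends linked to it by the second. A word without such a state gets empty
    types.\<close>
  define g where "g w = (if w \<in> ?W then
     ({a \<in> ?E. \<exists>s. val w = Some s \<and> (a, s) \<in> rel_of (take (Suc h) (pump w))},
      {b \<in> ?E. \<exists>s. val w = Some s \<and> (s, prod.swap b) \<in> rel_of (drop (Suc h) (pump w))}) else ({}, {}))" for w
  define spn where "spn w m = spine (off w (kk w m)) (pump w)" for w m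
  have spn_ids: "sids (spn w m) = [off w (kk w m)..<off w (kk w m) + sum_list (map wsize (pump w))]" for w m
    unfolding spn_def by (rule sids_spine)
  have spn_ne: "spn w m \<noteq> []" for w m using pump_ne[of w] length_spine[of "off w (kk w m)" "pump w"]
    unfolding spn_def by (metis length_0_conv)
  have spn_d: "distinct (sids (spn w m))" for w m unfolding spn_ids by simp
  have spn_range: "set (sids (spn w m)) \<subseteq> {off w (kk w m)..<off w (kk w m) + Bm}" if "w \<in> ?W" for w m
    unfolding spn_ids using wsz[OF that] by auto
  have hxlt: "hx w < card ?W" if "w \<in> ?W" for w using hx that by (auto simp: bij_betw_def)
  have off_top: "off w k + Bm \<le> base" if "w \<in> ?W" "k < K" for w k
  proof -
    have "hx w * K + k + 1 \<le> (hx w + 1) * K" using that(2) by simp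
    also have "\<dots> \<le> card ?W * K" using hxlt[OF that(1)] by (intro mult_le_mono1) simp
    finally have "(hx w * K + k + 1) * Bm \<le> card ?W * K * Bm" by (rule mult_le_mono1)
    then show ?thesis unfolding off_def base_def by simp
  qed
  have off_sep: "{off w k..<off w k + Bm} \<inter> {off w' k'..<off w' k' + Bm} = {}"
    if "w \<in> ?W" "w' \<in> ?W" "k < K" "k' < K" "k \<noteq> k' \<or> w \<noteq> w'" for w w' k k'
  proof -
    have ne: "hx w * K + k \<noteq> hx w' * K + k'"
    proof
      assume e: "hx w * K + k = hx w' * K + k'"
      then have "(hx w * K + k) mod K = (hx w' * K + k') mod K" by simp
      then have kk': "k = k'" using that(3,4) by simp
      then have "hx w * K = hx w' * K" using e by simp
      then have "hx w = hx w'" using that(3) by simp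
      then have "w = w'" using hx that(1,2) by (auto simp: bij_betw_def inj_on_def)
      then show False using kk' that(5) by simp
    qed
    have sep: "a * Bm + Bm \<le> b * Bm" if "a < b" for a b :: nat
      using mult_le_mono1[of "Suc a" b Bm] that by simp
    show ?thesis
      using ne sep[of "hx w * K + k" "hx w' * K + k'"] sep[of "hx w' * K + k'" "hx w * K + k"]
      unfolding off_def by (cases "hx w * K + k < hx w' * K + k'") auto
  qed
  have res: "reserved base spn ?W m \<inter> reserved base spn ?W m' = {}" if mm: "m < m'" "m' < K0" for m m'
  proof -
    have low: "v < base" if "w \<in> ?W" "v \<in> set (sids (spn w q))" "q < K0" for v w q
      using spn_range[OF that(1), of q] off_top[OF that(1) kk(2)[OF that(3), of w]] that(2) by auto
    have "set (sids (spn w m)) \<inter> set (sids (spn w' m')) = {}" if w: "w \<in> ?W" "w' \<in> ?W" for w w'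
    proof -
      have "kk w m \<noteq> kk w' m' \<or> w \<noteq> w'" using kk(1)[of w] mm by (auto simp: inj_on_def)
      then have "{off w (kk w m)..<off w (kk w m) + Bm} \<inter> {off w' (kk w' m')..<off w' (kk w' m') + Bm} = {}"
        by (rule off_sep[OF w kk(2) kk(2), rotated 2]) (use mm in auto)
      then show ?thesis using spn_range[OF w(1), of m] spn_range[OF w(2), of m'] by blast
    qed
    moreover have "base + m \<notin> set (sids (spn w m'))" "base + m' \<notin> set (sids (spn w m))" if "w \<in> ?W" for w
      using low[OF that, of "base + m" m'] low[OF that, of "base + m'" m] mm by auto
    ultimately show ?thesis unfolding reserved_def using mm by fastforce
  qed
  have reslow: "reserved base spn ?W m \<subseteq> {1..N}" if m: "m < K0" for m
  proof -
    have "set (sids (spn w m)) \<subseteq> {1..N}" if w: "w \<in> ?W" for w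
    proof -
      have "1 \<le> off w (kk w m)" unfolding off_def by simp
      moreover have "off w (kk w m) + Bm \<le> N" using off_top[OF w kk(2)[OF m, of w]] unfolding N_def by simp
      ultimately show ?thesis using spn_range[OF w, of m] by auto
    qed
    moreover have "base + m \<in> {1..N}" unfolding N_def base_def using m by simp
    ultimately show ?thesis unfolding reserved_def by blast
  qed
  have "g \<in> cut_pairs l" unfolding cut_pairs_def g_def by auto
  moreover have "feasible_upto l g K0" unfolding feasible_upto_def
  proof (intro conjI ballI allI impI)
    fix w a b assume w: "w \<in> ?W" and ab: "a \<in> fst (g w)" "b \<in> snd (g w)"
    then obtain s where "(a, s) \<in> rel_of (take (Suc h) (pump w))" "(s, prod.swap b) \<in> rel_of (drop (Suc h) (pump w))"
      unfolding g_def by auto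
    then have "(a, prod.swap b) \<in> rel_of (take (Suc h) (pump w) @ drop (Suc h) (pump w))"
      unfolding rel_of_append by blast
    then show "(a, prod.swap b) \<in> rel_of w" using pump(2)[OF w] by simp
  next
    fix i \<gamma>s assume i: "i \<in> in_labels P" and ok: "\<forall>\<gamma>\<in>set \<gamma>s. gok \<gamma> (in_labels P) \<Delta> ?W"
      and len: "length \<gamma>s \<le> \<Delta>" and size: "Suc (sum_list (map gsize \<gamma>s)) \<le> K0"
    show "closable i (map (gty g) \<gamma>s)"
    \<comment> \<open>Padding is attached behind the spine of a variable, so terms without variables
      are treated apart.\<close>
    proof (cases "varss 1 \<gamma>s = []")
      case True
      show ?thesis by (rule build_closable_pure[OF solves c i ok len True])
    next
      case False
      then obtain p0 where p0: "p0 \<in> set (varss 1 \<gamma>s)" by (cases "varss 1 \<gamma>s") auto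
      have lpos: "0 < l" using l by simp
      \<comment> \<open>A letter belongs to a node with two path edges, so
        \<open>2 \<le> \<Delta>\<close>, which the padding path needs.\<close>
      have dl: "letters \<noteq> {}"
      proof
        assume "letters = {}"
        then have "?W = {}" unfolding words_def using lpos by auto
        then have W: "\<forall>\<gamma>\<in>set \<gamma>s. gok \<gamma> (in_labels P) \<Delta> {}" using ok by simp
        then show False using gok_no_words(2)[OF W] False by blast
      qed
      then have D2: "2 \<le> \<Delta>" unfolding letters_def by auto
      let ?s0 = "builds base spn (\<lambda>_. []) 1 \<gamma>s"
      let ?L0 = "base # concat (map ids ?s0)"
      have b00: "distinct (concat (map ids ?s0)) \<and>
        set (concat (map ids ?s0)) \<subseteq> (\<Union>m\<in>{1..<1 + sum_list (map gsize \<gamma>s)}. reserved base spn ?W m)"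
        by (rule builds_ids[where n = K0, OF spn_ne spn_d res ok]) (use size in auto)
      have b0: "distinct (concat (map ids ?s0))"
        "set (concat (map ids ?s0)) \<subseteq> (\<Union>m\<in>{1..<1 + sum_list (map gsize \<gamma>s)}. reserved base spn ?W m)"
        using b00 by blast+
      have "base \<notin> reserved base spn ?W m" if "m \<in> {1..<1 + sum_list (map gsize \<gamma>s)}" for m
        using res[of 0 m] that size unfolding reserved_def[of _ _ _ 0] by auto
      then have "base \<notin> set (concat (map ids ?s0))" using b0(2) by blast
      then have d0: "distinct ?L0" using b0(1) by simp
      have r0: "set ?L0 \<subseteq> {1..N}"
      proof -
        have "(\<Union>m\<in>{1..<1 + sum_list (map gsize \<gamma>s)}. reserved base spn ?W m) \<subseteq> {1..N}"
          by (intro UN_least reslow) (use size in simp)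
        then have "set (concat (map ids ?s0)) \<subseteq> {1..N}" using b0(2) by (rule subset_trans[rotated])
        moreover have "base \<in> {1..N}" unfolding N_def base_def by simp
        ultimately show ?thesis by simp
      qed
      obtain qs where qs: "distinct qs" "set qs = {1..N} - set ?L0"
        using finite_distinct_list[of "{1..N} - set ?L0"] by auto
      define pad where "pad m = (if m = fst p0 then pad_path i qs else [])" for m
      let ?ss = "builds base spn pad 1 \<gamma>s"
      let ?r = "Rt base i ?ss"
      have "sum_list (map (\<lambda>p. mset (concat (map ids (pad (fst p))))) (varss 1 \<gamma>s)) = mset qs"
      proof -
        have "mset (concat (map ids (pad m))) = (if m = fst p0 then mset qs else {#})" for m
          unfolding pad_def using ids_pad_path[of i qs] by simp
        then show ?thesis using sum_list_single[OF distinct_varss[of 1 \<gamma>s], of "fst p0" "mset qs"] p0 by simp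
      qed
      then have "mset (concat (map ids ?ss)) = mset (concat (map ids ?s0)) + mset qs"
        using mset_builds_pad[where base = base and pad = pad and j = 1 and ts = \<gamma>s, OF spn_ne] by simp
      then have m: "mset (ids ?r) = mset (?L0 @ qs)" by simp
      have dL: "distinct (?L0 @ qs)" using d0 qs by auto
      have d: "distinct (ids ?r)" using mset_eq_imp_distinct_iff[OF m] dL by blast
      have V: "set (ids ?r) = {1..N}" using mset_eq_setD[OF m] qs(2) r0 by auto
      have lN: "length (ids ?r) = N" using distinct_card[OF d] V by simp
      have pok: "length (pad m) \<le> 1 \<and> (\<forall>t\<in>set (pad m). rok t)" for m
        unfolding pad_def using pad_path_ok[OF i D2, of qs] by simp
      have spok: "fst (snd e) \<in> in_labels P \<and> length (snd (snd e)) + 2 \<le> \<Delta> \<and> (\<forall>t\<in>set (snd (snd e)). rok t)"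
        if "w \<in> ?W" "e \<in> set (spn w m)" for w m e
        using spells_spine[OF pump(1)[OF that(1)], of "off w (kk w m)"] that(2)
        unfolding spells_def spn_def by (auto simp: in_set_conv_nth)
      have rok: "\<forall>s\<in>set ?ss. rok s" by (rule builds_rok[where W = ?W, OF spn_ne spok _ _ ok]) (use pok in auto)
      let ?nb = "rnb ?r" and ?inp = "rinp ?r"
      let ?out = "run_out A (t N) N ?nb ?inp" and ?\<sigma> = "run_states A (t N) N ?nb ?inp"
      have rng: "set (ids ?r) \<subseteq> {1..length (ids ?r)}" unfolding V lN by simp
      have sol: "solution (set (ids ?r)) ?nb ?inp ?out ?\<sigma>"
        using run_solution[OF solves c d i _ _ rng] rok len unfolding lN by simp
      have sym: "x \<in> ?nb y" if "y \<in> ?nb x" for x y using that unfolding rnb_def by blast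
      have H: "es ?\<sigma> x (rid (hd (chain (if b then spn w m else rev (spn w m)) (pad m)))) \<in> (if b then fst (g w) else snd (g w))"
        if w: "w \<in> ?W" and mK: "m < K0"
          and pl: "placed ?nb ?inp x (hd (chain (if b then spn w m else rev (spn w m)) (pad m)))"
          and so: "solution (set (ids (hd (chain (if b then spn w m else rev (spn w m)) (pad m))))) ?nb ?inp ?out ?\<sigma>"
        for m w b x
      proof -
        let ?sp = "spn w m" and ?c = "if b then spn w m else rev (spn w m)"
        have "?c \<noteq> []" using spn_ne by auto
        then obtain tr where tr: "chain ?c (pad m) = [tr]" using chain_single by blast
        have pl': "placed ?nb ?inp x tr" using pl tr by simp
        have "spined ?nb ?inp ?c" by (rule placed_spined[OF tr pl'])
        then have spd: "spined ?nb ?inp ?sp" using spined_rev[of ?nb ?inp "rev ?sp"] by (cases b) auto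
        have lsp: "length ?sp = length (pump w)" unfolding spn_def by simp
        have hl: "0 < h" "Suc h < length ?sp" using n pump(3)[OF w] lsp unfolding h_def by auto
        have "set (sids ?sp) \<subseteq> set (ids tr)"
          using mset_ids_chain[OF spn_ne, of b w m "pad m"] tr by (metis hd_conv_nth list.sel(1) mset_subset_eq_add_left set_mset_mono set_mset_mset)
        then have so': "solution (set (sids ?sp)) ?nb ?inp ?out ?\<sigma>" using solution_mono[OF so] tr by simp
        let ?X = "fst (?sp ! h)" and ?Y = "fst (?sp ! Suc h)"
        have mid: "es ?\<sigma> ?X ?Y = mid_state A (t N) N h ?sp"
          by (rule mid_state[OF spd sym]) (use n pump(3)[OF w] lsp in \<open>auto simp: h_def\<close>)
        have "?Y \<in> ?nb ?X" using spd hl unfolding spined_def by auto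
        moreover have "?X \<in> set (sids ?sp)"
          using nth_mem[of h ?sp] hl unfolding sids_def block_def by force
        ultimately have inE: "es ?\<sigma> ?X ?Y \<in> ?E" using so' unfolding solution_def by blast
        have "F w (kk w m) = Some (es ?\<sigma> ?X ?Y)" unfolding F_def Let_def mid[unfolded spn_def, symmetric]
          using inE unfolding spn_def by simp
        then have val: "val w = Some (es ?\<sigma> ?X ?Y)" using kk(3)[OF mK, of w] by simp
        have spl: "spells ?sp (pump w)" unfolding spn_def by (rule spells_spine[OF pump(1)[OF w]])
        show ?thesis
        proof (cases b)
          case True
          have "(es ?\<sigma> x (rid tr), es ?\<sigma> ?X ?Y) \<in> rel_of (take (Suc h) (pump w))"
            using chain_left[OF spl _ pl' so' hl(2)] tr True by simp
          moreover have "rel_of (take (Suc h) (pump w)) \<subseteq> ?E \<times> ?E"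
            by (rule rel_of_sub) (use pump(1)[OF w] pump_ne[of w] set_take_subset[of "Suc h" "pump w"] in auto)
          ultimately show ?thesis using True val tr w unfolding g_def by auto
        next
          case False
          have r: "(es ?\<sigma> ?X ?Y, prod.swap (es ?\<sigma> x (rid tr))) \<in> rel_of (drop (Suc h) (pump w))"
            using chain_right[OF spl _ pl' so' hl(2)] tr False by simp
          moreover have "rel_of (drop (Suc h) (pump w)) \<subseteq> ?E \<times> ?E"
            by (rule rel_of_sub) (use pump(1)[OF w] hl(2) lsp set_drop_subset[of "Suc h" "pump w"] in auto)
          ultimately have "prod.swap (es ?\<sigma> x (rid tr)) \<in> ?E" by blast
          then have "es ?\<sigma> x (rid tr) \<in> ?E" by (auto simp: es_def)
          then show ?thesis using False val tr w r unfolding g_def by auto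
        qed
      qed
      have "list_all2 (\<in>) (map (\<lambda>s. es ?\<sigma> base (rid s)) ?ss) (map (gty g) \<gamma>s)"
      proof (rule builds_type[where W = ?W and n = K0, OF H _ _ _])
        show "\<forall>s\<in>set ?ss. placed ?nb ?inp base s \<and> solution (set (ids s)) ?nb ?inp ?out ?\<sigma>"
        proof
          fix s assume s: "s \<in> set ?ss"
          have "set (ids s) \<subseteq> set (ids ?r)" using s by auto
          then show "placed ?nb ?inp base s \<and> solution (set (ids s)) ?nb ?inp ?out ?\<sigma>"
            using placed_children[OF d s] solution_mono[OF sol] by blast
        qed
      qed (use ok size in auto)
      then show ?thesis by (rule closable_of_solution[OF d sol])
    qed
  qed
  ultimately show ?thesis by blast
qed

text \<open>Failure persists when the bound grows, so if every candidate failed at some size, none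
  would survive the maximum of these sizes.\<close>

theorem feasible_ex:
  assumes solves: "solves_in c \<Delta> P A t" and c: "1 \<le> c"
    and l: "card (Pow ((Sg \<times> Sg) \<times> (Sg \<times> Sg))) < l"
    and big: "\<And>C1 C2. \<exists>n. 2 * (radius P + t (C1 * (n + 1) + C2) + 1) + 3 \<le> n"
  shows "\<exists>g. feasible l g"
proof (rule ccontr)
  assume "\<not> ?thesis"
  then have "\<forall>g\<in>cut_pairs l. \<exists>K0. \<not> feasible_upto l g K0" using feasible_upto_feasible by blast
  from bchoice[OF this] obtain f where f: "\<forall>g\<in>cut_pairs l. \<not> feasible_upto l g (f g)" ..
  obtain g where g: "g \<in> cut_pairs l" "feasible_upto l g (Max (f ` cut_pairs l))" using feasible_upto_ex[OF solves c l big] by blast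
  have "f g \<le> Max (f ` cut_pairs l)" using g(1) fin_cut_pairs by simp
  then show False using f g feasible_upto_antimono by blast
qed

end

section \<open>The new algorithm\<close>

text \<open>Lists of length exactly \<open>D\<close>, with repetitions, enumerate the nonempty sets of at most \<open>D\<close> elements.\<close>

definition palette :: "nat \<Rightarrow> nat \<Rightarrow> (nat \<times> bool) set set" where
  "palette b D = insert {} (set ` {xs. set xs \<subseteq> {..<b} \<times> UNIV \<and> length xs = D})"

lemma palette:
  shows finite_palette: "finite (palette b D)" and card_palette: "card (palette b D) \<le> (2 * b) ^ D + 1"
proof -
  let ?X = "{xs. set xs \<subseteq> {..<b} \<times> (UNIV :: bool set) \<and> length xs = D}"
  have X: "finite ?X" "card ?X = (2 * b) ^ D"
    by (simp_all add: finite_lists_length_eq card_lists_length_eq card_cartesian_product mult.commute)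
  then show "finite (palette b D)" unfolding palette_def by simp
  have "card (palette b D) \<le> Suc (card (set ` ?X))" unfolding palette_def by (rule card_insert_le_m1) auto
  also have "card (set ` ?X) \<le> (2 * b) ^ D" using card_image_le[OF X(1)] X(2) by metis
  finally show "card (palette b D) \<le> (2 * b) ^ D + 1" by simp
qed

lemma palette_mem:
  assumes "S \<subseteq> {..<b} \<times> UNIV" "finite S" "card S \<le> D" shows "S \<in> palette b D"
proof (cases "S = {}")
  case False
  obtain xs where xs: "set xs = S" "distinct xs" using finite_distinct_list[OF assms(2)] by blast
  define ys where "ys = xs @ replicate (D - length xs) (hd xs)"
  have "hd xs \<in> set xs" using xs False by (intro hd_in_set) auto
  then have ys: "set ys = S" unfolding ys_def using xs(1) by (auto simp: set_replicate_conv_if)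
  have "length ys = D" unfolding ys_def using xs assms(3) distinct_card[OF xs(2)] by simp
  then have "ys \<in> {xs. set xs \<subseteq> {..<b} \<times> UNIV \<and> length xs = D}" using ys assms(1) by simp
  then have "set ys \<in> set ` {xs. set xs \<subseteq> {..<b} \<times> (UNIV :: bool set) \<and> length xs = D}" by (rule imageI)
  then show ?thesis unfolding palette_def ys by (rule insertI2)
qed (simp add: palette_def)

text \<open>A colour has at most one entry per conflicting node, and these lie in a ball of radius
  \<open>4 * L + 4\<close>; the recorded positions are below the length \<open>b\<close> of the
  identifiers.\<close>

lemma colour_palette:
  fixes nb :: "nat \<Rightarrow> nat set"
  assumes "utree V nb" "\<And>v. v \<in> V \<Longrightarrow> card (nb v) \<le> d" "v \<in> V" "\<And>v. v \<in> V \<Longrightarrow> v < 2 ^ b"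
  shows "colour nb \<tau> L v \<in> palette b ((d + 1) ^ (4 * L + 4))"
proof (rule palette_mem)
  interpret T: utree V nb by fact
  have B: "finite (ball nb (4 * L + 4) v)" "ball nb (4 * L + 4) v \<subseteq> V"
    "card (ball nb (4 * L + 4) v) \<le> (d + 1) ^ (4 * L + 4)"
    using T.card_ball[OF assms(2,3), of "4 * L + 4"] by auto
  have sub: "colour nb \<tau> L v \<subseteq> (\<lambda>u. (diff_bit u v, bit v (diff_bit u v))) ` ball nb (4 * L + 4) v"
  proof
    fix p assume "p \<in> colour nb \<tau> L v"
    then obtain u where u: "p = (diff_bit u v, bit v (diff_bit u v))" "conflict nb \<tau> L v u" unfolding colour_def by blast
    then show "p \<in> (\<lambda>u. (diff_bit u v, bit v (diff_bit u v))) ` ball nb (4 * L + 4) v"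
      using conflict_ball[OF u(2)] by blast
  qed
  then show "finite (colour nb \<tau> L v)" by (rule finite_surj[OF B(1)])
  show "card (colour nb \<tau> L v) \<le> (d + 1) ^ (4 * L + 4)" using surj_card_le[OF B(1) sub] B(3) by simp
  have "diff_bit u v < b" if "conflict nb \<tau> L v u" for u
  proof -
    have "u \<in> V" "u \<noteq> v" using that conflict_ball[OF that] B(2) unfolding conflict_def by auto
    then show ?thesis using diff_bit_less[of u v b] assms(3,4) by blast
  qed
  then show "colour nb \<tau> L v \<subseteq> {..<b} \<times> UNIV" unfolding colour_def by auto
qed

section \<open>Estimates for the radius\<close>

definition width :: "nat \<Rightarrow> nat" where
  "width n = (LEAST b. n < 2 ^ b)"

lemma less_width: "n < 2 ^ width n"
  unfolding width_def by (rule LeastI[of _ n]) simp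

text \<open>\<open>width n - 1\<close> is at most the binary logarithm, and
  \<open>1 / 2 \<le> ln 2\<close> costs a factor 2. From \<open>n = 3\<close> on,
  \<open>1 \<le> ln n\<close> absorbs the remaining summand.\<close>

lemma width_le: assumes "3 \<le> n" shows "real (width n) \<le> 3 * ln (real n)"
proof -
  have n1: "1 \<le> ln (real n)"
  proof -
    have "exp 1 \<le> (3 :: real)" by (rule exp_le)
    then have "exp 1 \<le> real n" using assms by linarith
    then show ?thesis using assms by (subst ln_ge_iff) auto
  qed
  have w: "width n \<noteq> 0" using less_width[of n] assms by (cases "width n") auto
  then have "\<not> n < 2 ^ (width n - 1)" unfolding width_def by (intro not_less_Least) simp
  then have "(2 :: real) ^ (width n - 1) \<le> real n" by (metis not_less of_nat_le_iff of_nat_numeral of_nat_power)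
  then have "ln ((2 :: real) ^ (width n - 1)) \<le> ln (real n)" using assms by (subst ln_le_cancel_iff) auto
  then have "real (width n - 1) * ln 2 \<le> ln (real n)" by (simp add: ln_realpow)
  moreover have "1 / 2 \<le> ln (2 :: real)" using exp_half_le2 by (subst ln_ge_iff) auto
  then have "real (width n - 1) * (1 / 2) \<le> real (width n - 1) * ln 2" by (intro mult_left_mono) auto
  ultimately show ?thesis using n1 w by (simp add: of_nat_diff)
qed

text \<open>The bound \<open>ln x \<le> x powr a / a\<close> with \<open>a = 1 / (2 * D)\<close>
  becomes a multiple of the square root when raised to the power \<open>D\<close>.\<close>

lemma polylog_sqrt:
  assumes "0 < D"
  shows "\<exists>C\<ge>0. \<forall>n\<ge>3. real ((2 * (c * width n)) ^ D) \<le> C * sqrt (real n)"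
proof (intro exI[of _ "real (12 * c * D) ^ D"] conjI allI impI)
  fix n :: nat assume n: "3 \<le> n"
  have "ln (real n) \<le> real n powr (1 / (2 * D)) / (1 / (2 * D))" using n assms by (intro ln_powr_bound) auto
  then have "3 * ln (real n) \<le> 6 * D * real n powr (1 / (2 * D))" by (simp add: mult.commute mult.left_commute)
  with width_le[OF n] have "real (width n) \<le> 6 * D * real n powr (1 / (2 * D))" by (rule order_trans)
  then have "2 * (c * real (width n)) \<le> 2 * (c * (6 * D * real n powr (1 / (2 * D))))" by (intro mult_left_mono) auto
  also have "\<dots> = real (12 * c * D) * real n powr (1 / (2 * D))" by simp
  finally have "(2 * (c * real (width n))) ^ D \<le> (real (12 * c * D) * real n powr (1 / (2 * D))) ^ D"
    by (intro power_mono) auto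
  also have "\<dots> = real (12 * c * D) ^ D * (real n powr (1 / (2 * D))) ^ D" by (simp add: power_mult_distrib)
  also have "(real n powr (1 / (2 * D))) ^ D = real n powr (1 / 2)"
    using assms n by (simp add: powr_power)
  also have "\<dots> = sqrt (real n)" by (rule powr_half_sqrt) simp
  finally show "real ((2 * (c * width n)) ^ D) \<le> real (12 * c * D) ^ D * sqrt (real n)" by simp
qed simp

text \<open>With \<open>\<tau>\<close> about sqrt n, both \<open>\<tau>\<close> and
  \<open>n / \<tau>\<close> are of order sqrt n. \<open>D\<close> bounds the size of a colour,
  \<open>c * width n\<close> the bit positions in it, so the last argument bounds the number of
  colours.\<close>

definition sqrt_radius :: "nat \<Rightarrow> nat \<Rightarrow> nat \<Rightarrow> nat \<Rightarrow> nat" where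
  "sqrt_radius D c L n = local_radius n (nat \<lfloor>sqrt (real n)\<rfloor>) L ((2 * (c * width n)) ^ D + 1)"

lemma sqrt_radius_bigo:
  assumes "0 < D" shows "(\<lambda>n. real (sqrt_radius D c L n)) \<in> O(\<lambda>n. sqrt (real n))"
proof -
  obtain C where C: "0 \<le> C" "\<And>n. 3 \<le> n \<Longrightarrow> real ((2 * (c * width n)) ^ D) \<le> C * sqrt (real n)"
    using polylog_sqrt[OF assms, of c] by blast
  define B where "B = 8 + 4 * real (10 * L + 13) + real (4 * L + 6 + (4 * L + 4) + L + 1) + C * real (4 * L + 4)"
  show ?thesis
  proof (rule bigoI[of _ B], rule eventually_sequentiallyI[of 3])
    fix n :: nat assume n: "3 \<le> n"
    define s where "s = sqrt (real n)"
    define \<tau> where "\<tau> = nat \<lfloor>s\<rfloor>"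
    define K where "K = (2 * (c * width n)) ^ D"
    have s1: "1 \<le> s" unfolding s_def using n by simp
    have t: "real \<tau> \<le> s" "s < real \<tau> + 1" unfolding \<tau>_def using s1 by linarith+
    have "real (n div (\<tau> + 1)) \<le> real n / (real \<tau> + 1)" using of_nat_div_le_of_nat[of n "\<tau> + 1"] by (simp add: add.commute)
    also have "\<dots> \<le> real n / s" using t s1 by (intro divide_left_mono) auto
    also have "\<dots> = s" unfolding s_def by (rule real_div_sqrt) simp
    finally have q: "real (n div (\<tau> + 1)) \<le> s" .
    have q1: "(real (n div (\<tau> + 1)) + 1) * real (10 * L + 13) \<le> (s + s) * real (10 * L + 13)"
      using q s1 by (intro mult_right_mono) auto
    have K: "real K * real (4 * L + 4) \<le> C * s * real (4 * L + 4)"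
      using C(2)[OF n] unfolding K_def s_def by (intro mult_right_mono) auto
    have const: "real x \<le> real x * s" for x using s1 mult_left_mono[of 1 s "real x"] by simp
    have mono: "2 * (2 * a + 1 + q) + 1 + (a + e + k) \<le> 2 * (2 * s + s + q') + s + (s + e' + k')"
      if "a \<le> s" "1 \<le> s" "q \<le> q'" "e \<le> e'" "k \<le> k'" for a q q' e e' k k' :: real
      using that by simp
    have "real (sqrt_radius D c L n) = 2 * (2 * real \<tau> + 1 + (real (n div (\<tau> + 1)) + 1) * real (10 * L + 13)) + 1 +
        (real \<tau> + real (4 * L + 6 + (4 * L + 4) + L + 1) + real K * real (4 * L + 4))"
      unfolding sqrt_radius_def local_radius_def comp_radius_def s_def[symmetric] \<tau>_def[symmetric] K_def[symmetric]
      by (simp add: algebra_simps)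
    also have "\<dots> \<le> 2 * (2 * s + s + (s + s) * real (10 * L + 13)) + s +
        (s + real (4 * L + 6 + (4 * L + 4) + L + 1) * s + C * s * real (4 * L + 4))"
      by (rule mono[OF t(1) s1 q1 const K])
    also have "\<dots> = B * s" unfolding B_def by (simp add: algebra_simps)
    finally show "norm (real (sqrt_radius D c L n)) \<le> B * norm (sqrt (real n))" unfolding s_def by simp
  qed
qed

text \<open>With \<open>m = C1 * (n + 1) + C2\<close>, the estimate
  \<open>t m \<le> m / (4 * (C1 + 1))\<close> gives \<open>4 * t m \<le> n + 1 + C2\<close>. Hence
  \<open>2 * t m\<close> takes up about half of \<open>n\<close> and the constants fit into the
  rest.\<close>

lemma sublinear_big:
  assumes "(\<lambda>n. real (t n)) \<in> o(\<lambda>n. real n)"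
  shows "\<exists>n. 2 * (r + t (C1 * (n + 1) + C2) + 1) + 3 \<le> n"
proof (cases "C1 = 0")
  case True
  then show ?thesis by (intro exI[of _ "2 * (r + t C2 + 1) + 3"]) simp
next
  case False
  have "eventually (\<lambda>n. norm (real (t n)) \<le> 1 / (4 * real (C1 + 1)) * norm (real n)) at_top"
    by (rule landau_o.smallD[OF assms]) simp
  then obtain N where N: "\<And>n. N \<le> n \<Longrightarrow> norm (real (t n)) \<le> 1 / (4 * real (C1 + 1)) * norm (real n)"
    unfolding eventually_sequentially by blast
  have small: "4 * (C1 + 1) * t m \<le> m" if "N \<le> m" for m
  proof -
    have "real (t m) * (4 * real (C1 + 1)) \<le> real m" using N[OF that] by (simp add: field_simps)
    then have "real (4 * (C1 + 1) * t m) \<le> real m" by (simp add: algebra_simps)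
    then show ?thesis by linarith
  qed
  define n where "n = N + 4 * r + C2 + 11"
  let ?m = "C1 * (n + 1) + C2"
  have "n + 1 \<le> C1 * (n + 1)" using False by (cases C1) auto
  then have "N \<le> ?m" unfolding n_def by linarith
  then have "4 * (C1 + 1) * t ?m \<le> ?m" by (rule small)
  also have "\<dots> \<le> (C1 + 1) * (n + 1 + C2)" by (simp add: algebra_simps)
  finally have "(C1 + 1) * (4 * t ?m) \<le> (C1 + 1) * (n + 1 + C2)" by (simp only: mult.assoc mult.left_commute)
  then have "4 * t ?m \<le> n + 1 + C2" by (simp only: mult_le_cancel1)
  then have "2 * (r + t ?m + 1) + 3 \<le> n" unfolding n_def by simp
  then show ?thesis ..
qed

section \<open>The algorithm as a function of views\<close>

context lcl_trees begin

text \<open>The construction is carried out on each tree after renaming nodes to identifiers. It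
  becomes a LOCAL algorithm because \<open>local_out_agree\<close> makes its result depend on the
  view only.\<close>

theorem solvable_sqrt_radius:
  assumes feas: "feasible (2 * L + 1) g" and c: "1 \<le> c"
  shows "solvable_in c \<Delta> P (sqrt_radius ((\<Delta> + 1) ^ (4 * L + 4)) c L)"
proof -
  define D where "D = (\<Delta> + 1) ^ (4 * L + 4)"
  define b where "b n = c * width n" for n
  define K where "K n = (2 * b n) ^ D + 1" for n
  define \<tau> where "\<tau> n = nat \<lfloor>sqrt (real n)\<rfloor>" for n
  have t': "sqrt_radius D c L n = local_radius n (\<tau> n) L (K n)" for n
    unfolding sqrt_radius_def K_def b_def \<tau>_def ..
  have "\<forall>n. \<exists>h. bij_betw h (palette (b n) D) {0..<card (palette (b n) D)}"
    using ex_bij_betw_finite_nat[OF finite_palette] by blast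
  from choice[OF this] obtain enc where enc: "\<And>n. bij_betw (enc n) (palette (b n) D) {0..<card (palette (b n) D)}" by blast
  define adm where "adm T ident inp v \<longleftrightarrow> T \<in> trees \<Delta> \<and> inp ` pverts T \<subseteq> in_labels P \<and> identifiers c T ident \<and>
    v \<in> pverts T" for T :: "nat pair_pre_digraph" and ident inp v
  define out where "out T ident inp v = local_out (enc (card (pverts T))) g (\<tau> (card (pverts T))) L (K (card (pverts T)))
    (img_nb ident (nbr T)) (img_inp (pverts T) ident inp) (ident v)" for T :: "nat pair_pre_digraph" and ident inp v
  have ut: "utree (pverts T) (nbr T)" if "T \<in> trees \<Delta>" for T
    using that is_tree_utree unfolding trees_def by blast
  have alg: "algorithm_tree (lcl_nok P) (in_labels P) Sg \<Delta> (ident ` pverts T) (img_nb ident (nbr T))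
     (img_inp (pverts T) ident inp) L (\<tau> (card (pverts T))) (K (card (pverts T))) g (enc (card (pverts T)))"
    if T: "T \<in> trees \<Delta>" and inp: "inp ` pverts T \<subseteq> in_labels P" and ident: "identifiers c T ident" for T ident inp
  proof -
    interpret T: utree "pverts T" "nbr T" by (rule ut[OF T])
    let ?n = "card (pverts T)" and ?V = "ident ` pverts T" and ?nb = "img_nb ident (nbr T)"
    have inj: "inj_on ident (pverts T)" using ident unfolding identifiers_def by blast
    have u: "utree ?V ?nb" by (rule T.utree_img[OF inj])
    have deg: "card (?nb v) \<le> \<Delta>" if v: "v \<in> ?V" for v
    proof -
      obtain x where x: "x \<in> pverts T" "v = ident x" using v by blast
      have "card (?nb v) = card (nbr T x)"
        unfolding x(2) T.img_nb[OF inj x(1)] using T.nb_sub inj by (intro card_image) (blast intro: inj_on_subset)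
      moreover have "degree T x \<le> \<Delta>" using T x(1) unfolding trees_def by blast
      ultimately show ?thesis unfolding degree_nbr by simp
    qed
    have rng: "v < 2 ^ b ?n" if "v \<in> ?V" for v
    proof -
      have "v \<le> ?n ^ c" using that ident unfolding identifiers_def by auto
      also have "\<dots> < (2 ^ width ?n) ^ c" using c by (intro power_strict_mono less_width) auto
      finally show ?thesis unfolding b_def by (simp add: power_mult[symmetric] mult.commute)
    qed
    have pal: "colour ?nb (\<tau> ?n) L v \<in> palette (b ?n) D" if "v \<in> ?V" for v
      unfolding D_def by (rule colour_palette[OF u deg that rng])
    show ?thesis
    proof (intro algorithm_tree.intro edge_problem_tree.intro u edge_problem_tree_axioms.intro algorithm_tree_axioms.intro feas deg)
      fix v assume "v \<in> ?V"
      then show "img_inp (pverts T) ident inp v \<in> in_labels P" using img_inp[OF inj, of _ inp] inp by auto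
    next
      fix x y assume "x \<in> ?V" "y \<in> ?V" "enc ?n (colour ?nb (\<tau> ?n) L x) = enc ?n (colour ?nb (\<tau> ?n) L y)"
      then show "colour ?nb (\<tau> ?n) L x = colour ?nb (\<tau> ?n) L y"
        using pal[of x] pal[of y] enc[of ?n] unfolding bij_betw_def inj_on_def by blast
    next
      fix x assume "x \<in> ?V"
      then have "enc ?n (colour ?nb (\<tau> ?n) L x) < card (palette (b ?n) D)"
        using pal[of x] enc[of ?n] unfolding bij_betw_def by force
      then show "enc ?n (colour ?nb (\<tau> ?n) L x) < K ?n" unfolding K_def using card_palette[of "b ?n" D] by linarith
    qed
  qed
  define view where "view T ident inp v = view_of T ident inp (sqrt_radius D c L (card (pverts T))) v"
    for T :: "nat pair_pre_digraph" and ident and inp :: "nat \<Rightarrow> 'i" and v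
  have out_eq: "out T ident inp v = out T' ident' inp' v'"
    if a: "adm T ident inp v" and a': "adm T' ident' inp' v'" and eq: "view T ident inp v = view T' ident' inp' v'"
    for T ident inp v T' ident' inp' v'
  proof -
    let ?n = "card (pverts T)"
    have T: "utree (pverts T) (nbr T)" "inj_on ident (pverts T)" "v \<in> pverts T"
      and T': "utree (pverts T') (nbr T')" "inj_on ident' (pverts T')" "v' \<in> pverts T'"
      using a a' ut unfolding adm_def identifiers_def by auto
    have n: "card (pverts T') = ?n" using eq unfolding view_def view_of_def by simp
    have eq': "view_of T ident inp (sqrt_radius D c L ?n) v = view_of T' ident' inp' (sqrt_radius D c L ?n) v'"
      using eq n unfolding view_def by simp
    have "agree (local_radius (card (ident ` pverts T)) (\<tau> ?n) L (K ?n)) (ident v) (img_nb ident (nbr T)) (img_inp (pverts T) ident inp)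
       (img_nb ident' (nbr T')) (img_inp (pverts T') ident' inp')"
      using view_eq_agree(3)[OF T T' eq'] unfolding t' card_image[OF T(2)] .
    from algorithm_tree.local_out_agree[OF alg this] show ?thesis
      using a n view_eq_agree(1)[OF T T' eq'] unfolding out_def adm_def by simp
  qed
  \<comment> \<open>Some admissible instance with the given view is guessed; by
    \<open>out_eq\<close> all of them yield the same output.\<close>
  define A where "A w = (let q = (SOME q. adm (fst q) (fst (snd q)) (fst (snd (snd q))) (snd (snd (snd q))) \<and>
      view (fst q) (fst (snd q)) (fst (snd (snd q))) (snd (snd (snd q))) = w)
    in out (fst q) (fst (snd q)) (fst (snd (snd q))) (snd (snd (snd q))))" for w
  have A: "A (view T ident inp v) = out T ident inp v" if a: "adm T ident inp v" for T ident inp v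
  proof -
    define q where "q = (SOME q. adm (fst q) (fst (snd q)) (fst (snd (snd q))) (snd (snd (snd q))) \<and>
      view (fst q) (fst (snd q)) (fst (snd (snd q))) (snd (snd (snd q))) = view T ident inp v)"
    have "adm (fst q) (fst (snd q)) (fst (snd (snd q))) (snd (snd (snd q))) \<and>
      view (fst q) (fst (snd q)) (fst (snd (snd q))) (snd (snd (snd q))) = view T ident inp v"
      unfolding q_def by (rule someI[of _ "(T, ident, inp, v)"]) (simp add: a)
    then show ?thesis unfolding A_def Let_def q_def[symmetric] using out_eq[OF _ a] by blast
  qed
  have "solves_in c \<Delta> P A (sqrt_radius D c L)" unfolding solves_in_def
  proof (intro ballI allI impI)
    fix T inp ident assume T: "T \<in> trees \<Delta>" and inp: "inp ` pverts T \<subseteq> in_labels P" and ident: "identifiers c T ident"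
    interpret T: utree "pverts T" "nbr T" by (rule ut[OF T])
    have inj: "inj_on ident (pverts T)" using ident unfolding identifiers_def by blast
    obtain \<sigma> where \<sigma>: "\<And>a. a \<in> ident ` pverts T \<Longrightarrow> lcl_nok P (img_inp (pverts T) ident inp a)
       (local_out (enc (card (pverts T))) g (\<tau> (card (pverts T))) L (K (card (pverts T)))
         (img_nb ident (nbr T)) (img_inp (pverts T) ident inp) a)
       (image_mset (es \<sigma> a) (mset_set (img_nb ident (nbr T) a)))"
      using algorithm_tree.local_out_solution[OF alg[OF T inp ident]] by blast
    have "valid_labelling P T inp (out T ident inp)"
    proof (rule lcl_nok_valid[OF ut[OF T]])
      fix v assume v: "v \<in> pverts T"
      have "inj_on ident (nbr T v)" using inj T.nb_sub by (blast intro: inj_on_subset)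
      then have "mset_set (img_nb ident (nbr T) (ident v)) = image_mset ident (mset_set (nbr T v))"
        unfolding T.img_nb[OF inj v] by (simp add: image_mset_mset_set)
      then have "image_mset (es \<sigma> (ident v)) (mset_set (img_nb ident (nbr T) (ident v))) =
          image_mset (es (\<lambda>x y. \<sigma> (ident x) (ident y)) v) (mset_set (nbr T v))"
        by (simp add: multiset.map_comp o_def es_def[abs_def])
      then show "lcl_nok P (inp v) (out T ident inp v) (image_mset (es (\<lambda>x y. \<sigma> (ident x) (ident y)) v) (mset_set (nbr T v)))"
        using \<sigma>[of "ident v"] v img_inp[OF inj v, of inp] unfolding out_def by simp
    qed
    then show "valid_labelling P T inp (\<lambda>v. A (view_of T ident inp (sqrt_radius D c L (card (pverts T))) v))"
    proof (rule valid_labelling_cong)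
      fix v assume "v \<in> pverts T"
      then have "adm T ident inp v" unfolding adm_def using T inp ident by blast
      from A[OF this] show "out T ident inp v = A (view_of T ident inp (sqrt_radius D c L (card (pverts T))) v)"
        unfolding view_def ..
    qed
  qed
  then show ?thesis unfolding solvable_in_def D_def by blast
qed

end

theorem sublinear_imp_sqrt:
  fixes P :: "('i, 'o) lcl"
  assumes c: "1 \<le> c" and P: "is_lcl P"
    and t: "solvable_in c \<Delta> P t" "(\<lambda>n. real (t n)) \<in> o(\<lambda>n. real n)"
  shows "\<exists>t. solvable_in c \<Delta> P t \<and> (\<lambda>n. real (t n)) \<in> O(\<lambda>n. sqrt (real n))"
proof -
  interpret lcl_trees P \<Delta> by unfold_locales (rule P)
  obtain A where A: "solves_in c \<Delta> P A t" using t(1) unfolding solvable_in_def by blast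
  define L where "L = card (Pow ((Sg \<times> Sg) \<times> (Sg \<times> Sg)))"
  have "L < 2 * L + 1" by simp
  then obtain g where "feasible (2 * L + 1) g"
    using feasible_ex[OF A c _ sublinear_big[OF t(2)]] unfolding L_def by blast
  from solvable_sqrt_radius[OF this c] show ?thesis
    by (intro exI conjI) (assumption, rule sqrt_radius_bigo, simp)
qed

theorem mainTheorem2:
  fixes \<Delta> c :: nat and P :: "('i, 'o) lcl"
  assumes "1 \<le> c"
    and "is_lcl P"
  shows "((\<exists>t. solvable_in c \<Delta> P t \<and> (\<lambda>n. real (t n)) \<in> o(\<lambda>n. real n)) \<longrightarrow>
          (\<exists>t. solvable_in c \<Delta> P t \<and> (\<lambda>n. real (t n)) \<in> O(\<lambda>n. sqrt (real n)))) \<and>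
         \<not> (\<exists>t. is_time_complexity c \<Delta> P t \<and>
              (\<lambda>n. real (t n)) \<in> \<omega>(\<lambda>n. sqrt (real n)) \<and> (\<lambda>n. real (t n)) \<in> o(\<lambda>n. real n))"
proof
  show "(\<exists>t. solvable_in c \<Delta> P t \<and> (\<lambda>n. real (t n)) \<in> o(\<lambda>n. real n)) \<longrightarrow>
          (\<exists>t. solvable_in c \<Delta> P t \<and> (\<lambda>n. real (t n)) \<in> O(\<lambda>n. sqrt (real n)))"
    using sublinear_imp_sqrt[OF assms] by blast
  show "\<not> (\<exists>t. is_time_complexity c \<Delta> P t \<and>
              (\<lambda>n. real (t n)) \<in> \<omega>(\<lambda>n. sqrt (real n)) \<and> (\<lambda>n. real (t n)) \<in> o(\<lambda>n. real n))"
  proof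
    assume "\<exists>t. is_time_complexity c \<Delta> P t \<and>
              (\<lambda>n. real (t n)) \<in> \<omega>(\<lambda>n. sqrt (real n)) \<and> (\<lambda>n. real (t n)) \<in> o(\<lambda>n. real n)"
    then obtain t where t: "solvable_in c \<Delta> P t" "\<And>t' n. solvable_in c \<Delta> P t' \<Longrightarrow> t n \<le> t' n"
      "(\<lambda>n. real (t n)) \<in> \<omega>(\<lambda>n. sqrt (real n))" "(\<lambda>n. real (t n)) \<in> o(\<lambda>n. real n)"
      unfolding is_time_complexity_def by blast
    obtain t' where t': "solvable_in c \<Delta> P t'" "(\<lambda>n. real (t' n)) \<in> O(\<lambda>n. sqrt (real n))"
      using sublinear_imp_sqrt[OF assms t(1,4)] by blast
    obtain C where C: "0 < C" "eventually (\<lambda>n. norm (real (t' n)) \<le> C * norm (sqrt (real n))) at_top"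
      using landau_o.bigE[OF t'(2)] by blast
    \<comment> \<open>The lower bound holds for every constant, so it is taken with one larger than
      the constant \<open>C\<close> of the upper bound.\<close>
    have "eventually (\<lambda>n. (C + 1) * norm (sqrt (real n)) \<le> norm (real (t n))) at_top"
      using landau_omega.smallD[OF t(3), of "C + 1"] C(1) by simp
    with C(2) have "eventually (\<lambda>n::nat. n = 0) at_top"
    proof eventually_elim
      case (elim n)
      have "real (t n) \<le> real (t' n)" using t(2)[OF t'(1), of n] by simp
      then have "(C + 1) * sqrt (real n) \<le> C * sqrt (real n)" using elim by simp
      then have "sqrt (real n) \<le> 0" by (simp add: algebra_simps)
      then show "n = 0" by simp
    qed
    then obtain N where "\<And>n::nat. N \<le> n \<Longrightarrow> n = 0" unfolding eventually_sequentially by blast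
    from this[of "Suc N"] show False by simp
  qed
qed

end
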